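(* For each $N\in\{2,3,4,5,6,7,8,9,10,12,13,16,18,25\}$ let $\mathcal L_N=D_t^2+\mathcal A_N(t)D_t+\mathcal B_N(t)$ ($D_t=d/dt$, $t=t_N$) be the normal-form Picard–Fuchs operator for $\Gamma_0(N)$ defined in the context, so that $\mathcal L_Nh_N=0$, where $h_N$ is the holomorphic function near $t=0$ defined in the context. Then: $\mathcal L_2=D_t^2+\bigl[\frac1t+\frac1{2(t+64)}\bigr]D_t+\frac1{16t(t+64)}$ $\mathcal L_3=D_t^2+\bigl[\frac1t+\frac2{3(t+27)}\bigr]D_t+\frac1{9t(t+27)}$ $\mathcal L_4=D_t^2+\bigl[\frac1t+\frac1{t+16}\bigr]D_t+\frac1{4t(t+16)}$ $\mathcal L_5=D_t^2+\bigl[\frac1t+\frac{t+11}{t^2+22t+125}\bigr]D_t+\frac{t+10}{4t(t^2+22t+125)}$ $\mathcal L_6=D_t^2+\bigl[\frac1t+\frac1{t+8}+\frac1{t+9}\bigr]D_t+\frac{t+6}{t(t+8)(t+9)}$ $\mathcal L_7=D_t^2+\bigl[\frac1t+\frac{4t+26}{3(t^2+13t+49)}\bigr]D_t+\frac{4t+21}{9t(t^2+13t+49)}$ $\mathcal L_8=D_t^2+\bigl[\frac1t+\frac1{t+4}+\frac1{t+8}\bigr]D_t+\frac1{t(t+8)}$ $\mathcal L_9=D_t^2+\bigl[\frac1t+\frac{2t+9}{t^2+9t+27}\bigr]D_t+\frac{t+3}{t(t^2+9t+27)}$ $\mathcal L_{10}=D_t^2+\bigl[\frac1t+\frac1{t+4}+\frac1{t+5}+\frac{t+4}{t^2+8t+20}\bigr]D_t+\frac{9t^3+95t^2+340t+400}{4t(t+4)(t+5)(t^2+8t+20)}$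 $\mathcal L_{12}=D_t^2+\bigl[\frac1t+\frac1{t+2}+\frac1{t+3}+\frac1{t+4}+\frac1{t+6}\bigr]D_t+\frac{4(t^2+6t+6)}{t(t+2)(t+4)(t+6)}$ $\mathcal L_{13}=D_t^2+\bigl[\frac1t+\frac{t+3}{t^2+6t+13}+\frac{4t+10}{3(t^2+5t+13)}\bigr]D_t+\frac{49t^3+351t^2+1027t+1014}{36t(t^2+5t+13)(t^2+6t+13)}$ $\mathcal L_{16}=D_t^2+\bigl[\frac1t+\frac1{t+2}+\frac1{t+4}+\frac{2t+4}{t^2+4t+8}\bigr]D_t+\frac{4(t+2)^2}{t(t+4)(t^2+4t+8)}$ $\mathcal L_{18}=D_t^2+\bigl[\frac1t+\frac1{t+2}+\frac1{t+3}+\frac{2t+3}{t^2+3t+3}+\frac{2t+6}{t^2+6t+12}\bigr]D_t+\frac{9(t+2)(t^3+6t^2+12t+6)}{t(t+3)(t^2+3t+3)(t^2+6t+12)}$ $\mathcal L_{25}=D_t^2+\bigl[\frac1t+\frac{4t^3+15t^2+30t+25}{t^4+5t^3+15t^2+25t+25}+\frac{t+1}{t^2+2t+5}\bigr]D_t+\frac{25(t^5+5t^4+15t^3+25t^2+25t+10)}{4t(t^2+2t+5)(t^4+5t^3+15t^2+25t+25)}$.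
   Context: $j=q^{-1}+744+\cdots$ is the elliptic modular invariant, $q=e^{2\pi i\tau}$, and $[m]=\eta(m\tau)$ with $\eta$ the Dedekind eta function. The canonical Hauptmodul $t_N$, a generator of the function field of the genus-zero curve $X_0(N)$, is: $t_2=2^{12}[2]^{24}/[1]^{24}$, $t_3=3^6[3]^{12}/[1]^{12}$, $t_4=2^8[4]^8/[1]^8$, $t_5=5^3[5]^6/[1]^6$, $t_6=2^33^2[2][6]^5/([1]^5[3])$, $t_7=7^2[7]^4/[1]^4$, $t_8=2^5[2]^2[8]^4/([1]^4[4]^2)$, $t_9=3^3[9]^3/[1]^3$, $t_{10}=2^2\cdot5\,[2][10]^3/([1]^3[5])$, $t_{12}=2^2\cdot3\,[2]^2[3][12]^3/([1]^3[4][6]^2)$, $t_{13}=13[13]^2/[1]^2$, $t_{16}=2^3[2][16]^2/([1]^2[8])$, $t_{18}=2\cdot3\,[2][3][18]^2/([1]^2[6][9])$, $t_{25}=5[25]/[1]$. Write $j=P_N(t_N)/Q_N(t_N)$ with coprime polynomials $P_N,Q_N$. Near $t=0$, $h_N(t)=[P_N(t)/P_N(0)]^{-1/12}\,{}_2F_1\bigl(\tfrac1{12},\tfrac5{12};1;12^3Q_N(t)/P_N(t)\bigr)$ (power equal to $1$ at $t=0$). The operator $\mathcal L_N$ is the monic second-order operator obtained from the Gauss hypergeometric operator $D_x^2+\bigl[\frac1x+\frac1{2(x-1)}\bigr]D_x+\frac{5/144}{x(x-1)}$ (which annihilates ${}_2F_1(\frac1{12},\frac5{12};1;x)$) by pulling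 back along $x=12^3Q_N(t)/P_N(t)$ and then making the substitution $\hat u=P_N(t)^{-1/12}u$; i.e. the solutions of $\mathcal L_N\hat u=0$ are the functions $P_N(t)^{-1/12}u(12^3Q_N(t)/P_N(t))$ with $u$ a solution of the hypergeometric equation. *)

theory Defs
  imports
    "HOL-Complex_Analysis.Complex_Analysis"
    "HOL-Computational_Algebra.Computational_Algebra"
    "HOL-Computational_Algebra.Field_as_Ring"
begin

section \<open>The modular invariant and the canonical Hauptmoduln\<close>

definition nome :: "complex \<Rightarrow> complex" where
  "nome \<tau> = exp (2 * of_real pi * \<i> * \<tau>)"

definition dedekind_eta :: "complex \<Rightarrow> complex" where
  "dedekind_eta \<tau> = exp (2 * of_real pi * \<i> * \<tau> / 24) * (\<Prod>n. 1 - nome \<tau> ^ Suc n)"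

definition eisenstein_E4 :: "complex \<Rightarrow> complex" where
  "eisenstein_E4 \<tau> = 1 + 240 * (\<Sum>n. (\<Sum>d | d dvd Suc n. of_nat d ^ 3) * nome \<tau> ^ Suc n)"

text \<open>The modular discriminant, in the normalization with leading term \<open>q\<close>, is \<open>\<eta>\<^sup>2\<^sup>4\<close>;
  hence the quotient below expands as \<open>q\<^sup>-\<^sup>1 + 744 + \<dots>\<close>.\<close>

definition klein_j :: "complex \<Rightarrow> complex" where
  "klein_j \<tau> = eisenstein_E4 \<tau> ^ 3 / dedekind_eta \<tau> ^ 24"

definition levels :: "nat set" where
  "levels = {2, 3, 4, 5, 6, 7, 8, 9, 10, 12, 13, 16, 18, 25}"

definition hauptmodul :: "nat \<Rightarrow> complex \<Rightarrow> complex" where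
  "hauptmodul N \<tau> =
    (let e = (\<lambda>m::nat. dedekind_eta (of_nat m * \<tau>)) in
     if N = 2 then 2^12 * e 2 ^ 24 / e 1 ^ 24
     else if N = 3 then 3^6 * e 3 ^ 12 / e 1 ^ 12
     else if N = 4 then 2^8 * e 4 ^ 8 / e 1 ^ 8
     else if N = 5 then 5^3 * e 5 ^ 6 / e 1 ^ 6
     else if N = 6 then 2^3 * 3^2 * (e 2 * e 6 ^ 5) / (e 1 ^ 5 * e 3)
     else if N = 7 then 7^2 * e 7 ^ 4 / e 1 ^ 4
     else if N = 8 then 2^5 * (e 2 ^ 2 * e 8 ^ 4) / (e 1 ^ 4 * e 4 ^ 2)
     else if N = 9 then 3^3 * e 9 ^ 3 / e 1 ^ 3
     else if N = 10 then 2^2 * 5 * (e 2 * e 10 ^ 3) / (e 1 ^ 3 * e 5)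
     else if N = 12 then 2^2 * 3 * (e 2 ^ 2 * e 3 * e 12 ^ 3) / (e 1 ^ 3 * e 4 * e 6 ^ 2)
     else if N = 13 then 13 * e 13 ^ 2 / e 1 ^ 2
     else if N = 16 then 2^3 * (e 2 * e 16 ^ 2) / (e 1 ^ 2 * e 8)
     else if N = 18 then 2 * 3 * (e 2 * e 3 * e 18 ^ 2) / (e 1 ^ 2 * e 6 * e 9)
     else if N = 25 then 5 * e 25 / e 1
     else undefined)"

text \<open>The coprime pair \<open>(P, Q)\<close> with \<open>j = P(t\<^sub>N)/Q(t\<^sub>N)\<close> is unique up to a common constant
  factor, on which neither the operator nor the function defined below depends. As \<open>j\<close> is finite on
  the upper half-plane, \<open>Q(t\<^sub>N)\<close> does not vanish there; this is demanded explicitly because of the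
  convention \<open>z / 0 = 0\<close>.\<close>

definition j_representation :: "nat \<Rightarrow> complex poly \<Rightarrow> complex poly \<Rightarrow> bool" where
  "j_representation N P Q \<longleftrightarrow>
     coprime P Q \<and>
     (\<forall>\<tau>. Im \<tau> > 0 \<longrightarrow>
        poly Q (hauptmodul N \<tau>) \<noteq> 0 \<and>
        klein_j \<tau> = poly P (hauptmodul N \<tau>) / poly Q (hauptmodul N \<tau>))"


section \<open>The function \<open>h\<^sub>N\<close>\<close>

text \<open>The principal branch of the power is equal to 1 at \<open>t = 0\<close> and holomorphic near it.\<close>

definition h_fun :: "complex poly \<Rightarrow> complex poly \<Rightarrow> complex \<Rightarrow> complex" where
  "h_fun P Q t =
     (poly P t / poly P 0) powr (- (1/12)) *
     eval_fps (fps_hypergeo [1/12, 5/12] [1] 1) (12^3 * poly Q t / poly P t)"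


section \<open>Monic second-order differential operators over the field of rational functions\<close>

type_synonym ratfun = "complex poly fract"

text \<open>The pair \<open>(A, B)\<close> stands for \<open>D\<^sup>2 + A D + B\<close>.\<close>

type_synonym monic_op2 = "ratfun \<times> ratfun"

definition rf_var :: ratfun where
  "rf_var = Fract [:0, 1:] 1"

definition rf_deriv :: "ratfun \<Rightarrow> ratfun" where
  "rf_deriv r = (let (a, b) = quot_of_fract r in Fract (pderiv a * b - a * pderiv b) (b ^ 2))"

definition rf_eval :: "ratfun \<Rightarrow> complex \<Rightarrow> complex" where
  "rf_eval r z = (let (a, b) = quot_of_fract r in poly a z / poly b z)"

definition apply_op :: "monic_op2 \<Rightarrow> (complex \<Rightarrow> complex) \<Rightarrow> complex \<Rightarrow> complex" where
  "apply_op L f z =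
     deriv (deriv f) z + rf_eval (fst L) z * deriv f z + rf_eval (snd L) z * f z"

definition gauss_A :: "'a::field \<Rightarrow> 'a" where
  "gauss_A x = 1 / x + 1 / (2 * (x - 1))"

definition gauss_B :: "'a::field \<Rightarrow> 'a" where
  "gauss_B x = (5 / 144) / (x * (x - 1))"

text \<open>By the chain rule, with \<open>x = x(t)\<close>, one has \<open>D\<^sub>x = x'\<^sup>-\<^sup>1 D\<^sub>t\<close> and
  \<open>D\<^sub>x\<^sup>2 = x'\<^sup>-\<^sup>2 (D\<^sub>t\<^sup>2 - (x''/x') D\<^sub>t)\<close>; the result is made monic. The coefficients \<open>a\<close>, \<open>b\<close> of
  \<open>D\<^sub>x\<^sup>2 + a(x) D\<^sub>x + b(x)\<close> are given as maps on rational functions, so that \<open>a x\<close> is the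
  composite.\<close>

definition pullback_op :: "(ratfun \<Rightarrow> ratfun) \<Rightarrow> (ratfun \<Rightarrow> ratfun) \<Rightarrow> ratfun \<Rightarrow> monic_op2" where
  "pullback_op a b x =
     (let x1 = rf_deriv x; x2 = rf_deriv x1
      in (a x * x1 - x2 / x1, b x * x1 ^ 2))"

text \<open>The operator \<open>f L f\<^sup>-\<^sup>1\<close>, where \<open>f\<close> has logarithmic derivative \<open>f'/f = g\<close>: it annihilates
  \<open>f u\<close> iff \<open>L\<close> annihilates \<open>u\<close>.\<close>

definition conj_op :: "ratfun \<Rightarrow> monic_op2 \<Rightarrow> monic_op2" where
  "conj_op g L =
     (let (A, B) = L in (A - 2 * g, B - A * g + g ^ 2 - rf_deriv g))"

text \<open>The logarithmic derivative of \<open>P\<^sup>-\<^sup>1\<^sup>/\<^sup>1\<^sup>2\<close> is \<open>-P'/(12 P)\<close>.\<close>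

definition picard_fuchs :: "complex poly \<Rightarrow> complex poly \<Rightarrow> monic_op2" where
  "picard_fuchs P Q =
     (let p = to_fract P; q = to_fract Q
      in conj_op (- (1/12) * (rf_deriv p / p)) (pullback_op gauss_A gauss_B (12^3 * q / p)))"


subsection \<open>Consistency of the definitions\<close>

lemma rf_eval_Fract:
  assumes "poly b z \<noteq> 0"
  shows "rf_eval (Fract a b) z = poly a z / poly b z"
proof -
  define c where "c = fst (quot_of_fract (Fract a b))"
  define d where "d = snd (quot_of_fract (Fract a b))"
  have b0: "b \<noteq> 0" using assms by auto
  have d0: "d \<noteq> 0" by (simp add: d_def)
  have "Fract c d = Fract a b" by (simp add: c_def d_def)
  hence eq: "c * b = a * d" using b0 d0 by (simp add: eq_fract)
  have eq': "poly c z * poly b z = poly a z * poly d z"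
    using arg_cong[OF eq, of "\<lambda>p. poly p z"] by simp
  have cop: "coprime c d" unfolding c_def d_def by (rule coprime_quot_of_fract)
  have "poly d z \<noteq> 0"
  proof
    assume d: "poly d z = 0"
    hence "poly c z = 0" using eq' assms by simp
    hence "[:-z, 1:] dvd c" "[:-z, 1:] dvd d" using d by (auto simp: poly_eq_0_iff_dvd)
    hence "is_unit [:-z, 1:]" using cop by (meson coprime_common_divisor)
    thus False by (simp add: is_unit_pCons_iff)
  qed
  thus ?thesis using eq' assms
    by (simp add: rf_eval_def case_prod_unfold c_def[symmetric] d_def[symmetric] field_simps)
qed

lemma rf_deriv_Fract:
  assumes "b \<noteq> 0"
  shows "rf_deriv (Fract a b) = Fract (pderiv a * b - a * pderiv b) (b ^ 2)"
proof -
  define c where "c = fst (quot_of_fract (Fract a b))"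
  define d where "d = snd (quot_of_fract (Fract a b))"
  have d0: "d \<noteq> 0" by (simp add: d_def)
  have "Fract c d = Fract a b" by (simp add: c_def d_def)
  hence eq: "c * b = a * d" using assms d0 by (simp add: eq_fract)
  have eq': "pderiv c * b + c * pderiv b = pderiv a * d + a * pderiv d"
    using arg_cong[OF eq, of pderiv] by (simp add: pderiv_mult algebra_simps)
  have "(pderiv c * d - c * pderiv d) * b^2 = (pderiv a * b - a * pderiv b) * d^2"
    using eq eq' by algebra
  thus ?thesis using assms d0
    by (simp add: rf_deriv_def case_prod_unfold c_def[symmetric] d_def[symmetric] eq_fract)
qed

definition rf_at :: "ratfun \<Rightarrow> complex \<Rightarrow> complex \<Rightarrow> bool" where
  "rf_at r z c \<longleftrightarrow> (\<exists>a b. poly b z \<noteq> 0 \<and> r = Fract a b \<and> c = poly a z / poly b z)"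

lemma rf_at_eval: "rf_at r z c \<Longrightarrow> rf_eval r z = c"
  by (auto simp: rf_at_def rf_eval_Fract)

lemma rf_at_Fract: "poly b z \<noteq> 0 \<Longrightarrow> rf_at (Fract a b) z (poly a z / poly b z)"
  by (auto simp: rf_at_def)

lemma rf_at_of_nat: "rf_at (of_nat n) z (of_nat n)"
  unfolding rf_at_def
  by (rule exI[of _ "of_nat n"], rule exI[of _ 1]) (simp add: Fract_of_nat_eq)

lemma rf_at_numeral: "rf_at (numeral n) z (numeral n)"
  using rf_at_of_nat[of "numeral n" z] by simp

lemma rf_at_1: "rf_at 1 z 1"
  using rf_at_of_nat[of 1 z] by simp

lemma rf_at_add: "rf_at r z c \<Longrightarrow> rf_at s z d \<Longrightarrow> rf_at (r + s) z (c + d)"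
  unfolding rf_at_def
proof (elim exE conjE)
  fix a b a' b'
  assume *: "poly b z \<noteq> 0" "r = Fract a b" "c = poly a z / poly b z"
    "poly b' z \<noteq> 0" "s = Fract a' b'" "d = poly a' z / poly b' z"
  hence "b \<noteq> 0" "b' \<noteq> 0" by auto
  thus "\<exists>a b. poly b z \<noteq> 0 \<and> r + s = Fract a b \<and> c + d = poly a z / poly b z"
    using * by - (rule exI[of _ "a * b' + a' * b"], rule exI[of _ "b * b'"], simp add: add_frac_eq algebra_simps)
qed

lemma rf_at_uminus: "rf_at r z c \<Longrightarrow> rf_at (- r) z (- c)"
  unfolding rf_at_def
proof (elim exE conjE)
  fix a b
  assume "poly b z \<noteq> 0" "r = Fract a b" "c = poly a z / poly b z"
  thus "\<exists>a b. poly b z \<noteq> 0 \<and> - r = Fract a b \<and> - c = poly a z / poly b z"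
    by (intro exI[of _ "- a"] exI[of _ b]) auto
qed

lemma rf_at_diff: "rf_at r z c \<Longrightarrow> rf_at s z d \<Longrightarrow> rf_at (r - s) z (c - d)"
  using rf_at_add[of r z c "- s" "- d"] rf_at_uminus[of s z d] by simp

lemma rf_at_mult: "rf_at r z c \<Longrightarrow> rf_at s z d \<Longrightarrow> rf_at (r * s) z (c * d)"
  unfolding rf_at_def
proof (elim exE conjE)
  fix a b a' b'
  assume "poly b z \<noteq> 0" "r = Fract a b" "c = poly a z / poly b z"
    "poly b' z \<noteq> 0" "s = Fract a' b'" "d = poly a' z / poly b' z"
  thus "\<exists>a b. poly b z \<noteq> 0 \<and> r * s = Fract a b \<and> c * d = poly a z / poly b z"
    by (intro exI[of _ "a * a'"] exI[of _ "b * b'"]) auto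
qed

lemma rf_at_divide:
  "rf_at r z c \<Longrightarrow> rf_at s z d \<Longrightarrow> d \<noteq> 0 \<Longrightarrow> rf_at (r / s) z (c / d)"
  unfolding rf_at_def
proof (elim exE conjE)
  fix a b a' b'
  assume "poly b z \<noteq> 0" "r = Fract a b" "c = poly a z / poly b z" "d \<noteq> 0"
    "poly b' z \<noteq> 0" "s = Fract a' b'" "d = poly a' z / poly b' z"
  thus "\<exists>a b. poly b z \<noteq> 0 \<and> r / s = Fract a b \<and> c / d = poly a z / poly b z"
    by (intro exI[of _ "a * b'"] exI[of _ "b * a'"]) auto
qed

lemma rf_at_power: "rf_at r z c \<Longrightarrow> rf_at (r ^ n) z (c ^ n)"
  by (induction n) (auto intro: rf_at_1 rf_at_mult)

lemma rf_at_deriv: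
  assumes "rf_at r z c"
  shows "rf_at (rf_deriv r) z (deriv (rf_eval r) z)"
    and "((rf_eval r) has_field_derivative deriv (rf_eval r) z) (at z)"
    and "\<forall>\<^sub>F w in nhds z. rf_at r w (rf_eval r w)"
proof -
  obtain a b where ab: "poly b z \<noteq> 0" "r = Fract a b"
    using assms by (auto simp: rf_at_def)
  have "isCont (poly b) z" by simp
  hence ev: "\<forall>\<^sub>F w in nhds z. poly b w \<noteq> 0"
    using ab(1) by (simp add: eventually_nhds_conv_at continuous_within tendsto_imp_eventually_ne)
  thus "\<forall>\<^sub>F w in nhds z. rf_at r w (rf_eval r w)"
    by eventually_elim (auto simp: ab(2) rf_eval_Fract intro: rf_at_Fract)
  have ev': "\<forall>\<^sub>F w in nhds z. rf_eval r w = poly a w / poly b w"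
    using ev by eventually_elim (simp add: ab(2) rf_eval_Fract)
  define D where "D = poly (pderiv a * b - a * pderiv b) z / poly (b ^ 2) z"
  have "((\<lambda>w. poly a w / poly b w) has_field_derivative D) (at z)"
    unfolding D_def using ab(1)
    by (auto intro!: derivative_eq_intros simp: power2_eq_square field_simps)
  hence der: "((rf_eval r) has_field_derivative D) (at z)"
    by (subst DERIV_cong_ev[OF refl ev' refl])
  have b0: "b \<noteq> 0" using ab by auto
  have "rf_at (rf_deriv r) z D"
    unfolding ab(2) rf_deriv_Fract[OF b0] D_def using ab(1) by (intro rf_at_Fract) auto
  with der show "rf_at (rf_deriv r) z (deriv (rf_eval r) z)"
    and "((rf_eval r) has_field_derivative deriv (rf_eval r) z) (at z)"
    by (simp_all add: DERIV_imp_deriv)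
qed

text \<open>Wherever all the ingredients are regular, \<open>f\<^sup>-\<^sup>1 u(x)\<close> with \<open>f\<close> a branch of \<open>P\<^sup>1\<^sup>/\<^sup>1\<^sup>2\<close> is a
  solution of the Picard--Fuchs equation iff \<open>u\<close> is one of the hypergeometric equation.\<close>

lemma apply_picard_fuchs:
  fixes P Q :: "complex poly" and z :: complex
  defines "x \<equiv> (\<lambda>t. 12^3 * poly Q t / poly P t)"
  assumes nz: "poly P z \<noteq> 0" "x z \<noteq> 0" "x z \<noteq> 1" "deriv x z \<noteq> 0"
    and u: "u analytic_on {x z}"
    and f: "f analytic_on {z}" "\<forall>\<^sub>F t in nhds z. f t ^ 12 = poly P t"
  shows "apply_op (picard_fuchs P Q) (\<lambda>t. u (x t) / f t) z =
    deriv x z ^ 2 / f z *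
    (deriv (deriv u) (x z) + gauss_A (x z) * deriv u (x z) + gauss_B (x z) * u (x z))"
proof -
  define X where "X = 12^3 * to_fract Q / to_fract P"
  define G where "G = (1/12) * (rf_deriv (to_fract P) / to_fract P)"
  have P: "rf_at (to_fract P) w (poly P w)" for w
    using rf_at_Fract[of 1 w P] by (simp add: to_fract_def)
  have Q: "rf_at (to_fract Q) w (poly Q w)" for w
    using rf_at_Fract[of 1 w Q] by (simp add: to_fract_def)
  have P': "rf_at (rf_deriv (to_fract P)) w (poly (pderiv P) w)" for w
  proof -
    have "rf_deriv (to_fract P) = Fract (pderiv P) 1"
      using rf_deriv_Fract[of 1 P] by (simp add: to_fract_def pderiv_1)
    thus ?thesis using rf_at_Fract[of 1 w "pderiv P"] by simp
  qed
  have evP: "\<forall>\<^sub>F w in nhds z. poly P w \<noteq> 0"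
  proof -
    have "isCont (poly P) z" by simp
    thus ?thesis using nz(1)
      by (simp add: eventually_nhds_conv_at continuous_within tendsto_imp_eventually_ne)
  qed
  have Xat: "rf_at X w (x w)" if "poly P w \<noteq> 0" for w
    unfolding X_def x_def using that
    by (intro rf_at_divide rf_at_mult rf_at_power rf_at_numeral P Q)
  have Xx: "\<forall>\<^sub>F w in nhds z. rf_eval X w = x w"
    using evP by eventually_elim (use Xat rf_at_eval in blast)
  define g where "g = (\<lambda>w. poly (pderiv P) w / (12 * poly P w))"
  have Gat: "rf_at G w (g w)" if "poly P w \<noteq> 0" for w
  proof -
    have "rf_at G w (1/12 * (poly (pderiv P) w / poly P w))"
      unfolding G_def using that
      by (intro rf_at_divide rf_at_mult rf_at_1 rf_at_numeral P P') auto
    thus ?thesis by (simp add: g_def)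
  qed
  have Gg: "\<forall>\<^sub>F w in nhds z. rf_eval G w = g w"
    using evP by eventually_elim (use Gat rf_at_eval in blast)

  have evX: "\<forall>\<^sub>F w in nhds z. (x has_field_derivative deriv x w) (at w) \<and>
      rf_at (rf_deriv X) w (deriv x w) \<and> deriv x w = rf_eval (rf_deriv X) w"
    using eventually_eventually[THEN iffD2, OF Xx] evP
  proof eventually_elim
    case (elim w)
    have 1: "deriv (rf_eval X) w = deriv x w"
      by (rule deriv_cong_ev[OF elim(1) refl])
    have 2: "(x has_field_derivative deriv (rf_eval X) w) (at w)"
      using rf_at_deriv(2)[OF Xat[OF elim(2)]]
      by (subst DERIV_cong_ev[OF refl _ refl, of _ "rf_eval X"])
         (use elim(1) in \<open>auto elim: eventually_mono\<close>)
    show ?case using rf_at_deriv(1)[OF Xat[OF elim(2)]] 2 rf_at_eval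
      unfolding 1 by metis
  qed
  hence dX: "rf_at (rf_deriv X) z (deriv x z)" and dx: "(x has_field_derivative deriv x z) (at z)"
    by (auto dest: eventually_nhds_x_imp_x)
  have evdX: "\<forall>\<^sub>F w in nhds z. deriv x w = rf_eval (rf_deriv X) w"
    using evX by (auto elim: eventually_mono)
  define x2 where "x2 = deriv (deriv x) z"
  have x2eq: "deriv (rf_eval (rf_deriv X)) z = x2"
    unfolding x2_def by (rule deriv_cong_ev[OF _ refl]) (use evdX in \<open>auto elim: eventually_mono\<close>)
  have ddX: "rf_at (rf_deriv (rf_deriv X)) z x2"
    using rf_at_deriv(1)[OF dX] by (simp add: x2eq)
  have ddx: "(deriv x has_field_derivative x2) (at z)"
    using rf_at_deriv(2)[OF dX] unfolding x2eq
    by (subst DERIV_cong_ev[OF refl evdX refl])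

  define g1 where "g1 = deriv g z"
  have g1eq: "deriv (rf_eval G) z = g1"
    unfolding g1_def by (rule deriv_cong_ev[OF Gg refl])
  have dG: "rf_at (rf_deriv G) z g1"
    using rf_at_deriv(1)[OF Gat[OF nz(1)]] by (simp add: g1eq)
  have dg: "(g has_field_derivative g1) (at z)"
    using rf_at_deriv(2)[OF Gat[OF nz(1)]] unfolding g1eq
    by (subst DERIV_cong_ev[OF refl _ refl, of _ "rf_eval G"])
       (use Gg in \<open>auto elim: eventually_mono\<close>)
  have dmG: "rf_deriv (- G) = - rf_deriv G"
  proof -
    obtain a b where G: "G = Fract a b" "b \<noteq> 0"
      by (cases G rule: Fract_cases) auto
    have "- G = Fract (- a) b" using G by simp
    thus ?thesis using G by (simp add: rf_deriv_Fract pderiv_minus)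
  qed

  define A where "A = gauss_A (x z) * deriv x z - x2 / deriv x z + 2 * g z"
  define B where "B = gauss_B (x z) * deriv x z ^ 2
      + (gauss_A (x z) * deriv x z - x2 / deriv x z) * g z + g z ^ 2 + g1"
  have Aat: "rf_at (gauss_A X) z (gauss_A (x z))"
    unfolding gauss_A_def using nz
    by (intro rf_at_add rf_at_divide rf_at_mult rf_at_diff rf_at_1 rf_at_numeral Xat) auto
  have Bat: "rf_at (gauss_B X) z (gauss_B (x z))"
    unfolding gauss_B_def using nz
    by (intro rf_at_add rf_at_divide rf_at_mult rf_at_diff rf_at_1 rf_at_numeral Xat) auto
  have pf: "picard_fuchs P Q =
      (gauss_A X * rf_deriv X - rf_deriv (rf_deriv X) / rf_deriv X - 2 * (- G),
       gauss_B X * rf_deriv X ^ 2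
       - (gauss_A X * rf_deriv X - rf_deriv (rf_deriv X) / rf_deriv X) * (- G)
       + (- G) ^ 2 - rf_deriv (- G))"
    by (simp add: picard_fuchs_def conj_op_def pullback_op_def Let_def X_def G_def)
  have "rf_at (fst (picard_fuchs P Q)) z
      (gauss_A (x z) * deriv x z - x2 / deriv x z - 2 * (- g z))"
    unfolding pf fst_conv using nz
    by (intro rf_at_add rf_at_divide rf_at_mult rf_at_diff rf_at_uminus rf_at_numeral Aat dX ddX Gat)
  hence evA: "rf_eval (fst (picard_fuchs P Q)) z = A"
    by (simp add: rf_at_eval A_def)
  have "rf_at (snd (picard_fuchs P Q)) z
      (gauss_B (x z) * deriv x z ^ 2
       - (gauss_A (x z) * deriv x z - x2 / deriv x z) * (- g z) + (- g z) ^ 2 - (- g1))"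
    unfolding pf snd_conv dmG using nz
    by (intro rf_at_add rf_at_divide rf_at_mult rf_at_diff rf_at_uminus rf_at_power
          Aat Bat dX ddX Gat dG)
  hence evB: "rf_eval (snd (picard_fuchs P Q)) z = B"
    by (simp add: rf_at_eval B_def)

  have evf: "\<forall>\<^sub>F t in nhds z. f t \<noteq> 0 \<and> (f has_field_derivative g t * f t) (at t)"
  proof -
    have "\<forall>\<^sub>F t in nhds z. f analytic_on {t}"
      using f(1) by (simp add: analytic_at_imp_isCont eventually_nhds analytic_on_def)
        (metis analytic_on_def analytic_at_ball analytic_at centre_in_ball open_ball)
    thus ?thesis using eventually_eventually[THEN iffD2, OF f(2)] evP
    proof eventually_elim
      case (elim t)
      have ft: "f t ^ 12 = poly P t" using elim(2) by (rule eventually_nhds_x_imp_x)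
      hence f0: "f t \<noteq> 0" using elim(3) by auto
      have df: "(f has_field_derivative deriv f t) (at t)"
        using elim(1) analytic_on_imp_differentiable_at DERIV_deriv_iff_field_differentiable by blast
      have "((\<lambda>t. f t ^ 12) has_field_derivative 12 * f t ^ 11 * deriv f t) (at t)"
        by (auto intro!: derivative_eq_intros df)
      moreover have "((\<lambda>t. f t ^ 12) has_field_derivative poly (pderiv P) t) (at t)"
        by (subst DERIV_cong_ev[OF refl elim(2) refl]) (rule poly_DERIV)
      ultimately have "12 * f t ^ 11 * deriv f t = poly (pderiv P) t"
        by (rule DERIV_unique)
      hence "12 * f t ^ 12 * deriv f t = poly (pderiv P) t * f t"
        by (simp add: eval_nat_numeral algebra_simps)
      hence "deriv f t = g t * f t"
        using elim(3) unfolding ft g_def by (simp add: field_simps)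
      thus ?case using f0 df by simp
    qed
  qed
  have evu: "\<forall>\<^sub>F t in nhds z. (u has_field_derivative deriv u (x t)) (at (x t))"
  proof -
    have "\<forall>\<^sub>F y in nhds (x z). u analytic_on {y}"
      using u by (simp add: analytic_at_imp_isCont eventually_nhds analytic_on_def)
        (metis analytic_on_def analytic_at_ball analytic_at centre_in_ball open_ball)
    hence "\<forall>\<^sub>F y in nhds (x z). (u has_field_derivative deriv u y) (at y)"
      by eventually_elim
        (use analytic_on_imp_differentiable_at DERIV_deriv_iff_field_differentiable in blast)
    moreover have "filterlim x (nhds (x z)) (nhds z)"
      using DERIV_isCont[OF dx] by (simp add: isCont_def tendsto_at_iff_tendsto_nhds)
    ultimately show ?thesis by (rule eventually_compose_filterlim)
  qed
  have ddu: "(deriv u has_field_derivative deriv (deriv u) (x z)) (at (x z))"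
    using analytic_deriv[OF u] analytic_on_imp_differentiable_at
      DERIV_deriv_iff_field_differentiable by blast
  define v where "v = (\<lambda>t. u (x t) / f t)"
  have dv: "\<forall>\<^sub>F t in nhds z. deriv v t = (deriv u (x t) * deriv x t - g t * u (x t)) / f t"
    using evX evf evu
  proof eventually_elim
    case (elim t)
    have "((\<lambda>t. u (x t)) has_field_derivative deriv u (x t) * deriv x t) (at t)"
      using DERIV_chain2[of u _ x t] elim by blast
    moreover have "(f has_field_derivative g t * f t) (at t)" "f t \<noteq> 0" using elim by auto
    ultimately have "(v has_field_derivative
        (deriv u (x t) * deriv x t * f t - u (x t) * (g t * f t)) / (f t * f t)) (at t)"
      unfolding v_def by (rule DERIV_divide)
    hence "deriv v t = (deriv u (x t) * deriv x t * f t - u (x t) * (g t * f t)) / (f t * f t)"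
      by (rule DERIV_imp_deriv)
    also have "\<dots> = (f t * (deriv u (x t) * deriv x t - g t * u (x t))) / (f t * f t)"
      by (simp add: algebra_simps)
    also have "\<dots> = (deriv u (x t) * deriv x t - g t * u (x t)) / f t"
      using elim by simp
    finally show ?case .
  qed
  have fz: "f z \<noteq> 0" "(f has_field_derivative g z * f z) (at z)"
    using evf by (auto dest: eventually_nhds_x_imp_x)
  have ux: "((\<lambda>t. u (x t)) has_field_derivative deriv u (x z) * deriv x z) (at z)"
    using DERIV_chain2[OF _ dx, of u] evu by (auto dest: eventually_nhds_x_imp_x)
  have dux: "((\<lambda>t. deriv u (x t)) has_field_derivative deriv (deriv u) (x z) * deriv x z) (at z)"
    using DERIV_chain2[OF ddu dx] .
  have "deriv (deriv v) z =
      deriv (\<lambda>t. (deriv u (x t) * deriv x t - g t * u (x t)) / f t) z"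
    by (rule deriv_cong_ev[OF dv refl])
  also have "\<dots> = ((deriv (deriv u) (x z) * deriv x z ^ 2 + deriv u (x z) * x2
      - g1 * u (x z) - g z * (deriv u (x z) * deriv x z))
      - g z * (deriv u (x z) * deriv x z - g z * u (x z))) / f z"
    by (rule DERIV_imp_deriv)
       (use fz in \<open>auto intro!: derivative_eq_intros dux ux ddx dg simp: field_simps power2_eq_square\<close>)
  finally have ddv: "deriv (deriv v) z = \<dots>" .
  have dvz: "deriv v z = (deriv u (x z) * deriv x z - g z * u (x z)) / f z"
    using dv by (rule eventually_nhds_x_imp_x)
  have vz: "v z = u (x z) / f z" by (simp add: v_def)
  have "apply_op (picard_fuchs P Q) v z = deriv x z ^ 2 / f z *
    (deriv (deriv u) (x z) + gauss_A (x z) * deriv u (x z) + gauss_B (x z) * u (x z))"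
    unfolding apply_op_def evA evB ddv dvz vz A_def B_def using fz(1) nz(4)
    by (simp add: field_simps power2_eq_square)
  thus ?thesis by (simp add: v_def)
qed

end

theory Submission
  imports Defs
begin

text \<open>Writing \<open>E\<^sub>4\<close> and the logarithmic derivative of \<open>\<eta>\<close> as lattice sums shows that \<open>j\<close> is a modular
  function. Given that \<open>j\<close> is some rational function of the eta quotient \<open>t\<close>, the function \<open>t\<close> is invariant
  under \<open>\<Gamma>\<^sub>0(N)\<close>. For explicit polynomials \<open>P, Q\<close>, the product of the translates of \<open>P(t) - j Q(t)\<close> over the
  cosets of \<open>\<Gamma>\<^sub>0(N)\<close> is then a modular function, so \<open>P(t) = j Q(t)\<close> as soon as enough \<open>q\<close>-coefficients of the
  difference vanish, and coprimality makes \<open>P, Q\<close> unique up to a common constant.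

  The cover \<open>1728 Q/P\<close> is ramified of order 3 over \<open>0\<close> and of order 2 over \<open>1\<close> away from the elliptic points,
  so that the corresponding singularities of the pulled-back operator disappear. For \<open>N = 4, 8, 9, 12, 16, 18, 25\<close>
  the rational function \<open>P/Q\<close> factors through the one of level \<open>2\<close>, \<open>3\<close>, \<open>5\<close> or \<open>6\<close>; the operators
  of those levels are therefore computed in an arbitrary transcendental rational function \<open>y\<close>.\<close>

section \<open>Lattice sums\<close>

text \<open>The roots of unity in the transformation law of eta are the obstacle. They are avoided
  by using only the absolute value of eta, through |eta|^24 (Im tau)^6, which is invariant under the
  full modular group. It shows that an element of Gamma_0(N) multiplies t by a constant of modulus
  1; the assumed relation j = P(t)/Q(t), together with j t tending to \<open>\<kappa>\<close> at
  infinity, forces that constant to be 1. The same absolute value bounds t at every cusp. Only the N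
  cosets with bottom row (1, d), which lead to the cusp 0, let t grow, each with order -1/N; this
  keeps the number of q-coefficients to be compared near deg P plus the number of the other cosets.
  For the list of cosets, closure under the two generators of the modular group is all that is used.
  The explicit P and Q are certificates, checked in integer arithmetic modulo a power of q. On the
  operator side the facts to be proved are identities between polynomials in y, y' and y'', so that
  a substitution y = y(t) costs only the logarithmic derivatives of a few factors.\<close>

abbreviation e2pi :: "complex \<Rightarrow> complex" where "e2pi z \<equiv> exp (2 * of_real pi * \<i> * z)"

section \<open>The cotangent and its derivatives as rational functions of the nome\<close>

lemma e2pi_eq_1_iff: "e2pi z = 1 \<longleftrightarrow> z \<in> \<int>"
proof -
  have "e2pi z = 1 \<longleftrightarrow> (\<exists>n::int. 2 * of_real pi * \<i> * z = of_int (2 * n) * of_real pi * \<i>)"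
    using exp_eq[of "2 * of_real pi * \<i> * z" 0] by (simp add: algebra_simps)
  also have "\<dots> \<longleftrightarrow> (\<exists>n::int. z = of_int n)"
    by (intro ex_cong1) (auto simp: field_simps)
  finally show ?thesis by (auto simp: Ints_def)
qed

lemma nonint_Polygamma_arg:
  assumes "z \<notin> \<int>"
  shows "z \<notin> \<int>\<^sub>\<le>\<^sub>0" "1 - z \<notin> \<int>\<^sub>\<le>\<^sub>0" "z \<noteq> 0" "1 - z \<noteq> 0"
proof -
  show "z \<notin> \<int>\<^sub>\<le>\<^sub>0" "z \<noteq> 0" "1 - z \<noteq> 0" using assms nonpos_Ints_Int by auto
  show "1 - z \<notin> \<int>\<^sub>\<le>\<^sub>0" using assms nonpos_Ints_Int[of "1 - z"]
    by (metis Ints_1 Ints_diff diff_diff_eq2 add_diff_cancel_left' diff_add_cancel minus_diff_eq)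
qed

text \<open>Logarithmic derivative of Gamma(z) Gamma(1 - z) = pi / sin(pi z). The result is pi
  cot(pi z), rewritten as a rational function of \<open>e2pi z\<close> because q-expansions are the
  goal.\<close>

lemma Digamma_reflection:
  assumes "z \<notin> \<int>"
  shows "Digamma (1 - z) - Digamma z = of_real pi * \<i> * (e2pi z + 1) / (e2pi z - 1)"
proof -
  define s where "s = sin (of_real pi * z)"
  have nz: "s \<noteq> 0"
  proof
    assume "s = 0"
    then obtain n :: int where n: "of_real pi * z = of_real (real_of_int n * pi)"
      unfolding s_def by (subst (asm) sin_eq_0) auto
    hence "of_real pi * z = of_real pi * of_int n" by (simp add: mult.commute)
    hence "z = of_int n" by (subst (asm) mult_cancel_left) auto
    thus False using assms by auto
  qed
  note z = nonint_Polygamma_arg[OF assms]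
  have 1: "((\<lambda>w. Gamma w * Gamma (1 - w)) has_field_derivative
      Gamma z * Gamma (1 - z) * (Digamma z - Digamma (1 - z))) (at z)"
    by (auto intro!: derivative_eq_intros simp: z algebra_simps)
  have 2: "((\<lambda>w. of_real pi / sin (of_real pi * w)) has_field_derivative
      - (of_real pi * of_real pi * cos (of_real pi * z)) / s ^ 2) (at z)"
    unfolding s_def using nz
    by (auto intro!: derivative_eq_intros simp: s_def power2_eq_square)
  have "Gamma z * Gamma (1 - z) * (Digamma z - Digamma (1 - z)) =
      - (of_real pi * of_real pi * cos (of_real pi * z)) / s ^ 2"
    using DERIV_unique[OF 1] 2 unfolding Gamma_reflection_complex by blast
  hence "of_real pi / s * (Digamma z - Digamma (1 - z)) =
      - (of_real pi * of_real pi * cos (of_real pi * z)) / s ^ 2"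
    unfolding Gamma_reflection_complex s_def .
  hence "of_real pi * ((Digamma (1 - z) - Digamma z) * s) = of_real pi * (of_real pi * cos (of_real pi * z))"
    using nz by (simp add: field_simps power2_eq_square)
  hence eq: "(Digamma (1 - z) - Digamma z) * s = of_real pi * cos (of_real pi * z)"
    by (subst (asm) mult_cancel_left) auto
  \<comment> \<open>A square root of \<open>e2pi z\<close>: sine and cosine of pi z are rational in
    \<open>w\<close>, and \<open>w\<close> drops out of their quotient.\<close>
  define w where "w = exp (\<i> * (of_real pi * z))"
  have w0: "w \<noteq> 0" by (simp add: w_def)
  have w2: "w ^ 2 = e2pi z" unfolding w_def by (simp add: exp_double[symmetric] algebra_simps)
  have "s = (w - inverse w) / (2 * \<i>)" "cos (of_real pi * z) = (w + inverse w) / 2"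
    unfolding s_def w_def sin_exp_eq cos_exp_eq exp_minus by (rule refl)+
  moreover have "(w - inverse w) * w = w^2 - 1" "(w + inverse w) * w = w^2 + 1"
    using w0 by (simp_all only: ring_distribs left_inverse power2_eq_square not_False_eq_True)
  hence "(w - inverse w) / (2 * \<i>) = (w^2 - 1) / (2 * \<i> * w)"
      "(w + inverse w) / 2 = (w^2 + 1) / (2 * w)"
    using mult_divide_mult_cancel_right[OF w0, of "w - inverse w" "2 * \<i>"]
      mult_divide_mult_cancel_right[OF w0, of "w + inverse w" 2] by metis+
  ultimately have s: "s = (e2pi z - 1) / (2 * \<i> * w)" and c: "cos (of_real pi * z) = (e2pi z + 1) / (2 * w)"
    by (simp_all add: w2)
  have "e2pi z \<noteq> 1" using assms by (simp add: e2pi_eq_1_iff)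
  hence q1: "e2pi z - 1 \<noteq> 0" by simp
  have "(Digamma (1 - z) - Digamma z) * (e2pi z - 1) =
      ((Digamma (1 - z) - Digamma z) * ((e2pi z - 1) / (2 * \<i> * w))) * (2 * \<i> * w)"
    using w0 by simp
  also have "\<dots> = of_real pi * ((e2pi z + 1) / (2 * w)) * (2 * \<i> * w)"
    by (simp only: eq[unfolded s c])
  also have "\<dots> = of_real pi * \<i> * (e2pi z + 1)" using w0 by simp
  finally show ?thesis using q1 by (simp only: nonzero_eq_divide_eq not_False_eq_True)
qed

lemma open_nonints: "open (- \<int> :: complex set)"
  using closed_Ints by blast

text \<open>Derivatives of the reflection formula for Digamma. On functions of q = e2pi z the
  operator d/dz acts as 2 pi i q d/dq, so every right-hand side stays rational in q; q^2 + 4 q + 1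
  is the Eulerian polynomial belonging to the cubes. \<open>Polygamma 2\<close> is only a stage on
  the way to \<open>Polygamma 3\<close>.\<close>

lemma Polygamma_reflection:
  assumes z: "z \<notin> \<int>"
  shows "Polygamma 1 z + Polygamma 1 (1 - z) = -4 * of_real pi ^ 2 * e2pi z / (1 - e2pi z) ^ 2"
    and "Polygamma 3 z + Polygamma 3 (1 - z) =
      16 * of_real pi ^ 4 * (e2pi z * (e2pi z ^ 2 + 4 * e2pi z + 1)) / (1 - e2pi z) ^ 4"
proof -
  have q1: "e2pi z - 1 \<noteq> 0" if "z \<notin> \<int>" for z using that e2pi_eq_1_iff by auto
  \<comment> \<open>The formulas hold off the integers only; as that set is open, both sides still
    have the same derivative.\<close>
  have step: "D1 = D2" if "\<And>w. w \<notin> \<int> \<Longrightarrow> f w = g w" "(f has_field_derivative D1) (at z)"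
     "(g has_field_derivative D2) (at z)" "z \<notin> \<int>" for f g :: "complex \<Rightarrow> complex" and D1 D2 z
    using has_field_derivative_transform_within_open[of f D1 z "- \<int>" g] that open_nonints
      DERIV_unique by auto
  have 1: "Polygamma 1 z + Polygamma 1 (1 - z) = -4 * of_real pi ^ 2 * (e2pi z / (e2pi z - 1) ^ 2)"
    if z: "z \<notin> \<int>" for z
  proof (rule step[OF _ _ _ z])
    show "- (Digamma (1 - w) - Digamma w) = - (of_real pi * \<i> * (e2pi w + 1) / (e2pi w - 1))"
      if "w \<notin> \<int>" for w using Digamma_reflection[OF that] by simp
    show "((\<lambda>w. - (Digamma (1 - w) - Digamma w)) has_field_derivative
        Polygamma 1 z + Polygamma 1 (1 - z)) (at z)"
      using nonint_Polygamma_arg[OF z] by (auto intro!: derivative_eq_intros)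
    show "((\<lambda>w. - (of_real pi * \<i> * (e2pi w + 1) / (e2pi w - 1))) has_field_derivative
        -4 * of_real pi ^ 2 * (e2pi z / (e2pi z - 1) ^ 2)) (at z)"
      apply (rule derivative_eq_intros refl q1 z)+
      using q1[OF z] by (simp add: divide_simps) (simp add: algebra_simps power2_eq_square)
  qed
  show "Polygamma 1 z + Polygamma 1 (1 - z) = -4 * of_real pi ^ 2 * e2pi z / (1 - e2pi z) ^ 2"
    using 1[OF z] by (simp add: power2_commute)
  have 2: "Polygamma 2 z - Polygamma 2 (1 - z) =
      8 * \<i> * of_real pi ^ 3 * (e2pi z * (e2pi z + 1) / (e2pi z - 1) ^ 3)"
    if z: "z \<notin> \<int>" for z
  proof (rule step[OF 1 _ _ z])
    show "((\<lambda>w. Polygamma 1 w + Polygamma 1 (1 - w)) has_field_derivative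
        Polygamma 2 z - Polygamma 2 (1 - z)) (at z)"
      using nonint_Polygamma_arg[OF z] by (auto intro!: derivative_eq_intros simp: numeral_2_eq_2)
    show "((\<lambda>w. -4 * of_real pi ^ 2 * (e2pi w / (e2pi w - 1) ^ 2)) has_field_derivative
        8 * \<i> * of_real pi ^ 3 * (e2pi z * (e2pi z + 1) / (e2pi z - 1) ^ 3)) (at z)"
    proof -
      have e: "(e2pi has_field_derivative 2 * of_real pi * \<i> * e2pi z) (at z)"
        by (auto intro!: derivative_eq_intros)
      have "((\<lambda>w. w / (w - 1) ^ 2) has_field_derivative - ((e2pi z + 1) / (e2pi z - 1) ^ 3)) (at (e2pi z))"
        apply (rule derivative_eq_intros refl)+
        using q1[OF z] apply simp
        using q1[OF z] by (simp add: divide_simps) (simp add: algebra_simps eval_nat_numeral)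
      from DERIV_cmult[OF DERIV_chain2[OF this e], of "-4 * of_real pi ^ 2"] show ?thesis
        by (rule DERIV_cong) (simp add: power2_eq_square power3_eq_cube power4_eq_xxxx mult_ac)
    qed
  qed
  have 3: "Polygamma 3 z + Polygamma 3 (1 - z) =
      16 * of_real pi ^ 4 * (e2pi z * (e2pi z ^ 2 + 4 * e2pi z + 1) / (e2pi z - 1) ^ 4)"
    if z: "z \<notin> \<int>" for z
  proof (rule step[OF 2 _ _ z])
    show "((\<lambda>w. Polygamma 2 w - Polygamma 2 (1 - w)) has_field_derivative
        Polygamma 3 z + Polygamma 3 (1 - z)) (at z)"
      using nonint_Polygamma_arg[OF z]
      by (auto intro!: derivative_eq_intros simp: numeral_2_eq_2 numeral_3_eq_3)
    show "((\<lambda>w. 8 * \<i> * of_real pi ^ 3 * (e2pi w * (e2pi w + 1) / (e2pi w - 1) ^ 3)) has_field_derivative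
        16 * of_real pi ^ 4 * (e2pi z * (e2pi z ^ 2 + 4 * e2pi z + 1) / (e2pi z - 1) ^ 4)) (at z)"
    proof -
      have e: "(e2pi has_field_derivative 2 * of_real pi * \<i> * e2pi z) (at z)"
        by (auto intro!: derivative_eq_intros)
      have "((\<lambda>w. w * (w + 1) / (w - 1) ^ 3) has_field_derivative
          - ((e2pi z ^ 2 + 4 * e2pi z + 1) / (e2pi z - 1) ^ 4)) (at (e2pi z))"
        apply (rule derivative_eq_intros refl)+
        using q1[OF z] apply simp
        using q1[OF z] by (simp add: divide_simps) (simp add: algebra_simps eval_nat_numeral)
      from DERIV_cmult[OF DERIV_chain2[OF this e], of "8 * \<i> * of_real pi ^ 3"] show ?thesis
        by (rule DERIV_cong) (simp add: power2_eq_square power3_eq_cube power4_eq_xxxx mult_ac)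
    qed
  qed
  have eq: "(1 - e2pi z) ^ 4 = (e2pi z - 1) ^ 4" by algebra
  show "Polygamma 3 z + Polygamma 3 (1 - z) =
      16 * of_real pi ^ 4 * (e2pi z * (e2pi z ^ 2 + 4 * e2pi z + 1)) / (1 - e2pi z) ^ 4"
    by (simp only: 3[OF z] eq times_divide_eq_right)
qed

lemma has_sum_nat_int_split:
  fixes f :: "int \<Rightarrow> complex"
  assumes "((\<lambda>n::nat. f (int n)) has_sum a) UNIV" "((\<lambda>n::nat. f (- int n - 1)) has_sum b) UNIV"
  shows "(f has_sum (a + b)) UNIV"
proof -
  have 1: "(f has_sum a) {0..}"
  proof -
    have "((\<lambda>n::nat. f (int n)) has_sum a) UNIV \<longleftrightarrow> (f has_sum a) {0..}"
      by (rule has_sum_reindex_bij_witness[of _ nat int]) auto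
    thus ?thesis using assms(1) by simp
  qed
  have 2: "(f has_sum b) {..<0}"
  proof -
    have "((\<lambda>n::nat. f (- int n - 1)) has_sum b) UNIV \<longleftrightarrow> (f has_sum b) {..<0}"
      by (rule has_sum_reindex_bij_witness[of _ "\<lambda>n. nat (- n - 1)" "\<lambda>n. - int n - 1"]) auto
    thus ?thesis using assms(2) by simp
  qed
  have "(f has_sum (a + b)) ({0..} \<union> {..<0})"
    using 1 2 by (rule has_sum_Un_disjoint) auto
  moreover have "{0..} \<union> {..<0} = (UNIV :: int set)" by auto
  ultimately show ?thesis by simp
qed

lemma Polygamma_has_sum:
  fixes z :: complex
  assumes "z \<notin> \<int>\<^sub>\<le>\<^sub>0" "j \<ge> 1"
  shows "((\<lambda>n::nat. 1 / (z + of_nat n) ^ Suc j) has_sum ((-1) ^ Suc j * Polygamma j z / fact j)) UNIV"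
proof -
  have sm: "summable (\<lambda>n. 1 / (norm (z + of_nat n)) ^ Suc j)"
  proof -
    \<comment> \<open>From \<open>M\<close> on, n is at least twice the norm of z, so the norm of z
      + n is at least n/2.\<close>
    define M where "M = nat \<lceil>2 * norm z\<rceil> + 1"
    have "eventually (\<lambda>n. norm (1 / norm (z + of_nat n) ^ Suc j) \<le> 2 ^ Suc j * inverse (of_nat n ^ Suc j)) sequentially"
      using eventually_ge_at_top[of M]
    proof eventually_elim
      case (elim n)
      hence n: "real n \<ge> 2 * norm z" "n > 0" unfolding M_def by linarith+
      have le: "real n / 2 \<le> norm (z + of_nat n)"
        using norm_triangle_ineq4[of "z + of_nat n" z] n by simp
      hence pos: "0 < norm (z + of_nat n)" using n by linarith
      have "norm (1 / norm (z + of_nat n) ^ Suc j) = 1 / norm (z + of_nat n) ^ Suc j" by simp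
      also have "\<dots> \<le> 1 / (real n / 2) ^ Suc j"
      proof (rule divide_left_mono)
        show "(real n / 2) ^ Suc j \<le> norm (z + of_nat n) ^ Suc j" using le by (rule power_mono) simp
        show "0 < norm (z + of_nat n) ^ Suc j * (real n / 2) ^ Suc j"
          by (rule mult_pos_pos; rule zero_less_power) (use pos n(2) in simp_all)
      qed simp
      also have "\<dots> = 2 ^ Suc j * inverse (of_nat n ^ Suc j)"
        by (simp add: power_divide inverse_eq_divide)
      finally show ?case .
    qed
    moreover have "summable (\<lambda>n. 2 ^ Suc j * inverse (real n ^ Suc j))"
      by (intro summable_mult inverse_power_summable) (use assms in auto)
    ultimately show ?thesis by (rule summable_comparison_test_ev)
  qed
  have "summable (\<lambda>n. 1 / (z + of_nat n) ^ Suc j)"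
    by (rule summable_norm_cancel) (use sm in \<open>simp add: norm_divide norm_power norm_mult\<close>)
  moreover have "(\<Sum>n. 1 / (z + of_nat n) ^ Suc j) = (-1) ^ Suc j * Polygamma j z / fact j"
    using assms by (simp add: Polygamma_def inverse_eq_divide)
  ultimately show ?thesis
    using sm by (intro norm_summable_imp_has_sum) (auto simp: sums_iff norm_divide norm_power norm_mult)
qed

text \<open>The Lipschitz formulas. Negative integers are reindexed so that 1 - z + n appears with n
  a natural number, the even exponent hiding the sign; the two halves are then polygamma series at z
  and at 1 - z.\<close>

lemma has_sum_lattice_row:
  assumes z: "z \<notin> \<int>"
  shows "((\<lambda>n::int. 1 / (z + of_int n) ^ 2) has_sum (-4 * of_real pi ^ 2 * e2pi z / (1 - e2pi z) ^ 2)) UNIV"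
    and "((\<lambda>n::int. 1 / (z + of_int n) ^ 4) has_sum
      (8 / 3 * of_real pi ^ 4 * (e2pi z * (e2pi z ^ 2 + 4 * e2pi z + 1)) / (1 - e2pi z) ^ 4)) UNIV"
proof -
  note z' = nonint_Polygamma_arg[OF z]
  have neg: "(z + of_int (- int n - 1)) ^ k = (1 - z + of_nat n) ^ k" if "even k" for n k
  proof -
    have "z + of_int (- int n - 1) = - (1 - z + of_nat n)" by simp
    thus ?thesis using that by (metis power_minus_even)
  qed
  have "((\<lambda>n::int. 1 / (z + of_int n) ^ 2) has_sum (Polygamma 1 z + Polygamma 1 (1 - z))) UNIV"
    by (rule has_sum_nat_int_split)
       (use Polygamma_has_sum[OF z'(1), of 1] Polygamma_has_sum[OF z'(2), of 1] in
         \<open>simp_all only: neg even_numeral of_int_of_nat_eq, simp_all add: numeral_2_eq_2\<close>)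
  thus "((\<lambda>n::int. 1 / (z + of_int n) ^ 2) has_sum (-4 * of_real pi ^ 2 * e2pi z / (1 - e2pi z) ^ 2)) UNIV"
    by (simp only: Polygamma_reflection(1)[OF z])
  have "((\<lambda>n::int. 1 / (z + of_int n) ^ 4) has_sum (Polygamma 3 z / 6 + Polygamma 3 (1 - z) / 6)) UNIV"
    by (rule has_sum_nat_int_split)
       (use Polygamma_has_sum[OF z'(1), of 3] Polygamma_has_sum[OF z'(2), of 3] in
         \<open>simp_all only: neg even_numeral of_int_of_nat_eq, simp_all add: fact_numeral\<close>)
  thus "((\<lambda>n::int. 1 / (z + of_int n) ^ 4) has_sum
      (8 / 3 * of_real pi ^ 4 * (e2pi z * (e2pi z ^ 2 + 4 * e2pi z + 1)) / (1 - e2pi z) ^ 4)) UNIV"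
    by (simp only: add_divide_distrib[symmetric] Polygamma_reflection(2)[OF z]) (simp add: mult.assoc)
qed

text \<open>At z = 1/2 the reflection formula evaluates the sum over odd denominators to pi^4/96.
  The even denominators reproduce the whole sum divided by 16, which leaves a linear equation for
  it.\<close>

lemma zeta_4: "((\<lambda>n::nat. 1 / of_nat (Suc n) ^ 4 :: complex) has_sum (of_real pi ^ 4 / 90)) UNIV"
proof -
  \<comment> \<open>\<open>a n\<close> has denominator n + 1, so even indices stand for odd
    denominators.\<close>
  define a where "a = (\<lambda>n::nat. 1 / of_nat (Suc n) ^ 4 :: complex)"
  have half: "(1 / 2 :: complex) \<notin> \<int>"
  proof
    assume "(1 / 2 :: complex) \<in> \<int>"
    then obtain n where "(1 / 2 :: complex) = of_int n" by (auto elim: Ints_cases)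
    hence "(of_int 1 :: complex) = of_int (2 * n)" by (simp add: field_simps)
    thus False unfolding of_int_eq_iff by presburger
  qed
  have "e2pi (1 / 2) = -1" using exp_pi_i by simp
  hence pg: "Polygamma 3 (1 / 2 :: complex) = of_real pi ^ 4"
    using Polygamma_reflection(2)[OF half] by simp
  have summ: "a summable_on UNIV"
    using Polygamma_has_sum[of 1 3] has_sum_imp_summable by (simp add: a_def add.commute nonpos_Ints_def)
  have "((\<lambda>n. 1 / 16 * (1 / (1 / 2 + of_nat n) ^ Suc 3)) has_sum
      (1 / 16 * ((-1) ^ Suc 3 * Polygamma 3 (1 / 2) / fact 3 :: complex))) UNIV"
    by (intro has_sum_cmult_right Polygamma_has_sum nonint_Polygamma_arg half) auto
  also have "(\<lambda>n. 1 / 16 * (1 / (1 / 2 + of_nat n) ^ Suc 3)) = (\<lambda>n. a (2 * n))"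
  proof
    fix n
    have eq: "(of_nat (Suc (2 * n)) :: complex) = 2 * (1 / 2 + of_nat n)" by simp
    show "1 / 16 * (1 / (1 / 2 + of_nat n) ^ Suc 3) = a (2 * n)"
      unfolding a_def eq power_mult_distrib by simp
  qed
  finally have ev: "((\<lambda>n. a (2 * n)) has_sum (of_real pi ^ 4 / 96)) UNIV"
    by (simp add: pg fact_numeral)
  have od: "((\<lambda>n. a (2 * n + 1)) has_sum (infsum a UNIV / 16)) UNIV"
  proof -
    have "((\<lambda>n. a n / 16) has_sum (infsum a UNIV / 16)) UNIV"
      using summ by (intro has_sum_divide_const) auto
    also have "(\<lambda>n. a n / 16) = (\<lambda>n. a (2 * n + 1))"
    proof
      fix n
      have eq: "(of_nat (Suc (2 * n + 1)) :: complex) = 2 * of_nat (Suc n)" by simp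
      show "a n / 16 = a (2 * n + 1)" unfolding a_def eq power_mult_distrib by simp
    qed
    finally show ?thesis .
  qed
  have 1: "(a has_sum (of_real pi ^ 4 / 96)) {n. even n}"
  proof -
    have "((\<lambda>n. a (2 * n)) has_sum (of_real pi ^ 4 / 96)) UNIV \<longleftrightarrow> (a has_sum (of_real pi ^ 4 / 96)) {n. even n}"
      by (rule has_sum_reindex_bij_witness[of _ "\<lambda>n. n div 2" "\<lambda>n. 2 * n"]) auto
    thus ?thesis using ev by simp
  qed
  have 2: "(a has_sum (infsum a UNIV / 16)) {n. odd n}"
  proof -
    have "((\<lambda>n. a (2 * n + 1)) has_sum (infsum a UNIV / 16)) UNIV \<longleftrightarrow> (a has_sum (infsum a UNIV / 16)) {n. odd n}"
      by (rule has_sum_reindex_bij_witness[of _ "\<lambda>n. n div 2" "\<lambda>n. 2 * n + 1"]) auto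
    thus ?thesis using od by simp
  qed
  have "(a has_sum (of_real pi ^ 4 / 96 + infsum a UNIV / 16)) ({n. even n} \<union> {n. odd n})"
    using 1 2 by (rule has_sum_Un_disjoint) auto
  also have "{n::nat. even n} \<union> {n. odd n} = UNIV" by auto
  finally have *: "infsum a UNIV = of_real pi ^ 4 / 96 + infsum a UNIV / 16"
    by (rule infsumI)
  hence "infsum a UNIV = of_real pi ^ 4 / 90" by (simp add: field_simps)
  with has_sum_infsum[OF summ] have "(a has_sum (of_real pi ^ 4 / 90)) UNIV" by (simp only:)
  thus ?thesis unfolding a_def .
qed

section \<open>Summation over the integers and over the lattice\<close>

lemma filterlim_int_intervals:
  "filterlim (\<lambda>N. {- int N..<int N}) (finite_subsets_at_top UNIV) sequentially"
  unfolding filterlim_iff eventually_finite_subsets_at_top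
proof safe
  fix P and X :: "int set"
  assume X: "finite X" and P: "\<forall>Y. finite Y \<and> X \<subseteq> Y \<and> Y \<subseteq> UNIV \<longrightarrow> P Y"
  obtain b where b: "\<And>x. x \<in> X \<Longrightarrow> \<bar>x\<bar> \<le> b"
    using X finite_imageI[of X abs] by (metis Max_ge imageI)
  show "\<forall>\<^sub>F N in sequentially. P {- int N..<int N}"
    using eventually_gt_at_top[of "nat b"]
  proof eventually_elim
    case (elim N)
    have "X \<subseteq> {- int N..<int N}" using b elim by (force simp: abs_le_iff)
    thus ?case using P by simp
  qed
qed

lemma has_sum_int_tendsto:
  fixes f :: "int \<Rightarrow> 'a :: {comm_monoid_add, topological_space}"
  assumes "(f has_sum S) UNIV"
  shows "(\<lambda>N. \<Sum>n\<in>{- int N..<int N}. f n) \<longlonglongrightarrow> S"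
  using filterlim_compose[OF assms[unfolded has_sum_def] filterlim_int_intervals] .

text \<open>Excluding the upper end makes the sum end in g(-N) and g(N), the symmetric pair to which
  the cotangent expansion applies.\<close>

lemma sum_int_telescope:
  fixes g :: "int \<Rightarrow> 'a :: ab_group_add"
  shows "(\<Sum>n\<in>{- int N..<int N}. g n - g (n + 1)) = g (- int N) - g (int N)"
proof (induction N)
  case (Suc N)
  have "{- int (Suc N)..<int (Suc N)} = insert (- int (Suc N)) (insert (int N) {- int N..<int N})"
    by auto
  thus ?case using Suc.IH by (simp add: algebra_simps)
qed simp

lemma has_sum_nonzero_int:
  fixes f :: "int \<Rightarrow> complex"
  assumes "\<And>m. f (- m) = f m" "((\<lambda>k::nat. f (int (Suc k))) has_sum s) UNIV"
  shows "(f has_sum (2 * s)) {m. m \<noteq> 0}"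
proof -
  have 1: "(f has_sum s) {m. m > 0}"
  proof -
    have "((\<lambda>k::nat. f (int (Suc k))) has_sum s) UNIV \<longleftrightarrow> (f has_sum s) {m. m > 0}"
      by (rule has_sum_reindex_bij_witness[of _ "\<lambda>m. nat (m - 1)" "\<lambda>k. int (Suc k)"]) auto
    thus ?thesis using assms(2) by simp
  qed
  have 2: "(f has_sum s) {m. m < 0}"
  proof -
    have "(f has_sum s) {m. m > 0} \<longleftrightarrow> (f has_sum s) {m. m < 0}"
      by (rule has_sum_reindex_bij_witness[of _ uminus uminus]) (auto simp: assms(1))
    thus ?thesis using 1 by simp
  qed
  have "(f has_sum (s + s)) ({m. m > 0} \<union> {m. m < 0})"
    using 1 2 by (rule has_sum_Un_disjoint) auto
  moreover have "{m. m > 0} \<union> {m. m < 0} = {m::int. m \<noteq> 0}" by auto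
  ultimately show ?thesis by (simp only: mult_2)
qed

lemma has_sum_nonzero_intD:
  fixes f :: "int \<Rightarrow> complex"
  assumes "\<And>m. f (- m) = f m" "(f has_sum S) {m. m \<noteq> 0}"
  shows "((\<lambda>k::nat. f (int (Suc k))) has_sum (S / 2)) UNIV"
proof -
  have "f summable_on {m. m > 0}"
    by (rule summable_on_subset[OF has_sum_imp_summable[OF assms(2)]]) auto
  then obtain s where "(f has_sum s) {m. m > 0}" by (auto simp: summable_on_def)
  moreover have "((\<lambda>k::nat. f (int (Suc k))) has_sum s) UNIV \<longleftrightarrow> (f has_sum s) {m. m > 0}"
    by (rule has_sum_reindex_bij_witness[of _ "\<lambda>m. nat (m - 1)" "\<lambda>k. int (Suc k)"]) auto
  ultimately have s: "((\<lambda>k::nat. f (int (Suc k))) has_sum s) UNIV" by simp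
  have "2 * s = S" using has_sum_unique[OF has_sum_nonzero_int[OF assms(1) s] assms(2)] .
  thus ?thesis using s by auto
qed

lemma summable_on_int_powr: "(\<lambda>k::int. (1 + real_of_int \<bar>k\<bar>) powr (-3/2)) summable_on UNIV"
proof -
  let ?f = "\<lambda>k::int. (1 + real_of_int \<bar>k\<bar>) powr (-3/2)"
  have s: "summable (\<lambda>n. real n powr (-3/2))" by (subst summable_real_powr_iff) auto
  have "(\<lambda>n. ?f (int n)) summable_on UNIV"
    using summable_nonneg_imp_summable_on[OF iffD2[OF summable_Suc_iff s]] by simp
  hence 1: "?f summable_on {0..}"
    by (subst summable_on_reindex_bij_witness[of _ int nat UNIV "\<lambda>n. ?f (int n)"]) auto
  have "(\<lambda>n. ?f (- int n - 1)) summable_on UNIV"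
  proof -
    have "summable (\<lambda>n. real (Suc (Suc n)) powr (-3/2))"
      by (rule iffD2[OF summable_Suc_iff[of "\<lambda>n. real (Suc n) powr (-3/2)"] iffD2[OF summable_Suc_iff s]])
    from summable_nonneg_imp_summable_on[OF this] show ?thesis
      by (simp add: abs_if add.commute)
  qed
  hence 2: "?f summable_on {..<0}"
    by (subst summable_on_reindex_bij_witness[of _ "\<lambda>n. - int n - 1" "\<lambda>n. nat (- n - 1)" UNIV "\<lambda>n. ?f (- int n - 1)"]) auto
  have "?f summable_on ({0..} \<union> {..<0})" using 1 2 by (rule summable_on_Un_disjoint) auto
  moreover have "{0..} \<union> {..<0::int} = UNIV" by auto
  ultimately show ?thesis by (simp only:)
qed

text \<open>The product of two one-dimensional series with exponent 3/2 is a majorant, because (1 +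
  |m|)(1 + |n|) is at most (3/2 (|m| + |n|))^2 off the origin. Exponent 3 serves both the series of
  weight 4 and the corrected series of weight 2.\<close>

lemma lattice_summable:
  "(\<lambda>(m, n). 1 / real_of_int (\<bar>m\<bar> + \<bar>n\<bar>) ^ 3) summable_on (UNIV - {(0, 0)})"
proof (rule summable_on_comparison_test)
  let ?f = "\<lambda>k::int. (1 + real_of_int \<bar>k\<bar>) powr (-3/2)"
  obtain s where s: "(?f has_sum s) UNIV" using summable_on_int_powr by (auto simp: summable_on_def)
  have "(\<lambda>x. 27/8 * (?f (fst x) * ?f (snd x))) summable_on (UNIV \<times> UNIV)"
  proof (intro summable_on_cmult_right summable_on_SigmaI)
    show "((\<lambda>n. ?f (fst (m, n)) * ?f (snd (m, n))) has_sum (?f m * s)) UNIV" for m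
      using has_sum_cmult_right[OF s] by simp
    show "(\<lambda>m. ?f m * s) summable_on UNIV"
      by (rule summable_on_cmult_left[OF summable_on_int_powr])
  qed auto
  thus "(\<lambda>x. 27/8 * (?f (fst x) * ?f (snd x))) summable_on (UNIV - {(0, 0)})"
    by (rule summable_on_subset) auto
next
  let ?f = "\<lambda>k::int. (1 + real_of_int \<bar>k\<bar>) powr (-3/2)"
  fix x :: "int \<times> int" assume x: "x \<in> UNIV - {(0, 0)}"
  obtain m n where mn: "x = (m, n)" by (cases x)
  define a b where "a = real_of_int \<bar>m\<bar>" "b = real_of_int \<bar>n\<bar>"
  have "\<bar>m\<bar> + \<bar>n\<bar> \<ge> 1" using x mn by auto
  hence ab: "a \<ge> 0" "b \<ge> 0" "a + b \<ge> 1" unfolding a_b_def by linarith+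
  \<comment> \<open>The difference is a square plus a product that is nonnegative because a + b >=
    1.\<close>
  have "9 * (a + b) ^ 2 - 4 * ((1 + a) * (1 + b)) = (a - b) ^ 2 + 4 * ((a + b - 1) * (2 * (a + b) + 1))"
    by algebra
  moreover have "0 \<le> (a + b - 1) * (2 * (a + b) + 1)" using ab by simp
  moreover have "(3 / 2 * (a + b)) ^ 2 = 9 / 4 * (a + b) ^ 2" by (simp only: power_mult_distrib) (simp add: power_divide)
  ultimately have "(1 + a) * (1 + b) \<le> (3 / 2 * (a + b)) ^ 2"
    using zero_le_power2[of "a - b"] by linarith
  hence "((1 + a) * (1 + b)) powr (3/2) \<le> ((3 / 2 * (a + b)) ^ 2) powr (3/2)"
    using ab by (intro powr_mono2) auto
  also have "((3 / 2 * (a + b)) ^ 2) powr (3/2) = (3 / 2 * (a + b)) ^ 3"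
  proof -
    have *: "(x ^ 2) powr (3/2) = x ^ 3" if "x \<ge> 0" for x :: real
      using that powr_powr[of x 2 "3/2"] by simp
    show ?thesis by (rule *) (use ab in simp)
  qed
  finally have le: "((1 + a) * (1 + b)) powr (3/2) \<le> 27 / 8 * (a + b) ^ 3"
    by (simp only: power_mult_distrib) (simp add: power_divide)
  have "1 / (a + b) ^ 3 \<le> 27/8 * ((1 + a) powr (-3/2) * (1 + b) powr (-3/2))"
  proof -
    have p: "((1 + a) * (1 + b)) powr (3/2) > 0" using ab by simp
    have "1 / (a + b) ^ 3 = 27 / 8 / (27 / 8 * (a + b) ^ 3)" by simp
    also have "\<dots> \<le> 27 / 8 / ((1 + a) * (1 + b)) powr (3/2)"
      using le p ab by (intro divide_left_mono mult_pos_pos) auto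
    also have "\<dots> = 27/8 * ((1 + a) powr (-3/2) * (1 + b) powr (-3/2))"
      using ab by (simp add: powr_mult powr_minus inverse_eq_divide)
    finally show ?thesis .
  qed
  thus "(case x of (m, n) \<Rightarrow> 1 / real_of_int (\<bar>m\<bar> + \<bar>n\<bar>) ^ 3) \<le> 27/8 * (?f (fst x) * ?f (snd x))"
    by (simp add: mn a_b_def)
qed auto

text \<open>The imaginary part controls |m|, and the triangle inequality then controls |n|; the two
  summands of \<open>L\<close> are these two contributions.\<close>

lemma lattice_norm_bound:
  assumes "Im \<tau> > 0"
  obtains L where "L > 0" "\<And>m n::int. real_of_int (\<bar>m\<bar> + \<bar>n\<bar>) \<le> L * norm (of_int m * \<tau> + of_int n)"
proof
  define L where "L = 1 / Im \<tau> + (1 + norm \<tau> / Im \<tau>)"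
  show "L > 0" unfolding L_def using assms by (intro add_pos_nonneg add_nonneg_nonneg divide_nonneg_pos divide_pos_pos) auto
  fix m n :: int
  let ?w = "of_int m * \<tau> + of_int n"
  have "\<bar>real_of_int m\<bar> * Im \<tau> = \<bar>Im ?w\<bar>" using assms by (simp add: abs_mult)
  also have "\<dots> \<le> norm ?w" by (rule abs_Im_le_cmod)
  finally have m: "\<bar>real_of_int m\<bar> \<le> norm ?w / Im \<tau>" using assms by (simp add: field_simps)
  have "\<bar>real_of_int n\<bar> = norm (?w - of_int m * \<tau>)" by simp
  also have "\<dots> \<le> norm ?w + norm (of_int m * \<tau>)" by (rule norm_triangle_ineq4)
  also have "norm (of_int m * \<tau>) = \<bar>real_of_int m\<bar> * norm \<tau>" by (simp add: norm_mult)
  also have "\<dots> \<le> norm ?w / Im \<tau> * norm \<tau>" using m by (intro mult_right_mono) auto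
  finally have "\<bar>real_of_int n\<bar> \<le> norm ?w + norm ?w / Im \<tau> * norm \<tau>" by simp
  with m have "\<bar>real_of_int m\<bar> + \<bar>real_of_int n\<bar> \<le> norm ?w / Im \<tau> + (norm ?w + norm ?w / Im \<tau> * norm \<tau>)"
    by linarith
  also have "\<dots> = L * norm ?w" unfolding L_def by (simp add: algebra_simps)
  finally show "real_of_int (\<bar>m\<bar> + \<bar>n\<bar>) \<le> L * norm ?w" by simp
qed

lemma uhp_nonint: 
  assumes "Im z \<noteq> 0" 
  shows "z \<notin> \<int>" "z + of_int n \<noteq> 0" "z + of_int n + 1 \<noteq> 0"
  using assms by (auto simp: complex_is_Int_iff complex_eq_iff)

text \<open>\<open>lat2\<close> and \<open>lat4\<close> are the sums of k q^k and of k^3 q^k for q =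
  e2pi z in closed form. Unlike the series they make sense for |q| > 1, hence at m tau for both
  signs of m, and they turn out to be even in z.\<close>

definition lat2 :: "complex \<Rightarrow> complex" where
  "lat2 z = e2pi z / (1 - e2pi z) ^ 2"

definition lat4 :: "complex \<Rightarrow> complex" where
  "lat4 z = e2pi z * (e2pi z ^ 2 + 4 * e2pi z + 1) / (1 - e2pi z) ^ 4"

lemma e2pi_minus: "e2pi (- z) = inverse (e2pi z)"
  by (simp add: exp_minus)

lemma lat2_minus: "lat2 (- z) = lat2 z"
proof -
  have *: "inverse e / (1 - inverse e) ^ 2 = e / (1 - e) ^ 2" if "e \<noteq> 0" for e :: complex
  proof -
    have "(1 - inverse e) * e = - (1 - e)" using that by (simp add: algebra_simps)
    hence "(1 - inverse e) ^ 2 * e ^ 2 = (1 - e) ^ 2" by (metis power_mult_distrib power2_minus)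
    moreover have "inverse e / (1 - inverse e) ^ 2 = (inverse e * e ^ 2) / ((1 - inverse e) ^ 2 * e ^ 2)"
      using that by simp
    moreover have "inverse e * e ^ 2 = e" using that by (simp add: power2_eq_square)
    ultimately show ?thesis by simp
  qed
  show ?thesis unfolding lat2_def e2pi_minus by (rule *) simp
qed

lemma lat4_minus: "lat4 (- z) = lat4 z"
proof -
  have *: "inverse e * (inverse e ^ 2 + 4 * inverse e + 1) / (1 - inverse e) ^ 4 = e * (e ^ 2 + 4 * e + 1) / (1 - e) ^ 4"
    if "e \<noteq> 0" for e :: complex
  proof -
    have "(1 - inverse e) * e = - (1 - e)" using that by (simp add: algebra_simps)
    hence 1: "(1 - inverse e) ^ 4 * e ^ 4 = (1 - e) ^ 4"
      by (metis power_mult_distrib power_minus_even even_numeral)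
    have "inverse e * (inverse e ^ 2 + 4 * inverse e + 1) * e ^ 4 =
        (inverse e * e) * ((inverse e * e) ^ 2 + 4 * (inverse e * e) * e + e ^ 2) * e"
      by algebra
    also have "\<dots> = e * (e ^ 2 + 4 * e + 1)" using that by (simp add: algebra_simps)
    finally have 2: "inverse e * (inverse e ^ 2 + 4 * inverse e + 1) * e ^ 4 = e * (e ^ 2 + 4 * e + 1)" .
    have "inverse e * (inverse e ^ 2 + 4 * inverse e + 1) / (1 - inverse e) ^ 4 =
        (inverse e * (inverse e ^ 2 + 4 * inverse e + 1) * e ^ 4) / ((1 - inverse e) ^ 4 * e ^ 4)"
      using that by simp
    thus ?thesis unfolding 1 2 .
  qed
  show ?thesis unfolding lat4_def e2pi_minus by (rule *) simp
qed

text \<open>2 zeta(2) and 2 zeta(4): the contributions of the lattice points on one axis.\<close>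

lemma has_sum_inverse_powers_nonzero_int:
  "((\<lambda>n::int. 1 / of_int n ^ 2 :: complex) has_sum (of_real pi ^ 2 / 3)) {n. n \<noteq> 0}"
  "((\<lambda>n::int. 1 / of_int n ^ 4 :: complex) has_sum (of_real pi ^ 4 / 45)) {n. n \<noteq> 0}"
proof -
  have "((\<lambda>k::nat. 1 / real (k + 1) ^ 2) has_sum (pi ^ 2 / 6)) UNIV"
    using inverse_squares_sums by (intro sums_nonneg_imp_has_sum) auto
  hence "((\<lambda>k::nat. of_real (1 / real (k + 1) ^ 2) :: complex) has_sum of_real (pi ^ 2 / 6)) UNIV"
    by (rule has_sum_of_real)
  hence "((\<lambda>k::nat. 1 / of_int (int (Suc k)) ^ 2 :: complex) has_sum (of_real pi ^ 2 / 6)) UNIV"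
    by (simp add: add.commute)
  from has_sum_nonzero_int[OF _ this]
  show "((\<lambda>n::int. 1 / of_int n ^ 2 :: complex) has_sum (of_real pi ^ 2 / 3)) {n. n \<noteq> 0}" by simp
  have "((\<lambda>k::nat. 1 / of_int (int (Suc k)) ^ 4 :: complex) has_sum (of_real pi ^ 4 / 90)) UNIV"
    using zeta_4 by simp
  from has_sum_nonzero_int[OF _ this]
  show "((\<lambda>n::int. 1 / of_int n ^ 4 :: complex) has_sum (of_real pi ^ 4 / 45)) {n. n \<noteq> 0}" by simp
qed

section \<open>The Eisenstein series of weight 4\<close>

definition lattice_G4 :: "complex \<Rightarrow> complex" where
  "lattice_G4 \<tau> = (\<Sum>\<^sub>\<infinity>(m, n)\<in>UNIV - {(0, 0)}. 1 / (of_int m * \<tau> + of_int n) ^ 4)"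

lemma lattice_G4_has_sum:
  assumes "Im \<tau> > 0"
  shows "((\<lambda>(m, n). 1 / (of_int m * \<tau> + of_int n) ^ 4) has_sum lattice_G4 \<tau>) (UNIV - {(0, 0)})"
proof -
  obtain L where L: "L > 0" "\<And>m n::int. real_of_int (\<bar>m\<bar> + \<bar>n\<bar>) \<le> L * norm (of_int m * \<tau> + of_int n)"
    using lattice_norm_bound[OF assms] by blast
  have "(\<lambda>x. norm (case x of (m, n) \<Rightarrow> 1 / (of_int m * \<tau> + of_int n) ^ 4)) summable_on (UNIV - {(0, 0)})"
  proof (rule Infinite_Sum.abs_summable_on_comparison_test')
    show "(\<lambda>x. L ^ 4 * (case x of (m, n) \<Rightarrow> 1 / real_of_int (\<bar>m\<bar> + \<bar>n\<bar>) ^ 3)) summable_on (UNIV - {(0, 0)})"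
      by (rule summable_on_cmult_right[OF lattice_summable])
    fix x :: "int \<times> int" assume x: "x \<in> UNIV - {(0, 0)}"
    obtain m n where mn: "x = (m, n)" by (cases x)
    define s where "s = real_of_int (\<bar>m\<bar> + \<bar>n\<bar>)"
    define d where "d = norm (of_int m * \<tau> + of_int n)"
    have "\<bar>m\<bar> + \<bar>n\<bar> \<ge> 1" using x mn by auto
    hence s: "s \<ge> 1" unfolding s_def by linarith
    have sd: "s \<le> L * d" unfolding s_def d_def by (rule L)
    hence d: "d > 0" using s L(1) by (metis less_le_trans mult_pos_pos not_less zero_less_one
        mult_nonneg_nonpos linorder_not_le order.strict_implies_order)
    \<comment> \<open>Since \<open>s\<close> is at least 1, the exponent 4 may be weakened to 3, for
      which a majorant is available.\<close>
    have "s ^ 3 * 1 \<le> s ^ 3 * s" using s by (intro mult_left_mono) auto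
    also have "\<dots> = s ^ 4" by (simp add: eval_nat_numeral)
    also have "\<dots> \<le> (L * d) ^ 4" using sd s by (intro power_mono) auto
    finally have "s ^ 3 \<le> L ^ 4 * d ^ 4" by (simp only: power_mult_distrib mult_1_right)
    hence "1 / d ^ 4 \<le> L ^ 4 * (1 / s ^ 3)"
      using s d by (simp add: divide_simps)
    thus "norm (case x of (m, n) \<Rightarrow> 1 / (of_int m * \<tau> + of_int n) ^ 4) \<le>
        L ^ 4 * (case x of (m, n) \<Rightarrow> 1 / real_of_int (\<bar>m\<bar> + \<bar>n\<bar>) ^ 3)"
      by (simp add: mn s_def d_def norm_divide norm_power)
  qed
  thus ?thesis unfolding lattice_G4_def by (intro has_sum_infsum) (rule abs_summable_summable)
qed

text \<open>By absolute convergence the lattice may be rearranged by (m, n) -> (n, -m) once the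
  factor tau^4 has been pulled out.\<close>

lemma lattice_G4_inversion:
  assumes "Im \<tau> > 0"
  shows "lattice_G4 (- 1 / \<tau>) = \<tau> ^ 4 * lattice_G4 \<tau>"
proof -
  have t0: "\<tau> \<noteq> 0" using assms by auto
  have im: "Im (- 1 / \<tau>) > 0"
    using assms t0 by (simp add: Im_divide power2_eq_square[symmetric] sum_power2_gt_zero_iff complex_eq_iff)
  have "((\<lambda>(m, n). 1 / (of_int m * (- 1 / \<tau>) + of_int n) ^ 4) has_sum lattice_G4 (- 1 / \<tau>)) (UNIV - {(0, 0)})
    \<longleftrightarrow> ((\<lambda>(m, n). \<tau> ^ 4 * (1 / (of_int m * \<tau> + of_int n) ^ 4)) has_sum lattice_G4 (- 1 / \<tau>)) (UNIV - {(0, 0)})"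
  proof -
    have "\<tau> ^ 4 / (of_int n * \<tau> - of_int m) ^ 4 = 1 / (of_int n - of_int m / \<tau>) ^ 4" for m n
    proof -
      have "of_int n - of_int m / \<tau> = (of_int n * \<tau> - of_int m) / \<tau>"
        using t0 by (simp add: diff_divide_distrib)
      thus ?thesis by (simp only: power_divide) (simp add: divide_divide_eq_right)
    qed
    thus ?thesis
      by (intro has_sum_reindex_bij_witness[of _ "\<lambda>(m, n). (- n, m)" "\<lambda>(m, n). (n, - m)"]) auto
  qed
  with lattice_G4_has_sum[OF im]
  have "((\<lambda>(m, n). \<tau> ^ 4 * (1 / (of_int m * \<tau> + of_int n) ^ 4)) has_sum lattice_G4 (- 1 / \<tau>)) (UNIV - {(0, 0)})"
    by simp
  moreover have "((\<lambda>(m, n). \<tau> ^ 4 * (1 / (of_int m * \<tau> + of_int n) ^ 4)) has_sum \<tau> ^ 4 * lattice_G4 \<tau>) (UNIV - {(0, 0)})"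
    using has_sum_cmult_right[OF lattice_G4_has_sum[OF assms], of "\<tau> ^ 4"] by (simp add: case_prod_unfold)
  ultimately show ?thesis by (rule has_sum_unique)
qed

text \<open>Summation row by row: the row m = 0 gives 2 zeta(4) = pi^4/45, and the rows m and -m
  give equal Lipschitz sums.\<close>

lemma lattice_G4_expansion:
  assumes "Im \<tau> > 0"
  shows "((\<lambda>k::nat. lat4 (of_nat (Suc k) * \<tau>)) has_sum
    (3 / (16 * of_real pi ^ 4) * (lattice_G4 \<tau> - of_real pi ^ 4 / 45))) UNIV"
proof -
  let ?f = "\<lambda>(m::int, n::int). 1 / (of_int m * \<tau> + of_int n) ^ 4"
  let ?g = "\<lambda>m::int. if m = 0 then of_real pi ^ 4 / 45 else 8 / 3 * of_real pi ^ 4 * lat4 (of_int m * \<tau>)"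
  have S: "UNIV - {(0, 0)} = Sigma (UNIV::int set) (\<lambda>m. if m = 0 then {n. n \<noteq> 0} else (UNIV::int set))"
    by (auto split: if_splits)
  have "(?g has_sum lattice_G4 \<tau>) UNIV"
  proof (rule has_sum_SigmaD[OF lattice_G4_has_sum[OF assms, unfolded S]])
    fix m :: int
    show "((\<lambda>n. ?f (m, n)) has_sum ?g m) (if m = 0 then {n. n \<noteq> 0} else UNIV)"
    proof (cases "m = 0")
      case True
      thus ?thesis using has_sum_inverse_powers_nonzero_int(2) by simp
    next
      case False
      hence "of_int m * \<tau> \<notin> \<int>" using assms by (intro uhp_nonint) auto
      from has_sum_lattice_row(2)[OF this] False show ?thesis
        by (simp add: lat4_def mult.assoc)
    qed
  qed
  moreover have "(?g has_sum (of_real pi ^ 4 / 45)) {0}"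
    by (rule has_sum_finiteI) auto
  ultimately have "(?g has_sum (lattice_G4 \<tau> - of_real pi ^ 4 / 45)) (UNIV - {0})"
    by (rule has_sum_Diff) auto
  moreover have "UNIV - {0::int} = {m. m \<noteq> 0}" by auto
  ultimately have "((\<lambda>m::int. 8 / 3 * of_real pi ^ 4 * lat4 (of_int m * \<tau>)) has_sum (lattice_G4 \<tau> - of_real pi ^ 4 / 45)) {m. m \<noteq> 0}"
    by (subst has_sum_cong[of _ _ ?g]) auto
  hence "((\<lambda>k::nat. 8 / 3 * of_real pi ^ 4 * lat4 (of_int (int (Suc k)) * \<tau>)) has_sum ((lattice_G4 \<tau> - of_real pi ^ 4 / 45) / 2)) UNIV"
    by (rule has_sum_nonzero_intD[rotated]) (simp add: lat4_minus)
  from has_sum_cmult_right[OF this, of "3 / (8 * of_real pi ^ 4)"] show ?thesis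
    by (simp add: mult.assoc[symmetric])
qed

section \<open>The Eisenstein series of weight 2 and its anomaly\<close>

lemma Im_neg_inverse: "Im \<tau> > 0 \<Longrightarrow> Im (- 1 / \<tau>) > 0"
  by (cases "\<tau> = 0") (auto simp: Im_divide power2_eq_square[symmetric] sum_power2_gt_zero_iff complex_eq_iff)

text \<open>The Digamma series at 1 - z and at z are subtracted. A telescoping series with sum 1/z
  then shifts the index in one of them, so that z + k + 1 is paired with z - (k + 1).\<close>

lemma cot_partial_fractions:
  assumes z: "z \<notin> \<int>"
  shows "(\<lambda>k. 1 / (z + of_nat (Suc k)) + 1 / (z - of_nat (Suc k))) sums
    (of_real pi * \<i> * (e2pi z + 1) / (e2pi z - 1) - 1 / z)"
proof -
  note z' = nonint_Polygamma_arg[OF z]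
  have D: "(\<lambda>k. inverse (of_nat (Suc k)) - inverse (w + of_nat k)) sums (Digamma w + euler_mascheroni)"
    if "w \<noteq> 0" for w :: complex
    using summable_Digamma[OF that] by (simp add: Digamma_def summable_sums)
  have zk: "z + of_nat k \<noteq> 0" for k
    using z by (metis Ints_of_nat Ints_minus add_eq_0_iff2)
  have "(\<lambda>k. inverse (z + of_nat k) - inverse (z + of_nat (Suc k))) sums (inverse (z + of_nat 0) - 0)"
    by (intro telescope_sums' filterlim_compose[OF tendsto_inverse_0]
              tendsto_add_filterlim_at_infinity[OF tendsto_const] tendsto_of_nat)
  from sums_diff[OF sums_diff[OF D[OF z'(4)] D[OF z'(3)]] this]
  have "(\<lambda>k. inverse (z + of_nat (Suc k)) - inverse (1 - z + of_nat k)) sums (Digamma (1 - z) - Digamma z - 1 / z)"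
    by (simp add: inverse_eq_divide)
  moreover have "inverse (z + of_nat (Suc k)) - inverse (1 - z + of_nat k) =
      1 / (z + of_nat (Suc k)) + 1 / (z - of_nat (Suc k))" for k
  proof -
    have "1 - z + of_nat k = - (z - of_nat (Suc k))" by simp
    thus ?thesis by (simp only: inverse_minus_eq) (simp add: inverse_eq_divide)
  qed
  ultimately show ?thesis by (simp only: Digamma_reflection[OF z])
qed

lemma norm_e2pi: "norm (e2pi z) = exp (- 2 * pi * Im z)"
  by simp

lemma has_sum_finite_sum:
  fixes f :: "'a \<Rightarrow> 'b \<Rightarrow> 'c :: topological_comm_monoid_add"
  assumes "finite I" "\<And>i. i \<in> I \<Longrightarrow> (f i has_sum s i) A"
  shows "((\<lambda>x. \<Sum>i\<in>I. f i x) has_sum (\<Sum>i\<in>I. s i)) A"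
  using assms by (induction I rule: finite_induct) (auto intro!: has_sum_add)

text \<open>The double series of \<open>1/(m\<tau> + n)\<^sup>2\<close> converges only conditionally. Subtracting the telescoping terms
  \<open>1/(m\<tau> + n) - 1/(m\<tau> + n + 1)\<close> makes it absolutely convergent; the two orders of summation of the
  telescoping part differ by \<open>2\<pi>i/\<tau>\<close>, which is the anomaly in the transformation law.\<close>

definition eis2_term :: "complex \<Rightarrow> int \<times> int \<Rightarrow> complex" where
  "eis2_term \<tau> = (\<lambda>(m, n). 1 / ((of_int m * \<tau> + of_int n) ^ 2 * (of_int m * \<tau> + of_int n + 1)))"

text \<open>Evaluated by rows this is the Eisenstein series of weight 2 without its row m = 0, that
  is G_2(tau) - pi^2/3. As an absolutely convergent double sum it may equally be evaluated by
  columns.\<close>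

definition eis2 :: "complex \<Rightarrow> complex" where
  "eis2 \<tau> = (\<Sum>\<^sub>\<infinity>x\<in>{m. m \<noteq> 0} \<times> UNIV. eis2_term \<tau> x)"

lemma eis2_has_sum:
  assumes "Im \<tau> > 0"
  shows "(eis2_term \<tau> has_sum eis2 \<tau>) ({m. m \<noteq> 0} \<times> UNIV)"
proof -
  obtain L where L: "L > 0" "\<And>m n::int. real_of_int (\<bar>m\<bar> + \<bar>n\<bar>) \<le> L * norm (of_int m * \<tau> + of_int n)"
    using lattice_norm_bound[OF assms] by blast
  have "(\<lambda>x. norm (eis2_term \<tau> x)) summable_on ({m. m \<noteq> 0} \<times> UNIV)"
  proof (rule Infinite_Sum.abs_summable_on_comparison_test')
    have "(\<lambda>x. 2 * L ^ 3 * (case x of (m, n) \<Rightarrow> 1 / real_of_int (\<bar>m\<bar> + \<bar>n\<bar>) ^ 3)) summable_on (UNIV - {(0, 0)})"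
      by (rule summable_on_cmult_right[OF lattice_summable])
    thus "(\<lambda>x. 2 * L ^ 3 * (case x of (m, n) \<Rightarrow> 1 / real_of_int (\<bar>m\<bar> + \<bar>n\<bar>) ^ 3)) summable_on ({m. m \<noteq> 0} \<times> UNIV)"
      by (rule summable_on_subset) auto
    fix x :: "int \<times> int" assume x: "x \<in> {m. m \<noteq> 0} \<times> UNIV"
    obtain m n where mn: "x = (m, n)" by (cases x)
    hence m: "m \<noteq> 0" using x by auto
    define s where "s = real_of_int (\<bar>m\<bar> + \<bar>n\<bar>)"
    define s' where "s' = real_of_int (\<bar>m\<bar> + \<bar>n + 1\<bar>)"
    define d where "d = norm (of_int m * \<tau> + of_int n)"
    define d' where "d' = norm (of_int m * \<tau> + of_int n + 1)"
    \<comment> \<open>Both inequalities rest on |m| >= 1; the second pays for the shift from n to n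
      + 1 with a factor 2.\<close>
    have "\<bar>m\<bar> + \<bar>n\<bar> \<ge> 1" "2 * (\<bar>m\<bar> + \<bar>n + 1\<bar>) \<ge> \<bar>m\<bar> + \<bar>n\<bar>" using m by arith+
    hence s: "s \<ge> 1" "s \<le> 2 * s'" unfolding s_def s'_def by linarith+
    have sd: "s \<le> L * d" unfolding s_def d_def by (rule L)
    have sd': "s' \<le> L * d'" using L(2)[of m "n + 1"] unfolding s'_def d'_def by (simp add: add.assoc)
    have "L * d > 0" "L * d' > 0" using s sd sd' by linarith+
    hence d: "d > 0" "d' > 0" using L(1) by (auto simp: zero_less_mult_iff)
    have "s ^ 3 = s ^ 2 * s" by (simp add: eval_nat_numeral)
    also have "\<dots> \<le> (L * d) ^ 2 * (2 * (L * d'))"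
      using s sd sd' by (intro mult_mono power_mono) auto
    also have "\<dots> = 2 * L ^ 3 * (d ^ 2 * d')" by (simp add: power_mult_distrib eval_nat_numeral)
    finally have "s ^ 3 \<le> 2 * L ^ 3 * (d ^ 2 * d')" .
    hence "1 / (d ^ 2 * d') \<le> 2 * L ^ 3 * (1 / s ^ 3)"
      using s d by (simp add: divide_simps)
    thus "norm (eis2_term \<tau> x) \<le> 2 * L ^ 3 * (case x of (m, n) \<Rightarrow> 1 / real_of_int (\<bar>m\<bar> + \<bar>n\<bar>) ^ 3)"
      by (simp add: mn s_def d_def d'_def eis2_term_def norm_divide norm_power norm_mult)
  qed
  thus ?thesis unfolding eis2_def by (intro has_sum_infsum) (rule abs_summable_summable)
qed

lemma eis2_term_split:
  assumes "Im (of_int m * \<tau>) \<noteq> 0"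
  shows "eis2_term \<tau> (m, n) = 1 / (of_int m * \<tau> + of_int n) ^ 2 -
     (1 / (of_int m * \<tau> + of_int n) - 1 / (of_int m * \<tau> + of_int (n + 1)))"
proof -
  have *: "1 / (a ^ 2 * (a + 1)) = 1 / a ^ 2 - (1 / a - 1 / (a + 1))" if "a \<noteq> 0" "a + 1 \<noteq> 0" for a :: complex
  proof -
    have "1 / a = (a * (a + 1)) / (a ^ 2 * (a + 1))" "1 / a ^ 2 = (a + 1) / (a ^ 2 * (a + 1))"
         "1 / (a + 1) = a ^ 2 / (a ^ 2 * (a + 1))"
      using that by (simp_all add: power2_eq_square)
    thus ?thesis by (simp add: diff_divide_distrib[symmetric] power2_eq_square algebra_simps)
  qed
  show ?thesis
    using *[OF uhp_nonint(2)[OF assms, of n] uhp_nonint(3)[OF assms, of n]]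
    by (simp add: eis2_term_def add.assoc)
qed

lemma tendsto_inverse_shift: "(\<lambda>N. 1 / (w + of_nat N)) \<longlonglongrightarrow> (0 :: complex)"
  using filterlim_compose[OF tendsto_inverse_0 tendsto_add_filterlim_at_infinity[OF tendsto_const tendsto_of_nat], of w]
  by (simp add: inverse_eq_divide)

text \<open>Along a row the telescoping correction sums to 0, so the row is the plain Lipschitz sum
  of squares. Once the correction is known to be summable, its value is read off from symmetric
  partial sums.\<close>

lemma eis2_row:
  assumes "Im \<tau> > 0" "m \<noteq> 0"
  shows "((\<lambda>n. eis2_term \<tau> (m, n)) has_sum (- 4 * of_real pi ^ 2 * lat2 (of_int m * \<tau>))) UNIV"
proof -
  let ?w = "of_int m * \<tau>"
  let ?b = "\<lambda>n::int. 1 / (?w + of_int n) - 1 / (?w + of_int (n + 1))"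
  have im: "Im ?w \<noteq> 0" using assms by simp
  have a: "((\<lambda>n::int. 1 / (?w + of_int n) ^ 2) has_sum (- 4 * of_real pi ^ 2 * lat2 ?w)) UNIV"
    using has_sum_lattice_row(1)[OF uhp_nonint(1)[OF im]] by (simp add: lat2_def)
  have h: "(\<lambda>n. eis2_term \<tau> (m, n)) summable_on UNIV"
    using summable_on_SigmaD1[of "\<lambda>m n. eis2_term \<tau> (m, n)" "{m. m \<noteq> 0}" "\<lambda>_. UNIV" m]
      has_sum_imp_summable[OF eis2_has_sum[OF assms(1)]] assms(2) by simp
  have "(\<lambda>n. 1 / (?w + of_int n) ^ 2 - eis2_term \<tau> (m, n)) summable_on UNIV"
    using summable_on_add[OF has_sum_imp_summable[OF a] summable_on_uminus[THEN iffD2, OF h]] by simp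
  hence "?b summable_on UNIV" by (simp only: eis2_term_split[OF im]) simp
  then obtain \<beta> where \<beta>: "(?b has_sum \<beta>) UNIV" by (auto simp: summable_on_def)
  have "(\<lambda>N. \<Sum>n\<in>{- int N..<int N}. ?b n) \<longlonglongrightarrow> \<beta>" by (rule has_sum_int_tendsto[OF \<beta>])
  moreover have "(\<Sum>n\<in>{- int N..<int N}. ?b n) = - (1 / (- ?w + of_nat N)) - 1 / (?w + of_nat N)" for N
  proof -
    have "- ?w + of_nat N = - (?w - of_nat N)" by simp
    thus ?thesis
      using sum_int_telescope[of "\<lambda>n. 1 / (?w + of_int n)" N] by (simp only: divide_minus_right) simp
  qed
  moreover have "(\<lambda>N. - (1 / (- ?w + of_nat N)) - 1 / (?w + of_nat N)) \<longlonglongrightarrow> - 0 - 0"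
    by (intro tendsto_intros tendsto_inverse_shift)
  ultimately have "\<beta> = 0" using LIMSEQ_unique by fastforce
  with \<beta> have "(?b has_sum 0) UNIV" by simp
  from has_sum_add[OF a has_sum_uminusI[OF this]] show ?thesis
    by (simp only: eis2_term_split[OF im] diff_conv_add_uminus minus_zero add_0_right)
qed

lemma eis2_rows:
  assumes "Im \<tau> > 0"
  shows "((\<lambda>m::int. - 4 * of_real pi ^ 2 * lat2 (of_int m * \<tau>)) has_sum eis2 \<tau>) {m. m \<noteq> 0}"
  by (rule has_sum_SigmaD[OF eis2_has_sum[OF assms]]) (use eis2_row[OF assms] in auto)

lemma eis2_expansion:
  assumes "Im \<tau> > 0"
  shows "((\<lambda>k::nat. lat2 (of_nat (Suc k) * \<tau>)) has_sum (- eis2 \<tau> / (8 * of_real pi ^ 2))) UNIV"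
proof -
  have "((\<lambda>k::nat. - 4 * of_real pi ^ 2 * lat2 (of_int (int (Suc k)) * \<tau>)) has_sum (eis2 \<tau> / 2)) UNIV"
    by (rule has_sum_nonzero_intD[OF _ eis2_rows[OF assms]]) (simp add: lat2_minus)
  from has_sum_cmult_right[OF this, of "- 1 / (4 * of_real pi ^ 2)"] show ?thesis by simp
qed

text \<open>Dividing by tau turns a column into a row based at n / tau. The Lipschitz formula
  includes m = 0, whose term 1/n^2 is removed; the column n = 0 is 2 zeta(2) / tau^2.\<close>

lemma eis2_column:
  assumes "Im \<tau> > 0"
  shows "((\<lambda>m::int. 1 / (of_int m * \<tau> + of_int n) ^ 2) has_sum
    (if n = 0 then of_real pi ^ 2 / 3 / \<tau> ^ 2
     else - 4 * of_real pi ^ 2 * lat2 (of_int n / \<tau>) / \<tau> ^ 2 - 1 / of_int n ^ 2)) {m. m \<noteq> 0}"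
proof (cases "n = 0")
  case True
  have "((\<lambda>m::int. 1 / of_int m ^ 2 / \<tau> ^ 2) has_sum (of_real pi ^ 2 / 3 / \<tau> ^ 2)) {m. m \<noteq> 0}"
    by (intro has_sum_divide_const has_sum_inverse_powers_nonzero_int)
  thus ?thesis using True by (simp add: power_mult_distrib)
next
  case False
  have t0: "\<tau> \<noteq> 0" using assms by auto
  have "Im (of_int n / \<tau>) \<noteq> 0" using False assms t0
    by (simp add: Im_divide power2_eq_square[symmetric] sum_power2_eq_zero_iff complex_eq_iff)
  from has_sum_lattice_row(1)[OF uhp_nonint(1)[OF this]]
  have "((\<lambda>m::int. 1 / (of_int n / \<tau> + of_int m) ^ 2 / \<tau> ^ 2) has_sum
      (- 4 * of_real pi ^ 2 * lat2 (of_int n / \<tau>) / \<tau> ^ 2)) UNIV"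
    by (intro has_sum_divide_const) (simp add: lat2_def)
  also have "(\<lambda>m::int. 1 / (of_int n / \<tau> + of_int m) ^ 2 / \<tau> ^ 2) = (\<lambda>m. 1 / (of_int m * \<tau> + of_int n) ^ 2)"
  proof
    fix m :: int
    have "(of_int n / \<tau> + of_int m) * \<tau> = of_int m * \<tau> + of_int n" using t0 by (simp add: distrib_right)
    thus "1 / (of_int n / \<tau> + of_int m) ^ 2 / \<tau> ^ 2 = 1 / (of_int m * \<tau> + of_int n) ^ 2"
      by (simp only: divide_divide_eq_left power_mult_distrib[symmetric])
  qed
  finally have "((\<lambda>m::int. 1 / (of_int m * \<tau> + of_int n) ^ 2) has_sum
      (- 4 * of_real pi ^ 2 * lat2 (of_int n / \<tau>) / \<tau> ^ 2)) UNIV" .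
  moreover have "((\<lambda>m::int. 1 / (of_int m * \<tau> + of_int n) ^ 2) has_sum (1 / of_int n ^ 2)) {0}"
    by (rule has_sum_finiteI) auto
  ultimately have "((\<lambda>m::int. 1 / (of_int m * \<tau> + of_int n) ^ 2) has_sum
      (- 4 * of_real pi ^ 2 * lat2 (of_int n / \<tau>) / \<tau> ^ 2 - 1 / of_int n ^ 2)) (UNIV - {0})"
    by (rule has_sum_Diff) auto
  moreover have "UNIV - {0::int} = {m. m \<noteq> 0}" by auto
  ultimately show ?thesis using False by simp
qed

text \<open>The double sum is evaluated by columns. Over finitely many columns the corrections
  telescope to the two outermost ones, whose sum over m is a cotangent at N / tau minus its polar
  term; the nonzero limit of that expression is the source of 2 pi i / tau. The column sums of
  squares add up to the same series at -1 / tau and zeta values.\<close>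

lemma eis2_inversion:
  assumes "Im \<tau> > 0"
  shows "eis2 \<tau> = eis2 (- 1 / \<tau>) / \<tau> ^ 2 + of_real pi ^ 2 / 3 / \<tau> ^ 2 - of_real pi ^ 2 / 3 + 2 * of_real pi * \<i> / \<tau>"
proof -
  have t0: "\<tau> \<noteq> 0" using assms by auto
  let ?A = "{m::int. m \<noteq> 0}"
  \<comment> \<open>\<open>\<alpha> n\<close> is the column sum of the squares and
    \<open>C n\<close> that of the corrected terms; their difference is the column sum of the
    telescoping part.\<close>
  define \<alpha> where "\<alpha> = (\<lambda>n::int. if n = 0 then of_real pi ^ 2 / 3 / \<tau> ^ 2
     else - 4 * of_real pi ^ 2 * lat2 (of_int n / \<tau>) / \<tau> ^ 2 - 1 / of_int n ^ 2)"
  define g where "g = (\<lambda>(m::int) (n::int). 1 / (of_int m * \<tau> + of_int n))"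
  define C where "C = (\<lambda>n. \<Sum>\<^sub>\<infinity>m\<in>?A. eis2_term \<tau> (m, n))"
  have sw: "((\<lambda>(n, m). eis2_term \<tau> (m, n)) has_sum eis2 \<tau>) (UNIV \<times> ?A)"
    using eis2_has_sum[OF assms] has_sum_swap[of "\<lambda>(n, m). eis2_term \<tau> (m, n)" UNIV ?A "eis2 \<tau>"] 
    by (simp add: case_prod_unfold)
  have Cn: "((\<lambda>m. eis2_term \<tau> (m, n)) has_sum C n) ?A" for n
    unfolding C_def
    using summable_on_SigmaD1[of "\<lambda>n m. eis2_term \<tau> (m, n)" UNIV "\<lambda>_. ?A" n] has_sum_imp_summable[OF sw]
    by (intro has_sum_infsum) simp
  have C: "(C has_sum eis2 \<tau>) UNIV"
    by (rule has_sum_SigmaD[OF sw]) (use Cn in simp)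
  have \<alpha>n: "((\<lambda>m. 1 / (of_int m * \<tau> + of_int n) ^ 2) has_sum \<alpha> n) ?A" for n
    using eis2_column[OF assms, of n] by (simp add: \<alpha>_def)
  have b: "((\<lambda>m. g m n - g m (n + 1)) has_sum (\<alpha> n - C n)) ?A" for n
  proof -
    have "((\<lambda>m. 1 / (of_int m * \<tau> + of_int n) ^ 2 + - eis2_term \<tau> (m, n)) has_sum (\<alpha> n + - C n)) ?A"
      by (intro has_sum_add has_sum_uminusI \<alpha>n Cn)
    thus ?thesis
      by (subst has_sum_cong[of _ _ "\<lambda>m. 1 / (of_int m * \<tau> + of_int n) ^ 2 + - eis2_term \<tau> (m, n)"])
         (use assms in \<open>auto simp: eis2_term_split g_def\<close>)
  qed
  have fin: "(\<Sum>n\<in>{- int N..<int N}. \<alpha> n - C n) =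
      - 2 / \<tau> * (of_real pi * \<i> * (e2pi (of_nat N / \<tau>) + 1) / (e2pi (of_nat N / \<tau>) - 1) - 1 / (of_nat N / \<tau>))"
    if N: "N \<ge> 1" for N
  proof -
    let ?w = "of_nat N / \<tau>"
    have "Im ?w \<noteq> 0" using N assms t0
      by (simp add: Im_divide power2_eq_square[symmetric] sum_power2_eq_zero_iff complex_eq_iff)
    hence w: "?w \<notin> \<int>" by (rule uhp_nonint)
    have "((\<lambda>m. \<Sum>n\<in>{- int N..<int N}. g m n - g m (n + 1)) has_sum (\<Sum>n\<in>{- int N..<int N}. \<alpha> n - C n)) ?A"
      by (rule has_sum_finite_sum) (use b in auto)
    hence "((\<lambda>m. g m (- int N) - g m (int N)) has_sum (\<Sum>n\<in>{- int N..<int N}. \<alpha> n - C n)) ?A"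
      by (simp only: sum_int_telescope)
    hence "((\<lambda>k. g (int (Suc k)) (- int N) - g (int (Suc k)) (int N)) has_sum ((\<Sum>n\<in>{- int N..<int N}. \<alpha> n - C n) / 2)) UNIV"
    proof (rule has_sum_nonzero_intD[rotated])
      fix m :: int
      have "g (- m) n = - g m (- n)" for n
      proof -
        have "of_int (- m) * \<tau> + of_int n = - (of_int m * \<tau> + of_int (- n))" by simp
        thus ?thesis unfolding g_def by (simp only: divide_minus_right)
      qed
      thus "g (- m) (- int N) - g (- m) (int N) = g m (- int N) - g m (int N)" by simp
    qed
    hence s1: "(\<lambda>k. g (int (Suc k)) (- int N) - g (int (Suc k)) (int N)) sums ((\<Sum>n\<in>{- int N..<int N}. \<alpha> n - C n) / 2)"
      by (rule has_sum_imp_sums)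
    have s2: "(\<lambda>k. - 1 / \<tau> * (1 / (?w + of_nat (Suc k)) + 1 / (?w - of_nat (Suc k)))) sums
      (- 1 / \<tau> * (of_real pi * \<i> * (e2pi ?w + 1) / (e2pi ?w - 1) - 1 / ?w))"
      by (intro sums_mult cot_partial_fractions w)
    have eq: "g (int (Suc k)) (- int N) - g (int (Suc k)) (int N) =
        - 1 / \<tau> * (1 / (?w + of_nat (Suc k)) + 1 / (?w - of_nat (Suc k)))" for k
    proof -
      have 1: "\<tau> * (?w + of_nat (Suc k)) = of_nat (Suc k) * \<tau> + of_nat N"
           "\<tau> * (?w - of_nat (Suc k)) = - (of_nat (Suc k) * \<tau> - of_nat N)"
        using t0 by (simp_all add: ring_distribs)
      have "- 1 / \<tau> * (1 / (?w + of_nat (Suc k)) + 1 / (?w - of_nat (Suc k))) =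
          - (1 / (\<tau> * (?w + of_nat (Suc k)))) - 1 / (\<tau> * (?w - of_nat (Suc k)))"
        by (simp add: ring_distribs)
      also have "\<dots> = g (int (Suc k)) (- int N) - g (int (Suc k)) (int N)"
        unfolding 1 divide_minus_right g_def by simp
      finally show ?thesis by simp
    qed
    have "(\<Sum>n\<in>{- int N..<int N}. \<alpha> n - C n) / 2 =
        - 1 / \<tau> * (of_real pi * \<i> * (e2pi ?w + 1) / (e2pi ?w - 1) - 1 / ?w)"
      by (rule sums_unique2[OF s1[unfolded eq] s2])
    hence "2 * ((\<Sum>n\<in>{- int N..<int N}. \<alpha> n - C n) / 2) =
        2 * (- 1 / \<tau> * (of_real pi * \<i> * (e2pi ?w + 1) / (e2pi ?w - 1) - 1 / ?w))" by (rule arg_cong)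
    thus ?thesis by (simp only: mult.assoc[symmetric]) simp
  qed
  have lim1: "(\<lambda>N. \<Sum>n\<in>{- int N..<int N}. \<alpha> n - C n) \<longlonglongrightarrow> - 2 / \<tau> * (of_real pi * \<i> * 1 - 0)"
  proof -
    \<comment> \<open>Im (N / tau) tends to minus infinity, so e2pi (N / tau) has norm exp (N r) and
      the quotient in the cotangent tends to 1.\<close>
    define r where "r = 2 * pi * Im \<tau> / norm \<tau> ^ 2"
    have r: "r > 0" using assms t0 by (simp add: r_def)
    have nq: "norm (inverse (e2pi (of_nat N / \<tau>))) = exp (- r) ^ N" for N
    proof -
      have "Im (of_nat N / \<tau>) = - (real N * Im \<tau> / norm \<tau> ^ 2)"
        using t0 by (simp add: Im_divide cmod_power2)
      hence "norm (e2pi (of_nat N / \<tau>)) = exp (real N * r)" unfolding norm_e2pi by (simp add: r_def)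
      moreover have "inverse (exp (real N * r)) = exp (- r) ^ N"
        by (simp add: exp_of_nat_mult exp_minus power_inverse)
      ultimately show ?thesis by (simp only: norm_inverse)
    qed
    have "(\<lambda>N. exp (- r) ^ N) \<longlonglongrightarrow> 0" by (rule LIMSEQ_realpow_zero) (use r in auto)
    hence q0: "(\<lambda>N. inverse (e2pi (of_nat N / \<tau>))) \<longlonglongrightarrow> 0"
      by (subst tendsto_norm_zero_iff[symmetric]) (simp only: nq)
    have "(\<lambda>N. (1 + inverse (e2pi (of_nat N / \<tau>))) / (1 - inverse (e2pi (of_nat N / \<tau>)))) \<longlonglongrightarrow> (1 + 0) / (1 - 0)"
      by (intro tendsto_intros q0) auto
    moreover have "(1 + inverse q) / (1 - inverse q) = (q + 1) / (q - 1)" if "q \<noteq> 0" for q :: complex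
    proof -
      have "(1 + inverse q) * q = q + 1" "(1 - inverse q) * q = q - 1" using that by (simp_all add: ring_distribs)
      thus ?thesis using mult_divide_mult_cancel_right[OF that, of "1 + inverse q" "1 - inverse q"] by metis
    qed
    ultimately have q1: "(\<lambda>N. (e2pi (of_nat N / \<tau>) + 1) / (e2pi (of_nat N / \<tau>) - 1)) \<longlonglongrightarrow> 1" by simp
    have "(\<lambda>N. \<tau> * (1 / (0 + of_nat N))) \<longlonglongrightarrow> \<tau> * 0" by (intro tendsto_intros tendsto_inverse_shift)
    hence w0: "(\<lambda>N. 1 / (of_nat N / \<tau>)) \<longlonglongrightarrow> 0" by simp
    have "(\<lambda>N. - 2 / \<tau> * (of_real pi * \<i> * ((e2pi (of_nat N / \<tau>) + 1) / (e2pi (of_nat N / \<tau>) - 1)) - 1 / (of_nat N / \<tau>)))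
       \<longlonglongrightarrow> - 2 / \<tau> * (of_real pi * \<i> * 1 - 0)"
      by (intro tendsto_mult tendsto_diff tendsto_const q1 w0)
    thus ?thesis
      by (rule Lim_transform_eventually) (use eventually_ge_at_top[of 1] in \<open>eventually_elim, simp add: fin\<close>)
  qed
  have "(\<alpha> has_sum (of_real pi ^ 2 / 3 / \<tau> ^ 2 + (eis2 (- 1 / \<tau>) / \<tau> ^ 2 - of_real pi ^ 2 / 3))) ({0} \<union> ?A)"
  proof (rule has_sum_Un_disjoint)
    show "(\<alpha> has_sum (of_real pi ^ 2 / 3 / \<tau> ^ 2)) {0}"
      by (rule has_sum_finiteI) (auto simp: \<alpha>_def)
    have "((\<lambda>n::int. - 4 * of_real pi ^ 2 * lat2 (of_int n * (- 1 / \<tau>)) / \<tau> ^ 2 + - (1 / of_int n ^ 2)) has_sum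
       (eis2 (- 1 / \<tau>) / \<tau> ^ 2 + - (of_real pi ^ 2 / 3))) ?A"
      by (intro has_sum_add has_sum_divide_const eis2_rows Im_neg_inverse assms has_sum_uminusI
          has_sum_inverse_powers_nonzero_int)
    moreover have "lat2 (of_int n * (- 1 / \<tau>)) = lat2 (of_int n / \<tau>)" for n
      using lat2_minus[of "of_int n / \<tau>"] by simp
    ultimately show "(\<alpha> has_sum (eis2 (- 1 / \<tau>) / \<tau> ^ 2 - of_real pi ^ 2 / 3)) ?A"
      by (subst has_sum_cong[of _ _ "\<lambda>n::int. - 4 * of_real pi ^ 2 * lat2 (of_int n * (- 1 / \<tau>)) / \<tau> ^ 2 + - (1 / of_int n ^ 2)"])
         (auto simp: \<alpha>_def)
  qed auto
  moreover have "{0} \<union> ?A = UNIV" by auto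
  ultimately have \<alpha>: "(\<alpha> has_sum (of_real pi ^ 2 / 3 / \<tau> ^ 2 + (eis2 (- 1 / \<tau>) / \<tau> ^ 2 - of_real pi ^ 2 / 3))) UNIV"
    by simp
  have "(\<lambda>N. (\<Sum>n\<in>{- int N..<int N}. \<alpha> n) - (\<Sum>n\<in>{- int N..<int N}. C n)) \<longlonglongrightarrow>
      of_real pi ^ 2 / 3 / \<tau> ^ 2 + (eis2 (- 1 / \<tau>) / \<tau> ^ 2 - of_real pi ^ 2 / 3) - eis2 \<tau>"
    by (intro tendsto_diff has_sum_int_tendsto \<alpha> C)
  with lim1 have "of_real pi ^ 2 / 3 / \<tau> ^ 2 + (eis2 (- 1 / \<tau>) / \<tau> ^ 2 - of_real pi ^ 2 / 3) - eis2 \<tau> =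
      - 2 / \<tau> * (of_real pi * \<i> * 1 - 0)"
    by (simp only: sum_subtractf) (rule LIMSEQ_unique)
  moreover have "- 2 / \<tau> * (of_real pi * \<i> * 1 - 0) = - (2 * of_real pi * \<i> / \<tau>)" by simp
  ultimately show ?thesis by (simp only: ) (simp add: algebra_simps)
qed

section \<open>Modularity of the invariant\<close>

lemma summable_cube_power:
  fixes x :: real
  assumes "0 \<le> x" "x < 1"
  shows "summable (\<lambda>n. (real n + 1) ^ 3 * x ^ n)"
proof -
  have 0: "summable (\<lambda>n. (\<lambda>_. 1) n * y ^ n)" if "norm y < 1" for y :: real
    using that by (simp add: summable_geometric)
  have 1: "summable (\<lambda>n. diffs (\<lambda>_. 1) n * y ^ n)" if "norm y < 1" for y :: real
    by (rule termdiff_converges[OF that 0])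
  have 2: "summable (\<lambda>n. diffs (diffs (\<lambda>_. 1)) n * y ^ n)" if "norm y < 1" for y :: real
    by (rule termdiff_converges[OF that 1])
  have "summable (\<lambda>n. diffs (diffs (diffs (\<lambda>_. 1))) n * x ^ n)"
    using assms by (intro termdiff_converges[OF _ 2, of _ 1]) auto
  hence "summable (\<lambda>n. (real n + 1) * ((real n + 2) * (real n + 3)) * x ^ n)"
    by (simp add: diffs_def add.commute)
  thus ?thesis
  proof (rule summable_comparison_test'[where N = 0])
    fix n :: nat
    have "(real n + 1) ^ 3 = (real n + 1) * ((real n + 1) * (real n + 1))" by (simp add: power3_eq_cube)
    also have "\<dots> \<le> (real n + 1) * ((real n + 2) * (real n + 3))"
      by (intro mult_left_mono mult_mono) auto
    finally show "norm ((real n + 1) ^ 3 * x ^ n) \<le> (real n + 1) * ((real n + 2) * (real n + 3)) * x ^ n"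
      using assms by (simp add: abs_mult mult_right_mono)
  qed
qed

text \<open>Shifting the index and expanding (n + 1)^j expresses the sum with exponent j through
  those with exponents 0, ..., j. The resulting triangular linear system for j = 1, 2, 3 yields the
  closed forms.\<close>

lemma power_sum_has_sum:
  fixes x :: "'a :: {real_normed_field, banach}"
  assumes "norm x < 1"
  shows "((\<lambda>k::nat. of_nat (Suc k) * x ^ Suc k) has_sum (x / (1 - x) ^ 2)) UNIV"
    and "((\<lambda>k::nat. of_nat (Suc k) ^ 3 * x ^ Suc k) has_sum (x * (x ^ 2 + 4 * x + 1) / (1 - x) ^ 4)) UNIV"
proof -
  have x1: "1 - x \<noteq> 0" using assms by auto
  have sn: "summable (\<lambda>n. norm (of_nat n ^ j * x ^ n))" if "j \<le> 3" for j
  proof (rule summable_comparison_test'[where N = 0])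
    show "summable (\<lambda>n. (real n + 1) ^ 3 * norm x ^ n)" by (rule summable_cube_power) (use assms in auto)
    fix n :: nat
    have "real n ^ j \<le> (real n + 1) ^ j" by (intro power_mono) auto
    also have "\<dots> \<le> (real n + 1) ^ 3" by (intro power_increasing that) auto
    finally show "norm (norm (of_nat n ^ j * x ^ n)) \<le> (real n + 1) ^ 3 * norm x ^ n"
      by (simp add: norm_mult norm_power mult_right_mono)
  qed
  define s where "s = (\<lambda>j::nat. \<Sum>n. of_nat n ^ j * x ^ n)"
  have s: "(\<lambda>n. of_nat n ^ j * x ^ n) sums s j" if "j \<le> 3" for j
    unfolding s_def by (rule summable_sums[OF summable_norm_cancel[OF sn[OF that]]])
  have t: "(\<lambda>n. of_nat (Suc n) ^ j * x ^ Suc n) sums s j" if "1 \<le> j" "j \<le> 3" for j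
    using s[OF that(2)] that by (subst sums_Suc_iff) (auto simp: power_0_left)
  have e0: "s 0 * (1 - x) = 1"
  proof -
    have "(\<lambda>n. x ^ n) sums s 0" using s[of 0] by simp
    hence "s 0 = 1 / (1 - x)" using geometric_sums[OF assms] by (rule sums_unique2)
    thus ?thesis using x1 by simp
  qed
  have e1: "s 1 = x * (s 1 + s 0)"
  proof (rule sums_unique2[OF t[of 1]])
    have "(\<lambda>n. x * (of_nat n ^ 1 * x ^ n + of_nat n ^ 0 * x ^ n)) sums (x * (s 1 + s 0))"
      by (intro sums_mult sums_add s) auto
    thus "(\<lambda>n. of_nat (Suc n) ^ 1 * x ^ Suc n) sums (x * (s 1 + s 0))"
      by (simp add: algebra_simps)
  qed auto
  have e2: "s 2 = x * (s 2 + 2 * s 1 + s 0)"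
  proof (rule sums_unique2[OF t[of 2]])
    have "(\<lambda>n. x * (of_nat n ^ 2 * x ^ n + 2 * (of_nat n ^ 1 * x ^ n) + of_nat n ^ 0 * x ^ n)) sums (x * (s 2 + 2 * s 1 + s 0))"
      by (intro sums_mult sums_add s) auto
    thus "(\<lambda>n. of_nat (Suc n) ^ 2 * x ^ Suc n) sums (x * (s 2 + 2 * s 1 + s 0))"
      by (simp add: algebra_simps power2_eq_square)
  qed auto
  have e3: "s 3 = x * (s 3 + 3 * s 2 + 3 * s 1 + s 0)"
  proof (rule sums_unique2[OF t[of 3]])
    have "(\<lambda>n. x * (of_nat n ^ 3 * x ^ n + 3 * (of_nat n ^ 2 * x ^ n) + 3 * (of_nat n ^ 1 * x ^ n) + of_nat n ^ 0 * x ^ n))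
        sums (x * (s 3 + 3 * s 2 + 3 * s 1 + s 0))"
      by (intro sums_mult sums_add s) auto
    thus "(\<lambda>n. of_nat (Suc n) ^ 3 * x ^ Suc n) sums (x * (s 3 + 3 * s 2 + 3 * s 1 + s 0))"
      by (simp add: algebra_simps power2_eq_square power3_eq_cube)
  qed auto
  have f1: "s 1 * (1 - x) ^ 2 = x" using e0 e1 by algebra
  have f2: "s 2 * (1 - x) ^ 3 = x * (x + 1)" using e0 e1 e2 f1 by algebra
  have f3: "s 3 * (1 - x) ^ 4 = x * (x ^ 2 + 4 * x + 1)" using e0 e3 f1 f2 by algebra
  have hs: "((\<lambda>k::nat. of_nat (Suc k) ^ j * x ^ Suc k) has_sum s j) UNIV" if "1 \<le> j" "j \<le> 3" for j
  proof (rule norm_summable_imp_has_sum[OF _ t[OF that]])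
    show "summable (\<lambda>n. norm (of_nat (Suc n) ^ j * x ^ Suc n))"
      using sn[OF that(2)] by (subst summable_Suc_iff)
  qed
  have "s 1 = x / (1 - x) ^ 2" using f1 x1 by (simp add: eq_divide_eq)
  with hs[of 1] show "((\<lambda>k::nat. of_nat (Suc k) * x ^ Suc k) has_sum (x / (1 - x) ^ 2)) UNIV" by simp
  have "s 3 = x * (x ^ 2 + 4 * x + 1) / (1 - x) ^ 4" using f3 x1 by (simp add: eq_divide_eq)
  with hs[of 3] show "((\<lambda>k::nat. of_nat (Suc k) ^ 3 * x ^ Suc k) has_sum (x * (x ^ 2 + 4 * x + 1) / (1 - x) ^ 4)) UNIV"
    by simp
qed

lemma norm_nome: "norm (nome \<tau>) = exp (- 2 * pi * Im \<tau>)"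
  unfolding nome_def by (rule norm_e2pi)

lemma norm_nome_less_1: "Im \<tau> > 0 \<Longrightarrow> norm (nome \<tau>) < 1"
  unfolding norm_nome by simp

lemma nome_nonzero [simp]: "nome \<tau> \<noteq> 0"
  by (simp add: nome_def)

lemma nome_plus_1: "nome (\<tau> + 1) = nome \<tau>"
  using e2pi_eq_1_iff[of 1] by (simp add: nome_def ring_distribs exp_add)

lemma e2pi_of_nat_mult: "e2pi (of_nat n * \<tau>) = nome \<tau> ^ n"
  unfolding nome_def by (simp add: exp_of_nat_mult[symmetric] mult_ac)

lemma nome_of_nat_mult: "nome (of_nat n * \<tau>) = nome \<tau> ^ n"
  unfolding nome_def by (simp add: exp_of_nat_mult[symmetric] mult_ac)

lemma lat_sums_summable:
  fixes q :: "'a :: {real_normed_field, banach}"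
  assumes "norm q < 1"
  shows "(\<lambda>(k, j). of_nat (Suc j) ^ 3 * (q ^ Suc k) ^ Suc j) summable_on UNIV"
    and "(\<lambda>(k, j). of_nat (Suc j) * (q ^ Suc k) ^ Suc j) summable_on UNIV"
proof -
  define r where "r = norm q"
  have r: "0 \<le> r" "r < 1" using assms by (auto simp: r_def)
  have rk: "norm (r ^ Suc k) < 1" for k
    using r by (metis abs_of_nonneg power_Suc_less_one real_norm_def zero_le_power power_Suc_less_one
       less_eq_real_def power_0_Suc zero_less_one)
  have 1: "(\<lambda>x. case x of (k, j) \<Rightarrow> real (Suc j) ^ 3 * (r ^ Suc k) ^ Suc j) summable_on (UNIV \<times> UNIV)"
  proof (rule summable_on_SigmaI)
    show "((\<lambda>j. case (k, j) of (k, j) \<Rightarrow> real (Suc j) ^ 3 * (r ^ Suc k) ^ Suc j) has_sum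
       (r ^ Suc k * ((r ^ Suc k) ^ 2 + 4 * r ^ Suc k + 1) / (1 - r ^ Suc k) ^ 4)) UNIV" for k
      using power_sum_has_sum(2)[OF rk[of k]] by simp
    show "(\<lambda>k. r ^ Suc k * ((r ^ Suc k) ^ 2 + 4 * r ^ Suc k + 1) / (1 - r ^ Suc k) ^ 4) summable_on UNIV"
    proof (rule norm_summable_imp_summable_on, rule summable_comparison_test'[where N = 0])
      \<comment> \<open>6 bounds x^2 + 4 x + 1 for x at most 1, and 1 - r bounds every 1 - x from
        below.\<close>
      show "summable (\<lambda>k. r ^ k * (6 / (1 - r) ^ 4))"
        using r by (intro summable_mult2 summable_geometric) auto
      fix k :: nat
      define x where "x = r ^ Suc k"
      have x: "0 \<le> x" "x \<le> r" "x \<le> r ^ k" "x < 1"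
        using r rk[of k] power_decreasing[of 1 "Suc k" r] power_decreasing[of k "Suc k" r] by (auto simp: x_def)
      have "x ^ 2 \<le> 1" using x by (simp add: power_le_one)
      hence "x * (x ^ 2 + 4 * x + 1) / (1 - x) ^ 4 \<le> r ^ k * 6 / (1 - r) ^ 4"
        using x r by (intro frac_le mult_mono power_mono) (auto intro!: mult_nonneg_nonneg add_nonneg_nonneg)
      thus "norm (norm (r ^ Suc k * ((r ^ Suc k) ^ 2 + 4 * r ^ Suc k + 1) / (1 - r ^ Suc k) ^ 4)) \<le> r ^ k * (6 / (1 - r) ^ 4)"
        unfolding x_def[symmetric] using x by (simp add: abs_mult)
    qed
  qed (use r in auto)
  have 2: "(\<lambda>x. real (Suc (snd x)) ^ 3 * (r ^ Suc (fst x)) ^ Suc (snd x)) summable_on UNIV"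
    using 1 by (simp only: case_prod_unfold UNIV_Times_UNIV)
  show "(\<lambda>(k, j). of_nat (Suc j) ^ 3 * (q ^ Suc k) ^ Suc j) summable_on UNIV"
    unfolding case_prod_unfold
    by (rule abs_summable_summable, rule Infinite_Sum.abs_summable_on_comparison_test'[OF 2])
       (simp only: r_def norm_mult norm_power norm_of_nat order_refl)
  show "(\<lambda>(k, j). of_nat (Suc j) * (q ^ Suc k) ^ Suc j) summable_on UNIV"
    unfolding case_prod_unfold
  proof (rule abs_summable_summable, rule Infinite_Sum.abs_summable_on_comparison_test'[OF 2])
    fix x :: "nat \<times> nat"
    have "real (Suc (snd x)) ^ 1 \<le> real (Suc (snd x)) ^ 3" by (rule power_increasing) auto
    hence "real (Suc (snd x)) * (r ^ Suc (fst x)) ^ Suc (snd x) \<le>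
        real (Suc (snd x)) ^ 3 * (r ^ Suc (fst x)) ^ Suc (snd x)"
      using r by (intro mult_right_mono zero_le_power) (simp_all only: power_one_right)
    thus "norm (of_nat (Suc (snd x)) * (q ^ Suc (fst x)) ^ Suc (snd x)) \<le>
        real (Suc (snd x)) ^ 3 * (r ^ Suc (fst x)) ^ Suc (snd x)"
      by (simp only: r_def norm_mult norm_power norm_of_nat)
  qed
qed

text \<open>The absolutely convergent double series of (j + 1)^3 q^((k + 1)(j + 1)) is grouped by n
  + 1 = (k + 1)(j + 1), with the divisor d = j + 1. Grouped by k it is the sum of the
  \<open>lat4\<close> values, hence known.\<close>

lemma eisenstein_E4_has_sum:
  assumes "Im \<tau> > 0"
  shows "((\<lambda>n. (\<Sum>d | d dvd Suc n. of_nat d ^ 3) * nome \<tau> ^ Suc n) has_sum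
    (3 / (16 * of_real pi ^ 4) * (lattice_G4 \<tau> - of_real pi ^ 4 / 45))) UNIV"
    (is "(_ has_sum ?S) _")
proof -
  let ?q = "nome \<tau>"
  let ?f = "\<lambda>(k, j). of_nat (Suc j) ^ 3 * (?q ^ Suc k) ^ Suc j"
  have q: "norm ?q < 1" using norm_nome_less_1[OF assms] .
  have "(?f has_sum ?S) (UNIV \<times> UNIV)"
  proof (rule has_sum_SigmaI)
    show "((\<lambda>j. ?f (k, j)) has_sum lat4 (of_nat (Suc k) * \<tau>)) UNIV" for k
    proof -
      have "norm (?q ^ Suc k) < 1"
        unfolding norm_power using q by (intro power_Suc_less_one) auto
      from power_sum_has_sum(2)[OF this] show ?thesis
        unfolding lat4_def e2pi_of_nat_mult prod.case .
    qed
    show "?f summable_on (UNIV \<times> UNIV)" using lat_sums_summable(1)[OF q] by simp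
  qed (rule lattice_G4_expansion[OF assms])
  moreover have "(?f has_sum ?S) (UNIV \<times> UNIV) \<longleftrightarrow>
    ((\<lambda>(n, d). of_nat d ^ 3 * ?q ^ Suc n) has_sum ?S) (Sigma UNIV (\<lambda>n. {d. d dvd Suc n}))"
  proof (rule has_sum_reindex_bij_witness[of _ "\<lambda>(n, d). (Suc n div d - 1, d - 1)"
      "\<lambda>(k, j). (Suc k * Suc j - 1, Suc j)"], goal_cases)
    case (3 b)
    obtain n d where b: "b = (n, d)" "d dvd Suc n" using 3 by auto
    then obtain e where e: "Suc n = d * e" by (auto elim: dvdE)
    hence de: "d > 0" "e > 0" by (auto intro: Nat.gr0I)
    hence "Suc n div d = e" "Suc (e - 1) * Suc (d - 1) - 1 = n" using e by (auto simp: mult.commute)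
    thus ?case using b de by (simp del: mult_Suc mult_Suc_right)
  next
    case (5 a)
    obtain k j where a: "a = (k, j)" by (cases a)
    have "Suc (Suc k * Suc j - 1) = Suc k * Suc j" by simp
    thus ?case unfolding a prod.case by (simp only: power_mult)
  qed (auto simp del: mult_Suc mult_Suc_right simp: dvd_def)
  ultimately have "((\<lambda>(n, d). of_nat d ^ 3 * ?q ^ Suc n) has_sum ?S) (Sigma UNIV (\<lambda>n. {d. d dvd Suc n}))"
    by simp
  thus ?thesis
    by (rule has_sum_SigmaD) (auto intro!: has_sum_finiteI simp: sum_distrib_right simp del: power_Suc)
qed

text \<open>Division by 2 zeta(4): the factor is 240 * 3/16 = 45, and the constant part 240 * 3/16 *
  1/45 = 1 cancels the leading 1.\<close>

lemma eisenstein_E4_conv_lattice_G4: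
  assumes "Im \<tau> > 0"
  shows "eisenstein_E4 \<tau> = 45 / of_real pi ^ 4 * lattice_G4 \<tau>"
proof -
  have "(\<Sum>n. (\<Sum>d | d dvd Suc n. of_nat d ^ 3) * nome \<tau> ^ Suc n) =
      3 / (16 * of_real pi ^ 4) * (lattice_G4 \<tau> - of_real pi ^ 4 / 45)"
    using has_sum_imp_sums[OF eisenstein_E4_has_sum[OF assms]] by (rule sums_unique[symmetric])
  hence "eisenstein_E4 \<tau> = 1 + 240 * (3 / (16 * of_real pi ^ 4) * (lattice_G4 \<tau> - of_real pi ^ 4 / 45))"
    unfolding eisenstein_E4_def by simp
  also have "\<dots> = 45 / of_real pi ^ 4 * lattice_G4 \<tau>" by (simp add: right_diff_distrib)
  finally show ?thesis .
qed

lemma eisenstein_E4_inversion: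
  assumes "Im \<tau> > 0"
  shows "eisenstein_E4 (- 1 / \<tau>) = \<tau> ^ 4 * eisenstein_E4 \<tau>"
  using eisenstein_E4_conv_lattice_G4[OF assms] eisenstein_E4_conv_lattice_G4[OF Im_neg_inverse[OF assms]]
    lattice_G4_inversion[OF assms] by simp

text \<open>The double series of (j + 1) q^((k + 1)(j + 1)) summed over k first. This order produces
  the logarithmic derivative of the Euler product, the other order the \<open>lat2\<close>
  values.\<close>

lemma eis2_lambert:
  assumes "Im \<tau> > 0"
  shows "((\<lambda>k. of_nat (Suc k) * nome \<tau> ^ Suc k / (1 - nome \<tau> ^ Suc k)) has_sum (- eis2 \<tau> / (8 * of_real pi ^ 2))) UNIV"
    (is "(_ has_sum ?S) _")
proof -
  let ?q = "nome \<tau>"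
  let ?f = "\<lambda>(k, j). of_nat (Suc j) * (?q ^ Suc k) ^ Suc j"
  have q: "norm ?q < 1" using norm_nome_less_1[OF assms] .
  have qk: "norm (?q ^ Suc k) < 1" for k
    unfolding norm_power using q by (intro power_Suc_less_one) auto
  have "(?f has_sum ?S) (UNIV \<times> UNIV)"
  proof (rule has_sum_SigmaI)
    show "((\<lambda>j. ?f (k, j)) has_sum lat2 (of_nat (Suc k) * \<tau>)) UNIV" for k
      using power_sum_has_sum(1)[OF qk[of k]] unfolding lat2_def e2pi_of_nat_mult prod.case .
    show "?f summable_on (UNIV \<times> UNIV)" using lat_sums_summable(2)[OF q] by simp
  qed (rule eis2_expansion[OF assms])
  hence "((\<lambda>(j, k). ?f (k, j)) has_sum ?S) (UNIV \<times> UNIV)"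
    using has_sum_swap[of ?f UNIV UNIV ?S] by (simp add: case_prod_unfold)
  thus ?thesis
  proof (rule has_sum_SigmaD, simp only: prod.case)
    fix j :: nat
    have "((\<lambda>k. of_nat (Suc j) * (?q ^ Suc j * (?q ^ Suc j) ^ k)) has_sum (of_nat (Suc j) * (?q ^ Suc j * (1 / (1 - ?q ^ Suc j))))) UNIV"
      using qk[of j]
      by (intro has_sum_cmult_right norm_summable_imp_has_sum geometric_sums)
         (simp_all add: norm_power summable_geometric del: power_Suc)
    moreover have "?q ^ Suc j * (?q ^ Suc j) ^ k = (?q ^ Suc k) ^ Suc j" for k
      by (metis power_Suc power_mult mult.commute)
    ultimately show "((\<lambda>k. of_nat (Suc j) * (?q ^ Suc k) ^ Suc j) has_sum
        of_nat (Suc j) * ?q ^ Suc j / (1 - ?q ^ Suc j)) UNIV"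
      by (simp only:) (simp only: times_divide_eq_right mult_1_right)
  qed
qed

section \<open>The Euler product and the inversion of eta\<close>

definition euler_prod :: "complex \<Rightarrow> complex" where
  "euler_prod q = (\<Prod>n. 1 - q ^ Suc n)"

lemma euler_prod_convergent:
  fixes q :: complex
  assumes "norm q < 1"
  shows "convergent_prod (\<lambda>n. 1 - q ^ Suc n)"
proof (rule abs_convergent_prod_imp_convergent_prod)
  have "summable (\<lambda>n. norm q ^ Suc n)" 
    using assms by (subst summable_Suc_iff) (simp add: summable_geometric)
  thus "abs_convergent_prod (\<lambda>n. 1 - q ^ Suc n)"
    unfolding abs_convergent_prod_conv_summable by (simp add: norm_power norm_mult)
qed

lemma one_minus_power_nonzero:
  fixes q :: complex
  assumes "norm q < 1"
  shows "1 - q ^ Suc n \<noteq> 0"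
proof
  assume "1 - q ^ Suc n = 0"
  hence "norm (q ^ Suc n) = 1" by simp
  moreover have "norm q ^ Suc n \<le> norm q ^ 1" using assms by (intro power_decreasing) auto
  ultimately show False using assms by (simp add: norm_power del: power_Suc)
qed

lemma euler_prod_nonzero: "norm q < 1 \<Longrightarrow> euler_prod q \<noteq> 0"
  unfolding euler_prod_def
  by (intro prodinf_nonzero euler_prod_convergent one_minus_power_nonzero)

lemma euler_prod_uniform_limit:
  assumes "r < 1"
  shows "uniform_limit (cball 0 r) (\<lambda>N q. \<Prod>n<N. 1 - q ^ Suc n) euler_prod sequentially"
proof (cases "r \<ge> 0")
  case True
  have "uniformly_convergent_on (cball 0 r) (\<lambda>N q. \<Prod>n<N. 1 - q ^ Suc n :: complex)"
  proof (rule uniformly_convergent_on_prod')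
    show "uniformly_convergent_on (cball 0 r) (\<lambda>N x. \<Sum>n<N. norm (1 - x ^ Suc n - 1 :: complex))"
    proof (rule Weierstrass_m_test')
      show "summable (\<lambda>n. r ^ Suc n)" using True assms by (subst summable_Suc_iff) (simp add: summable_geometric)
      fix n and x :: complex assume "x \<in> cball 0 r"
      hence "norm x ^ Suc n \<le> r ^ Suc n" by (intro power_mono) auto
      thus "norm (norm (1 - x ^ Suc n - 1)) \<le> r ^ Suc n" by (simp add: norm_power norm_mult)
    qed
  qed (auto intro!: continuous_intros)
  then obtain l where l: "uniform_limit (cball 0 r) (\<lambda>N q. \<Prod>n<N. 1 - q ^ Suc n :: complex) l sequentially"
    by (auto simp: uniformly_convergent_on_def)
  have "l q = euler_prod q" if q: "q \<in> cball 0 r" for q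
  proof (rule LIMSEQ_unique)
    show "(\<lambda>N. \<Prod>n<N. 1 - q ^ Suc n) \<longlonglongrightarrow> l q" using tendsto_uniform_limitI[OF l q] .
    have "norm q < 1" using q assms by simp
    from convergent_prod_LIMSEQ[OF euler_prod_convergent[OF this]]
    show "(\<lambda>N. \<Prod>n<N. 1 - q ^ Suc n) \<longlonglongrightarrow> euler_prod q"
      unfolding euler_prod_def LIMSEQ_lessThan_iff_atMost .
  qed
  thus ?thesis using uniform_limit_cong'[of "cball 0 r" "\<lambda>N q. \<Prod>n<N. 1 - q ^ Suc n" "\<lambda>N q. \<Prod>n<N. 1 - q ^ Suc n" l euler_prod] l
    by simp
next
  case False
  hence "cball 0 r = ({} :: complex set)" by auto
  thus ?thesis by simp
qed

lemma euler_prod_holomorphic: "euler_prod holomorphic_on ball 0 1"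
proof (rule holomorphic_uniform_sequence)
  fix x :: complex assume x: "x \<in> ball 0 1"
  define d where "d = (1 - norm x) / 2"
  have "norm y \<le> norm x + d" if "y \<in> cball x d" for y
    using norm_triangle_sub[of y x] that by (simp add: dist_norm norm_minus_commute)
  hence "cball x d \<subseteq> cball 0 (norm x + d)" by auto
  moreover have d: "0 < d" "norm x + d < 1" using x by (auto simp: d_def field_simps)
  moreover have "cball 0 (norm x + d) \<subseteq> (ball 0 1 :: complex set)" using d by auto
  ultimately show "\<exists>d. 0 < d \<and> cball x d \<subseteq> ball 0 1 \<and>
      uniform_limit (cball x d) (\<lambda>N q. \<Prod>n<N. 1 - q ^ Suc n) euler_prod sequentially"
    by (intro exI[of _ d] conjI uniform_limit_on_subset[OF euler_prod_uniform_limit[of "norm x + d"]]) auto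
qed (auto intro!: holomorphic_intros)

lemma euler_prod_logderiv:
  assumes "norm q < 1"
  shows "(\<lambda>k. of_nat (Suc k) * q ^ Suc k / (1 - q ^ Suc k)) sums (- q * deriv euler_prod q / euler_prod q)"
proof -
  define r where "r = (1 + norm q) / 2"
  have r: "norm q < r" "r < 1" using assms by (auto simp: r_def)
  have "(\<lambda>k. deriv (\<lambda>q. 1 - q ^ Suc k) q / (1 - q ^ Suc k)) sums (deriv euler_prod q / euler_prod q)"
  proof (rule logderiv_prodinf_complex_uniform_limit)
    show "uniform_limit (ball 0 r) (\<lambda>N q. \<Prod>n<N. 1 - q ^ Suc n) euler_prod sequentially"
      by (rule uniform_limit_on_subset[OF euler_prod_uniform_limit[OF r(2)]]) auto
  qed (use r in \<open>auto intro!: holomorphic_intros euler_prod_nonzero assms\<close>)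
  moreover have "deriv (\<lambda>q. 1 - q ^ Suc k) q = - (of_nat (Suc k) * q ^ k)" for k
    by (rule DERIV_imp_deriv) (auto intro!: derivative_eq_intros simp del: power_Suc)
  ultimately have "(\<lambda>k. - (of_nat (Suc k) * q ^ k) / (1 - q ^ Suc k)) sums (deriv euler_prod q / euler_prod q)"
    by simp
  from sums_mult[OF this, of "- q"] show ?thesis
    by (simp add: mult_ac del: of_nat_Suc)
qed

lemma dedekind_eta_conv_euler_prod:
  "dedekind_eta \<tau> = exp (2 * of_real pi * \<i> * \<tau> / 24) * euler_prod (nome \<tau>)"
  by (simp add: dedekind_eta_def euler_prod_def)

lemma dedekind_eta_24: "dedekind_eta \<tau> ^ 24 = nome \<tau> * euler_prod (nome \<tau>) ^ 24"
proof -
  have "exp (2 * of_real pi * \<i> * \<tau> / 24) ^ 24 = nome \<tau>"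
    unfolding nome_def by (simp add: exp_of_nat_mult[symmetric] mult_ac)
  thus ?thesis by (simp add: dedekind_eta_conv_euler_prod power_mult_distrib)
qed

lemma dedekind_eta_nonzero: "Im \<tau> > 0 \<Longrightarrow> dedekind_eta \<tau> \<noteq> 0"
  by (simp add: dedekind_eta_conv_euler_prod euler_prod_nonzero norm_nome_less_1)

lemma open_uhp: "open {\<tau>. Im \<tau> > 0}"
  by (rule open_halfspace_Im_gt)

lemma nome_holomorphic [holomorphic_intros]: "f holomorphic_on A \<Longrightarrow> (\<lambda>z. nome (f z)) holomorphic_on A"
  unfolding nome_def by (intro holomorphic_intros)

lemma euler_prod_nome_holomorphic: "(\<lambda>\<tau>. euler_prod (nome \<tau>)) holomorphic_on {\<tau>. Im \<tau> > 0}"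
proof -
  have "euler_prod \<circ> nome holomorphic_on {\<tau>. Im \<tau> > 0}"
    by (rule holomorphic_on_compose_gen[OF _ euler_prod_holomorphic])
       (auto intro!: holomorphic_intros simp: norm_nome_less_1)
  thus ?thesis by (simp add: o_def)
qed

lemma dedekind_eta_holomorphic: "dedekind_eta holomorphic_on {\<tau>. Im \<tau> > 0}"
  unfolding dedekind_eta_conv_euler_prod
  by (intro holomorphic_intros euler_prod_nome_holomorphic) auto

text \<open>The logarithmic derivative of q times the 24th power of the Euler product is 2 pi i (1 -
  24 S), i.e. 2 pi i E_2, where S is the Lambert series of n q^n / (1 - q^n), equal to
  -\<open>eis2\<close> / (8 pi^2).\<close>

lemma dedekind_eta_24_has_derivative:
  assumes "Im \<tau> > 0"
  shows "((\<lambda>\<tau>. dedekind_eta \<tau> ^ 24) has_field_derivative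
    (2 * of_real pi * \<i> + 6 * \<i> / of_real pi * eis2 \<tau>) * dedekind_eta \<tau> ^ 24) (at \<tau>)"
proof -
  let ?q = "nome \<tau>" and ?E = "euler_prod (nome \<tau>)"
  have q: "norm ?q < 1" using norm_nome_less_1[OF assms] .
  have E0: "?E \<noteq> 0" by (rule euler_prod_nonzero[OF q])
  have dq: "(nome has_field_derivative 2 * of_real pi * \<i> * ?q) (at \<tau>)"
    unfolding nome_def by (auto intro!: derivative_eq_intros)
  have dE: "(euler_prod has_field_derivative deriv euler_prod ?q) (at ?q)"
    by (rule holomorphic_derivI[OF euler_prod_holomorphic]) (use q in auto)
  have "- eis2 \<tau> / (8 * of_real pi ^ 2) = - ?q * deriv euler_prod ?q / ?E"
    by (rule sums_unique2[OF has_sum_imp_sums[OF eis2_lambert[OF assms]] euler_prod_logderiv[OF q]])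
  hence "- (?q * deriv euler_prod ?q) = - (eis2 \<tau> / (8 * of_real pi ^ 2) * ?E)"
    using E0 by (simp add: nonzero_eq_divide_eq[symmetric])
  hence qE: "?q * deriv euler_prod ?q = eis2 \<tau> / (8 * of_real pi ^ 2) * ?E" by simp
  have "((\<lambda>\<tau>. nome \<tau> * euler_prod (nome \<tau>) ^ 24) has_field_derivative
      2 * of_real pi * \<i> * ?q * ?E ^ 24 + ?q * (24 * ?E ^ 23 * (deriv euler_prod ?q * (2 * of_real pi * \<i> * ?q)))) (at \<tau>)"
    by (auto intro!: derivative_eq_intros dq DERIV_chain2[OF dE dq])
  also have "2 * of_real pi * \<i> * ?q * ?E ^ 24 + ?q * (24 * ?E ^ 23 * (deriv euler_prod ?q * (2 * of_real pi * \<i> * ?q))) =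
      2 * of_real pi * \<i> * ?q * ?E ^ 24 + ?q * (24 * ?E ^ 23 * (2 * of_real pi * \<i> * (?q * deriv euler_prod ?q)))"
    by (simp only: mult_ac)
  also have "\<dots> = (2 * of_real pi * \<i> + 24 * (2 * of_real pi * \<i> * (eis2 \<tau> / (8 * of_real pi ^ 2)))) * (?q * (?E ^ 23 * ?E))"
    unfolding qE by (simp add: eval_nat_numeral(2,3) algebra_simps)
  also have "24 * (2 * of_real pi * \<i> * (eis2 \<tau> / (8 * of_real pi ^ 2))) = 6 * \<i> / of_real pi * eis2 \<tau>"
    by (simp add: power2_eq_square)
  also have "?E ^ 23 * ?E = ?E ^ 24" by (simp add: power_Suc2[symmetric] del: power_Suc)
  finally show ?thesis unfolding dedekind_eta_24 .
qed

text \<open>The anomaly 2 pi i / tau of \<open>eis2\<close>, multiplied by 6 i / pi, is -12 / tau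
  and balances the logarithmic derivative of tau^12. Hence the quotient of the two sides is constant
  on the upper half-plane.\<close>

lemma dedekind_eta_24_inversion:
  assumes "Im \<tau> > 0"
  shows "dedekind_eta (- 1 / \<tau>) ^ 24 = \<tau> ^ 12 * dedekind_eta \<tau> ^ 24"
proof -
  define D where "D = (\<lambda>\<tau>. dedekind_eta \<tau> ^ 24)"
  define H where "H = (\<lambda>\<tau>. D (- 1 / \<tau>) / (\<tau> ^ 12 * D \<tau>))"
  define a where "a = (\<lambda>\<tau>. 2 * of_real pi * \<i> + 6 * \<i> / of_real pi * eis2 \<tau>)"
  have D: "(D has_field_derivative a z * D z) (at z)" "D z \<noteq> 0" if "Im z > 0" for z
    using dedekind_eta_24_has_derivative[OF that] dedekind_eta_nonzero[OF that] by (auto simp: D_def a_def)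
  have aS: "a (- 1 / z) / z ^ 2 = a z + 12 / z" if z: "Im z > 0" for z
  proof -
    have pi: "of_real pi \<noteq> (0::complex)" by simp
    have "a z = 2 * of_real pi * \<i> + 6 * \<i> / of_real pi * (eis2 (- 1 / z) / z ^ 2) +
       (6 * \<i> / of_real pi * (of_real pi ^ 2 / 3)) / z ^ 2 - 6 * \<i> / of_real pi * (of_real pi ^ 2 / 3) +
       (6 * \<i> / of_real pi * (2 * of_real pi * \<i>)) / z"
      unfolding a_def by (subst eis2_inversion[OF z]) (simp add: ring_distribs)
    also have "6 * \<i> / of_real pi * (of_real pi ^ 2 / 3) = 2 * of_real pi * \<i>"
      by (simp add: power2_eq_square)
    also have "6 * \<i> / of_real pi * (2 * of_real pi * \<i>) = -12" by simp
    finally have "a z = (2 * of_real pi * \<i>) / z ^ 2 + 6 * \<i> / of_real pi * (eis2 (- 1 / z) / z ^ 2) - 12 / z"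
      by simp
    thus ?thesis unfolding a_def by (simp add: add_divide_distrib)
  qed
  have H: "(H has_field_derivative 0) (at z)" if z: "Im z > 0" for z
  proof -
    have z0: "z \<noteq> 0" using z by auto
    have S: "((\<lambda>z. - 1 / z) has_field_derivative 1 / z ^ 2) (at z)"
      using z0 by (auto intro!: derivative_eq_intros simp: power2_eq_square)
    have 1: "((\<lambda>z. D (- 1 / z)) has_field_derivative a (- 1 / z) * D (- 1 / z) * (1 / z ^ 2)) (at z)"
      using DERIV_chain2[OF D(1)[OF Im_neg_inverse[OF z]] S] .
    have 2: "((\<lambda>z. z ^ 12 * D z) has_field_derivative (12 / z + a z) * (z ^ 12 * D z)) (at z)"
    proof (rule DERIV_cong)
      show "((\<lambda>z. z ^ 12 * D z) has_field_derivative z ^ 12 * (a z * D z) + (12 * z ^ 11) * D z) (at z)"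
        by (auto intro!: derivative_eq_intros D z)
      have "12 * z ^ 11 = 12 / z * z ^ 12" using z0 by (simp add: eval_nat_numeral)
      thus "z ^ 12 * (a z * D z) + (12 * z ^ 11) * D z = (12 / z + a z) * (z ^ 12 * D z)"
        by (simp only: ring_distribs mult_ac add_ac)
    qed
    have nz: "z ^ 12 * D z \<noteq> 0" using z0 D(2)[OF z] by simp
    have "(H has_field_derivative (a (- 1 / z) * D (- 1 / z) * (1 / z ^ 2) * (z ^ 12 * D z) -
        D (- 1 / z) * ((12 / z + a z) * (z ^ 12 * D z))) / ((z ^ 12 * D z) * (z ^ 12 * D z))) (at z)"
      unfolding H_def by (rule DERIV_divide[OF 1 2 nz])
    moreover have "a (- 1 / z) * D (- 1 / z) * (1 / z ^ 2) = (12 / z + a z) * D (- 1 / z)"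
    proof -
      have "a (- 1 / z) * D (- 1 / z) * (1 / z ^ 2) = a (- 1 / z) / z ^ 2 * D (- 1 / z)" by simp
      thus ?thesis unfolding aS[OF z] by (simp only: add.commute)
    qed
    ultimately show ?thesis by (simp only:) (simp add: mult_ac)
  qed
  have "H constant_on {z. Im z > 0}"
    by (rule DERIV_zero_connected_constant_on[where K = "{}"])
       (use H in \<open>auto intro!: convex_connected convex_halfspace_Im_gt open_uhp
             DERIV_continuous_on[OF has_field_derivative_at_within]\<close>)
  hence "H \<tau> = H \<i>" using assms by (auto simp: constant_on_def)
  \<comment> \<open>The fixed point of the inversion determines the constant, since i^12 =
    1.\<close>
  also have "H \<i> = 1" using D(2)[of \<i>] by (simp add: H_def eval_nat_numeral)
  finally have "D (- 1 / \<tau>) = \<tau> ^ 12 * D \<tau>"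
    using D(2)[OF assms] assms by (auto simp: H_def)
  thus ?thesis by (simp add: D_def)
qed

lemma dedekind_eta_24_plus_1: "dedekind_eta (\<tau> + 1) ^ 24 = dedekind_eta \<tau> ^ 24"
  by (simp add: dedekind_eta_24 nome_plus_1)

lemma klein_j_inversion:
  assumes "Im \<tau> > 0"
  shows "klein_j (- 1 / \<tau>) = klein_j \<tau>"
proof -
  have "\<tau> \<noteq> 0" using assms by auto
  hence "(\<tau> ^ 4 * eisenstein_E4 \<tau>) ^ 3 / (\<tau> ^ 12 * dedekind_eta \<tau> ^ 24) = eisenstein_E4 \<tau> ^ 3 / dedekind_eta \<tau> ^ 24"
    by (simp add: power_mult_distrib power_mult[symmetric])
  thus ?thesis unfolding klein_j_def eisenstein_E4_inversion[OF assms] dedekind_eta_24_inversion[OF assms] .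
qed

lemma klein_j_plus_1: "klein_j (\<tau> + 1) = klein_j \<tau>"
  by (simp add: klein_j_def dedekind_eta_24_plus_1 eisenstein_E4_def nome_plus_1)

section \<open>Moebius transformations and functions invariant under the full modular group\<close>

definition mob :: "int \<Rightarrow> int \<Rightarrow> int \<Rightarrow> int \<Rightarrow> complex \<Rightarrow> complex" where
  "mob a b c d \<tau> = (of_int a * \<tau> + of_int b) / (of_int c * \<tau> + of_int d)"

lemma mob_denominator_nonzero:
  assumes "a * d - b * c = 1" "Im \<tau> > 0"
  shows "of_int c * \<tau> + of_int d \<noteq> 0"
  using assms by (auto simp: complex_eq_iff)

lemma Im_mob:
  assumes "a * d - b * c = 1" "Im \<tau> > 0"
  shows "Im (mob a b c d \<tau>) = Im \<tau> / norm (of_int c * \<tau> + of_int d) ^ 2"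
proof -
  have "real_of_int (a * d - b * c) = 1" by (simp only: assms(1) of_int_1)
  hence "Im \<tau> * (real_of_int a * real_of_int d - real_of_int b * real_of_int c) = Im \<tau>" by simp
  hence "real_of_int a * Im \<tau> * (real_of_int c * Re \<tau> + real_of_int d) -
     (real_of_int a * Re \<tau> + real_of_int b) * (real_of_int c * Im \<tau>) = Im \<tau>" by (simp add: algebra_simps)
  thus ?thesis by (simp add: mob_def Im_divide cmod_power2)
qed

lemma Im_mob_pos:
  assumes "a * d - b * c = 1" "Im \<tau> > 0"
  shows "Im (mob a b c d \<tau>) > 0"
  using mob_denominator_nonzero[OF assms] assms by (simp add: Im_mob[OF assms])

lemma mob_mob:
  assumes "a * d - b * c = 1" "Im \<tau> > 0"
  shows "mob a' b' c' d' (mob a b c d \<tau>) = mob (a' * a + b' * c) (a' * b + b' * d) (c' * a + d' * c) (c' * b + d' * d) \<tau>"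
proof -
  let ?n = "of_int a * \<tau> + of_int b" and ?d = "of_int c * \<tau> + of_int d"
  have d: "?d \<noteq> 0" by (rule mob_denominator_nonzero[OF assms])
  have "of_int a' * (?n / ?d) + of_int b' = (of_int a' * ?n + of_int b' * ?d) / ?d"
       "of_int c' * (?n / ?d) + of_int d' = (of_int c' * ?n + of_int d' * ?d) / ?d"
  proof -
    have "A * (n / D) + B = (A * n + B * D) / D" if "D \<noteq> 0" for A B n D :: complex
      using that by (simp add: add_divide_distrib)
    from this[OF d] show "of_int a' * (?n / ?d) + of_int b' = (of_int a' * ?n + of_int b' * ?d) / ?d"
       "of_int c' * (?n / ?d) + of_int d' = (of_int c' * ?n + of_int d' * ?d) / ?d" by blast+
  qed
  moreover have "(A / ?d) / (B / ?d) = A / B" for A B using d by simp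
  ultimately have "mob a' b' c' d' (mob a b c d \<tau>) = (of_int a' * ?n + of_int b' * ?d) / (of_int c' * ?n + of_int d' * ?d)"
    unfolding mob_def by (simp only:)
  thus ?thesis unfolding mob_def by (simp add: algebra_simps)
qed

lemma mob_holomorphic:
  assumes "a * d - b * c = 1"
  shows "mob a b c d holomorphic_on {\<tau>. Im \<tau> > 0}"
  unfolding mob_def by (intro holomorphic_intros) (use mob_denominator_nonzero[OF assms] in auto)

text \<open>Euclid's algorithm on the first column (a, c): a translation on the left reduces a
  modulo c, inversion swaps the two entries, and |c| decreases. The value type is left open because
  the lemma serves the complex function j as well as the real function
  \<open>eta_height\<close>.\<close>

lemma modular_invariance:
  fixes f :: "complex \<Rightarrow> 'a"
  assumes T: "\<And>\<tau>. Im \<tau> > 0 \<Longrightarrow> f (\<tau> + 1) = f \<tau>"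
      and S: "\<And>\<tau>. Im \<tau> > 0 \<Longrightarrow> f (- 1 / \<tau>) = f \<tau>"
      and det: "a * d - b * c = 1" and im: "Im \<tau> > 0"
  shows "f (mob a b c d \<tau>) = f \<tau>"
proof -
  have Tn: "f (\<tau> + of_nat n) = f \<tau>" if "Im \<tau> > 0" for n \<tau>
    using that by (induction n) (auto simp: T add.assoc[symmetric] add.commute[of 1])
  have Ti: "f (\<tau> + of_int k) = f \<tau>" if "Im \<tau> > 0" for k \<tau>
  proof (cases "k \<ge> 0")
    case True
    thus ?thesis using Tn[OF that, of "nat k"] by (simp add: of_nat_nat)
  next
    case False
    thus ?thesis using Tn[of "\<tau> + of_int k" "nat (- k)"] that by (simp add: of_nat_nat)
  qed
  show ?thesis using det
  proof (induction "nat \<bar>c\<bar>" arbitrary: a b c d rule: less_induct)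
    case less
    show ?case
    proof (cases "c = 0")
      case True
      hence ad: "a * d = 1" using less.prems by simp
      \<comment> \<open>For c = 0 the determinant leaves only translations, by b if a = d = 1 and by
        -b if a = d = -1.\<close>
      hence "a = 1 \<and> d = 1 \<or> a = -1 \<and> d = -1" by (rule pos_zmult_eq_1_iff_lemma[THEN disjE]) (use ad in auto)
      thus ?thesis
      proof
        assume "a = 1 \<and> d = 1"
        thus ?thesis using True Ti[OF im, of b] by (simp add: mob_def)
      next
        assume "a = - 1 \<and> d = - 1"
        hence "mob a b c d \<tau> = \<tau> + of_int (- b)" using True by (simp add: mob_def)
        thus ?thesis using Ti[OF im, of "- b"] by simp
      qed
    next
      case False
      define k where "k = a div c"
      define a' where "a' = a mod c"
      define b' where "b' = b - k * d"
      have a: "a = k * c + a'" by (simp add: k_def a'_def)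
      have det': "a' * d - b' * c = 1" using less.prems by (simp add: a b'_def algebra_simps)
      have im': "Im (mob a' b' c d \<tau>) > 0" by (rule Im_mob_pos[OF det' im])
      have den: "of_int c * \<tau> + of_int d \<noteq> 0" by (rule mob_denominator_nonzero[OF det' im])
      have "mob a b c d \<tau> = mob a' b' c d \<tau> + of_int k"
      proof -
        have "of_int a * \<tau> + of_int b = (of_int a' * \<tau> + of_int b') + of_int k * (of_int c * \<tau> + of_int d)"
          by (simp add: a b'_def algebra_simps)
        thus ?thesis unfolding mob_def using den by (simp add: add_divide_distrib)
      qed
      hence "f (mob a b c d \<tau>) = f (mob a' b' c d \<tau>)" using Ti[OF im'] by simp
      also have "\<dots> = f (- 1 / mob a' b' c d \<tau>)" using S[OF im'] by simp
      also have "- 1 / mob a' b' c d \<tau> = mob (- c) (- d) a' b' \<tau>"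
        by (simp add: mob_def)
      also have "f \<dots> = f \<tau>"
      proof (rule less.hyps)
        show "nat \<bar>a'\<bar> < nat \<bar>c\<bar>" using False abs_mod_less[of c a] by (simp add: a'_def)
        show "(- c) * b' - (- d) * a' = 1" using det' by (simp add: algebra_simps)
      qed
      finally show ?thesis .
    qed
  qed
qed

lemma klein_j_mob:
  assumes "a * d - b * c = 1" "Im \<tau> > 0"
  shows "klein_j (mob a b c d \<tau>) = klein_j \<tau>"
  using modular_invariance[of klein_j, OF klein_j_plus_1 klein_j_inversion] assms by blast

text \<open>The absolute value of the discriminant, made invariant of weight 0 by the factor (Im
  tau)^6. Absolute values discard the roots of unity in the law of eta but still show the growth at
  the cusps.\<close>

definition eta_height :: "complex \<Rightarrow> real" where
  "eta_height \<tau> = norm (dedekind_eta \<tau>) ^ 24 * Im \<tau> ^ 6"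

lemma eta_height_mob:
  assumes "a * d - b * c = 1" "Im \<tau> > 0"
  shows "eta_height (mob a b c d \<tau>) = eta_height \<tau>"
proof (rule modular_invariance[OF _ _ assms])
  show "eta_height (\<tau> + 1) = eta_height \<tau>" for \<tau>
    using arg_cong[OF dedekind_eta_24_plus_1[of \<tau>], of norm] by (simp add: eta_height_def norm_power)
  fix \<tau> assume t: "Im \<tau> > 0"
  hence t0: "\<tau> \<noteq> 0" by auto
  have "Im (- 1 / \<tau>) = Im \<tau> / norm \<tau> ^ 2" by (simp add: Im_divide cmod_power2)
  thus "eta_height (- 1 / \<tau>) = eta_height \<tau>"
    using arg_cong[OF dedekind_eta_24_inversion[OF t], of norm] t0
    by (simp add: eta_height_def norm_power norm_mult power_divide power_mult[symmetric])
qed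

text \<open>The product of diag(\<open>\<delta>\<close>, 1) with (a b; c d) has determinant
  \<open>\<delta>\<close>. A matrix of determinant 1 on its left brings it to the triangular form (g
  h; 0 e) with g = gcd(c, \<open>\<delta>\<close>) and g e = \<open>\<delta>\<close>, and
  \<open>eta_height\<close> is invariant under that matrix.\<close>

lemma eta_height_dilate_mob:
  fixes \<delta> :: nat
  assumes det: "a * d - b * c = 1" and \<delta>: "\<delta> > 0"
  obtains h :: int where
    "\<And>\<tau>. Im \<tau> > 0 \<Longrightarrow> eta_height (of_nat \<delta> * mob a b c d \<tau>) =
     eta_height ((of_int (gcd c (int \<delta>)) * \<tau> + of_int h) / of_int (int \<delta> div gcd c (int \<delta>)))"
proof -
  define g where "g = gcd c (int \<delta>)"
  define e where "e = int \<delta> div g"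
  define c' where "c' = c div g"
  have g0: "g > 0" using \<delta> by (simp add: g_def)
  have ge: "int \<delta> = g * e" and gc: "c = g * c'" by (simp_all add: e_def c'_def g_def)
  have e0: "e > 0" using \<delta> ge g0 by (metis of_nat_0_less_iff zero_less_mult_pos)
  have "coprime a c"
    by (rule coprimeI) (metis det dvd_diff dvd_mult dvd_mult2)
  hence "coprime (e * a) c'"
  proof -
    assume ac: "coprime a c"
    have "coprime a c'" using ac by (simp add: gc)
    moreover have "coprime e c'" using div_gcd_coprime[of c "int \<delta>"] \<delta>
      by (simp add: e_def c'_def g_def coprime_commute)
    ultimately show ?thesis by simp
  qed
  \<comment> \<open>The bottom row (-c', e a) of the triangularizing matrix annihilates the first
    column (\<open>\<delta>\<close> a, c); Bezout coefficients complete it to determinant 1.\<close>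
  then obtain x y where xy: "x * (e * a) + y * c' = 1"
    using bezout_int[of "e * a" c'] by (auto simp: coprime_iff_gcd_eq_1)
  define h where "h = x * int \<delta> * b + y * d"
  have "eta_height (of_nat \<delta> * mob a b c d \<tau>) = eta_height ((of_int g * \<tau> + of_int h) / of_int e)"
    if im: "Im \<tau> > 0" for \<tau>
  proof -
  define z where "z = of_nat \<delta> * mob a b c d \<tau>"
  have imz: "Im z > 0" unfolding z_def using Im_mob_pos[OF det im] \<delta> by simp
  have den: "of_int c * \<tau> + of_int d \<noteq> 0" by (rule mob_denominator_nonzero[OF det im])
  have z: "z * (of_int c * \<tau> + of_int d) = of_nat \<delta> * (of_int a * \<tau> + of_int b)"
    using den by (simp add: z_def mob_def)
  have d1: "x * (e * a) - y * (- c') = 1" using xy by simp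
  have num: "(of_int x * z + of_int y) * (of_int c * \<tau> + of_int d) = of_int g * \<tau> + of_int h"
  proof -
    have "(of_int x * z + of_int y) * (of_int c * \<tau> + of_int d) =
        of_int x * (of_nat \<delta> * (of_int a * \<tau> + of_int b)) + of_int y * (of_int c * \<tau> + of_int d)"
      by (simp only: distrib_right[of _ _ "of_int c * \<tau> + of_int d"] mult.assoc z)
    also have "\<dots> = of_int (x * int \<delta> * a + y * c) * \<tau> + of_int h"
      by (simp add: h_def algebra_simps)
    also have "x * int \<delta> * a + y * c = g * (x * (e * a) + y * c')" by (simp add: ge gc algebra_simps)
    finally show ?thesis by (simp add: xy)
  qed
  have dn: "(of_int (- c') * z + of_int (e * a)) * (of_int c * \<tau> + of_int d) = of_int e"
  proof -
    have "(of_int (- c') * z + of_int (e * a)) * (of_int c * \<tau> + of_int d) =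
        of_int (- c') * (of_nat \<delta> * (of_int a * \<tau> + of_int b)) + of_int (e * a) * (of_int c * \<tau> + of_int d)"
      by (simp only: distrib_right[of _ _ "of_int c * \<tau> + of_int d"] mult.assoc z)
    also have "\<dots> = of_int (e * a * c - c' * int \<delta> * a) * \<tau> + of_int (e * a * d - c' * int \<delta> * b)"
      by (simp add: algebra_simps)
    also have "e * a * c - c' * int \<delta> * a = 0" by (simp add: ge gc)
    also have "e * a * d - c' * int \<delta> * b = e * (a * d - b * c)" by (simp add: ge gc algebra_simps)
    finally show ?thesis by (simp add: det)
  qed
  have "mob x y (- c') (e * a) z = (of_int g * \<tau> + of_int h) / of_int e"
    unfolding mob_def num[symmetric] dn[symmetric] using den by simp
  with eta_height_mob[OF d1 imz]
  have "eta_height ((of_int g * \<tau> + of_int h) / of_int e) = eta_height z" by simp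
  thus ?thesis by (simp add: z_def)
  qed
  thus ?thesis using that[of h] unfolding g_def e_def by simp
qed

section \<open>The cusp at infinity and the vanishing of modular functions\<close>

definition cusp :: "complex filter" where "cusp = filtercomap Im at_top"

lemma eventually_cusp: "eventually P cusp \<longleftrightarrow> (\<exists>B. \<forall>\<tau>. Im \<tau> \<ge> B \<longrightarrow> P \<tau>)"
  unfolding cusp_def eventually_filtercomap_at_top_linorder ..

lemma cusp_neq_bot [simp]: "cusp \<noteq> bot"
proof
  assume "cusp = bot"
  hence "eventually (\<lambda>_. False) cusp" by simp
  then obtain B where "\<And>\<tau>. Im \<tau> \<ge> B \<Longrightarrow> False" by (auto simp: eventually_cusp)
  from this[of "Complex 0 B"] show False by simp
qed

lemma filterlim_Im_cusp: "filterlim Im at_top cusp"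
  unfolding cusp_def by (rule filterlim_filtercomap)

lemma eventually_cusp_Im_gt: "eventually (\<lambda>\<tau>. Im \<tau> > B) cusp"
  by (rule filterlim_at_top_dense[THEN iffD1, rule_format, OF filterlim_Im_cusp])

text \<open>|f| attains a maximum over the half-plane Im > 4/5, so the maximum modulus principle
  makes f constant, with value the limit 0. Translations and the decay confine the search to a
  compact rectangle; a maximum on its lower edge is moved into the open half-plane by
  inversion.\<close>

lemma modular_function_vanishing_at_cusp:
  assumes holo: "f holomorphic_on {\<tau>. Im \<tau> > 0}"
      and T: "\<And>\<tau>. Im \<tau> > 0 \<Longrightarrow> f (\<tau> + 1) = f \<tau>"
      and S: "\<And>\<tau>. Im \<tau> > 0 \<Longrightarrow> f (- 1 / \<tau>) = f \<tau>"
      and lim: "(f \<longlongrightarrow> 0) cusp" and im: "Im \<tau> > 0"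
  shows "f \<tau> = 0"
proof -
  let ?H = "{\<tau>. Im \<tau> > 0}" and ?U = "{\<tau>. Im \<tau> > 4/5}"
  have shift: "\<exists>\<tau>'. \<bar>Re \<tau>'\<bar> \<le> 1/2 \<and> Im \<tau>' = Im \<tau> \<and> f \<tau>' = f \<tau>" if "Im \<tau> > 0" for \<tau>
  proof -
    define n where "n = \<lfloor>Re \<tau> + 1/2\<rfloor>"
    have "f (mob 1 (- n) 0 1 \<tau>) = f \<tau>" by (rule modular_invariance[OF T S]) (use that in auto)
    moreover have "mob 1 (- n) 0 1 \<tau> = \<tau> - of_int n" by (simp add: mob_def)
    moreover have "of_int n \<le> Re \<tau> + 1/2" "Re \<tau> + 1/2 < of_int n + 1" unfolding n_def by linarith+
    hence "\<bar>Re (\<tau> - of_int n)\<bar> \<le> 1/2" unfolding minus_complex.sel abs_le_iff by simp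
    ultimately show ?thesis by (intro exI[of _ "\<tau> - of_int n"]) auto
  qed
  have "\<exists>\<xi>\<in>?U. \<forall>z\<in>?U. norm (f z) \<le> norm (f \<xi>)"
  proof (cases "\<forall>z\<in>?U. f z = 0")
    case True
    thus ?thesis by (intro bexI[of _ \<i>]) auto
  next
    case False
    then obtain \<tau>0 where t0: "Im \<tau>0 > 4/5" "f \<tau>0 \<noteq> 0" by auto
    have "eventually (\<lambda>\<tau>. norm (f \<tau>) < norm (f \<tau>0)) cusp"
      using tendstoD[OF lim, of "norm (f \<tau>0)"] t0 by simp
    then obtain B where B: "\<And>\<tau>. Im \<tau> \<ge> B \<Longrightarrow> norm (f \<tau>) < norm (f \<tau>0)" by (auto simp: eventually_cusp)
    define K where "K = cbox (Complex (-1/2) (4/5)) (Complex (1/2) B)"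
    have K: "\<tau> \<in> K \<longleftrightarrow> \<bar>Re \<tau>\<bar> \<le> 1/2 \<and> 4/5 \<le> Im \<tau> \<and> Im \<tau> \<le> B" for \<tau>
      unfolding K_def in_cbox_complex_iff by (auto simp: abs_le_iff)
    have "Im \<tau>0 > 0" using t0 by auto
    then obtain \<tau>0' where t0': "\<bar>Re \<tau>0'\<bar> \<le> 1/2" "Im \<tau>0' = Im \<tau>0" "f \<tau>0' = f \<tau>0"
      using shift[of \<tau>0] by blast
    have "Im \<tau>0 < B" using B[of \<tau>0] by (meson less_irrefl not_less)
    hence K0: "\<tau>0' \<in> K" using t0 t0' by (simp add: K)
    have sub: "K \<subseteq> ?H" by (auto simp: K)
    have "continuous_on K (\<lambda>z. norm (f z))"
      by (intro continuous_intros continuous_on_subset[OF holomorphic_on_imp_continuous_on[OF holo] sub])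
    moreover have "compact K" by (simp add: K_def)
    ultimately obtain \<tau>1 where t1: "\<tau>1 \<in> K" "\<And>z. z \<in> K \<Longrightarrow> norm (f z) \<le> norm (f \<tau>1)"
      using continuous_attains_sup[of K "\<lambda>z. norm (f z)"] K0 by auto
    have le: "norm (f z) \<le> norm (f \<tau>1)" if "z \<in> ?U" for z
    proof (cases "Im z \<ge> B")
      case True
      have "norm (f z) < norm (f \<tau>0)" by (rule B[OF True])
      also have "\<dots> \<le> norm (f \<tau>1)" using t1(2)[OF K0] t0' by simp
      finally show ?thesis by simp
    next
      case False
      have "Im z > 0" using that by auto
      then obtain z' where "\<bar>Re z'\<bar> \<le> 1/2" "Im z' = Im z" "f z' = f z" using shift[of z] by blast
      thus ?thesis using t1(2)[of z'] False that by (simp add: K)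
    qed
    show ?thesis
    proof (cases "Im \<tau>1 > 4/5")
      case True
      thus ?thesis using le by auto
    next
      case False
      hence im1: "Im \<tau>1 = 4/5" using t1(1) by (simp add: K)
      \<comment> \<open>On the lower edge |tau|^2 is at most 1/4 + 16/25 < 1, so inversion lifts the
        point strictly above height 4/5. The choice of 4/5 only has to lie below sqrt(3)/2.\<close>
      have "Re \<tau>1 ^ 2 \<le> (1/2) ^ 2" using t1(1) by (intro abs_le_square_iff[THEN iffD1]) (simp add: K)
      moreover have "norm \<tau>1 ^ 2 = Re \<tau>1 ^ 2 + 16 / 25" unfolding cmod_power2 im1 by (simp add: power2_eq_square)
      ultimately have "norm \<tau>1 ^ 2 < 1" by (simp add: power2_eq_square)
      moreover have "norm \<tau>1 ^ 2 > 0" using im1 by (auto simp: complex_eq_iff)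
      ultimately have "4/5 / 1 < 4/5 / norm \<tau>1 ^ 2" by (intro divide_strict_left_mono) auto
      moreover have "Im (- 1 / \<tau>1) = Im \<tau>1 / norm \<tau>1 ^ 2" by (simp add: Im_divide cmod_power2)
      ultimately have "Im (- 1 / \<tau>1) > 4/5" by (simp add: im1)
      moreover have "f (- 1 / \<tau>1) = f \<tau>1" using S im1 by simp
      ultimately show ?thesis using le by (intro bexI[of _ "- 1 / \<tau>1"]) auto
    qed
  qed
  then obtain \<xi> where \<xi>: "\<xi> \<in> ?U" "\<And>z. z \<in> ?U \<Longrightarrow> norm (f z) \<le> norm (f \<xi>)" by blast
  have "f constant_on ?H"
  proof (rule maximum_modulus_principle[OF holo open_uhp _ _ _ \<xi>])
    show "connected ?H" by (intro convex_connected convex_halfspace_Im_gt)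
    show "open ?U" by (rule open_halfspace_Im_gt)
  qed (use \<xi> in auto)
  then obtain k where k: "\<And>z. Im z > 0 \<Longrightarrow> f z = k" by (auto simp: constant_on_def)
  have "(f \<longlongrightarrow> k) cusp"
    by (rule tendsto_eventually) (use eventually_cusp_Im_gt[of 0] k in \<open>auto elim: eventually_mono\<close>)
  hence "k = 0" using tendsto_unique[OF cusp_neq_bot _ lim] by blast
  thus ?thesis using k im by simp
qed

lemma holomorphic_mult_eq_0:
  assumes "f holomorphic_on A" "g holomorphic_on A" "open A" "connected A"
    and "\<And>z. z \<in> A \<Longrightarrow> f z * g z = 0"
  shows "(\<forall>z\<in>A. f z = 0) \<or> (\<forall>z\<in>A. g z = 0)"
proof (rule disjCI)
  assume "\<not> (\<forall>z\<in>A. g z = 0)"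
  then obtain z0 where z0: "z0 \<in> A" "g z0 \<noteq> 0" by auto
  have "isCont g z0"
    using assms z0 holomorphic_on_imp_continuous_on continuous_on_eq_continuous_at by blast
  hence "eventually (\<lambda>z. g z \<noteq> 0) (nhds z0)"
    using z0 by (simp add: eventually_nhds_conv_at continuous_within tendsto_imp_eventually_ne)
  then obtain V where V: "open V" "z0 \<in> V" "\<And>z. z \<in> V \<Longrightarrow> g z \<noteq> 0" by (auto simp: eventually_nhds)
  have fz: "f z = 0" if "z \<in> V \<inter> A" for z using assms(5)[of z] V(3)[of z] that by auto
  have "f z = 0" if "z \<in> A" for z
    by (rule analytic_continuation_open[of "V \<inter> A" A f "\<lambda>_. 0"])
       (use assms V z0 that fz in \<open>auto intro: open_Int\<close>)
  thus "\<forall>z\<in>A. f z = 0" by blast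
qed

lemma holomorphic_prod_eq_0:
  assumes "finite I" "\<And>i. i \<in> I \<Longrightarrow> f i holomorphic_on A" "open A" "connected A" "A \<noteq> {}"
    and "\<And>z. z \<in> A \<Longrightarrow> (\<Prod>i\<in>I. f i z) = 0"
  shows "\<exists>i\<in>I. \<forall>z\<in>A. f i z = 0"
  using assms
proof (induction I rule: finite_induct)
  case (insert x I)
  have "(\<forall>z\<in>A. f x z = 0) \<or> (\<forall>z\<in>A. (\<Prod>i\<in>I. f i z) = 0)"
    by (rule holomorphic_mult_eq_0) (use insert in \<open>auto intro!: holomorphic_intros\<close>)
  thus ?case using insert by blast
qed auto

section \<open>Growth at the cusps and the modular relation\<close>

text \<open>f is O(|q|^a) at infinity. The exponent is real because orders at the other cusps are
  fractional in q; a mere bound is recorded, so that no expansion in a fractional power of q has to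
  be formed.\<close>

definition order_ge :: "(complex \<Rightarrow> complex) \<Rightarrow> real \<Rightarrow> bool" where
  "order_ge f a \<longleftrightarrow> (\<lambda>\<tau>. norm (f \<tau>)) \<in> O[cusp](\<lambda>\<tau>. exp (- 2 * pi * a * Im \<tau>))"

lemma order_geE:
  assumes "order_ge f a"
  obtains C where "C > 0" "eventually (\<lambda>\<tau>. norm (f \<tau>) \<le> C * exp (- 2 * pi * a * Im \<tau>)) cusp"
  using assms unfolding order_ge_def by (elim landau_o.bigE) auto

lemma order_geI:
  "eventually (\<lambda>\<tau>. norm (f \<tau>) \<le> C * exp (- 2 * pi * a * Im \<tau>)) cusp \<Longrightarrow> order_ge f a"
  unfolding order_ge_def by (rule bigoI[of _ C]) simp

lemma order_ge_mono:
  assumes "order_ge f a" "b \<le> a"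
  shows "order_ge f b"
proof -
  obtain C where C: "C > 0" "eventually (\<lambda>\<tau>. norm (f \<tau>) \<le> C * exp (- 2 * pi * a * Im \<tau>)) cusp"
    using order_geE[OF assms(1)] .
  have "eventually (\<lambda>\<tau>. norm (f \<tau>) \<le> C * exp (- 2 * pi * b * Im \<tau>)) cusp"
    using C(2) eventually_cusp_Im_gt[of 0]
  proof eventually_elim
    case (elim \<tau>)
    have "exp (- 2 * pi * a * Im \<tau>) \<le> exp (- 2 * pi * b * Im \<tau>)"
      using assms(2) elim by (simp add: mult_right_mono)
    thus ?case using elim(1) C(1) by (meson mult_left_mono less_imp_le order_trans)
  qed
  thus ?thesis by (rule order_geI)
qed

lemma order_ge_mult:
  assumes "order_ge f a" "order_ge g b"
  shows "order_ge (\<lambda>\<tau>. f \<tau> * g \<tau>) (a + b)"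
proof -
  have "exp (- 2 * pi * (a + b) * Im \<tau>) = exp (- 2 * pi * a * Im \<tau>) * exp (- 2 * pi * b * Im \<tau>)" for \<tau>
    by (simp only: exp_add[symmetric] ring_distribs)
  thus ?thesis
    using landau_o.big.mult[OF assms[unfolded order_ge_def]] unfolding order_ge_def norm_mult by simp
qed

lemma order_ge_add:
  assumes "order_ge f a" "order_ge g a"
  shows "order_ge (\<lambda>\<tau>. f \<tau> + g \<tau>) a"
proof -
  obtain C where C: "C > 0" "eventually (\<lambda>\<tau>. norm (f \<tau>) \<le> C * exp (- 2 * pi * a * Im \<tau>)) cusp"
    using order_geE[OF assms(1)] .
  obtain D where D: "D > 0" "eventually (\<lambda>\<tau>. norm (g \<tau>) \<le> D * exp (- 2 * pi * a * Im \<tau>)) cusp"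
    using order_geE[OF assms(2)] .
  show ?thesis
    by (rule order_geI[of _ "C + D"], use C(2) D(2) in eventually_elim)
       (use norm_triangle_ineq in \<open>fastforce simp: distrib_right intro: order_trans\<close>)
qed

lemma order_ge_uminus: "order_ge f a \<Longrightarrow> order_ge (\<lambda>\<tau>. - f \<tau>) a"
  by (simp add: order_ge_def)

lemma order_ge_diff: "order_ge f a \<Longrightarrow> order_ge g a \<Longrightarrow> order_ge (\<lambda>\<tau>. f \<tau> - g \<tau>) a"
  using order_ge_add[OF _ order_ge_uminus, of f a g] by simp

lemma order_ge_cong:
  assumes "order_ge f a" "eventually (\<lambda>\<tau>. f \<tau> = g \<tau>) cusp"
  shows "order_ge g a"
proof -
  obtain C where C: "C > 0" "eventually (\<lambda>\<tau>. norm (f \<tau>) \<le> C * exp (- 2 * pi * a * Im \<tau>)) cusp"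
    using order_geE[OF assms(1)] .
  show ?thesis by (rule order_geI[of _ C], use C(2) assms(2) in eventually_elim) auto
qed

lemma order_ge_tendsto:
  assumes "(f \<longlongrightarrow> L) cusp"
  shows "order_ge f 0"
proof (rule order_geI[of _ "norm L + 1"])
  have "eventually (\<lambda>\<tau>. norm (f \<tau>) < norm L + 1) cusp"
    by (rule order_tendstoD(2)[OF tendsto_norm[OF assms]]) simp
  thus "eventually (\<lambda>\<tau>. norm (f \<tau>) \<le> (norm L + 1) * exp (- 2 * pi * 0 * Im \<tau>)) cusp"
    by (auto elim: eventually_mono)
qed

lemma order_ge_const: "order_ge (\<lambda>_. c) 0"
  by (rule order_ge_tendsto[OF tendsto_const])

lemma order_ge_nome: "order_ge nome 1"
  by (rule order_geI[of _ 1]) (simp add: norm_nome)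

lemma filterlim_nome_cusp: "filterlim nome (at 0) cusp"
proof (rule filterlim_atI)
  have "((\<lambda>\<tau>. exp (- 2 * pi * Im \<tau>)) \<longlongrightarrow> 0) cusp"
  proof (rule filterlim_compose[OF exp_at_bot])
    have "filterlim (\<lambda>\<tau>. (2 * pi) * Im \<tau>) at_top cusp"
      by (rule filterlim_tendsto_pos_mult_at_top[OF tendsto_const _ filterlim_Im_cusp]) simp
    thus "filterlim (\<lambda>\<tau>. - 2 * pi * Im \<tau>) at_bot cusp"
      by (simp add: filterlim_uminus_at_bot)
  qed
  thus "(nome \<longlongrightarrow> 0) cusp" by (subst tendsto_norm_zero_iff[symmetric]) (simp only: norm_nome)
qed auto

lemma order_ge_power: "order_ge f a \<Longrightarrow> order_ge (\<lambda>\<tau>. f \<tau> ^ n) (real n * a)"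
proof (induction n)
  case (Suc n)
  from order_ge_mult[OF Suc.prems Suc.IH[OF Suc.prems]] show ?case by (simp add: algebra_simps)
qed (simp add: order_ge_const)

lemma order_ge_imp_tendsto_0:
  assumes "order_ge f a" "a > 0"
  shows "(f \<longlongrightarrow> 0) cusp"
proof -
  obtain C where C: "C > 0" "eventually (\<lambda>\<tau>. norm (f \<tau>) \<le> C * exp (- 2 * pi * a * Im \<tau>)) cusp"
    using order_geE[OF assms(1)] .
  have "filterlim (\<lambda>\<tau>. (2 * pi * a) * Im \<tau>) at_top cusp"
    by (rule filterlim_tendsto_pos_mult_at_top[OF tendsto_const _ filterlim_Im_cusp]) (use assms in simp)
  hence "filterlim (\<lambda>\<tau>. - 2 * pi * a * Im \<tau>) at_bot cusp"
    by (simp add: filterlim_uminus_at_bot)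
  hence "((\<lambda>\<tau>. C * exp (- 2 * pi * a * Im \<tau>)) \<longlongrightarrow> C * 0) cusp"
    by (intro tendsto_intros filterlim_compose[OF exp_at_bot])
  hence "((\<lambda>\<tau>. norm (f \<tau>)) \<longlongrightarrow> 0) cusp"
    by (intro tendsto_sandwich[OF _ C(2) tendsto_const]) auto
  thus ?thesis by (subst tendsto_norm_zero_iff[symmetric])
qed

text \<open>The tail divided by q^K is again a power series in q and therefore bounded near q =
  0.\<close>

lemma powser_order_ge:
  fixes x0 :: complex
  assumes "summable (\<lambda>n. a n * x0 ^ n)" "x0 \<noteq> 0"
  shows "order_ge (\<lambda>\<tau>. (\<Sum>n. a n * nome \<tau> ^ n) - (\<Sum>n<K. a n * nome \<tau> ^ n)) (real K)"
proof -
  define g where "g = (\<lambda>q. \<Sum>n. a (n + K) * q ^ n)"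
  have "summable (\<lambda>n. a (n + K) * x0 ^ (n + K))" using summable_ignore_initial_segment[OF assms(1)] .
  hence "summable (\<lambda>n. (a (n + K) * x0 ^ (n + K)) * (1 / x0 ^ K))" by (rule summable_mult2)
  hence s: "summable (\<lambda>n. a (n + K) * x0 ^ n)" using assms(2) by (simp add: power_add)
  have n0: "filterlim nome (nhds 0) cusp" using filterlim_nome_cusp by (auto simp: filterlim_at)
  have "isCont g 0" unfolding g_def by (rule isCont_powser[OF s]) (use assms in simp)
  hence "((\<lambda>\<tau>. g (nome \<tau>)) \<longlongrightarrow> g 0) cusp" using n0 by (rule isCont_tendsto_compose)
  from order_ge_mult[OF order_ge_tendsto[OF this] order_ge_power[OF order_ge_nome, of K]]
  have "order_ge (\<lambda>\<tau>. g (nome \<tau>) * nome \<tau> ^ K) (real K)" by simp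
  moreover have "eventually (\<lambda>\<tau>. norm (nome \<tau>) < norm x0) cusp"
    by (rule order_tendstoD(2)[OF tendsto_norm_zero[OF n0]]) (use assms in simp)
  hence "eventually (\<lambda>\<tau>. g (nome \<tau>) * nome \<tau> ^ K = (\<Sum>n. a n * nome \<tau> ^ n) - (\<Sum>n<K. a n * nome \<tau> ^ n)) cusp"
  proof eventually_elim
    case (elim \<tau>)
    have 1: "summable (\<lambda>n. a n * nome \<tau> ^ n)" by (rule powser_inside[OF assms(1) elim])
    have 2: "summable (\<lambda>n. a (n + K) * nome \<tau> ^ n)" by (rule powser_inside[OF s elim])
    have "(\<Sum>n. a n * nome \<tau> ^ n) = (\<Sum>n. a (n + K) * nome \<tau> ^ (n + K)) + (\<Sum>n<K. a n * nome \<tau> ^ n)"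
      by (rule suminf_split_initial_segment[OF 1])
    also have "(\<Sum>n. a (n + K) * nome \<tau> ^ (n + K)) = g (nome \<tau>) * nome \<tau> ^ K"
      unfolding g_def suminf_mult2[OF 2] by (simp add: power_add mult.assoc)
    finally show ?case by simp
  qed
  ultimately show ?thesis by (rule order_ge_cong)
qed

lemma order_ge_sum:
  "(\<And>i. i \<in> I \<Longrightarrow> order_ge (f i) a) \<Longrightarrow> finite I \<Longrightarrow> order_ge (\<lambda>\<tau>. \<Sum>i\<in>I. f i \<tau>) a"
proof (induction I rule: infinite_finite_induct)
  case empty
  show ?case by (rule order_geI[of _ 0]) simp
qed (auto intro!: order_ge_add)

lemma order_ge_prod:
  "finite I \<Longrightarrow> (\<And>i. i \<in> I \<Longrightarrow> order_ge (f i) (a i)) \<Longrightarrow> order_ge (\<lambda>\<tau>. \<Prod>i\<in>I. f i \<tau>) (\<Sum>i\<in>I. a i)"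
proof (induction I rule: finite_induct)
  case empty
  show ?case by (simp add: order_ge_const)
qed (auto intro!: order_ge_mult)

lemma order_ge_poly:
  assumes "order_ge f (- m)" "m \<ge> 0" "degree p \<le> n"
  shows "order_ge (\<lambda>\<tau>. poly p (f \<tau>)) (- (m * real n))"
  unfolding poly_altdef
proof (rule order_ge_sum)
  fix i assume "i \<in> {..degree p}"
  hence "i \<le> n" using assms by simp
  have "order_ge (\<lambda>\<tau>. coeff p i * f \<tau> ^ i) (0 + real i * (- m))"
    by (intro order_ge_mult order_ge_const order_ge_power assms)
  thus "order_ge (\<lambda>\<tau>. coeff p i * f \<tau> ^ i) (- (m * real n))"
    using \<open>i \<le> n\<close> assms(2) by (elim order_ge_mono) (simp add: mult.commute mult_left_mono)
qed simp

section \<open>Eta quotients at the cusps\<close>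

definition eta_quotient :: "complex \<Rightarrow> (nat \<times> int) list \<Rightarrow> complex \<Rightarrow> complex" where
  "eta_quotient \<kappa> rs \<tau> = \<kappa> * (\<Prod>(\<delta>, r)\<leftarrow>rs. dedekind_eta (of_nat \<delta> * \<tau>) powi r)"

text \<open>Ligozat's formula: the sum of r gcd(c, \<open>\<delta>\<close>)^2 /
  \<open>\<delta>\<close>, divided by 24. The order is counted in q itself and not in the local
  parameter of the cusp.\<close>

definition cusp_order :: "int \<Rightarrow> (nat \<times> int) list \<Rightarrow> real" where
  "cusp_order c rs = (\<Sum>(\<delta>, r)\<leftarrow>rs. of_int r * of_int (gcd c (int \<delta>)) / of_int (int \<delta> div gcd c (int \<delta>))) / 24"

lemma powi_mult_distrib: "(x * y :: 'a :: field) powi n = x powi n * y powi n"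
  by (simp add: power_int_mult_distrib)

text \<open>The powers of Im tau contained in the heights cancel because the exponents sum to 0; the
  factors \<open>\<delta>\<close>^6 compensate for Im (\<open>\<delta>\<close> tau) =
  \<open>\<delta>\<close> Im tau.\<close>

lemma norm_eta_quotient:
  assumes "Im \<tau> > 0" "\<forall>(\<delta>, r)\<in>set rs. \<delta> > 0" "(\<Sum>(\<delta>, r)\<leftarrow>rs. r) = 0"
  shows "norm (eta_quotient \<kappa> rs \<tau>) ^ 24 =
    norm \<kappa> ^ 24 * (\<Prod>(\<delta>, r)\<leftarrow>rs. (real \<delta> ^ 6) powi (- r)) * (\<Prod>(\<delta>, r)\<leftarrow>rs. eta_height (of_nat \<delta> * \<tau>) powi r)"
proof -
  have "norm (\<Prod>(\<delta>, r)\<leftarrow>rs. dedekind_eta (of_nat \<delta> * \<tau>) powi r) ^ 24 * (Im \<tau> ^ 6) powi (\<Sum>(\<delta>, r)\<leftarrow>rs. r) =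
    (\<Prod>(\<delta>, r)\<leftarrow>rs. (real \<delta> ^ 6) powi (- r)) * (\<Prod>(\<delta>, r)\<leftarrow>rs. eta_height (of_nat \<delta> * \<tau>) powi r)"
    using assms(2)
  proof (induction rs)
    case (Cons x rs)
    obtain \<delta> r where x: "x = (\<delta>, r)" by (cases x)
    have \<delta>: "\<delta> > 0" using Cons.prems x by auto
    have h: "norm (dedekind_eta (of_nat \<delta> * \<tau>) powi r) ^ 24 * (Im \<tau> ^ 6) powi r =
        (real \<delta> ^ 6) powi (- r) * eta_height (of_nat \<delta> * \<tau>) powi r"
    proof -
      define A where "A = norm (dedekind_eta (of_nat \<delta> * \<tau>)) ^ 24"
      have "norm (dedekind_eta (of_nat \<delta> * \<tau>) powi r) ^ 24 = A powi r"
        unfolding A_def norm_power_int by (simp add: power_int_power power_int_power' mult.commute)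
      moreover have "eta_height (of_nat \<delta> * \<tau>) powi r = A powi r * ((real \<delta> ^ 6) powi r * (Im \<tau> ^ 6) powi r)"
        by (simp add: eta_height_def A_def power_mult_distrib powi_mult_distrib)
      moreover have "(real \<delta> ^ 6) powi (- r) * (real \<delta> ^ 6) powi r = 1"
        using \<delta> by (subst power_int_add[symmetric]) auto
      ultimately show ?thesis by (simp add: mult_ac)
    qed
    have i: "(Im \<tau> ^ 6) powi (r + n) = (Im \<tau> ^ 6) powi r * (Im \<tau> ^ 6) powi n" for n
      using assms(1) by (subst power_int_add) auto
    define X where "X = (\<Prod>(\<delta>, r)\<leftarrow>rs. dedekind_eta (of_nat \<delta> * \<tau>) powi r)"
    define Y where "Y = (\<Prod>(\<delta>, r)\<leftarrow>rs. (real \<delta> ^ 6) powi (- r))"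
    define Z where "Z = (\<Prod>(\<delta>, r)\<leftarrow>rs. eta_height (of_nat \<delta> * \<tau>) powi r)"
    have IH: "norm X ^ 24 * (Im \<tau> ^ 6) powi (\<Sum>(\<delta>, r)\<leftarrow>rs. r) = Y * Z"
      using Cons unfolding X_def Y_def Z_def by simp
    have "norm (dedekind_eta (of_nat \<delta> * \<tau>) powi r * X) ^ 24 * (Im \<tau> ^ 6) powi (r + (\<Sum>(\<delta>, r)\<leftarrow>rs. r)) =
        (norm (dedekind_eta (of_nat \<delta> * \<tau>) powi r) ^ 24 * (Im \<tau> ^ 6) powi r) *
        (norm X ^ 24 * (Im \<tau> ^ 6) powi (\<Sum>(\<delta>, r)\<leftarrow>rs. r))"
      unfolding i norm_mult power_mult_distrib by (simp only: mult_ac)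
    also have "\<dots> = ((real \<delta> ^ 6) powi (- r) * Y) * (eta_height (of_nat \<delta> * \<tau>) powi r * Z)"
      unfolding h IH by (simp only: mult_ac)
    finally show ?case unfolding X_def Y_def Z_def x by simp
  qed simp
  thus ?thesis using assms(3) by (simp add: eta_quotient_def norm_mult power_mult_distrib)
qed

lemma euler_prod_0 [simp]: "euler_prod 0 = 1"
  by (simp add: euler_prod_def)

lemma isCont_euler_prod: "norm q < 1 \<Longrightarrow> isCont euler_prod q"
  using holomorphic_on_imp_continuous_on[OF euler_prod_holomorphic]
  by (simp add: continuous_on_eq_continuous_at)

lemma tendsto_euler_prod_cusp:
  assumes "filterlim f at_top cusp" "\<And>\<tau>. f \<tau> = Im (w \<tau>)"
  shows "((\<lambda>\<tau>. euler_prod (nome (w \<tau>))) \<longlongrightarrow> 1) cusp"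
proof -
  have f: "f = (\<lambda>\<tau>. Im (w \<tau>))" using assms(2) by auto
  have "filterlim w cusp cusp"
    unfolding cusp_def filterlim_filtercomap_iff using assms(1) unfolding f by (simp add: o_def cusp_def)
  hence "filterlim (\<lambda>\<tau>. nome (w \<tau>)) (at 0) cusp" by (rule filterlim_compose[OF filterlim_nome_cusp])
  hence "((\<lambda>\<tau>. nome (w \<tau>)) \<longlongrightarrow> 0) cusp" by (auto simp: filterlim_at)
  from isCont_tendsto_compose[OF isCont_euler_prod this] show ?thesis by simp
qed

text \<open>For a triangular matrix the shift h only turns the phase of q. As the Euler product
  tends to 1, the height behaves like (g / e)^6 (Im tau)^6 exp (-2 pi (g / e) Im tau).\<close>

lemma eta_height_asymptotics:
  fixes g e h :: int
  assumes "g > 0" "e > 0"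
  shows "((\<lambda>\<tau>. eta_height ((of_int g * \<tau> + of_int h) / of_int e) powi r /
      ((Im \<tau> ^ 6) powi r * exp (- 2 * pi * (of_int r * of_int g / of_int e) * Im \<tau>))) \<longlongrightarrow>
      ((of_int g / of_int e) ^ 6) powi r) cusp"
proof -
  let ?w = "\<lambda>\<tau>. (of_int g * \<tau> + of_int h) / of_int e :: complex"
  define k where "k = (of_int g / of_int e :: real)"
  have k: "k > 0" using assms by (simp add: k_def)
  have im: "Im (?w \<tau>) = k * Im \<tau>" for \<tau>
  proof -
    have "?w \<tau> = (of_int g * \<tau> + of_int h) / of_real (of_int e)" by simp
    thus ?thesis by (simp only: Im_divide_of_real) (simp add: k_def)
  qed
  have "((\<lambda>\<tau>. euler_prod (nome (?w \<tau>))) \<longlongrightarrow> 1) cusp"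
    by (rule tendsto_euler_prod_cusp[OF _ im[symmetric]])
       (rule filterlim_tendsto_pos_mult_at_top[OF tendsto_const k filterlim_Im_cusp])
  hence "((\<lambda>\<tau>. (k ^ 6 * norm (euler_prod (nome (?w \<tau>))) ^ 24) powi r) \<longlongrightarrow> (k ^ 6 * norm (1::complex) ^ 24) powi r) cusp"
    using k by (intro tendsto_intros) auto
  moreover have "eventually (\<lambda>\<tau>. (k ^ 6 * norm (euler_prod (nome (?w \<tau>))) ^ 24) powi r =
    eta_height (?w \<tau>) powi r / ((Im \<tau> ^ 6) powi r * exp (- 2 * pi * (of_int r * of_int g / of_int e) * Im \<tau>))) cusp"
    using eventually_cusp_Im_gt[of 0]
  proof eventually_elim
    case (elim \<tau>)
    have "exp (- 2 * pi * (of_int r * of_int g / of_int e) * Im \<tau>) = exp (- 2 * pi * Im (?w \<tau>)) powi r"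
      unfolding im exp_power_int by (simp add: k_def mult_ac)
    moreover have "norm (dedekind_eta (?w \<tau>)) ^ 24 = exp (- 2 * pi * Im (?w \<tau>)) * norm (euler_prod (nome (?w \<tau>))) ^ 24"
      using arg_cong[OF dedekind_eta_24[of "?w \<tau>"], of norm] unfolding norm_mult norm_power norm_nome .
    ultimately have "eta_height (?w \<tau>) powi r = (k ^ 6 * norm (euler_prod (nome (?w \<tau>))) ^ 24) powi r *
        ((Im \<tau> ^ 6) powi r * exp (- 2 * pi * (of_int r * of_int g / of_int e) * Im \<tau>))"
      unfolding eta_height_def im by (simp only: powi_mult_distrib power_mult_distrib mult_ac)
    moreover have "(Im \<tau> ^ 6) powi r * exp (- 2 * pi * (of_int r * of_int g / of_int e) * Im \<tau>) \<noteq> 0"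
      using elim by simp
    ultimately show ?case by (metis nonzero_mult_div_cancel_right)
  qed
  ultimately show ?thesis unfolding k_def[symmetric] by (simp add: tendsto_cong)
qed

text \<open>Each dilated factor is brought to triangular form and the asymptotics are multiplied.
  The factors (Im tau)^6 disappear because the total weight is 0; a pure exponential remains as
  bound for the 24th power of |t|.\<close>

lemma eta_quotient_bigo_cusp:
  assumes det: "a * d - b * c = 1" and rs: "\<forall>(\<delta>, r)\<in>set rs. \<delta> > 0" "(\<Sum>(\<delta>, r)\<leftarrow>rs. r) = 0"
  shows "order_ge (\<lambda>\<tau>. eta_quotient \<kappa> rs (mob a b c d \<tau>)) (cusp_order c rs)"
proof -
  let ?g = "\<lambda>\<delta>::nat. gcd c (int \<delta>)" and ?e = "\<lambda>\<delta>::nat. int \<delta> div gcd c (int \<delta>)"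
  define hq where "hq = (\<lambda>rs \<tau>. \<Prod>(\<delta>, r)\<leftarrow>rs. eta_height (of_nat \<delta> * mob a b c d \<tau>) powi r)"
  define s where "s = (\<lambda>rs. \<Sum>(\<delta>, r)\<leftarrow>rs. real_of_int r * of_int (?g \<delta>) / of_int (?e \<delta>))"
  define C where "C = norm \<kappa> ^ 24 * (\<Prod>(\<delta>, r)\<leftarrow>rs. (real \<delta> ^ 6) powi (- r))"
  have "\<exists>L. ((\<lambda>\<tau>. hq rs \<tau> / ((Im \<tau> ^ 6) powi (\<Sum>(\<delta>, r)\<leftarrow>rs. r) * exp (- 2 * pi * s rs * Im \<tau>))) \<longlongrightarrow> L) cusp"
    using rs(1)
  proof (induction rs)
    case Nil
    show ?case by (auto simp: hq_def s_def intro!: exI[of _ 1])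
  next
    case (Cons x rs)
    obtain \<delta> r where x: "x = (\<delta>, r)" by (cases x)
    have \<delta>: "\<delta> > 0" using Cons.prems x by auto
    from Cons obtain L where L:
      "((\<lambda>\<tau>. hq rs \<tau> / ((Im \<tau> ^ 6) powi (\<Sum>(\<delta>, r)\<leftarrow>rs. r) * exp (- 2 * pi * s rs * Im \<tau>))) \<longlongrightarrow> L) cusp"
      by auto
    obtain h where h: "\<And>\<tau>. Im \<tau> > 0 \<Longrightarrow> eta_height (of_nat \<delta> * mob a b c d \<tau>) =
        eta_height ((of_int (?g \<delta>) * \<tau> + of_int h) / of_int (?e \<delta>))"
      using eta_height_dilate_mob[OF det \<delta>] by blast
    have ge: "?g \<delta> > 0" "?e \<delta> > 0" using \<delta>
      by (auto simp: pos_imp_zdiv_pos_iff zdvd_imp_le)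
    define t where "t = real_of_int r * of_int (?g \<delta>) / of_int (?e \<delta>)"
    define n where "n = (\<Sum>(\<delta>, r)\<leftarrow>rs. r)"
    have "((\<lambda>\<tau>. eta_height ((of_int (?g \<delta>) * \<tau> + of_int h) / of_int (?e \<delta>)) powi r /
      ((Im \<tau> ^ 6) powi r * exp (- 2 * pi * t * Im \<tau>)) *
      (hq rs \<tau> / ((Im \<tau> ^ 6) powi n * exp (- 2 * pi * s rs * Im \<tau>)))) \<longlongrightarrow>
      ((of_int (?g \<delta>) / of_int (?e \<delta>)) ^ 6) powi r * L) cusp"
      unfolding t_def n_def by (intro tendsto_mult eta_height_asymptotics ge L)
    moreover have "eventually (\<lambda>\<tau>. eta_height ((of_int (?g \<delta>) * \<tau> + of_int h) / of_int (?e \<delta>)) powi r /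
      ((Im \<tau> ^ 6) powi r * exp (- 2 * pi * t * Im \<tau>)) *
      (hq rs \<tau> / ((Im \<tau> ^ 6) powi n * exp (- 2 * pi * s rs * Im \<tau>))) =
      hq (x # rs) \<tau> / ((Im \<tau> ^ 6) powi (\<Sum>(\<delta>, r)\<leftarrow>x # rs. r) * exp (- 2 * pi * s (x # rs) * Im \<tau>))) cusp"
      using eventually_cusp_Im_gt[of 0]
    proof eventually_elim
      case (elim \<tau>)
      have "(Im \<tau> ^ 6) powi (r + n) = (Im \<tau> ^ 6) powi r * (Im \<tau> ^ 6) powi n"
        using elim by (subst power_int_add) auto
      moreover have "exp (- 2 * pi * (t + s rs) * Im \<tau>) = exp (- 2 * pi * t * Im \<tau>) * exp (- 2 * pi * s rs * Im \<tau>)"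
        by (simp only: exp_add[symmetric] ring_distribs)
      moreover have "s (x # rs) = t + s rs" "(\<Sum>(\<delta>, r)\<leftarrow>x # rs. r) = r + n"
        by (simp_all add: s_def t_def n_def x)
      moreover have "hq (x # rs) \<tau> = eta_height ((of_int (?g \<delta>) * \<tau> + of_int h) / of_int (?e \<delta>)) powi r * hq rs \<tau>"
        unfolding h[OF elim, symmetric] by (simp add: hq_def x)
      ultimately show ?case by (simp only: times_divide_times_eq mult_ac)
    qed
    ultimately show ?case by (auto simp: tendsto_cong)
  qed
  then obtain L where L: "((\<lambda>\<tau>. hq rs \<tau> / exp (- 2 * pi * s rs * Im \<tau>)) \<longlongrightarrow> L) cusp"
    using rs(2) by auto
  have s: "s rs = 24 * cusp_order c rs" by (simp add: s_def cusp_order_def)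
  have "eventually (\<lambda>\<tau>. hq rs \<tau> / exp (- 2 * pi * s rs * Im \<tau>) < \<bar>L\<bar> + 1) cusp"
    by (rule order_tendstoD(2)[OF L]) simp
  hence "eventually (\<lambda>\<tau>. norm (eta_quotient \<kappa> rs (mob a b c d \<tau>)) \<le>
      root 24 (C * (\<bar>L\<bar> + 1)) * norm (exp (- 2 * pi * cusp_order c rs * Im \<tau>))) cusp"
    using eventually_cusp_Im_gt[of 0]
  proof eventually_elim
    case (elim \<tau>)
    have C: "C \<ge> 0" unfolding C_def using rs(1)
      by (intro mult_nonneg_nonneg prod_list_nonneg) auto
    define E where "E = exp (- 2 * pi * cusp_order c rs * Im \<tau>)"
    have "exp (- 2 * pi * s rs * Im \<tau>) = exp (24 * (- 2 * pi * cusp_order c rs * Im \<tau>))" by (simp add: s)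
    also have "\<dots> = E ^ 24" unfolding E_def by (subst exp_of_nat_mult[symmetric]) simp
    finally have e: "exp (- 2 * pi * s rs * Im \<tau>) = E ^ 24" .
    have "norm (eta_quotient \<kappa> rs (mob a b c d \<tau>)) ^ 24 = C * hq rs \<tau>"
      unfolding C_def hq_def by (rule norm_eta_quotient[OF Im_mob_pos[OF det elim(2)] rs])
    also have "\<dots> \<le> C * ((\<bar>L\<bar> + 1) * E ^ 24)"
      using elim(1) C unfolding e by (intro mult_left_mono) (simp_all add: divide_less_eq E_def)
    also have "\<dots> = (root 24 (C * (\<bar>L\<bar> + 1)) * E) ^ 24"
      using C by (simp add: power_mult_distrib)
    \<comment> \<open>The rule compares powers with an exponent of the form \<open>Suc n\<close>,
      hence the 23 for the 24th power.\<close>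
    finally have "norm (eta_quotient \<kappa> rs (mob a b c d \<tau>)) \<le> root 24 (C * (\<bar>L\<bar> + 1)) * E"
      by (rule power_le_imp_le_base[of _ 23, unfolded Suc_numeral, simplified]) (use C in \<open>simp add: E_def\<close>)
    thus ?case by (simp add: E_def)
  qed
  thus ?thesis unfolding order_ge_def by (intro bigoI[of _ "root 24 (C * (\<bar>L\<bar> + 1))"]) simp
qed

section \<open>The behaviour of j and of a Hauptmodul at infinity\<close>

definition sigma3 :: "nat \<Rightarrow> complex" where
  "sigma3 n = (\<Sum>d | d dvd n. of_nat d ^ 3)"

lemma eisenstein_E4_order_ge:
  "order_ge (\<lambda>\<tau>. eisenstein_E4 \<tau> - (1 + 240 * nome \<tau> * (\<Sum>n<K. sigma3 (Suc n) * nome \<tau> ^ n))) (real (Suc K))"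
proof -
  have s: "summable (\<lambda>n. sigma3 (Suc n) * nome \<tau> ^ n)" if "Im \<tau> > 0" for \<tau>
  proof -
    have "summable (\<lambda>n. sigma3 (Suc n) * nome \<tau> ^ Suc n * (1 / nome \<tau>))"
      using sums_summable[OF has_sum_imp_sums[OF eisenstein_E4_has_sum[OF that]]]
      unfolding sigma3_def by (rule summable_mult2)
    thus ?thesis by simp
  qed
  have "order_ge (\<lambda>\<tau>. (240 * nome \<tau>) * ((\<Sum>n. sigma3 (Suc n) * nome \<tau> ^ n) - (\<Sum>n<K. sigma3 (Suc n) * nome \<tau> ^ n)))
      (0 + 1 + real K)"
    by (intro order_ge_mult order_ge_const order_ge_nome powser_order_ge[OF s[of \<i>]]) auto
  hence "order_ge (\<lambda>\<tau>. (240 * nome \<tau>) * ((\<Sum>n. sigma3 (Suc n) * nome \<tau> ^ n) - (\<Sum>n<K. sigma3 (Suc n) * nome \<tau> ^ n)))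
      (real (Suc K))" by simp
  moreover have "eventually (\<lambda>\<tau>. (240 * nome \<tau>) * ((\<Sum>n. sigma3 (Suc n) * nome \<tau> ^ n) - (\<Sum>n<K. sigma3 (Suc n) * nome \<tau> ^ n))
     = eisenstein_E4 \<tau> - (1 + 240 * nome \<tau> * (\<Sum>n<K. sigma3 (Suc n) * nome \<tau> ^ n))) cusp"
    using eventually_cusp_Im_gt[of 0]
  proof eventually_elim
    case (elim \<tau>)
    have "eisenstein_E4 \<tau> = 1 + 240 * (\<Sum>n. nome \<tau> * (sigma3 (Suc n) * nome \<tau> ^ n))"
      unfolding eisenstein_E4_def sigma3_def by (simp add: mult_ac)
    also have "\<dots> = 1 + 240 * nome \<tau> * (\<Sum>n. sigma3 (Suc n) * nome \<tau> ^ n)"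
      unfolding suminf_mult[OF s[OF elim]] by simp
    finally show ?case by (simp add: right_diff_distrib)
  qed
  ultimately show ?thesis by (rule order_ge_cong)
qed

lemma tendsto_eisenstein_E4_cusp: "(eisenstein_E4 \<longlongrightarrow> 1) cusp"
  using order_ge_imp_tendsto_0[OF eisenstein_E4_order_ge[of 0]]
  by (simp add: LIM_zero_iff)

lemma tendsto_nome_klein_j_cusp: "((\<lambda>\<tau>. nome \<tau> * klein_j \<tau>) \<longlongrightarrow> 1) cusp"
proof -
  have "((\<lambda>\<tau>. euler_prod (nome \<tau>)) \<longlongrightarrow> 1) cusp"
    by (rule tendsto_euler_prod_cusp[OF filterlim_Im_cusp]) simp
  hence "((\<lambda>\<tau>. eisenstein_E4 \<tau> ^ 3 / euler_prod (nome \<tau>) ^ 24) \<longlongrightarrow> 1 ^ 3 / 1 ^ 24) cusp"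
    by (intro tendsto_intros tendsto_eisenstein_E4_cusp) auto
  thus ?thesis by (simp add: klein_j_def dedekind_eta_24)
qed

lemma klein_j_order_ge: "order_ge klein_j (-1)"
proof -
  have "order_ge (\<lambda>\<tau>. inverse (nome \<tau>)) (-1)"
    by (rule order_geI[of _ 1]) (simp add: norm_inverse norm_nome exp_minus[symmetric])
  from order_ge_mult[OF this order_ge_tendsto[OF tendsto_nome_klein_j_cusp]]
  have "order_ge (\<lambda>\<tau>. inverse (nome \<tau>) * (nome \<tau> * klein_j \<tau>)) (-1)" by simp
  thus ?thesis by (simp add: mult.assoc[symmetric])
qed

text \<open>\<open>weight\<close> makes the eta quotient a function of weight 0.
  \<open>order\<close> makes the fractional powers of q combine to q itself, so that t =
  \<open>\<kappa>\<close> q + ... has a simple zero at infinity.\<close>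

locale eta_hauptmodul =
  fixes N :: nat and \<kappa> :: complex and rs :: "(nat \<times> int) list"
  assumes N: "N > 0" and \<kappa>: "\<kappa> \<noteq> 0"
    and dvd: "\<forall>(\<delta>, r)\<in>set rs. \<delta> > 0 \<and> \<delta> dvd N"
    and weight: "(\<Sum>(\<delta>, r)\<leftarrow>rs. r) = 0"
    and order: "(\<Sum>(\<delta>, r)\<leftarrow>rs. int \<delta> * r) = 24"
begin

abbreviation t where "t \<equiv> eta_quotient \<kappa> rs"

lemma rs_pos: "\<forall>(\<delta>, r)\<in>set rs. \<delta> > 0"
  using dvd by auto

definition unit_part :: "complex \<Rightarrow> complex" where
  "unit_part q = \<kappa> * (\<Prod>(\<delta>, r)\<leftarrow>rs. euler_prod (q ^ \<delta>) powi r)"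

lemma t_conv_unit_part: "t \<tau> = nome \<tau> * unit_part (nome \<tau>)"
proof -
  have step: "(\<Prod>(\<delta>, r)\<leftarrow>rs. dedekind_eta (of_nat \<delta> * \<tau>) powi r) =
     exp (of_int (\<Sum>(\<delta>, r)\<leftarrow>rs. int \<delta> * r) * (2 * of_real pi * \<i> * \<tau> / 24)) *
     (\<Prod>(\<delta>, r)\<leftarrow>rs. euler_prod (nome \<tau> ^ \<delta>) powi r)"
  proof (induction rs)
    case (Cons x rs)
    obtain \<delta> r where x: "x = (\<delta>, r)" by (cases x)
    have "exp (2 * of_real pi * \<i> * (of_nat \<delta> * \<tau>) / 24) powi r =
        exp (of_int (int \<delta> * r) * (2 * of_real pi * \<i> * \<tau> / 24))"
      unfolding exp_power_int by (rule arg_cong[of _ _ exp]) simp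
    hence "dedekind_eta (of_nat \<delta> * \<tau>) powi r =
        exp (of_int (int \<delta> * r) * (2 * of_real pi * \<i> * \<tau> / 24)) * euler_prod (nome \<tau> ^ \<delta>) powi r"
      unfolding dedekind_eta_conv_euler_prod nome_of_nat_mult powi_mult_distrib by simp
    moreover have "exp (of_int (int \<delta> * r + n) * (2 * of_real pi * \<i> * \<tau> / 24)) =
        exp (of_int (int \<delta> * r) * (2 * of_real pi * \<i> * \<tau> / 24)) * exp (of_int n * (2 * of_real pi * \<i> * \<tau> / 24))" for n
      by (simp only: exp_add[symmetric] of_int_add distrib_right)
    ultimately show ?case using Cons.IH by (simp add: x mult_ac)
  qed simp
  have "exp (of_int 24 * (2 * of_real pi * \<i> * \<tau> / 24)) = nome \<tau>" by (simp add: nome_def mult_ac)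
  with step have "(\<Prod>(\<delta>, r)\<leftarrow>rs. dedekind_eta (of_nat \<delta> * \<tau>) powi r) =
      nome \<tau> * (\<Prod>(\<delta>, r)\<leftarrow>rs. euler_prod (nome \<tau> ^ \<delta>) powi r)" by (simp only: order)
  thus ?thesis by (simp only: eta_quotient_def unit_part_def mult.left_commute)
qed

lemma tendsto_unit_part: "((\<lambda>\<tau>. unit_part (nome \<tau>)) \<longlongrightarrow> \<kappa>) cusp"
proof -
  have "((\<lambda>\<tau>. \<Prod>(\<delta>, r)\<leftarrow>rs. euler_prod (nome \<tau> ^ \<delta>) powi r) \<longlongrightarrow> 1) cusp"
    using rs_pos
  proof (induction rs)
    case (Cons x rs)
    obtain \<delta> r where x: "x = (\<delta>, r)" by (cases x)
    have "((\<lambda>\<tau>. euler_prod (nome (of_nat \<delta> * \<tau>))) \<longlongrightarrow> 1) cusp"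
    proof (rule tendsto_euler_prod_cusp)
      show "filterlim (\<lambda>\<tau>. real \<delta> * Im \<tau>) at_top cusp"
        by (rule filterlim_tendsto_pos_mult_at_top[OF tendsto_const _ filterlim_Im_cusp])
           (use Cons.prems x in auto)
    qed simp
    hence "((\<lambda>\<tau>. euler_prod (nome \<tau> ^ \<delta>) powi r * (\<Prod>(\<delta>, r)\<leftarrow>rs. euler_prod (nome \<tau> ^ \<delta>) powi r)) \<longlongrightarrow> 1 powi r * 1) cusp"
      using Cons unfolding nome_of_nat_mult by (intro tendsto_intros) auto
    thus ?case by (simp add: x)
  qed simp
  from tendsto_mult[OF tendsto_const[of \<kappa>] this] show ?thesis by (simp add: unit_part_def)
qed

lemma tendsto_t: "(t \<longlongrightarrow> 0) cusp"
proof -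
  have "(nome \<longlongrightarrow> 0) cusp" using filterlim_nome_cusp by (auto simp: filterlim_at)
  from tendsto_mult[OF this tendsto_unit_part] show ?thesis by (simp add: t_conv_unit_part[abs_def])
qed

lemma tendsto_klein_j_t: "((\<lambda>\<tau>. klein_j \<tau> * t \<tau>) \<longlongrightarrow> \<kappa>) cusp"
  using tendsto_mult[OF tendsto_nome_klein_j_cusp tendsto_unit_part] by (simp add: t_conv_unit_part mult_ac)

lemma t_nonzero:
  assumes "Im \<tau> > 0"
  shows "t \<tau> \<noteq> 0"
proof -
  have "(\<Prod>(\<delta>, r)\<leftarrow>rs. dedekind_eta (of_nat \<delta> * \<tau>) powi r) \<noteq> 0"
    using rs_pos assms by (induction rs) (auto simp: dedekind_eta_nonzero)
  thus ?thesis using \<kappa> by (simp add: eta_quotient_def)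
qed

lemma t_holomorphic: "t holomorphic_on {\<tau>. Im \<tau> > 0}"
proof -
  have "(\<lambda>\<tau>. \<Prod>(\<delta>, r)\<leftarrow>rs. dedekind_eta (of_nat \<delta> * \<tau>) powi r) holomorphic_on {\<tau>. Im \<tau> > 0}"
    using rs_pos
  proof (induction rs)
    case (Cons x rs)
    obtain \<delta> r where x: "x = (\<delta>, r)" by (cases x)
    have "(dedekind_eta \<circ> (\<lambda>\<tau>. of_nat \<delta> * \<tau>)) holomorphic_on {\<tau>. Im \<tau> > 0}"
      by (rule holomorphic_on_compose_gen[OF _ dedekind_eta_holomorphic])
         (use Cons.prems x in \<open>auto intro!: holomorphic_intros\<close>)
    hence "(\<lambda>\<tau>. dedekind_eta (of_nat \<delta> * \<tau>)) holomorphic_on {\<tau>. Im \<tau> > 0}" by (simp add: o_def)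
    hence "(\<lambda>\<tau>. dedekind_eta (of_nat \<delta> * \<tau>) powi r * (\<Prod>(\<delta>, r)\<leftarrow>rs. dedekind_eta (of_nat \<delta> * \<tau>) powi r)) holomorphic_on {\<tau>. Im \<tau> > 0}"
      using Cons x by (intro holomorphic_intros) (auto simp: dedekind_eta_nonzero)
    thus ?case by (simp add: x)
  qed auto
  thus ?thesis unfolding eta_quotient_def by (intro holomorphic_intros)
qed

text \<open>When N divides c, every \<open>\<delta>\<close> divides c, so the triangular form of the
  dilated matrix is a translation of \<open>\<delta>\<close> tau, which preserves the height. The
  phase of t is settled later by means of j.\<close>

lemma norm_t_mob:
  assumes det: "a * d - b * c = 1" and im: "Im \<tau> > 0" and c: "int N dvd c"
  shows "norm (t (mob a b c d \<tau>)) = norm (t \<tau>)"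
proof -
  have h: "eta_height (of_nat \<delta> * mob a b c d \<tau>) = eta_height (of_nat \<delta> * \<tau>)" if "(\<delta>, r) \<in> set rs" for \<delta> r
  proof -
    have \<delta>: "\<delta> > 0" "\<delta> dvd N" using dvd that by auto
    hence "int \<delta> dvd c" using c by (meson dvd_trans of_nat_dvd_iff)
    hence g: "gcd c (int \<delta>) = int \<delta>" by (simp add: gcd_proj2_iff)
    obtain h where "eta_height (of_nat \<delta> * mob a b c d \<tau>) =
        eta_height ((of_int (gcd c (int \<delta>)) * \<tau> + of_int h) / of_int (int \<delta> div gcd c (int \<delta>)))"
      using eta_height_dilate_mob[OF det \<delta>(1)] im by metis
    also have "(of_int (gcd c (int \<delta>)) * \<tau> + of_int h) / of_int (int \<delta> div gcd c (int \<delta>)) =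
        mob 1 h 0 1 (of_nat \<delta> * \<tau>)"
      unfolding g using \<delta> by (simp add: mob_def)
    also have "eta_height \<dots> = eta_height (of_nat \<delta> * \<tau>)"
      by (rule eta_height_mob) (use im \<delta> in auto)
    finally show ?thesis .
  qed
  have "map (\<lambda>(\<delta>, r). eta_height (of_nat \<delta> * mob a b c d \<tau>) powi r) rs =
      map (\<lambda>(\<delta>, r). eta_height (of_nat \<delta> * \<tau>) powi r) rs"
    using h by (intro map_cong) auto
  hence "norm (t (mob a b c d \<tau>)) ^ 24 = norm (t \<tau>) ^ 24"
    unfolding norm_eta_quotient[OF Im_mob_pos[OF det im] rs_pos weight] norm_eta_quotient[OF im rs_pos weight]
    by (simp only:)
  thus ?thesis by (rule power_eq_imp_eq_base) auto
qed

end

lemma filterlim_mob_shift: "((\<lambda>\<tau>. f (\<tau> :: complex)) \<longlongrightarrow> L) cusp \<Longrightarrow> (\<And>\<tau>. Im \<tau> > 0 \<Longrightarrow> g \<tau> = f \<tau>) \<Longrightarrow> (g \<longlongrightarrow> L) cusp"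
  by (rule Lim_transform_eventually[of f]) (use eventually_cusp_Im_gt[of 0] in \<open>auto elim: eventually_mono\<close>)

section \<open>Invariance under Gamma_0(N) and the relation between t and j\<close>

locale eta_hauptmodul_j = eta_hauptmodul +
  fixes P Q :: "complex poly"
  assumes coprime: "coprime P Q"
    and Q_nonzero: "\<And>\<tau>. Im \<tau> > 0 \<Longrightarrow> poly Q (t \<tau>) \<noteq> 0"
    and klein_j_eq: "\<And>\<tau>. Im \<tau> > 0 \<Longrightarrow> klein_j \<tau> = poly P (t \<tau>) / poly Q (t \<tau>)"
begin

text \<open>The rational function \<open>P/Q\<close> has a simple pole at \<open>0\<close>, because \<open>j t \<rightarrow> \<kappa>\<close> at the cusp.\<close>

lemma pole_at_0:
  obtains Q1 where "Q = pCons 0 Q1" "poly P 0 = \<kappa> * poly Q1 0" "poly Q1 0 \<noteq> 0"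
proof -
  have tend: "((\<lambda>\<tau>. poly p (t \<tau>)) \<longlongrightarrow> poly p 0) cusp" for p
    by (rule isCont_tendsto_compose[OF poly_isCont tendsto_t])
  have Q0: "poly Q 0 = 0"
  proof (rule ccontr)
    assume nz: "poly Q 0 \<noteq> 0"
    have "((\<lambda>\<tau>. poly P (t \<tau>) / poly Q (t \<tau>) * t \<tau>) \<longlongrightarrow> poly P 0 / poly Q 0 * 0) cusp"
      by (intro tendsto_intros tend nz tendsto_t)
    hence "((\<lambda>\<tau>. klein_j \<tau> * t \<tau>) \<longlongrightarrow> poly P 0 / poly Q 0 * 0) cusp"
      by (rule filterlim_mob_shift) (simp add: klein_j_eq)
    hence "((\<lambda>\<tau>. klein_j \<tau> * t \<tau>) \<longlongrightarrow> 0) cusp" by simp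
    thus False using tendsto_unique[OF cusp_neq_bot tendsto_klein_j_t] \<kappa> by blast
  qed
  then obtain Q1 where Q1: "Q = pCons 0 Q1" by (cases Q) auto
  have P0: "poly P 0 \<noteq> 0"
  proof
    assume "poly P 0 = 0"
    hence "[:0, 1:] dvd P" "[:0, 1:] dvd Q" using Q0 by (simp_all add: poly_eq_0_iff_dvd)
    hence "is_unit [:0, 1 :: complex:]" using coprime by (meson coprime_common_divisor)
    thus False by (simp add: is_unit_pCons_iff)
  qed
  have "((\<lambda>\<tau>. klein_j \<tau> * t \<tau> * poly Q1 (t \<tau>)) \<longlongrightarrow> \<kappa> * poly Q1 0) cusp"
    by (intro tendsto_mult tendsto_klein_j_t tend)
  moreover have "((\<lambda>\<tau>. klein_j \<tau> * t \<tau> * poly Q1 (t \<tau>)) \<longlongrightarrow> poly P 0) cusp"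
  proof (rule filterlim_mob_shift[OF tend[of P]])
    fix \<tau> assume im: "Im \<tau> > 0"
    show "klein_j \<tau> * t \<tau> * poly Q1 (t \<tau>) = poly P (t \<tau>)"
      using klein_j_eq[OF im] Q_nonzero[OF im] by (simp add: Q1)
  qed
  ultimately have "poly P 0 = \<kappa> * poly Q1 0" using tendsto_unique[OF cusp_neq_bot] by blast
  thus ?thesis using that Q1 P0 by auto
qed

text \<open>The quotient of the two sides is holomorphic of modulus 1, hence a constant
  \<open>\<zeta>\<close>. Invariance of j gives P(\<open>\<zeta>\<close> t) /
  Q(\<open>\<zeta>\<close> t) = P(t) / Q(t), and the residues at the simple pole 0 agree only if
  \<open>\<zeta>\<close> = 1.\<close>

lemma t_mob:
  assumes det: "a * d - b * c = 1" and c: "int N dvd c" and im: "Im \<tau> > 0"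
  shows "t (mob a b c d \<tau>) = t \<tau>"
proof -
  let ?H = "{\<tau>. Im \<tau> > 0}"
  define f where "f = (\<lambda>\<tau>. t (mob a b c d \<tau>) / t \<tau>)"
  have "(t \<circ> mob a b c d) holomorphic_on ?H"
    by (rule holomorphic_on_compose_gen[OF mob_holomorphic[OF det] t_holomorphic]) (use Im_mob_pos[OF det] in auto)
  hence "f holomorphic_on ?H" unfolding f_def o_def
    by (intro holomorphic_intros t_holomorphic) (auto simp: t_nonzero)
  hence "f constant_on ?H"
  proof (rule maximum_modulus_principle[where \<xi> = \<tau> and U = ?H])
    show "connected ?H" by (intro convex_connected convex_halfspace_Im_gt)
    show "norm (f z) \<le> norm (f \<tau>)" if "z \<in> ?H" for z
      using that norm_t_mob[OF det _ c, of z] norm_t_mob[OF det im c] t_nonzero[of z] t_nonzero[OF im]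
      by (simp add: f_def norm_divide)
  qed (use open_uhp im in auto)
  then obtain \<zeta> where "\<And>z. Im z > 0 \<Longrightarrow> f z = \<zeta>" by (auto simp: constant_on_def)
  hence \<zeta>: "t (mob a b c d z) = \<zeta> * t z" if "Im z > 0" for z
    using that t_nonzero[OF that] unfolding f_def by (metis nonzero_eq_divide_eq)
  obtain Q1 where Q1: "Q = pCons 0 Q1" "poly P 0 = \<kappa> * poly Q1 0" "poly Q1 0 \<noteq> 0" using pole_at_0 .
  have tend: "((\<lambda>\<tau>. poly p (\<zeta> * t \<tau>)) \<longlongrightarrow> poly p 0) cusp" for p
  proof -
    have "((\<lambda>\<tau>. \<zeta> * t \<tau>) \<longlongrightarrow> \<zeta> * 0) cusp" by (intro tendsto_intros tendsto_t)
    from isCont_tendsto_compose[OF poly_isCont this, of p] show ?thesis by simp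
  qed
  \<comment> \<open>The limit at infinity of \<open>\<zeta>\<close> j t times
    Q1(\<open>\<zeta>\<close> t) is computed twice: from j t -> \<open>\<kappa>\<close>, and from
    the relation transported by the matrix.\<close>
  have "((\<lambda>\<tau>. \<zeta> * (klein_j \<tau> * t \<tau>) * poly Q1 (\<zeta> * t \<tau>)) \<longlongrightarrow> \<zeta> * \<kappa> * poly Q1 0) cusp"
    by (intro tendsto_mult tendsto_const tendsto_klein_j_t tend)
  moreover have "((\<lambda>\<tau>. \<zeta> * (klein_j \<tau> * t \<tau>) * poly Q1 (\<zeta> * t \<tau>)) \<longlongrightarrow> poly P 0) cusp"
  proof (rule filterlim_mob_shift[OF tend[of P]])
    fix z assume im: "Im z > 0"
    have im': "Im (mob a b c d z) > 0" by (rule Im_mob_pos[OF det im])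
    show "\<zeta> * (klein_j z * t z) * poly Q1 (\<zeta> * t z) = poly P (\<zeta> * t z)"
      using klein_j_eq[OF im'] Q_nonzero[OF im'] klein_j_mob[OF det im]
      by (simp add: Q1(1) \<zeta>[OF im] mult_ac)
  qed
  ultimately have "\<zeta> * \<kappa> * poly Q1 0 = poly P 0" using tendsto_unique[OF cusp_neq_bot] by blast
  hence "\<zeta> = 1" using Q1 \<kappa> by simp
  thus ?thesis using \<zeta>[OF im] by simp
qed

text \<open>The quotient of the two matrices has lower left entry c' d - d' c. If N divides it, the
  quotient lies in Gamma_0(N); thus F depends only on the bottom row as a point of the projective
  line over Z/N.\<close>

lemma relation_equiv:
  assumes F: "\<And>\<tau>. F \<tau> = poly Pn (t \<tau>) - klein_j \<tau> * poly Qn (t \<tau>)"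
    and det: "a * d - b * c = 1" "a' * d' - b' * c' = 1" and c: "int N dvd c * d' - c' * d" and im: "Im \<tau> > 0"
  shows "F (mob a b c d \<tau>) = F (mob a' b' c' d' \<tau>)"
proof -
  let ?z = "mob a b c d \<tau>"
  have im': "Im ?z > 0" by (rule Im_mob_pos[OF det(1) im])
  have det': "(a' * d - b' * c) * (d' * a - c' * b) - (b' * a - a' * b) * (c' * d - d' * c) = 1"
    using det by algebra
  have c': "int N dvd c' * d - d' * c" using c by (metis dvd_minus_iff minus_diff_eq mult.commute)
  have eqs: "(a' * d - b' * c) * a + (b' * a - a' * b) * c = a'" "(a' * d - b' * c) * b + (b' * a - a' * b) * d = b'"
      "(c' * d - d' * c) * a + (d' * a - c' * b) * c = c'" "(c' * d - d' * c) * b + (d' * a - c' * b) * d = d'"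
    using det(1) by algebra+
  have "mob (a' * d - b' * c) (b' * a - a' * b) (c' * d - d' * c) (d' * a - c' * b) ?z = mob a' b' c' d' \<tau>"
    unfolding mob_mob[OF det(1) im] eqs ..
  moreover have "F (mob (a' * d - b' * c) (b' * a - a' * b) (c' * d - d' * c) (d' * a - c' * b) ?z) = F ?z"
    unfolding F t_mob[OF det' c' im'] klein_j_mob[OF det' im'] ..
  ultimately show ?thesis by simp
qed

text \<open>Cosets are represented by bottom rows. The second and third condition on
  \<open>L\<close> are closure under inversion, (c, d) -> (d, -c), and under translation, (c, d) ->
  (c, c + d), tested as points of the projective line modulo N. The poles of the product are counted
  thus: each of the N rows (1, d) contributes at most dP / N, each row of \<open>L\<close> at most
  1, the pole of j, whereas F itself has a zero of order at least K at infinity. So dP + length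
  \<open>L\<close> < K leaves a zero.\<close>

theorem modular_relation:
  assumes orders: "cusp_order 1 rs \<ge> - 1 / real N" "\<forall>(c, d)\<in>set L. cusp_order c rs \<ge> 0"
    and L: "\<forall>(c, d)\<in>set L. coprime c d"
      "\<forall>(c, d)\<in>Pair 1 ` {0..<int N} \<union> set L. \<exists>(c', d')\<in>insert (0, 1) (Pair 1 ` {0..<int N} \<union> set L). int N dvd d * d' + c * c'"
      "\<forall>(c, d)\<in>set L. \<exists>(c', d')\<in>insert (0, 1) (Pair 1 ` {0..<int N} \<union> set L). int N dvd c * d' - c' * (c + d)"
    and deg: "degree Pn \<le> dP" "degree Qn \<le> dQ" "dQ + N \<le> dP"
    and F: "order_ge (\<lambda>\<tau>. poly Pn (t \<tau>) - klein_j \<tau> * poly Qn (t \<tau>)) (real K)"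
    and K: "dP + length L < K"
    and im: "Im \<tau>0 > 0"
  shows "poly Pn (t \<tau>0) = klein_j \<tau>0 * poly Qn (t \<tau>0)"
proof -
  let ?H = "{\<tau>. Im \<tau> > 0}"
  define F where "F = (\<lambda>\<tau>. poly Pn (t \<tau>) - klein_j \<tau> * poly Qn (t \<tau>))"
  define A where "A = Pair (1::int) ` {0..<int N}"
  define R where "R = insert (0, 1) (A \<union> set L)"
  \<comment> \<open>Any matrix with the given bottom row will do. The value 0 off the upper
    half-plane turns equality on it into equality of functions.\<close>
  define orb where "orb = (\<lambda>(c::int, d::int) \<tau>. if Im \<tau> > 0 then
      F (mob (fst (SOME (a, b). a * d - b * c = 1)) (snd (SOME (a, b). a * d - b * c = 1)) c d \<tau>) else 0)"
  have orb0: "\<exists>a b. a * d - b * c = 1 \<and> (\<forall>\<tau>. Im \<tau> > 0 \<longrightarrow> orb (c, d) \<tau> = F (mob a b c d \<tau>))"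
    if cd: "coprime c d" for c d
  proof -
    obtain x y where "x * c + y * d = 1" using bezout_int[of c d] cd by (auto simp: coprime_iff_gcd_eq_1)
    hence "(\<lambda>(a, b). a * d - b * c = 1) (y, - x)" by (simp add: algebra_simps)
    hence "(\<lambda>(a, b). a * d - b * c = 1) (SOME (a, b). a * d - b * c = 1)" by (rule someI)
    thus ?thesis unfolding orb_def case_prod_unfold by auto
  qed
  have R: "coprime c d" if "(c, d) \<in> R" for c d
    using that L(1) unfolding R_def A_def by auto
  have finR: "finite R" unfolding R_def A_def by simp
  have orb: "orb (c, d) \<tau> = F (mob a b c' d' \<tau>)"
    if "(c, d) \<in> R" "a * d' - b * c' = 1" "int N dvd c * d' - c' * d" "Im \<tau> > 0" for a b c d c' d' \<tau>
    using orb0[OF R[OF that(1)]] relation_equiv[of F Pn Qn, OF F_def[THEN fun_cong, unfolded] _ that(2,3,4)] that(4)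
    by metis
  have orbS: "\<exists>y\<in>R. \<forall>\<tau>. Im \<tau> > 0 \<longrightarrow> orb x (- 1 / \<tau>) = orb y \<tau>" if x: "x \<in> R" for x
  proof -
    obtain c d where cd: "x = (c, d)" by (cases x)
    obtain a b where ab: "a * d - b * c = 1" "\<And>\<tau>. Im \<tau> > 0 \<Longrightarrow> orb (c, d) \<tau> = F (mob a b c d \<tau>)"
      using orb0[OF R] x cd by blast
    have "\<exists>(c', d')\<in>R. int N dvd d * d' + c * c'"
    proof (cases "x = (0, 1)")
      case True
      have "(1, 0) \<in> R" unfolding R_def A_def using N by auto
      thus ?thesis using True cd by (intro bexI[of _ "(1, 0)"]) auto
    next
      case False
      thus ?thesis using L(2) x cd unfolding R_def A_def by blast
    qed
    then obtain c' d' where y: "(c', d') \<in> R" "int N dvd d * d' + c * c'" by auto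
    show ?thesis
    proof (intro bexI[OF _ y(1)] allI impI)
      fix \<tau> assume im: "Im \<tau> > 0"
      have "mob a b c d (- 1 / \<tau>) = mob a b c d (mob 0 (-1) 1 0 \<tau>)" by (simp add: mob_def)
      also have "\<dots> = mob b (- a) d (- c) \<tau>" by (subst mob_mob) (use im in auto)
      finally have "orb x (- 1 / \<tau>) = F (mob b (- a) d (- c) \<tau>)"
        using ab(2)[OF Im_neg_inverse[OF im]] cd by simp
      also have "\<dots> = orb (c', d') \<tau>"
      proof (rule orb[OF y(1) _ _ im, symmetric])
        show "b * - c - - a * d = 1" using ab(1) by (simp add: algebra_simps)
        have "c' * - c - d * d' = - (d * d' + c * c')" by (simp add: algebra_simps)
        thus "int N dvd c' * - c - d * d'" using y(2) by (simp only: dvd_minus_iff)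
      qed
      finally show "orb x (- 1 / \<tau>) = orb (c', d') \<tau>" .
    qed
  qed
  have orbT: "\<exists>y\<in>R. \<forall>\<tau>. Im \<tau> > 0 \<longrightarrow> orb x (\<tau> + 1) = orb y \<tau>" if x: "x \<in> R" for x
  proof -
    obtain c d where cd: "x = (c, d)" by (cases x)
    obtain a b where ab: "a * d - b * c = 1" "\<And>\<tau>. Im \<tau> > 0 \<Longrightarrow> orb (c, d) \<tau> = F (mob a b c d \<tau>)"
      using orb0[OF R] x cd by blast
    have "\<exists>(c', d')\<in>R. int N dvd c * d' - c' * (c + d)"
    proof -
      consider "x = (0, 1)" | "x \<in> A" | "x \<in> set L" using x unfolding R_def by blast
      thus ?thesis
      proof cases
        case 1
        thus ?thesis using cd unfolding R_def by (intro bexI[of _ "(0, 1)"]) auto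
      next
        \<comment> \<open>(1, d) goes to (1, d + 1), reduced modulo N; closure under translation
          therefore has to be assumed for \<open>L\<close> only.\<close>
        case 2
        hence c: "c = 1" using cd by (auto simp: A_def)
        have "(1, (1 + d) mod int N) \<in> R" unfolding R_def A_def using N by auto
        thus ?thesis using c by (intro bexI[of _ "(1, (1 + d) mod int N)"]) (auto simp: mod_eq_dvd_iff[symmetric])
      next
        case 3
        thus ?thesis using L(3) cd unfolding R_def A_def by blast
      qed
    qed
    then obtain c' d' where y: "(c', d') \<in> R" "int N dvd c * d' - c' * (c + d)" by auto
    show ?thesis
    proof (intro bexI[OF _ y(1)] allI impI)
      fix \<tau> assume im: "Im \<tau> > 0"
      have "mob a b c d (\<tau> + 1) = mob a b c d (mob 1 1 0 1 \<tau>)" by (simp add: mob_def)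
      also have "\<dots> = mob a (a + b) c (c + d) \<tau>" by (subst mob_mob) (use im in auto)
      finally have "orb x (\<tau> + 1) = F (mob a (a + b) c (c + d) \<tau>)"
        using ab(2)[of "\<tau> + 1"] im cd by simp
      also have "\<dots> = orb (c', d') \<tau>"
      proof (rule orb[OF y(1) _ _ im, symmetric])
        show "a * (c + d) - (a + b) * c = 1" using ab(1) by (simp add: algebra_simps)
        have "c' * (c + d) - c * d' = - (c * d' - c' * (c + d))" by simp
        thus "int N dvd c' * (c + d) - c * d'" using y(2) by (simp only: dvd_minus_iff)
      qed
      finally show "orb x (\<tau> + 1) = orb (c', d') \<tau>" .
    qed
  qed
  have orb_junk: "orb x \<tau> = 0" if "\<not> Im \<tau> > 0" for x \<tau>
    using that by (auto simp: orb_def case_prod_unfold)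
  \<comment> \<open>The product runs over distinct functions. On this set, precomposition with a
    generator is injective, hence a permutation, even if two rows in \<open>R\<close> belong to one
    coset.\<close>
  define O' where "O' = orb ` R"
  have finO: "finite O'" using finR by (simp add: O'_def)
  have prod_perm: "(\<Prod>f\<in>O'. f (s \<tau>)) = (\<Prod>f\<in>O'. f \<tau>)"
    if s: "\<And>x. x \<in> R \<Longrightarrow> \<exists>y\<in>R. \<forall>\<tau>. Im \<tau> > 0 \<longrightarrow> orb x (s \<tau>) = orb y \<tau>"
      "\<And>\<tau>. Im \<tau> > 0 \<Longrightarrow> \<exists>\<sigma>. Im \<sigma> > 0 \<and> s \<sigma> = \<tau>" and im: "Im \<tau> > 0" for s \<tau>
  proof -
    define act where "act = (\<lambda>f \<tau>. if Im \<tau> > 0 then f (s \<tau>) else (0::complex))"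
    have "act f \<in> O'" if "f \<in> O'" for f
    proof -
      obtain x where x: "x \<in> R" "f = orb x" using \<open>f \<in> O'\<close> by (auto simp: O'_def)
      obtain y where y: "y \<in> R" "\<And>\<tau>. Im \<tau> > 0 \<Longrightarrow> orb x (s \<tau>) = orb y \<tau>" using s(1)[OF x(1)] by blast
      have "act f \<tau> = orb y \<tau>" for \<tau>
        by (cases "Im \<tau> > 0") (simp_all add: act_def x y(2) orb_junk)
      hence "act f = orb y" by blast
      thus ?thesis using y(1) by (auto simp: O'_def)
    qed
    moreover have inj: "inj_on act O'"
    proof (rule inj_onI)
      fix f g assume fg: "f \<in> O'" "g \<in> O'" "act f = act g"
      show "f = g"
      proof
        fix \<tau>
        show "f \<tau> = g \<tau>"
        proof (cases "Im \<tau> > 0")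
          case True
          obtain \<sigma> where "Im \<sigma> > 0" "s \<sigma> = \<tau>" using s(2)[OF True] by blast
          thus ?thesis using fun_cong[OF fg(3), of \<sigma>] by (simp add: act_def)
        qed (use fg(1,2) orb_junk in \<open>auto simp: O'_def\<close>)
      qed
    qed
    ultimately have "act ` O' = O'" by (intro endo_inj_surj finO) auto
    hence "(\<Prod>f\<in>O'. f \<tau>) = (\<Prod>f\<in>act ` O'. f \<tau>)" by simp
    also have "\<dots> = (\<Prod>f\<in>O'. act f \<tau>)" using inj by (simp add: prod.reindex)
    finally show ?thesis using im by (simp add: act_def)
  qed
  have orb_holo: "orb x holomorphic_on ?H" if x: "x \<in> R" for x
  proof -
    obtain c d where cd: "x = (c, d)" by (cases x)
    obtain a b where ab: "a * d - b * c = 1" "\<And>\<tau>. Im \<tau> > 0 \<Longrightarrow> orb (c, d) \<tau> = F (mob a b c d \<tau>)"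
      using orb0[OF R] x cd by blast
    have t: "(\<lambda>\<tau>. t (mob a b c d \<tau>)) holomorphic_on ?H"
      using holomorphic_on_compose_gen[OF mob_holomorphic[OF ab(1)] t_holomorphic] Im_mob_pos[OF ab(1)]
      by (auto simp: o_def)
    have p: "(\<lambda>\<tau>. poly p (t (mob a b c d \<tau>))) holomorphic_on ?H" for p
      unfolding poly_altdef by (intro holomorphic_intros t)
    \<comment> \<open>Holomorphy of j is taken from its representation P(t) / Q(t).\<close>
    have "(\<lambda>\<tau>. poly Pn (t (mob a b c d \<tau>)) - poly P (t \<tau>) / poly Q (t \<tau>) * poly Qn (t (mob a b c d \<tau>))) holomorphic_on ?H"
      by (intro holomorphic_intros p) (auto simp: poly_altdef Q_nonzero[unfolded poly_altdef] intro!: holomorphic_intros t_holomorphic)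
    thus ?thesis
      by (rule holomorphic_transform) (use ab klein_j_mob[OF ab(1)] klein_j_eq in \<open>auto simp: cd F_def\<close>)
  qed
  define \<Psi> where "\<Psi> = (\<lambda>\<tau>. \<Prod>f\<in>O'. f \<tau>)"
  obtain U where U: "U \<subseteq> R" "inj_on orb U" "O' = orb ` U"
    using subset_image_inj[of O' orb R] unfolding O'_def by blast
  have finU: "finite U" using U finR finite_subset by blast
  have orb_base: "orb (0, 1) \<tau> = F \<tau>" if "Im \<tau> > 0" for \<tau>
    using orb[of 0 1 1 1 0 0 \<tau>] that by (simp add: R_def mob_def)
  have "orb (0, 1) \<in> O'" unfolding O'_def R_def by blast
  then obtain u0 where u0: "u0 \<in> U" "orb u0 = orb (0, 1)" unfolding U(3) by (metis imageE)
  \<comment> \<open>The bound for the pole of a factor. By \<open>dQ + N \<le> dP\<close> the value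
    dP / N also covers 1 + dQ / N, the pole of j Qn(t); on the rows of \<open>L\<close> t stays
    bounded and only j contributes.\<close>
  define w where "w = (\<lambda>x. if x \<in> A then dP / N else 1 :: real)"
  have ord0: "order_ge (orb u0) K"
    unfolding u0(2) by (rule order_ge_cong[OF F[folded F_def]])
      (use eventually_cusp_Im_gt[of 0] orb_base in \<open>auto elim!: eventually_mono\<close>)
  have ordw: "order_ge (orb x) (- w x)" if x: "x \<in> A \<union> set L" for x
  proof -
    obtain c d where cd: "x = (c, d)" by (cases x)
    obtain a b where ab: "a * d - b * c = 1" "\<And>\<tau>. Im \<tau> > 0 \<Longrightarrow> orb (c, d) \<tau> = F (mob a b c d \<tau>)"
      using orb0[OF R] x cd unfolding R_def by blast
    define m where "m = (if x \<in> A then 1 / real N else 0)"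
    have "cusp_order c rs \<ge> - m" using x orders cd unfolding m_def A_def by (auto split: if_splits)
    hence tm: "order_ge (\<lambda>\<tau>. t (mob a b c d \<tau>)) (- m)"
      by (rule order_ge_mono[OF eta_quotient_bigo_cusp[OF ab(1) rs_pos weight]])
    have m: "m \<ge> 0" by (simp add: m_def)
    have le: "m * real dP \<le> w x" "1 + m * real dQ \<le> w x"
    proof -
      have "real N + real dQ \<le> real dP" using deg(3) by linarith
      thus "m * real dP \<le> w x" "1 + m * real dQ \<le> w x" using N by (simp_all add: m_def w_def field_simps)
    qed
    have "order_ge (\<lambda>\<tau>. poly Pn (t (mob a b c d \<tau>))) (- w x)"
      by (rule order_ge_mono[OF order_ge_poly[OF tm m deg(1)]]) (use le in simp)
    moreover have "order_ge (\<lambda>\<tau>. klein_j \<tau> * poly Qn (t (mob a b c d \<tau>))) (- w x)"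
      by (rule order_ge_mono[OF order_ge_mult[OF klein_j_order_ge order_ge_poly[OF tm m deg(2)]]]) (use le in simp)
    ultimately have "order_ge (\<lambda>\<tau>. poly Pn (t (mob a b c d \<tau>)) - klein_j \<tau> * poly Qn (t (mob a b c d \<tau>))) (- w x)"
      by (rule order_ge_diff)
    thus ?thesis
      by (rule order_ge_cong)
         (use eventually_cusp_Im_gt[of 0] ab(2) klein_j_mob[OF ab(1)] in \<open>auto elim!: eventually_mono simp: cd F_def\<close>)
  qed
  have Usub: "U - {u0} \<subseteq> A \<union> set L"
  proof
    fix x assume x: "x \<in> U - {u0}"
    have "x \<noteq> (0, 1)" using x u0 U(2) by (auto dest: inj_onD)
    thus "x \<in> A \<union> set L" using x U(1) unfolding R_def by blast
  qed
  have finA: "finite A" "card A \<le> N" unfolding A_def by (auto intro: card_image_le[THEN order_trans])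
  have "(\<Sum>x\<in>U - {u0}. w x) \<le> (\<Sum>x\<in>A \<union> (set L - A). w x)"
    using Usub finA by (intro sum_mono2) (auto simp: w_def)
  also have "\<dots> = real (card A) * (dP / N) + real (card (set L - A))"
    using finA by (subst sum.union_disjoint) (auto simp: w_def)
  also have "\<dots> \<le> real N * (dP / N) + real (length L)"
    using finA card_mono[of "set L" "set L - A"] card_length[of L] by (intro add_mono mult_right_mono) auto
  also have "\<dots> = real (dP + length L)" using N by simp
  also have "\<dots> < real K" using K by linarith
  finally have wK: "(\<Sum>x\<in>U - {u0}. w x) < real K" .
  have "order_ge (\<lambda>\<tau>. orb u0 \<tau> * (\<Prod>x\<in>U - {u0}. orb x \<tau>)) (real K + (\<Sum>x\<in>U - {u0}. - w x))"
    by (intro order_ge_mult ord0 order_ge_prod) (use finU ordw Usub in auto)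
  moreover have "\<Psi> = (\<lambda>\<tau>. orb u0 \<tau> * (\<Prod>x\<in>U - {u0}. orb x \<tau>))"
    unfolding \<Psi>_def U(3) using U(2) finU u0(1) by (auto simp: prod.reindex prod.remove)
  ultimately have lim: "(\<Psi> \<longlongrightarrow> 0) cusp"
    using wK by (intro order_ge_imp_tendsto_0[of _ "real K + (\<Sum>x\<in>U - {u0}. - w x)"]) (simp_all add: sum_negf)
  have \<Psi>0: "\<Psi> \<tau> = 0" if "Im \<tau> > 0" for \<tau>
  proof (rule modular_function_vanishing_at_cusp[OF _ _ _ lim that])
    show "\<Psi> holomorphic_on ?H" unfolding \<Psi>_def
      by (intro holomorphic_intros) (auto simp: O'_def orb_holo)
    show "\<Psi> (\<tau> + 1) = \<Psi> \<tau>" if "Im \<tau> > 0" for \<tau>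
      unfolding \<Psi>_def by (rule prod_perm[of "\<lambda>\<tau>. \<tau> + 1"]) (use orbT that in \<open>auto intro: exI[of _ "_ - 1"]\<close>)
    show "\<Psi> (- 1 / \<tau>) = \<Psi> \<tau>" if "Im \<tau> > 0" for \<tau>
      unfolding \<Psi>_def
    proof (rule prod_perm[of "\<lambda>\<tau>. - 1 / \<tau>"])
      fix \<tau> assume "Im \<tau> > 0"
      thus "\<exists>\<sigma>. Im \<sigma> > 0 \<and> - 1 / \<sigma> = \<tau>" using Im_neg_inverse by (intro exI[of _ "- 1 / \<tau>"]) auto
    qed (use orbS that in auto)
  qed
  have "\<exists>f\<in>O'. \<forall>z\<in>?H. f z = 0"
  proof (rule holomorphic_prod_eq_0[OF finO])
    show "connected ?H" by (intro convex_connected convex_halfspace_Im_gt)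
    have "\<i> \<in> ?H" by simp
    thus "?H \<noteq> {}" by blast
  qed (use \<Psi>0 orb_holo open_uhp in \<open>auto simp: \<Psi>_def O'_def\<close>)
  then obtain c d where cd: "(c, d) \<in> R" "\<And>z. Im z > 0 \<Longrightarrow> orb (c, d) z = 0" by (auto simp: O'_def)
  obtain a b where ab: "a * d - b * c = 1" "\<And>\<tau>. Im \<tau> > 0 \<Longrightarrow> orb (c, d) \<tau> = F (mob a b c d \<tau>)"
    using orb0[OF R[OF cd(1)]] by blast
  \<comment> \<open>The inverse matrix transports the vanishing of the factor back to F at the given
    point.\<close>
  have det': "d * a - (- b) * (- c) = 1" using ab(1) by (simp add: mult.commute)
  have im': "Im (mob d (- b) (- c) a \<tau>0) > 0" by (rule Im_mob_pos[OF det' im])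
  have "mob a b c d (mob d (- b) (- c) a \<tau>0) = mob (a * d - b * c) 0 0 (a * d - b * c) \<tau>0"
    unfolding mob_mob[OF det' im] by (simp add: mult.commute)
  also have "\<dots> = \<tau>0" unfolding ab(1) by (simp add: mob_def)
  finally have "F \<tau>0 = 0" using ab(2)[OF im'] cd(2)[OF im'] by simp
  thus ?thesis by (simp add: F_def)
qed

end

section \<open>Truncated expansions in the nome\<close>

text \<open>Coefficients stand in increasing degree. The ring is generic because the same integer
  list is evaluated at complex numbers, at polynomials, at rational functions and at the
  nome.\<close>

fun horner :: "int list \<Rightarrow> 'a :: comm_ring_1 \<Rightarrow> 'a" where
  "horner [] x = 0"
| "horner (c # cs) x = of_int c + x * horner cs x"

fun factors :: "(int list \<times> nat) list \<Rightarrow> 'a :: comm_ring_1 \<Rightarrow> 'a" where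
  "factors [] x = 1"
| "factors ((c, n) # fs) x = horner c x ^ n * factors fs x"

text \<open>The head of the list is applied first, so it is the innermost polynomial.\<close>

fun compose_horner :: "int list list \<Rightarrow> 'a :: comm_ring_1 \<Rightarrow> 'a" where
  "compose_horner [] x = x"
| "compose_horner (c # cs) x = compose_horner cs (horner c x)"

section \<open>Arithmetic with truncated integer series\<close>

fun padd :: "int list \<Rightarrow> int list \<Rightarrow> int list" where
  "padd [] ys = ys"
| "padd xs [] = xs"
| "padd (x # xs) (y # ys) = (x + y) # padd xs ys"

fun tmul :: "nat \<Rightarrow> int list \<Rightarrow> int list \<Rightarrow> int list" where
  "tmul 0 xs ys = []"
| "tmul (Suc K) [] ys = []"
| "tmul (Suc K) (x # xs) ys = padd (map ((*) x) (take (Suc K) ys)) (0 # tmul K xs ys)"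

text \<open>Long division by a series with constant term 1: each coefficient of the quotient is the
  current leading coefficient of the dividend and stays an integer.\<close>

fun tdiv :: "nat \<Rightarrow> int list \<Rightarrow> int list \<Rightarrow> int list" where
  "tdiv 0 zs ys = []"
| "tdiv (Suc K) [] ys = []"
| "tdiv (Suc K) (z # zs) ys = z # tdiv K (padd zs (map ((*) (- z)) (tl ys))) ys"

fun tpow :: "nat \<Rightarrow> int list \<Rightarrow> nat \<Rightarrow> int list" where
  "tpow K xs 0 = [1]"
| "tpow K xs (Suc n) = tmul K xs (tpow K xs n)"

fun thorner :: "nat \<Rightarrow> int list \<Rightarrow> int list \<Rightarrow> int list" where
  "thorner K [] xs = []"
| "thorner K (c # cs) xs = padd [c] (tmul K xs (thorner K cs xs))"

fun tfactors :: "nat \<Rightarrow> (int list \<times> nat) list \<Rightarrow> int list \<Rightarrow> int list" where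
  "tfactors K [] xs = [1]"
| "tfactors K ((c, n) # fs) xs = tmul K (tpow K (thorner K c xs) n) (tfactors K fs xs)"

fun tcompose :: "nat \<Rightarrow> int list list \<Rightarrow> int list \<Rightarrow> int list" where
  "tcompose K [] xs = xs"
| "tcompose K (c # cs) xs = tcompose K cs (thorner K c xs)"

text \<open>A constant of its own, because rewriting does not share the two occurrences of \<open>xs\<close>.\<close>

definition teuler_step :: "nat \<Rightarrow> nat \<Rightarrow> int list \<Rightarrow> int list" where
  "teuler_step K m xs = take K (padd xs (replicate m 0 @ map uminus xs))"

text \<open>The first n factors of the Euler product in the variable q^\<open>\<delta>\<close>;
  multiplying by 1 - q^m is a shift by m places and a subtraction.\<close>

fun teuler :: "nat \<Rightarrow> nat \<Rightarrow> nat \<Rightarrow> int list" where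
  "teuler K \<delta> 0 = [1]"
| "teuler K \<delta> (Suc n) = teuler_step K (\<delta> * Suc n) (teuler K \<delta> n)"

fun teta :: "nat \<Rightarrow> (nat \<times> nat) list \<Rightarrow> int list" where
  "teta K [] = [1]"
| "teta K ((\<delta>, n) # rs) = tmul K (tpow K (teuler K \<delta> (K div \<delta>)) n) (teta K rs)"

definition tsigma3 :: "int \<Rightarrow> int" where
  "tsigma3 n = (\<Sum>d\<leftarrow>[1..n]. if d dvd n then d ^ 3 else 0)"

definition tE4 :: "nat \<Rightarrow> int list" where
  "tE4 K = 1 # map (\<lambda>n. 240 * tsigma3 n) [1..int K]"

definition tsqr :: "nat \<Rightarrow> int list \<Rightarrow> int list" where "tsqr K xs = tmul K xs xs"

text \<open>24 = 3 * 2^3, so five truncated products replace twenty-four.\<close>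

definition tpow24 :: "nat \<Rightarrow> int list \<Rightarrow> int list" where
  "tpow24 K xs = tsqr K (tsqr K (tsqr K (tmul K xs (tsqr K xs))))"

text \<open>\<open>D\<close> and \<open>E\<close> stand for the discriminant and E_4^3: the relation
  j = P/Q is tested in multiplied-out form, which avoids dividing by a series that starts with
  q.\<close>

definition trelation :: "nat \<Rightarrow> int list \<Rightarrow> int list \<Rightarrow> int list \<Rightarrow> (int list \<times> nat) list \<Rightarrow> (int list \<times> nat) list \<Rightarrow> bool" where
  "trelation K D E xs Pf Qf \<longleftrightarrow>
    list_all ((=) 0) (padd (tmul K D (tfactors K Pf xs)) (map uminus (tmul K E (tfactors K Qf xs))))"

definition check_relation ::
  "nat \<Rightarrow> int \<Rightarrow> (nat \<times> nat) list \<Rightarrow> (nat \<times> nat) list \<Rightarrow> int list list \<Rightarrow> (int list \<times> nat) list \<Rightarrow> (int list \<times> nat) list \<Rightarrow> bool" where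
  "check_relation K k num den cs Pf Qf \<longleftrightarrow>
    trelation K (0 # tpow24 K (teuler K 1 K)) (tpow K (tE4 K) 3)
      (tcompose K cs (0 # map ((*) k) (tdiv K (teta K num) (teta K den)))) Pf Qf"

section \<open>Truncation as an identity between polynomials, and congruences modulo powers of
  q\<close>

lemma poly_of_int [simp]: "poly (of_int c) x = (of_int c :: complex)"
  by (simp add: of_int_poly)

lemma poly_horner: "poly (horner cs p) x = (horner cs (poly p x) :: complex)"
  by (induction cs) auto

lemma poly_factors: "poly (factors fs p) x = (factors fs (poly p x) :: complex)"
  by (induction fs rule: factors.induct[where ?a1.0 = p]) (auto simp: poly_horner poly_power)

lemma poly_compose_horner: "poly (compose_horner cs p) x = (compose_horner cs (poly p x) :: complex)"
  by (induction cs arbitrary: p) (auto simp: poly_horner)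

lemma horner_padd: "horner (padd xs ys) (q :: 'a :: comm_ring_1) = horner xs q + horner ys q"
  by (induction xs ys rule: padd.induct) (auto simp: algebra_simps)

lemma horner_map_mult: "horner (map ((*) c) xs) (q :: 'a :: comm_ring_1) = of_int c * horner xs q"
  by (induction xs) (auto simp: algebra_simps)

lemma horner_map_uminus: "horner (map uminus xs) (q :: 'a :: comm_ring_1) = - horner xs q"
  by (induction xs) (auto simp: algebra_simps)

lemma horner_append: "horner (xs @ ys) (q :: 'a :: comm_ring_1) = horner xs q + q ^ length xs * horner ys q"
  by (induction xs) (auto simp: algebra_simps)

lemma horner_replicate_0: "horner (replicate n 0) (q :: 'a :: comm_ring_1) = 0"
  by (induction n) auto

text \<open>Truncation errors are kept as q^K times a polynomial in q. At infinity that polynomial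
  is bounded, so the error is of order K.\<close>

lemma horner_take: "\<exists>r. \<forall>q :: 'a :: comm_ring_1. horner xs q = horner (take K xs) q + q ^ K * horner r q"
proof (cases "K \<le> length xs")
  case True
  have "horner (take K xs @ drop K xs) q = horner (take K xs) q + q ^ K * horner (drop K xs) q" for q :: 'a
    using True by (simp only: horner_append) simp
  thus ?thesis by auto
next
  case False
  thus ?thesis by (intro exI[of _ "[]"]) auto
qed

lemma horner_tmul:
  "\<exists>r. \<forall>q :: 'a :: comm_ring_1. horner xs q * horner ys q = horner (tmul K xs ys) q + q ^ K * horner r q"
proof (induction K xs ys rule: tmul.induct)
  case (1 xs ys)
  show ?case
  proof (induction xs)
    case (Cons x xs)
    then obtain r where "\<forall>q :: 'a. horner xs q * horner ys q = horner r q" by auto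
    thus ?case
      by (intro exI[of _ "padd (map ((*) x) ys) (0 # r)"])
         (auto simp: horner_padd horner_map_mult algebra_simps)
  qed (auto intro!: exI[of _ "[]"])
next
  case (3 K x xs ys)
  then obtain r where r: "\<And>q :: 'a. horner xs q * horner ys q = horner (tmul K xs ys) q + q ^ K * horner r q" by auto
  obtain r' where r': "\<And>q :: 'a. horner ys q = horner (take (Suc K) ys) q + q ^ Suc K * horner r' q"
    using horner_take[of ys "Suc K"] by auto
  show ?case
  proof (intro exI allI)
    fix q :: 'a
    have "horner (x # xs) q * horner ys q = of_int x * horner ys q + q * (horner xs q * horner ys q)"
      by (simp add: algebra_simps)
    also have "\<dots> = of_int x * (horner (take (Suc K) ys) q + q ^ Suc K * horner r' q) +
        q * (horner (tmul K xs ys) q + q ^ K * horner r q)"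
      by (simp only: r) (simp only: r'[of q])
    also have "\<dots> = horner (tmul (Suc K) (x # xs) ys) q + q ^ Suc K * horner (padd (map ((*) x) r') r) q"
      by (simp add: horner_padd horner_map_mult algebra_simps)
    finally show "horner (x # xs) q * horner ys q =
        horner (tmul (Suc K) (x # xs) ys) q + q ^ Suc K * horner (padd (map ((*) x) r') r) q" .
  qed
qed (auto intro!: exI[of _ "[]"])

lemma horner_tdiv:
  assumes "hd ys = 1" "ys \<noteq> []"
  shows "\<exists>r. \<forall>q :: 'a :: comm_ring_1. horner zs q = horner (tdiv K zs ys) q * horner ys q + q ^ K * horner r q"
proof (induction K arbitrary: zs)
  case 0
  show ?case by (auto intro!: exI[of _ zs])
next
  case (Suc K)
  show ?case
  proof (cases zs)
    case Nil
    thus ?thesis by (auto intro!: exI[of _ "[]"])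
  next
    case (Cons z zs')
    obtain ys' where ys: "ys = 1 # ys'" using assms by (cases ys) auto
    define ws where "ws = padd zs' (map ((*) (- z)) (tl ys))"
    obtain r where r: "\<And>q :: 'a. horner ws q = horner (tdiv K ws ys) q * horner ys q + q ^ K * horner r q"
      using Suc.IH[of ws] by blast
    have w: "horner ws q = horner zs' q - of_int z * horner ys' q" for q :: 'a
      unfolding ws_def by (simp add: ys horner_padd horner_map_mult)
    have "horner zs q = horner (tdiv (Suc K) zs ys) q * horner ys q + q ^ Suc K * horner r q" for q :: 'a
    proof -
      have "horner zs q = of_int z * horner ys q + q * horner ws q"
        unfolding w by (simp add: Cons ys algebra_simps)
      also have "\<dots> = of_int z * horner ys q + q * (horner (tdiv K ws ys) q * horner ys q + q ^ K * horner r q)"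
        by (simp only: r)
      also have "\<dots> = horner (z # tdiv K ws ys) q * horner ys q + q ^ Suc K * horner r q"
        by (simp add: algebra_simps)
      finally show ?thesis by (simp only: Cons tdiv.simps ws_def)
    qed
    thus ?thesis by blast
  qed
qed

text \<open>Congruence modulo q^K between a function of tau and a coefficient list, expressed by
  growth at infinity; the function need not be given as a power series.\<close>

definition qcong :: "nat \<Rightarrow> (complex \<Rightarrow> complex) \<Rightarrow> int list \<Rightarrow> bool" where
  "qcong K f xs \<longleftrightarrow> order_ge (\<lambda>\<tau>. f \<tau> - horner xs (nome \<tau>)) (real K)"

lemma horner_order_ge: "order_ge (\<lambda>\<tau>. horner xs (nome \<tau>)) 0"
proof (induction xs)
  case (Cons x xs)
  have "order_ge (\<lambda>\<tau>. of_int x + nome \<tau> * horner xs (nome \<tau>)) 0"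
    by (intro order_ge_add order_ge_const order_ge_mono[OF order_ge_mult[OF order_ge_nome Cons.IH]]) auto
  thus ?case by simp
qed (simp add: order_ge_const)

lemma qcong_order_ge: "qcong K f xs \<Longrightarrow> order_ge f 0"
  unfolding qcong_def
  using order_ge_add[OF order_ge_mono horner_order_ge, of "\<lambda>\<tau>. f \<tau> - horner xs (nome \<tau>)" "real K" xs] by simp

lemma horner_order_geI:
  assumes "\<And>q :: complex. g q = q ^ K * horner r q"
  shows "order_ge (\<lambda>\<tau>. g (nome \<tau>)) (real K)"
  using order_ge_mult[OF order_ge_power[OF order_ge_nome, of K] horner_order_ge[of r]] by (simp add: assms)

lemma qcong_refl: "qcong K (\<lambda>\<tau>. horner xs (nome \<tau>)) xs"
  unfolding qcong_def using order_ge_mono[of "\<lambda>_. 0"] by (auto intro: order_geI[of _ 0])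

lemma qcong_trans:
  assumes "qcong K f xs" "\<And>q :: complex. horner xs q = horner ys q + q ^ K * horner r q"
  shows "qcong K f ys"
proof -
  have "order_ge (\<lambda>\<tau>. (f \<tau> - horner xs (nome \<tau>)) + (horner xs (nome \<tau>) - horner ys (nome \<tau>))) (real K)"
    by (intro order_ge_add assms(1)[unfolded qcong_def] horner_order_geI[where r = r]) (simp add: assms(2))
  thus ?thesis by (simp add: qcong_def)
qed

lemma qcong_take: "qcong K f xs \<Longrightarrow> qcong K f (take K xs)"
  using horner_take[of xs K, where 'a = complex] qcong_trans by blast

lemma qcong_add: "qcong K f xs \<Longrightarrow> qcong K g ys \<Longrightarrow> qcong K (\<lambda>\<tau>. f \<tau> + g \<tau>) (padd xs ys)"
  unfolding qcong_def using order_ge_add[of "\<lambda>\<tau>. f \<tau> - horner xs (nome \<tau>)" "real K" "\<lambda>\<tau>. g \<tau> - horner ys (nome \<tau>)"]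
  by (simp add: horner_padd algebra_simps)

lemma qcong_uminus: "qcong K f xs \<Longrightarrow> qcong K (\<lambda>\<tau>. - f \<tau>) (map uminus xs)"
  unfolding qcong_def using order_ge_uminus[of "\<lambda>\<tau>. f \<tau> - horner xs (nome \<tau>)" "real K"]
  by (simp add: horner_map_uminus algebra_simps)

lemma qcong_const: "qcong K (\<lambda>_. of_int c) [c]"
  using qcong_refl[of K "[c]"] by simp

lemma qcong_mult':
  assumes "qcong K f xs" "qcong K g ys"
  shows "order_ge (\<lambda>\<tau>. f \<tau> * g \<tau> - horner xs (nome \<tau>) * horner ys (nome \<tau>)) (real K)"
proof -
  have "order_ge (\<lambda>\<tau>. (f \<tau> - horner xs (nome \<tau>)) * g \<tau> + horner xs (nome \<tau>) * (g \<tau> - horner ys (nome \<tau>))) (real K)"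
    using order_ge_mult[OF assms(1)[unfolded qcong_def] qcong_order_ge[OF assms(2)]]
      order_ge_mult[OF horner_order_ge assms(2)[unfolded qcong_def], of xs]
    by (intro order_ge_add) auto
  thus ?thesis by (simp add: algebra_simps)
qed

lemma qcong_mult:
  assumes "qcong K f xs" "qcong K g ys"
  shows "qcong K (\<lambda>\<tau>. f \<tau> * g \<tau>) (tmul K xs ys)"
proof -
  obtain r where r: "\<And>q :: complex. horner xs q * horner ys q = horner (tmul K xs ys) q + q ^ K * horner r q"
    using horner_tmul[of xs ys K] by blast
  have "order_ge (\<lambda>\<tau>. (f \<tau> * g \<tau> - horner xs (nome \<tau>) * horner ys (nome \<tau>)) +
      (horner xs (nome \<tau>) * horner ys (nome \<tau>) - horner (tmul K xs ys) (nome \<tau>))) (real K)"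
    by (intro order_ge_add qcong_mult' assms
        horner_order_geI[where g = "\<lambda>q. horner xs q * horner ys q - horner (tmul K xs ys) q" and r = r])
       (simp add: r)
  thus ?thesis by (simp add: qcong_def)
qed

lemma qcong_scale: "qcong K f xs \<Longrightarrow> qcong K (\<lambda>\<tau>. of_int c * f \<tau>) (map ((*) c) xs)"
  unfolding qcong_def using order_ge_mult[OF order_ge_const[of "of_int c"], of "\<lambda>\<tau>. f \<tau> - horner xs (nome \<tau>)" "real K"]
  by (simp add: horner_map_mult algebra_simps)

lemma qcong_nome_mult:
  assumes "qcong K f xs"
  shows "qcong K (\<lambda>\<tau>. nome \<tau> * f \<tau>) (0 # xs)"
proof -
  have "order_ge (\<lambda>\<tau>. nome \<tau> * (f \<tau> - horner xs (nome \<tau>))) (1 + real K)"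
    by (intro order_ge_mult order_ge_nome assms[unfolded qcong_def])
  hence "order_ge (\<lambda>\<tau>. nome \<tau> * (f \<tau> - horner xs (nome \<tau>))) (real K)" by (rule order_ge_mono) simp
  thus ?thesis by (simp add: qcong_def algebra_simps)
qed

lemma qcong_power: "qcong K f xs \<Longrightarrow> qcong K (\<lambda>\<tau>. f \<tau> ^ n) (tpow K xs n)"
  by (induction n) (use qcong_const[of K 1] in \<open>auto intro!: qcong_mult\<close>)

lemma qcong_horner: "qcong K f xs \<Longrightarrow> qcong K (\<lambda>\<tau>. horner c (f \<tau>)) (thorner K c xs)"
proof (induction c)
  case Nil
  show ?case using qcong_refl[of K "[]"] by simp
qed (auto intro!: qcong_add qcong_mult qcong_const simp del: padd.simps)

lemma qcong_factors: "qcong K f xs \<Longrightarrow> qcong K (\<lambda>\<tau>. factors fs (f \<tau>)) (tfactors K fs xs)"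
  by (induction K fs xs rule: tfactors.induct)
     (use qcong_const[of K 1] in \<open>auto intro!: qcong_mult qcong_power qcong_horner qcong_const[of _ 1, simplified]\<close>)

lemma qcong_compose_horner: "qcong K f xs \<Longrightarrow> qcong K (\<lambda>\<tau>. compose_horner cs (f \<tau>)) (tcompose K cs xs)"
  by (induction cs arbitrary: f xs) (auto intro: qcong_horner)

text \<open>The quotient is specified by f g = h. Since g tends to 1, dividing the error estimate by
  g does not change its order.\<close>

lemma qcong_divide:
  assumes "qcong K h zs" "qcong K g ys" "hd ys = 1" "ys \<noteq> []"
    and "(g \<longlongrightarrow> 1) cusp" "\<And>\<tau>. Im \<tau> > 0 \<Longrightarrow> f \<tau> * g \<tau> = h \<tau>"
  shows "qcong K f (tdiv K zs ys)"
proof -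
  let ?D = "\<lambda>\<tau>. horner (tdiv K zs ys) (nome \<tau>)"
  obtain r where r: "\<And>q :: complex. horner zs q = horner (tdiv K zs ys) q * horner ys q + q ^ K * horner r q"
    using horner_tdiv[OF assms(3,4), of zs K] by blast
  have "order_ge (\<lambda>\<tau>. (h \<tau> - horner zs (nome \<tau>)) + (horner zs (nome \<tau>) - ?D \<tau> * horner ys (nome \<tau>)) -
      ?D \<tau> * (g \<tau> - horner ys (nome \<tau>))) (real K)"
    using order_ge_mult[OF horner_order_ge assms(2)[unfolded qcong_def], of "tdiv K zs ys"]
    by (intro order_ge_diff order_ge_add assms(1)[unfolded qcong_def]
        horner_order_geI[where g = "\<lambda>q. horner zs q - horner (tdiv K zs ys) q * horner ys q" and r = r])
       (simp_all add: r)
  hence 1: "order_ge (\<lambda>\<tau>. h \<tau> - ?D \<tau> * g \<tau>) (real K)" by (simp add: algebra_simps)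
  have "((\<lambda>\<tau>. inverse (g \<tau>)) \<longlongrightarrow> inverse 1) cusp" by (intro tendsto_intros assms) auto
  from order_ge_mult[OF order_ge_tendsto[OF this] 1]
  have "order_ge (\<lambda>\<tau>. inverse (g \<tau>) * (h \<tau> - ?D \<tau> * g \<tau>)) (real K)" by simp
  moreover have "eventually (\<lambda>\<tau>. inverse (g \<tau>) * (h \<tau> - ?D \<tau> * g \<tau>) = f \<tau> - ?D \<tau>) cusp"
    using eventually_cusp_Im_gt[of 0] tendsto_imp_eventually_ne[OF assms(5), of 0, simplified]
  proof eventually_elim
    case (elim \<tau>)
    thus ?case by (simp add: assms(6)[symmetric] algebra_simps)
  qed
  ultimately show ?thesis unfolding qcong_def by (rule order_ge_cong)
qed

text \<open>For |q| at most 1/2 the omitted powers sum to at most s = 2 |q|^(M + 1), so the tail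
  product differs from 1 by at most e^s - 1, which is at most 2 s because s is at most 1.\<close>

lemma euler_prod_tail_bound:
  fixes q :: complex
  assumes "norm q \<le> 1 / 2"
  shows "norm (euler_prod q - (\<Prod>n<M. 1 - q ^ Suc n)) \<le> norm (\<Prod>n<M. 1 - q ^ Suc n) * (4 * norm q ^ Suc M)"
proof -
  define x where "x = norm q"
  have x: "0 \<le> x" "x \<le> 1 / 2" using assms by (auto simp: x_def)
  have q1: "norm q < 1" using assms by simp
  define s where "s = 2 * x ^ Suc M"
  have "x ^ Suc M \<le> x ^ 1" using x by (intro power_decreasing) auto
  hence s: "0 \<le> s" "s \<le> 1" using x by (auto simp: s_def)
  let ?T = "\<Prod>n. 1 - q ^ Suc (n + M)"
  have conv: "convergent_prod (\<lambda>n. 1 - q ^ Suc (n + M))"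
    using euler_prod_convergent[OF q1] convergent_prod_iff_shift[of "\<lambda>n. 1 - q ^ Suc n" M] by simp
  have split: "euler_prod q = ?T * (\<Prod>n<M. 1 - q ^ Suc n)"
    unfolding euler_prod_def
    by (rule prodinf_split_initial_segment[OF euler_prod_convergent[OF q1]])
       (use one_minus_power_nonzero[OF q1] in auto)
  have fin: "norm ((\<Prod>n\<le>m. 1 - q ^ Suc (n + M)) - 1) \<le> 2 * s" for m
  proof -
    have "norm ((\<Prod>n\<le>m. 1 + (- (q ^ Suc (n + M)))) - 1) \<le> (\<Prod>n\<le>m. 1 + norm (- (q ^ Suc (n + M)))) - 1"
      by (rule norm_prod_minus1_le_prod_minus1)
    also have "(\<Prod>n\<le>m. 1 + norm (- (q ^ Suc (n + M)))) \<le> exp (\<Sum>n\<le>m. norm (- (q ^ Suc (n + M))))"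
      by (rule prod_le_exp_sum) auto
    also have "(\<Sum>n\<le>m. norm (- (q ^ Suc (n + M)))) = x ^ Suc M * (\<Sum>n\<le>m. x ^ n)"
      by (simp add: x_def norm_power norm_mult power_add sum_distrib_left mult_ac)
    finally have "norm ((\<Prod>n\<le>m. 1 - q ^ Suc (n + M)) - 1) \<le> exp (x ^ Suc M * (\<Sum>n\<le>m. x ^ n)) - 1" by simp
    moreover have "(\<Sum>n\<le>m. x ^ n) \<le> 2"
    proof -
      have "(\<Sum>n\<le>m. x ^ n) \<le> (\<Sum>n. x ^ n)"
        using x by (intro sum_le_suminf summable_geometric) auto
      also have "\<dots> = 1 / (1 - x)" using x by (intro suminf_geometric) auto
      also have "\<dots> \<le> 2" using x by (simp add: field_simps)
      finally show ?thesis .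
    qed
    hence "exp (x ^ Suc M * (\<Sum>n\<le>m. x ^ n)) \<le> exp s"
      using x mult_left_mono[of "\<Sum>n\<le>m. x ^ n" 2 "x ^ Suc M"] by (simp add: s_def mult.commute)
    moreover have "exp s \<le> 1 + s + s ^ 2" using s by (intro exp_bound) auto
    moreover have "s ^ 2 \<le> s" using s by (simp add: power2_eq_square mult_left_le)
    ultimately show ?thesis by linarith
  qed
  have "norm (?T - 1) \<le> 2 * s"
  proof (rule Lim_bounded)
    show "(\<lambda>m. norm ((\<Prod>n\<le>m. 1 - q ^ Suc (n + M)) - 1)) \<longlonglongrightarrow> norm (?T - 1)"
      by (intro tendsto_intros convergent_prod_LIMSEQ conv)
  qed (use fin in auto)
  moreover have "euler_prod q - (\<Prod>n<M. 1 - q ^ Suc n) = (\<Prod>n<M. 1 - q ^ Suc n) * (?T - 1)"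
    unfolding split by (simp add: algebra_simps)
  ultimately show ?thesis
    unfolding norm_mult by (simp only: norm_mult) (simp add: mult_left_mono s_def x_def)
qed

lemma filterlim_dilate_cusp: "\<delta> > 0 \<Longrightarrow> filterlim (\<lambda>\<tau>. of_nat \<delta> * \<tau>) cusp cusp"
  unfolding cusp_def filterlim_filtercomap_iff o_def
  using filterlim_tendsto_pos_mult_at_top[OF tendsto_const[of "real \<delta>"] _ filterlim_Im_cusp]
  by (simp add: cusp_def)

lemma order_ge_dilate:
  assumes "order_ge f a" "\<delta> > 0"
  shows "order_ge (\<lambda>\<tau>. f (of_nat \<delta> * \<tau>)) (real \<delta> * a)"
proof -
  obtain C where C: "C > 0" "eventually (\<lambda>\<tau>. norm (f \<tau>) \<le> C * exp (- 2 * pi * a * Im \<tau>)) cusp"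
    using order_geE[OF assms(1)] .
  show ?thesis
    by (rule order_geI[of _ C], use eventually_compose_filterlim[OF C(2) filterlim_dilate_cusp[OF assms(2)]] in eventually_elim)
       (simp add: mult_ac)
qed

lemma euler_prod_order_ge:
  "order_ge (\<lambda>\<tau>. euler_prod (nome \<tau>) - (\<Prod>n<M. 1 - nome \<tau> ^ Suc n)) (real (Suc M))"
proof -
  have n0: "(nome \<longlongrightarrow> 0) cusp" using filterlim_nome_cusp by (auto simp: filterlim_at)
  have "((\<lambda>\<tau>. \<Prod>n<M. 1 - nome \<tau> ^ Suc n) \<longlongrightarrow> (\<Prod>n<M. 1 - 0 ^ Suc n)) cusp"
    by (intro tendsto_intros n0)
  from order_ge_mult[OF order_ge_tendsto[OF this] order_ge_power[OF order_ge_nome, of "Suc M"]]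
  have "order_ge (\<lambda>\<tau>. (\<Prod>n<M. 1 - nome \<tau> ^ Suc n) * nome \<tau> ^ Suc M) (real (Suc M))" by simp
  then obtain C where C: "C > 0" "eventually (\<lambda>\<tau>. norm ((\<Prod>n<M. 1 - nome \<tau> ^ Suc n) * nome \<tau> ^ Suc M)
      \<le> C * exp (- 2 * pi * real (Suc M) * Im \<tau>)) cusp"
    by (rule order_geE)
  have "eventually (\<lambda>\<tau>. norm (nome \<tau>) < 1 / 2) cusp"
    by (rule order_tendstoD(2)[OF tendsto_norm_zero[OF n0]]) simp
  with C(2) have "eventually (\<lambda>\<tau>. norm (euler_prod (nome \<tau>) - (\<Prod>n<M. 1 - nome \<tau> ^ Suc n)) \<le>
      (4 * C) * exp (- 2 * pi * real (Suc M) * Im \<tau>)) cusp"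
  proof eventually_elim
    case (elim \<tau>)
    have "norm (euler_prod (nome \<tau>) - (\<Prod>n<M. 1 - nome \<tau> ^ Suc n)) \<le>
        norm (\<Prod>n<M. 1 - nome \<tau> ^ Suc n) * (4 * norm (nome \<tau>) ^ Suc M)"
      by (rule euler_prod_tail_bound) (use elim in simp)
    also have "\<dots> = 4 * norm ((\<Prod>n<M. 1 - nome \<tau> ^ Suc n) * nome \<tau> ^ Suc M)"
      unfolding norm_mult norm_power by simp
    also have "\<dots> \<le> 4 * (C * exp (- 2 * pi * real (Suc M) * Im \<tau>))" using elim(1) by simp
    finally show ?case by (simp only: mult.assoc)
  qed
  thus ?thesis by (rule order_geI)
qed

text \<open>The first omitted exponent is \<open>\<delta>\<close> (K div \<open>\<delta>\<close> +
  1), which exceeds K; so K div \<open>\<delta>\<close> factors are enough.\<close>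

lemma qcong_teuler:
  assumes "\<delta> > 0"
  shows "qcong K (\<lambda>\<tau>. euler_prod (nome \<tau> ^ \<delta>)) (teuler K \<delta> (K div \<delta>))"
proof -
  have 1: "qcong K (\<lambda>\<tau>. \<Prod>i<n. 1 - nome \<tau> ^ (\<delta> * Suc i)) (teuler K \<delta> n)" for n
  proof (induction n)
    case 0
    show ?case using qcong_const[of K 1] by simp
  next
    case (Suc n)
    have "order_ge (\<lambda>\<tau>. (1 - nome \<tau> ^ (\<delta> * Suc n)) *
        ((\<Prod>i<n. 1 - nome \<tau> ^ (\<delta> * Suc i)) - horner (teuler K \<delta> n) (nome \<tau>))) (0 + real K)"
    proof (intro order_ge_mult Suc.IH[unfolded qcong_def])
      have "order_ge (\<lambda>\<tau>. 1 - nome \<tau> ^ (\<delta> * Suc n)) 0"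
        by (intro order_ge_diff order_ge_const order_ge_mono[OF order_ge_power[OF order_ge_nome]]) simp
      thus "order_ge (\<lambda>\<tau>. 1 - nome \<tau> ^ (\<delta> * Suc n)) 0" .
    qed
    hence "qcong K (\<lambda>\<tau>. \<Prod>i<Suc n. 1 - nome \<tau> ^ (\<delta> * Suc i))
        (padd (teuler K \<delta> n) (replicate (\<delta> * Suc n) 0 @ map uminus (teuler K \<delta> n)))"
      unfolding qcong_def
      by (simp add: horner_padd horner_append horner_replicate_0 horner_map_uminus algebra_simps del: mult_Suc_right)
    thus ?case unfolding teuler.simps teuler_step_def by (rule qcong_take)
  qed
  have "order_ge (\<lambda>\<tau>. euler_prod (nome (of_nat \<delta> * \<tau>)) - (\<Prod>n<K div \<delta>. 1 - nome (of_nat \<delta> * \<tau>) ^ Suc n))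
      (real \<delta> * real (Suc (K div \<delta>)))"
    by (rule order_ge_dilate[OF euler_prod_order_ge assms])
  hence "order_ge (\<lambda>\<tau>. euler_prod (nome \<tau> ^ \<delta>) - (\<Prod>n<K div \<delta>. 1 - nome \<tau> ^ (\<delta> * Suc n))) (real \<delta> * real (Suc (K div \<delta>)))"
    unfolding nome_of_nat_mult power_mult .
  moreover have "real K \<le> real \<delta> * real (Suc (K div \<delta>))"
  proof -
    have "K < \<delta> * Suc (K div \<delta>)" using assms dividend_less_times_div[of \<delta> K] by simp
    thus ?thesis by (metis of_nat_mult of_nat_le_iff less_imp_le)
  qed
  ultimately have "order_ge (\<lambda>\<tau>. euler_prod (nome \<tau> ^ \<delta>) - (\<Prod>n<K div \<delta>. 1 - nome \<tau> ^ (\<delta> * Suc n))) (real K)"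
    by (rule order_ge_mono)
  from order_ge_add[OF this 1[of "K div \<delta>", unfolded qcong_def]] show ?thesis by (simp add: qcong_def)
qed

definition eta_prod :: "(nat \<times> nat) list \<Rightarrow> complex \<Rightarrow> complex" where
  "eta_prod rs q = (\<Prod>(\<delta>, n)\<leftarrow>rs. euler_prod (q ^ \<delta>) ^ n)"

lemma qcong_teta:
  "\<forall>(\<delta>, n)\<in>set rs. \<delta> > 0 \<Longrightarrow> qcong K (\<lambda>\<tau>. eta_prod rs (nome \<tau>)) (teta K rs)"
  unfolding eta_prod_def
  by (induction K rs rule: teta.induct)
     (use qcong_const[of _ 1] in \<open>auto intro!: qcong_mult qcong_power qcong_teuler\<close>)

text \<open>The division needs a divisor with constant term 1. Truncation is to \<open>Suc K\<close>
  in what follows because length 0 would lose that term.\<close>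

definition unit_head :: "int list \<Rightarrow> bool" where "unit_head xs \<longleftrightarrow> (\<exists>ys. xs = 1 # ys)"

lemma unit_head_tmul: "unit_head xs \<Longrightarrow> unit_head ys \<Longrightarrow> unit_head (tmul (Suc K) xs ys)"
  by (auto simp: unit_head_def)

lemma unit_head_tpow: "unit_head xs \<Longrightarrow> unit_head (tpow (Suc K) xs n)"
proof (induction n)
  case (Suc n)
  thus ?case unfolding tpow.simps by (intro unit_head_tmul) auto
qed (auto simp: unit_head_def)

lemma unit_head_teuler:
  assumes "\<delta> > 0"
  shows "unit_head (teuler (Suc K) \<delta> n)"
proof (induction n)
  case (Suc n)
  then obtain ys where ys: "teuler (Suc K) \<delta> n = 1 # ys" by (auto simp: unit_head_def)
  obtain m where "\<delta> * Suc n = Suc m" using assms by (cases "\<delta> * Suc n") auto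
  thus ?case unfolding teuler.simps teuler_step_def ys by (simp add: unit_head_def)
qed (auto simp: unit_head_def)

lemma unit_head_teta: "\<forall>(\<delta>, n)\<in>set rs. \<delta> > 0 \<Longrightarrow> unit_head (teta (Suc K) rs)"
proof (induction rs)
  case (Cons x rs)
  obtain \<delta> n where x: "x = (\<delta>, n)" by (cases x)
  show ?case unfolding x teta.simps
    by (intro unit_head_tmul unit_head_tpow unit_head_teuler) (use Cons x in auto)
qed (auto simp: unit_head_def)

lemma tendsto_eta_prod:
  "\<forall>(\<delta>, n)\<in>set rs. \<delta> > 0 \<Longrightarrow> ((\<lambda>\<tau>. eta_prod rs (nome \<tau>)) \<longlongrightarrow> 1) cusp"
proof (induction rs)
  case (Cons x rs)
  obtain \<delta> n where x: "x = (\<delta>, n)" by (cases x)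
  have "((\<lambda>\<tau>. euler_prod (nome (of_nat \<delta> * \<tau>))) \<longlongrightarrow> 1) cusp"
  proof (rule tendsto_euler_prod_cusp)
    show "filterlim (\<lambda>\<tau>. real \<delta> * Im \<tau>) at_top cusp"
      by (rule filterlim_tendsto_pos_mult_at_top[OF tendsto_const _ filterlim_Im_cusp])
         (use Cons.prems x in auto)
  qed simp
  hence "((\<lambda>\<tau>. euler_prod (nome \<tau> ^ \<delta>) ^ n * eta_prod rs (nome \<tau>)) \<longlongrightarrow> 1 ^ n * 1) cusp"
    using Cons unfolding nome_of_nat_mult by (intro tendsto_intros) auto
  thus ?case by (simp add: x eta_prod_def)
qed (simp add: eta_prod_def)

lemma eta_prod_nonzero:
  assumes "norm q < 1" "\<forall>(\<delta>, n)\<in>set rs. \<delta> > 0"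
  shows "eta_prod rs q \<noteq> 0"
  using assms(2)
proof (induction rs)
  case (Cons x rs)
  obtain \<delta> n where x: "x = (\<delta>, n)" by (cases x)
  have "norm q ^ \<delta> \<le> norm q ^ 1" using assms(1) Cons.prems x by (intro power_decreasing) auto
  hence "euler_prod (q ^ \<delta>) \<noteq> 0" using assms(1) by (intro euler_prod_nonzero) (simp add: norm_power)
  thus ?case using Cons by (simp add: x eta_prod_def)
qed (simp add: eta_prod_def)

lemma horner_conv_sum: "horner xs (q :: 'a :: comm_ring_1) = (\<Sum>i<length xs. of_int (xs ! i) * q ^ i)"
  by (induction xs) (simp_all add: sum.lessThan_Suc_shift sum_distrib_left mult_ac del: sum.lessThan_Suc)

lemma tsigma3: "of_int (tsigma3 (int n)) = sigma3 n" if "n > 0"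
proof -
  have "tsigma3 (int n) = (\<Sum>d\<in>{1..int n}. if d dvd int n then d ^ 3 else 0)"
    unfolding tsigma3_def by (simp add: sum_list_distinct_conv_sum_set)
  also have "\<dots> = (\<Sum>d\<in>{d\<in>{1..int n}. d dvd int n}. d ^ 3)"
    by (rule sum.inter_filter[symmetric]) simp
  also have "\<dots> = (\<Sum>d | d dvd n. int d ^ 3)"
    by (rule sum.reindex_bij_witness[of _ int nat])
       (use that in \<open>auto simp: nat_dvd_iff dvd_imp_le zdvd_imp_le intro: Nat.gr0I\<close>)
  finally show ?thesis by (simp add: sigma3_def)
qed

lemma qcong_tE4: "qcong K eisenstein_E4 (tE4 K)"
proof -
  have "horner (tE4 K) q = 1 + 240 * q * (\<Sum>n<K. sigma3 (Suc n) * q ^ n)" for q :: complex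
  proof -
    have "horner (map (\<lambda>n. 240 * tsigma3 n) [1..int K]) q = 240 * (\<Sum>n<K. sigma3 (Suc n) * q ^ n)"
      unfolding horner_conv_sum sum_distrib_left
      by (rule sum.cong) (use tsigma3[of "Suc _"] in \<open>auto simp: add.commute\<close>)
    thus ?thesis by (simp add: tE4_def)
  qed
  thus ?thesis using order_ge_mono[OF eisenstein_E4_order_ge[of K], of "real K"] by (simp add: qcong_def)
qed

lemma qcong_tpow24: "qcong K f xs \<Longrightarrow> qcong K (\<lambda>\<tau>. f \<tau> ^ 24) (tpow24 K xs)"
proof -
  assume f: "qcong K f xs"
  have sqr: "qcong K (\<lambda>\<tau>. f \<tau> ^ 2) (tsqr K xs)" if "qcong K f xs" for f xs
    using qcong_mult[OF that that] by (simp add: tsqr_def power2_eq_square)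
  have "qcong K (\<lambda>\<tau>. (((f \<tau> * f \<tau> ^ 2) ^ 2) ^ 2) ^ 2) (tpow24 K xs)"
    unfolding tpow24_def by (intro sqr qcong_mult f)
  moreover have "(((z * z ^ 2) ^ 2) ^ 2) ^ 2 = z ^ 24" for z :: complex
    by (simp add: power_mult_distrib power_mult[symmetric] power_add[symmetric])
  ultimately show ?thesis by simp
qed

text \<open>The check works modulo q^(K + 1). Dividing by the discriminant, which has a simple zero
  at infinity, costs one power of q and leaves order K.\<close>

lemma (in eta_hauptmodul) check_relation_order_ge:
  assumes k: "\<kappa> = of_int k"
    and rs: "rs = map (\<lambda>(\<delta>, n). (\<delta>, int n)) num @ map (\<lambda>(\<delta>, n). (\<delta>, - int n)) den"
    and check: "check_relation (Suc K) k num den cs Pf Qf"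
  shows "order_ge (\<lambda>\<tau>. poly (factors Pf (compose_horner cs [:0, 1:])) (t \<tau>) -
     klein_j \<tau> * poly (factors Qf (compose_horner cs [:0, 1:])) (t \<tau>)) (real K)"
proof -
  let ?K = "Suc K"
  have pos: "\<forall>(\<delta>, n)\<in>set num. \<delta> > 0" "\<forall>(\<delta>, n)\<in>set den. \<delta> > 0"
    using rs_pos unfolding rs by auto
  define u where "u = (\<lambda>q. eta_prod num q / eta_prod den q)"
  have "unit_part q = of_int k * u q" for q
  proof -
    have "(\<Prod>(\<delta>, r)\<leftarrow>map (\<lambda>(\<delta>, n). (\<delta>, int n)) num. euler_prod (q ^ \<delta>) powi r) = eta_prod num q"
      unfolding eta_prod_def by (induction num) auto
    moreover have "(\<Prod>(\<delta>, r)\<leftarrow>map (\<lambda>(\<delta>, n). (\<delta>, - int n)) den. euler_prod (q ^ \<delta>) powi r) = inverse (eta_prod den q)"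
      unfolding eta_prod_def by (induction den) (auto simp: power_int_minus)
    ultimately show ?thesis unfolding unit_part_def
      by (simp only: rs map_append prod_list.append k u_def divide_inverse)
  qed
  hence t: "t \<tau> = nome \<tau> * (of_int k * u (nome \<tau>))" for \<tau> by (simp add: t_conv_unit_part)
  have "qcong ?K (\<lambda>\<tau>. u (nome \<tau>)) (tdiv ?K (teta ?K num) (teta ?K den))"
  proof (rule qcong_divide[OF qcong_teta[OF pos(1)] qcong_teta[OF pos(2)] _ _ tendsto_eta_prod[OF pos(2)]])
    show "hd (teta ?K den) = 1" "teta ?K den \<noteq> []" using unit_head_teta[OF pos(2), of K] by (auto simp: unit_head_def)
    show "u (nome \<tau>) * eta_prod den (nome \<tau>) = eta_prod num (nome \<tau>)" if "Im \<tau> > 0" for \<tau>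
      using eta_prod_nonzero[OF norm_nome_less_1[OF that] pos(2)] by (simp add: u_def)
  qed
  hence "qcong ?K t (0 # map ((*) k) (tdiv ?K (teta ?K num) (teta ?K den)))"
    unfolding t[abs_def] by (intro qcong_nome_mult qcong_scale)
  hence x: "qcong ?K (\<lambda>\<tau>. compose_horner cs (t \<tau>)) (tcompose ?K cs (0 # map ((*) k) (tdiv ?K (teta ?K num) (teta ?K den))))"
    by (rule qcong_compose_horner)
  have D: "qcong ?K (\<lambda>\<tau>. nome \<tau> * euler_prod (nome \<tau>) ^ 24) (0 # tpow24 ?K (teuler ?K 1 ?K))"
    using qcong_teuler[of 1 ?K] by (intro qcong_nome_mult qcong_tpow24) simp
  have E: "qcong ?K (\<lambda>\<tau>. eisenstein_E4 \<tau> ^ 3) (tpow ?K (tE4 ?K) 3)"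
    by (intro qcong_power qcong_tE4)
  let ?zs = "padd (tmul ?K (0 # tpow24 ?K (teuler ?K 1 ?K)) (tfactors ?K Pf (tcompose ?K cs (0 # map ((*) k) (tdiv ?K (teta ?K num) (teta ?K den))))))
     (map uminus (tmul ?K (tpow ?K (tE4 ?K) 3) (tfactors ?K Qf (tcompose ?K cs (0 # map ((*) k) (tdiv ?K (teta ?K num) (teta ?K den)))))))"
  have "list_all ((=) 0) ?zs" using check unfolding check_relation_def trelation_def .
  moreover have "horner zs q = 0" if "list_all ((=) 0) zs" for zs and q :: complex
    using that by (induction zs) auto
  ultimately have z: "horner ?zs q = 0" for q :: complex by blast
  have "qcong ?K (\<lambda>\<tau>. (nome \<tau> * euler_prod (nome \<tau>) ^ 24) * factors Pf (compose_horner cs (t \<tau>)) +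
      - (eisenstein_E4 \<tau> ^ 3 * factors Qf (compose_horner cs (t \<tau>)))) ?zs"
    by (intro qcong_add qcong_uminus qcong_mult D E qcong_factors x)
  hence *: "order_ge (\<lambda>\<tau>. (nome \<tau> * euler_prod (nome \<tau>) ^ 24) * factors Pf (compose_horner cs (t \<tau>)) +
      - (eisenstein_E4 \<tau> ^ 3 * factors Qf (compose_horner cs (t \<tau>)))) (real ?K)"
    unfolding qcong_def z by simp
  have "order_ge (\<lambda>\<tau>. inverse (nome \<tau>)) (-1)"
    by (rule order_geI[of _ 1]) (simp add: norm_inverse norm_nome exp_minus[symmetric])
  moreover have "((\<lambda>\<tau>. inverse (euler_prod (nome \<tau>) ^ 24)) \<longlongrightarrow> inverse (1 ^ 24)) cusp"
    by (intro tendsto_intros tendsto_euler_prod_cusp[OF filterlim_Im_cusp]) auto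
  ultimately have "order_ge (\<lambda>\<tau>. inverse (nome \<tau>) * inverse (euler_prod (nome \<tau>) ^ 24) *
      ((nome \<tau> * euler_prod (nome \<tau>) ^ 24) * factors Pf (compose_horner cs (t \<tau>)) +
      - (eisenstein_E4 \<tau> ^ 3 * factors Qf (compose_horner cs (t \<tau>))))) (-1 + 0 + real ?K)"
    by (intro order_ge_mult order_ge_tendsto[of _ "inverse (1 ^ 24)"] *)
  hence "order_ge (\<lambda>\<tau>. inverse (nome \<tau>) * inverse (euler_prod (nome \<tau>) ^ 24) *
      ((nome \<tau> * euler_prod (nome \<tau>) ^ 24) * factors Pf (compose_horner cs (t \<tau>)) +
      - (eisenstein_E4 \<tau> ^ 3 * factors Qf (compose_horner cs (t \<tau>))))) (real K)" by simp
  thus ?thesis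
  proof (rule order_ge_cong, use eventually_cusp_Im_gt[of 0] in eventually_elim)
    case (elim \<tau>)
    define e where "e = nome \<tau> * euler_prod (nome \<tau>) ^ 24"
    have "e \<noteq> 0" using euler_prod_nonzero[OF norm_nome_less_1[OF elim]] by (simp add: e_def)
    moreover have "klein_j \<tau> = eisenstein_E4 \<tau> ^ 3 / e" by (simp add: klein_j_def dedekind_eta_24 e_def)
    moreover have "inverse (nome \<tau>) * inverse (euler_prod (nome \<tau>) ^ 24) = inverse e" by (simp add: e_def)
    ultimately show ?case
      by (simp add: poly_factors poly_compose_horner e_def[symmetric] inverse_eq_divide diff_divide_distrib)
  qed
qed

section \<open>Identification of P and Q with explicit polynomials\<close>

lemma coprime_polyI:
  fixes p q :: "complex poly"
  assumes "\<And>x. poly p x = 0 \<Longrightarrow> poly q x = 0 \<Longrightarrow> False" "p \<noteq> 0"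
  shows "coprime p q"
proof (rule coprimeI)
  fix d assume d: "d dvd p" "d dvd q"
  show "is_unit d"
  proof (rule ccontr)
    assume "\<not> is_unit d"
    moreover have "d \<noteq> 0" using d assms(2) by auto
    ultimately have "degree d \<noteq> 0" by (auto simp: is_unit_iff_degree)
    hence "\<not> constant (poly d)" by (simp add: constant_degree)
    then obtain x where "poly d x = 0" using fundamental_theorem_of_algebra by blast
    thus False using assms(1)[of x] d by (metis dvd_trans poly_eq_0_iff_dvd)
  qed
qed

lemma degree_horner: "degree (horner c (p :: complex poly)) \<le> (length c - 1) * degree p"
proof (induction c)
  case (Cons c cs)
  show ?case
  proof (cases cs)
    case (Cons d ds)
    have "degree (p * horner cs p) \<le> degree p + (length cs - 1) * degree p"
      using Cons.IH degree_mult_le[of p "horner cs p"] by linarith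
    also have "\<dots> = length cs * degree p" by (simp add: Cons)
    finally have "degree (p * horner cs p) \<le> length cs * degree p" .
    thus ?thesis by (auto intro!: degree_add_le simp: of_int_poly)
  qed (simp add: of_int_poly)
qed simp

fun factors_degree :: "(int list \<times> nat) list \<Rightarrow> nat" where
  "factors_degree [] = 0"
| "factors_degree ((c, n) # fs) = n * (length c - 1) + factors_degree fs"

fun compose_degree :: "int list list \<Rightarrow> nat" where
  "compose_degree [] = 1"
| "compose_degree (c # cs) = (length c - 1) * compose_degree cs"

lemma degree_factors: "degree (factors fs (p :: complex poly)) \<le> factors_degree fs * degree p"
proof (induction fs)
  case (Cons f fs)
  obtain c n where f: "f = (c, n)" by (cases f)
  have "degree (horner c p ^ n) \<le> n * ((length c - 1) * degree p)"
    using degree_power_le[of "horner c p" n] degree_horner[of c p]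
    by (meson mult_le_mono2 order_trans mult.commute[THEN eq_refl])
  hence "degree (horner c p ^ n * factors fs p) \<le> n * ((length c - 1) * degree p) + factors_degree fs * degree p"
    using Cons degree_mult_le[of "horner c p ^ n" "factors fs p"] by linarith
  thus ?case by (simp add: f algebra_simps)
qed simp

lemma degree_compose_horner: "degree (compose_horner cs (p :: complex poly)) \<le> compose_degree cs * degree p"
proof (induction cs arbitrary: p)
  case (Cons c cs)
  have "degree (compose_horner cs (horner c p)) \<le> compose_degree cs * ((length c - 1) * degree p)"
    using Cons[of "horner c p"] degree_horner[of c p] by (meson mult_le_mono2 order_trans)
  thus ?case by (simp add: algebra_simps)
qed simp

definition level_poly :: "int list list \<Rightarrow> (int list \<times> nat) list \<Rightarrow> complex poly" where
  "level_poly cs fs = factors fs (compose_horner cs [:0, 1:])"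

lemma poly_level_poly: "poly (level_poly cs fs) x = factors fs (compose_horner cs x)"
  by (simp add: level_poly_def poly_factors poly_compose_horner)

lemma degree_level_poly: "degree (level_poly cs fs) \<le> factors_degree fs * compose_degree cs"
  unfolding level_poly_def
  using degree_factors[of fs "compose_horner cs [:0, 1:]"] degree_compose_horner[of cs "[:0, 1:]"]
  by (simp add: order_trans[OF _ mult_le_mono2])

text \<open>24 N times \<open>cusp_order\<close>, as an integer that can be evaluated:
  \<open>\<delta>\<close> / gcd(c, \<open>\<delta>\<close>) divides N, so both integer divisions are
  exact.\<close>

definition cusp_order_num :: "nat \<Rightarrow> int \<Rightarrow> (nat \<times> int) list \<Rightarrow> int" where
  "cusp_order_num N c rs = (\<Sum>(\<delta>, r)\<leftarrow>rs. r * gcd c (int \<delta>) * (int N div (int \<delta> div gcd c (int \<delta>))))"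

lemma cusp_order_conv_num:
  assumes "N > 0" "\<forall>(\<delta>, r)\<in>set rs. \<delta> > 0 \<and> \<delta> dvd N"
  shows "cusp_order c rs = of_int (cusp_order_num N c rs) / (24 * real N)"
proof -
  have "(\<Sum>(\<delta>, r)\<leftarrow>rs. real_of_int r * of_int (gcd c (int \<delta>)) / of_int (int \<delta> div gcd c (int \<delta>))) =
      of_int (cusp_order_num N c rs) / real N"
    using assms(2)
  proof (induction rs)
    case (Cons x rs)
    obtain \<delta> r where x: "x = (\<delta>, r)" by (cases x)
    have \<delta>: "\<delta> > 0" "\<delta> dvd N" using Cons.prems x by auto
    define e where "e = int \<delta> div gcd c (int \<delta>)"
    have "e dvd int \<delta>" unfolding e_def by (metis dvd_div_mult_self dvd_triv_left gcd_dvd2)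
    hence eN: "e dvd int N" using \<delta>(2) by (meson dvd_trans of_nat_dvd_iff)
    have e0: "e \<noteq> 0" using eN assms(1) by auto
    obtain f where f: "int N = e * f" using eN by (auto elim: dvdE)
    hence fN: "real N = of_int e * of_int f" by (metis of_int_mult of_int_of_nat_eq)
    have f0: "f \<noteq> 0" using f assms(1) by auto
    have "int N div e = f" using f e0 by simp
    moreover have "real_of_int r * of_int (gcd c (int \<delta>)) / of_int e = real_of_int r * of_int (gcd c (int \<delta>)) * of_int f / real N"
      unfolding fN using e0 f0 by simp
    ultimately have "real_of_int r * of_int (gcd c (int \<delta>)) / of_int e = of_int (r * gcd c (int \<delta>) * (int N div e)) / real N"
      by (simp only: of_int_mult)
    thus ?case using Cons by (simp add: x e_def cusp_order_num_def add_divide_distrib)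
  qed (simp add: cusp_order_num_def)
  thus ?thesis by (simp add: cusp_order_def)
qed

definition eta_exponents :: "(nat \<times> nat) list \<Rightarrow> (nat \<times> nat) list \<Rightarrow> (nat \<times> int) list" where
  "eta_exponents num den = map (\<lambda>(\<delta>, n). (\<delta>, int n)) num @ map (\<lambda>(\<delta>, n). (\<delta>, - int n)) den"

text \<open>The finitely many arithmetic hypotheses of the modular relation in decidable form. The
  bound -24 is the order -1/N scaled by 24 N, and \<open>R'\<close> is the list of bottom
  rows.\<close>

definition check_level ::
  "nat \<Rightarrow> nat \<Rightarrow> int \<Rightarrow> (nat \<times> nat) list \<Rightarrow> (nat \<times> nat) list \<Rightarrow> (int \<times> int) list \<Rightarrow> nat \<Rightarrow> nat \<Rightarrow> bool" where
  "check_level N K k num den L dP dQ \<longleftrightarrow>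
    N > 0 \<and> k \<noteq> 0 \<and> dQ + N \<le> dP \<and> dP + length L < K \<and>
    list_all (\<lambda>(\<delta>, r). \<delta> > 0 \<and> \<delta> dvd N) (eta_exponents num den) \<and>
    (\<Sum>(\<delta>, r)\<leftarrow>eta_exponents num den. r) = 0 \<and>
    (\<Sum>(\<delta>, r)\<leftarrow>eta_exponents num den. int \<delta> * r) = 24 \<and>
    cusp_order_num N 1 (eta_exponents num den) \<ge> - 24 \<and>
    list_all (\<lambda>(c, d). gcd c d = 1 \<and> cusp_order_num N c (eta_exponents num den) \<ge> 0) L \<and>
    (let R = map (Pair 1) [0..int N - 1] @ L; R' = (0, 1) # R in
      list_all (\<lambda>(c, d). list_ex (\<lambda>(c', d'). int N dvd d * d' + c * c') R') R \<and>
      list_all (\<lambda>(c, d). list_ex (\<lambda>(c', d'). int N dvd c * d' - c' * (c + d)) R') L)"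

text \<open>The explicit pair satisfies Pn(t) = j Qn(t), so P Qn - Pn Q vanishes at all values of t.
  These are infinitely many, hence P Qn = Pn Q as polynomials, and coprimality of both pairs makes
  each numerator divide the other.\<close>

lemma level_identification:
  assumes rep: "j_representation N P Q"
    and ht: "\<And>\<tau>. hauptmodul N \<tau> = eta_quotient (of_int k) (eta_exponents num den) \<tau>"
    and check: "check_level N K k num den L (factors_degree Pf * compose_degree cs) (factors_degree Qf * compose_degree cs)"
    and rel: "check_relation (Suc K) k num den cs Pf Qf"
    and no_root: "\<And>x :: complex. factors Pf x = 0 \<Longrightarrow> factors Qf x = 0 \<Longrightarrow> False"
  shows "poly P 0 \<noteq> 0" "poly Q 0 = 0" "poly (pderiv Q) 0 \<noteq> 0"
    "\<exists>c. c \<noteq> 0 \<and> P = smult c (level_poly cs Pf) \<and> Q = smult c (level_poly cs Qf)"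
proof -
  let ?rs = "eta_exponents num den"
  let ?R = "Pair 1 ` {0..<int N} \<union> set L"
  have N: "N > 0" using check by (simp add: check_level_def)
  have dvd: "\<forall>(\<delta>, r)\<in>set ?rs. \<delta> > 0 \<and> \<delta> dvd N" using check by (simp add: check_level_def list_all_iff)
  interpret eta_hauptmodul_j N "of_int k" ?rs P Q
  proof
    show "of_int k \<noteq> (0 :: complex)" using check by (simp add: check_level_def)
    show "coprime P Q" using rep by (simp add: j_representation_def)
    show "poly Q (eta_quotient (of_int k) ?rs \<tau>) \<noteq> 0"
      "klein_j \<tau> = poly P (eta_quotient (of_int k) ?rs \<tau>) / poly Q (eta_quotient (of_int k) ?rs \<tau>)" if "Im \<tau> > 0" for \<tau>
      using rep that by (auto simp: j_representation_def ht)
  qed (use N dvd check in \<open>auto simp: check_level_def\<close>)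
  obtain Q1 where Q1: "Q = pCons 0 Q1" "poly P 0 = of_int k * poly Q1 0" "poly Q1 0 \<noteq> 0"
    using pole_at_0 .
  show "poly P 0 \<noteq> 0" "poly Q 0 = 0" "poly (pderiv Q) 0 \<noteq> 0"
    using Q1 \<kappa> by (simp_all add: pderiv_pCons)
  define Pn where "Pn = level_poly cs Pf"
  define Qn where "Qn = level_poly cs Qf"
  have ord: "cusp_order c ?rs = of_int (cusp_order_num N c ?rs) / (24 * real N)" for c
    by (rule cusp_order_conv_num[OF N dvd])
  have R: "set (map (Pair 1) [0..int N - 1] @ L) = ?R" by auto
  have rel': "poly Pn (t \<tau>) = klein_j \<tau> * poly Qn (t \<tau>)" if "Im \<tau> > 0" for \<tau>
  proof (rule modular_relation[OF _ _ _ _ _ _ _ _ _ _ that])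
    have "real_of_int (cusp_order_num N 1 ?rs) \<ge> real_of_int (- 24)"
      using check by (simp only: of_int_le_iff check_level_def)
    thus "- 1 / real N \<le> cusp_order 1 ?rs" unfolding ord using N by (simp add: field_simps)
    show "\<forall>(c, d)\<in>set L. 0 \<le> cusp_order c ?rs"
      using check unfolding ord by (fastforce simp: check_level_def list_all_iff)
    show "\<forall>(c, d)\<in>set L. coprime c d"
      using check by (auto simp: check_level_def list_all_iff coprime_iff_gcd_eq_1)
    show "\<forall>(c, d)\<in>?R. \<exists>(c', d')\<in>insert (0, 1) ?R. int N dvd d * d' + c * c'"
      "\<forall>(c, d)\<in>set L. \<exists>(c', d')\<in>insert (0, 1) ?R. int N dvd c * d' - c' * (c + d)"
      using check unfolding check_level_def Let_def list_all_iff list_ex_iff R list.set(2) by blast+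
    show "degree Pn \<le> factors_degree Pf * compose_degree cs" "degree Qn \<le> factors_degree Qf * compose_degree cs"
      unfolding Pn_def Qn_def by (rule degree_level_poly)+
    show "factors_degree Qf * compose_degree cs + N \<le> factors_degree Pf * compose_degree cs"
      "factors_degree Pf * compose_degree cs + length L < K"
      using check by (simp_all add: check_level_def)
    show "order_ge (\<lambda>\<tau>. poly Pn (t \<tau>) - klein_j \<tau> * poly Qn (t \<tau>)) (real K)"
      unfolding Pn_def Qn_def level_poly_def
      by (rule check_relation_order_ge[OF _ _ rel]) (simp_all add: eta_exponents_def)
  qed
  have root: "poly (P * Qn - Pn * Q) (t \<tau>) = 0" if "Im \<tau> > 0" for \<tau>
    using rel'[OF that] klein_j_eq[OF that] Q_nonzero[OF that] by simp
  have eq: "P * Qn = Pn * Q"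
  proof (rule ccontr)
    assume "P * Qn \<noteq> Pn * Q"
    hence "finite {x. poly (P * Qn - Pn * Q) x = 0}" by (intro poly_roots_finite) simp
    \<comment> \<open>t tends to 0 at infinity without ever being 0, so far up it avoids the
      finitely many nonzero roots, although each of its values is a root.\<close>
    hence fin: "finite ({x. poly (P * Qn - Pn * Q) x = 0} - {0})" by simp
    have "eventually (\<lambda>\<tau>. \<forall>x\<in>{x. poly (P * Qn - Pn * Q) x = 0} - {0}. t \<tau> \<noteq> x) cusp"
      by (intro eventually_ball_finite[OF fin] ballI tendsto_imp_eventually_ne[OF tendsto_t]) auto
    hence "eventually (\<lambda>\<tau>. False) cusp"
      using eventually_cusp_Im_gt[of 0]
    proof eventually_elim
      case (elim \<tau>)
      thus ?case using root[of \<tau>] t_nonzero[of \<tau>] by blast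
    qed
    thus False by simp
  qed
  have P0: "P \<noteq> 0" using Q1 \<kappa> by auto
  have Pn0: "Pn \<noteq> 0"
  proof
    assume "Pn = 0"
    hence z: "factors Pf (compose_horner cs x) = 0" for x :: complex
      using poly_level_poly[of cs Pf x] by (simp add: Pn_def)
    have "Qn = 0" using eq \<open>Pn = 0\<close> P0 by simp
    hence "factors Qf (compose_horner cs (0::complex)) = 0"
      using poly_level_poly[of cs Qf 0] by (simp add: Qn_def)
    thus False using no_root z by blast
  qed
  \<comment> \<open>A common zero of the composites gives a common zero of the uncomposed factors at
    the composed argument.\<close>
  have cop: "coprime Pn Qn"
    by (rule coprime_polyI[OF _ Pn0]) (use no_root in \<open>auto simp: Pn_def Qn_def poly_level_poly\<close>)
  have "P dvd Pn" using eq coprime by (metis coprime_dvd_mult_left_iff dvd_triv_left)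
  moreover have "Pn dvd P" using eq cop by (metis coprime_dvd_mult_left_iff dvd_triv_left)
  ultimately obtain u v where uv: "Pn = P * u" "P = Pn * v" by (elim dvdE)
  hence "Pn * (v * u) = Pn * 1" by (metis mult.assoc mult_1_right)
  hence "v * u = 1" by (simp only: mult_left_cancel[OF Pn0])
  hence "is_unit v" by (metis dvd_triv_left)
  then obtain c where c: "v = [:c:]" "is_unit c" by (auto simp: is_unit_poly_iff)
  hence c0: "c \<noteq> 0" by auto
  have Pc: "P = smult c Pn" using uv(2) c by simp
  have "Pn * Q = Pn * smult c Qn" using eq[symmetric] unfolding Pc by simp
  hence "Q = smult c Qn" by (simp only: mult_left_cancel[OF Pn0])
  thus "\<exists>c. c \<noteq> 0 \<and> P = smult c (level_poly cs Pf) \<and> Q = smult c (level_poly cs Qf)"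
    using Pc c0 unfolding Pn_def Qn_def by blast
qed

section \<open>The holomorphic solution\<close>

definition gauss_series :: "complex fps" where
  "gauss_series = fps_hypergeo [1/12, 5/12] [1] 1"

lemma gauss_series_rec:
  "of_nat (Suc n) ^ 2 * fps_nth gauss_series (Suc n) = (1/12 + of_nat n) * (5/12 + of_nat n) * fps_nth gauss_series n"
proof -
  have nz: "(of_nat (Suc n) :: complex) \<noteq> 0" by (simp del: of_nat_Suc)
  have "fps_nth gauss_series (Suc n) =
      (1/12 + of_nat n) * (5/12 + of_nat n) / (of_nat (Suc n) * of_nat (Suc n)) * fps_nth gauss_series n"
    unfolding gauss_series_def fps_hypergeo_rec by simp
  thus ?thesis using nz by (simp add: power2_eq_square del: of_nat_Suc)
qed

text \<open>The ratio (1/12 + n)(5/12 + n) / (n + 1)^2 of consecutive coefficients is below 1, and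
  the first coefficient is 1.\<close>

lemma gauss_series_nth_bound: "norm (fps_nth gauss_series n) \<le> 1"
proof (induction n)
  case 0
  show ?case by (simp add: gauss_series_def)
next
  case (Suc n)
  have "real (Suc n) ^ 2 * norm (fps_nth gauss_series (Suc n)) =
      norm (1/12 + of_nat n :: complex) * norm (5/12 + of_nat n :: complex) * norm (fps_nth gauss_series n)"
    using arg_cong[OF gauss_series_rec[of n], of norm]
    unfolding norm_mult norm_power norm_of_nat .
  also have "norm (1/12 + of_nat n :: complex) = 1/12 + real n"
    using norm_of_real[of "1/12 + real n", where 'a = complex] by simp
  also have "norm (5/12 + of_nat n :: complex) = 5/12 + real n"
    using norm_of_real[of "5/12 + real n", where 'a = complex] by simp
  also have "(1/12 + real n) * (5/12 + real n) * norm (fps_nth gauss_series n) \<le> real (Suc n) * real (Suc n) * 1"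
    using Suc.IH by (intro mult_mono) auto
  finally have "real (Suc n) ^ 2 * norm (fps_nth gauss_series (Suc n)) \<le> real (Suc n) ^ 2 * 1"
    by (simp only: power2_eq_square mult_1_right)
  thus ?case by (rule mult_left_le_imp_le) simp
qed

lemma gauss_series_conv_radius: "fps_conv_radius gauss_series \<ge> 1"
  unfolding fps_conv_radius_def
proof (rule conv_radius_geI_ex')
  fix r :: real assume r: "0 < r" "ereal r < 1"
  show "summable (\<lambda>n. fps_nth gauss_series n * of_real r ^ n)"
  proof (rule summable_comparison_test'[where N = 0])
    show "summable (\<lambda>n. r ^ n)" using r by (intro summable_geometric) auto
    show "norm (fps_nth gauss_series n * of_real r ^ n) \<le> r ^ n" for n
      using r gauss_series_nth_bound[of n] by (simp add: norm_mult norm_power mult_left_le_one_le)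
  qed
qed

text \<open>The hypergeometric equation multiplied by x (1 - x), so that its coefficients are
  polynomials; comparing coefficients it becomes the recurrence.\<close>

lemma gauss_series_ode:
  "fps_X * (1 - fps_X) * fps_deriv (fps_deriv gauss_series) +
   (1 - fps_const (3/2) * fps_X) * fps_deriv gauss_series - fps_const (5/144) * gauss_series = 0"
proof (rule fps_ext)
  fix n
  let ?a = "fps_nth gauss_series"
  have X: "fps_nth (fps_X * f) n = (if n = 0 then 0 else fps_nth f (n - 1))" for f :: "complex fps" by simp
  have XX: "fps_nth (fps_X * (fps_X * f)) n = (if n < 2 then 0 else fps_nth f (n - 2))" for f :: "complex fps"
    by (auto simp: numeral_2_eq_2)
  have e: "fps_X * (1 - fps_X) * fps_deriv (fps_deriv gauss_series) +
   (1 - fps_const (3/2) * fps_X) * fps_deriv gauss_series - fps_const (5/144) * gauss_series =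
   fps_X * fps_deriv (fps_deriv gauss_series) - fps_X * (fps_X * fps_deriv (fps_deriv gauss_series)) +
   fps_deriv gauss_series - fps_const (3/2) * (fps_X * fps_deriv gauss_series) - fps_const (5/144) * gauss_series"
    by (simp add: algebra_simps)
  have 1: "fps_nth (fps_X * fps_deriv (fps_deriv gauss_series)) n = of_nat n * of_nat (Suc n) * ?a (Suc n)"
    unfolding X by (cases n) auto
  have 2: "fps_nth (fps_X * (fps_X * fps_deriv (fps_deriv gauss_series))) n = (of_nat n * of_nat n - of_nat n) * ?a n"
  proof (cases "n < 2")
    case True
    hence "n = 0 \<or> n = 1" by auto
    thus ?thesis unfolding XX using True by auto
  next
    case False
    then obtain m where "n = Suc (Suc m)" by (metis less_2_cases_iff not0_implies_Suc One_nat_def)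
    thus ?thesis unfolding XX by (simp add: algebra_simps)
  qed
  have 3: "fps_nth (fps_X * fps_deriv gauss_series) n = of_nat n * ?a n"
    unfolding X by (cases n) auto
  have "fps_nth (fps_X * (1 - fps_X) * fps_deriv (fps_deriv gauss_series) +
   (1 - fps_const (3/2) * fps_X) * fps_deriv gauss_series - fps_const (5/144) * gauss_series) n =
     of_nat (Suc n) ^ 2 * ?a (Suc n) - (1/12 + of_nat n) * (5/12 + of_nat n) * ?a n"
    unfolding e fps_sub_nth fps_add_nth fps_mult_left_const_nth 1 2 3 fps_deriv_nth
    by (simp add: algebra_simps power2_eq_square)
  thus "fps_nth (fps_X * (1 - fps_X) * fps_deriv (fps_deriv gauss_series) +
   (1 - fps_const (3/2) * fps_X) * fps_deriv gauss_series - fps_const (5/144) * gauss_series) n = fps_nth 0 n"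
    by (simp only: gauss_series_rec) simp
qed

lemma gauss_radius:
  assumes "norm (x :: complex) < 1"
  shows "norm x < fps_conv_radius gauss_series" "norm x < fps_conv_radius (fps_deriv gauss_series)"
    "norm x < fps_conv_radius (fps_deriv (fps_deriv gauss_series))"
proof -
  have "ereal (norm x) < 1" using assms by (simp add: one_ereal_def)
  thus 1: "norm x < fps_conv_radius gauss_series" using gauss_series_conv_radius by (rule less_le_trans)
  show 2: "norm x < fps_conv_radius (fps_deriv gauss_series)" by (rule less_le_trans[OF 1 fps_conv_radius_deriv])
  show "norm x < fps_conv_radius (fps_deriv (fps_deriv gauss_series))"
    by (rule less_le_trans[OF 2 fps_conv_radius_deriv])
qed

lemma eval_gauss_series_ode:
  assumes x: "norm (x :: complex) < 1"
  shows "x * (1 - x) * eval_fps (fps_deriv (fps_deriv gauss_series)) x +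
   (1 - 3/2 * x) * eval_fps (fps_deriv gauss_series) x - 5/144 * eval_fps gauss_series x = 0"
proof -
  have m: "norm x < fps_conv_radius (f * g)" if "norm x < fps_conv_radius f" "norm x < fps_conv_radius g" for f g
    by (rule less_le_trans[OF _ fps_conv_radius_mult]) (use that in auto)
  have p: "norm x < fps_conv_radius (f + g)" if "norm x < fps_conv_radius f" "norm x < fps_conv_radius g" for f g
    by (rule less_le_trans[OF _ fps_conv_radius_add]) (use that in auto)
  have d: "norm x < fps_conv_radius (f - g)" if "norm x < fps_conv_radius f" "norm x < fps_conv_radius g" for f g
    by (rule less_le_trans[OF _ fps_conv_radius_diff]) (use that in auto)
  have r: "norm x < fps_conv_radius (fps_const c :: complex fps)" "norm x < fps_conv_radius (fps_X :: complex fps)"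
     "norm x < fps_conv_radius (1 :: complex fps)" for c by auto
  have "eval_fps (fps_X * (1 - fps_X) * fps_deriv (fps_deriv gauss_series) +
   (1 - fps_const (3/2) * fps_X) * fps_deriv gauss_series - fps_const (5/144) * gauss_series) x = 0"
    unfolding gauss_series_ode by simp
  thus ?thesis
    by (simp only: eval_fps_add eval_fps_diff eval_fps_mult m p d r gauss_radius[OF x] eval_fps_X eval_fps_const eval_fps_1)
qed

text \<open>The constant c will absorb a twelfth root of P(0). The point x = 0 is left out because
  the normalized equation is singular there.\<close>

lemma gauss_function_solves:
  fixes c x :: complex
  assumes x: "norm x < 1" "x \<noteq> 0"
  defines "u \<equiv> (\<lambda>x. c * eval_fps gauss_series x)"
  shows "u analytic_on {x}" "deriv (deriv u) x + gauss_A x * deriv u x + gauss_B x * u x = 0"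
proof -
  have "eval_fps gauss_series analytic_on {x}"
    by (rule analytic_on_eval_fps) (use gauss_radius(1)[OF x(1)] in \<open>auto simp: in_eball_iff\<close>)
  thus "u analytic_on {x}" unfolding u_def by (rule analytic_on_mult[OF analytic_on_const])
  have du: "(u has_field_derivative c * eval_fps (fps_deriv gauss_series) y) (at y)" if "norm y < 1" for y
    unfolding u_def by (intro DERIV_cmult has_field_derivative_eval_fps gauss_radius that)
  have "eventually (\<lambda>y. y \<in> ball 0 1) (nhds x)" by (rule eventually_nhds_in_open) (use x in auto)
  hence "eventually (\<lambda>y. deriv u y = c * eval_fps (fps_deriv gauss_series) y) (nhds x)"
    by eventually_elim (use DERIV_imp_deriv[OF du] in simp)
  hence "deriv (deriv u) x = deriv (\<lambda>y. c * eval_fps (fps_deriv gauss_series) y) x"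
    by (rule deriv_cong_ev) simp
  also have "\<dots> = c * eval_fps (fps_deriv (fps_deriv gauss_series)) x"
    by (intro DERIV_imp_deriv DERIV_cmult has_field_derivative_eval_fps gauss_radius x)
  finally have ddu: "deriv (deriv u) x = c * eval_fps (fps_deriv (fps_deriv gauss_series)) x" .
  define U0 where "U0 = eval_fps gauss_series x"
  define U1 where "U1 = eval_fps (fps_deriv gauss_series) x"
  define U2 where "U2 = eval_fps (fps_deriv (fps_deriv gauss_series)) x"
  have ode: "x * (1 - x) * U2 + (1 - 3/2 * x) * U1 - 5/144 * U0 = 0"
    unfolding U0_def U1_def U2_def by (rule eval_gauss_series_ode[OF x(1)])
  have x1: "x - 1 \<noteq> 0" using x by auto
  have nz: "x * (x - 1) \<noteq> 0" using x x1 by simp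
  have A: "gauss_A x * (x * (x - 1)) = 3/2 * x - 1"
  proof -
    have *: "1 / (2 * y) * (x * y) = x / 2" if "y \<noteq> 0" for y using that by simp
    have "1 / x * (x * (x - 1)) = x - 1" "1 / (2 * (x - 1)) * (x * (x - 1)) = x / 2" using x *[OF x1] by simp_all
    thus ?thesis unfolding gauss_A_def distrib_right by simp
  qed
  have B: "gauss_B x * (x * (x - 1)) = 5/144" unfolding gauss_B_def using nz by simp
  have "(U2 + gauss_A x * U1 + gauss_B x * U0) * (x * (x - 1)) =
      U2 * (x * (x - 1)) + (gauss_A x * (x * (x - 1))) * U1 + (gauss_B x * (x * (x - 1))) * U0"
    by (simp add: algebra_simps)
  also have "\<dots> = - (x * (1 - x) * U2 + (1 - 3/2 * x) * U1 - 5/144 * U0)"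
    unfolding A B by (simp add: algebra_simps)
  finally have "(U2 + gauss_A x * U1 + gauss_B x * U0) * (x * (x - 1)) = 0" by (simp only: ode minus_zero)
  hence "U2 + gauss_A x * U1 + gauss_B x * U0 = 0" using nz by (simp only: mult_eq_0_iff) blast
  moreover have "deriv (deriv u) x + gauss_A x * deriv u x + gauss_B x * u x =
      c * (U2 + gauss_A x * U1 + gauss_B x * U0)"
    unfolding ddu DERIV_imp_deriv[OF du[OF x(1)]] by (simp add: u_def U0_def U1_def U2_def algebra_simps)
  ultimately show "deriv (deriv u) x + gauss_A x * deriv u x + gauss_B x * u x = 0" by simp
qed

text \<open>The simple zero of Q makes x vanish at 0 with nonzero derivative, so
  \<open>apply_picard_fuchs\<close> applies at all nearby points except 0 itself, where the equation
  is singular. Analyticity at 0 comes from the convergent series in x.\<close>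

theorem h_fun_solves_picard_fuchs:
  fixes P Q :: "complex poly"
  assumes P0: "poly P 0 \<noteq> 0" and Q0: "poly Q 0 = 0" and Q1: "poly (pderiv Q) 0 \<noteq> 0"
  shows "h_fun P Q analytic_on {0}"
    and "eventually (\<lambda>z. apply_op (picard_fuchs P Q) (h_fun P Q) z = 0) (at 0)"
proof -
  define x where "x = (\<lambda>t. 12^3 * poly Q t / poly P t)"
  define w where "w = (\<lambda>t. poly P t / poly P 0)"
  \<comment> \<open>A twelfth root of P(0), which makes f^12 = P exactly; the same factor in
    \<open>u\<close> cancels it in u(x) / f.\<close>
  define c where "c = exp (Ln (poly P 0) / 12)"
  define f where "f = (\<lambda>t. c * (w t powr (1/12)))"
  define u where "u = (\<lambda>x. c * eval_fps gauss_series x)"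
  have c12: "c ^ 12 = poly P 0" unfolding c_def using P0 by (simp add: exp_of_nat_mult[symmetric])
  have h: "h_fun P Q = (\<lambda>t. u (x t) / f t)"
  proof
    fix t
    have "w t powr (- (1/12)) = inverse (w t powr (1/12))" by (rule powr_minus)
    moreover have "c \<noteq> 0" by (simp add: c_def)
    ultimately show "h_fun P Q t = u (x t) / f t"
      by (simp add: h_fun_def w_def x_def u_def f_def gauss_series_def inverse_eq_divide)
  qed
  have cont: "isCont (poly p) 0" for p :: "complex poly" by simp
  have tpoly: "(poly p \<longlongrightarrow> poly p 0) (nhds 0)" for p :: "complex poly"
    using cont[of p] unfolding isCont_def tendsto_at_iff_tendsto_nhds .
  have tP: "(poly P \<longlongrightarrow> poly P 0) (nhds 0)" "(poly Q \<longlongrightarrow> 0) (nhds 0)"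
    using tpoly[of P] tpoly[of Q] unfolding Q0 by blast+
  have tw: "(w \<longlongrightarrow> 1) (nhds 0)" unfolding w_def using tendsto_divide[OF tP(1) tendsto_const P0] P0 by simp
  have tx: "(x \<longlongrightarrow> 0) (nhds 0)" unfolding x_def
    using tendsto_divide[OF tendsto_mult[OF tendsto_const tP(2)] tP(1) P0, of "12^3"] by simp
  define dx where "dx = (\<lambda>t. 12^3 * (poly (pderiv Q) t * poly P t - poly Q t * poly (pderiv P) t) / poly P t ^ 2)"
  have dx: "(x has_field_derivative dx t) (at t)" if "poly P t \<noteq> 0" for t
    unfolding x_def dx_def using that
    by (auto intro!: derivative_eq_intros simp: power2_eq_square field_simps)
  have ev1: "eventually (\<lambda>t. poly P t \<noteq> 0) (nhds 0)"
    by (rule tendsto_imp_eventually_ne[OF tP(1) P0])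
  have ev2: "eventually (\<lambda>t. Re (w t) > 0) (nhds 0)"
    by (rule order_tendstoD(1)[OF tendsto_Re[OF tw]]) simp
  have ev3: "eventually (\<lambda>t. norm (x t) < 1) (nhds 0)"
    by (rule order_tendstoD(2)[OF tendsto_norm[OF tx]]) simp
  have "(dx \<longlongrightarrow> 12^3 * (poly (pderiv Q) 0 * poly P 0 - poly Q 0 * poly (pderiv P) 0) / poly P 0 ^ 2) (nhds 0)"
    unfolding dx_def using P0 by (intro tendsto_intros tpoly) auto
  hence ev4: "eventually (\<lambda>t. dx t \<noteq> 0) (nhds 0)"
    by (rule tendsto_imp_eventually_ne) (use P0 Q0 Q1 in auto)
  have "eventually (\<lambda>t. poly P t \<noteq> 0 \<and> Re (w t) > 0 \<and> norm (x t) < 1 \<and> dx t \<noteq> 0) (nhds 0)"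
    using ev1 ev2 ev3 ev4 by eventually_elim auto
  then obtain V where V: "open V" "0 \<in> V"
    "\<And>t. t \<in> V \<Longrightarrow> poly P t \<noteq> 0 \<and> Re (w t) > 0 \<and> norm (x t) < 1 \<and> dx t \<noteq> 0"
    by (auto simp: eventually_nhds)
  have w_holo: "w holomorphic_on V" unfolding w_def poly_altdef by (intro holomorphic_intros)
      (use P0 in \<open>auto simp: poly_altdef\<close>)
  have w_slit: "w t \<notin> \<real>\<^sub>\<le>\<^sub>0" if "t \<in> V" for t
    using V(3)[OF that] by (auto simp: complex_nonpos_Reals_iff)
  have f_holo: "f holomorphic_on V"
    unfolding f_def by (intro holomorphic_intros w_holo) (use w_slit in auto)
  have w0: "w t \<noteq> 0" if "t \<in> V" for t using V(3)[OF that] by auto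
  have f0: "f t \<noteq> 0" if "t \<in> V" for t using w0[OF that] by (simp add: f_def c_def)
  have f12: "f t ^ 12 = poly P t" if "t \<in> V" for t
  proof -
    have "(w t powr (1/12)) ^ 12 = w t"
      using w0[OF that] by (simp add: powr_def exp_of_nat_mult[symmetric])
    thus ?thesis using P0 by (simp add: f_def power_mult_distrib c12 w_def)
  qed
  have x_holo: "x holomorphic_on V"
    unfolding holomorphic_on_open[OF V(1)] using dx V(3) by blast
  have "(eval_fps gauss_series \<circ> x) holomorphic_on V"
    by (rule holomorphic_on_compose_gen[OF x_holo holomorphic_on_eval_fps[of "ball 0 1"]])
       (use V(3) gauss_radius(1) in \<open>auto simp: in_eball_iff\<close>)
  hence "(\<lambda>t. u (x t) / f t) holomorphic_on V"
    unfolding u_def o_def by (intro holomorphic_intros f_holo) (use f0 in auto)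
  hence "h_fun P Q analytic_on V" unfolding h by (simp add: analytic_on_open[OF V(1)])
  thus "h_fun P Q analytic_on {0}" by (rule analytic_on_subset) (use V in auto)

  have "eventually (\<lambda>t. poly Q t \<noteq> 0) (at 0)"
  proof -
    have "Q \<noteq> 0" using Q1 by auto
    hence "\<not> 0 islimpt {t. poly Q t = 0}" by (intro islimpt_finite poly_roots_finite)
    thus ?thesis unfolding islimpt_iff_eventually by simp
  qed
  moreover have "eventually (\<lambda>t. t \<in> V) (at 0)"
    using V eventually_nhds_in_open[OF V(1,2)] by (auto simp: eventually_at_filter elim: eventually_mono)
  ultimately show "eventually (\<lambda>z. apply_op (picard_fuchs P Q) (h_fun P Q) z = 0) (at 0)"
  proof eventually_elim
    case (elim z)
    have x1: "norm (x z) < 1" and Pz: "poly P z \<noteq> 0" and dxz: "dx z \<noteq> 0" using V(3)[OF elim(2)] by auto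
    have x0: "x z \<noteq> 0" using elim(1) Pz by (simp add: x_def)
    have x1': "x z \<noteq> 1" using x1 by auto
    have dx': "deriv x z \<noteq> 0" using DERIV_imp_deriv[OF dx[OF Pz]] dxz by simp
    have u': "u analytic_on {x z}" unfolding u_def by (rule gauss_function_solves(1)[OF x1 x0])
    have f': "f analytic_on {z}"
      using f_holo V(1) elim(2) analytic_on_open analytic_on_subset by (metis empty_subsetI insert_subset)
    have f12': "eventually (\<lambda>t. f t ^ 12 = poly P t) (nhds z)"
      using eventually_nhds_in_open[OF V(1) elim(2)] by eventually_elim (rule f12)
    have "apply_op (picard_fuchs P Q) (\<lambda>t. u (x t) / f t) z =
      deriv x z ^ 2 / f z * (deriv (deriv u) (x z) + gauss_A (x z) * deriv u (x z) + gauss_B (x z) * u (x z))"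
      unfolding x_def
      by (rule apply_picard_fuchs[OF Pz x0[unfolded x_def] x1'[unfolded x_def] dx'[unfolded x_def] u'[unfolded x_def] f' f12'])
    also have "\<dots> = 0" using gauss_function_solves(2)[OF x1 x0, of c] by (simp add: u_def)
    finally show ?case unfolding h .
  qed
qed

section \<open>The pulled-back operator\<close>

lemma rf_deriv_to_fract: "rf_deriv (to_fract p) = to_fract (pderiv p)"
  using rf_deriv_Fract[of 1 p] by (simp add: to_fract_def pderiv_1)

lemma rf_deriv_const: "rf_deriv (to_fract [:c:]) = 0"
  by (simp add: rf_deriv_to_fract pderiv_pCons)

lemma of_nat_ratfun: "(of_nat n :: ratfun) = to_fract [:of_nat n:]"
  by (simp add: to_fract_def Fract_of_nat_eq[symmetric] of_nat_poly)

lemma numeral_ratfun: "(numeral n :: ratfun) = to_fract [:numeral n:]"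
  using of_nat_ratfun[of "numeral n"] by simp

text \<open>Characteristic 0 makes numerals such as 12 or 1728 cancellable among rational
  functions.\<close>

instance fract :: ("{idom, ring_char_0}") field_char_0
  by standard (auto intro!: injI simp: Fract_of_nat_eq[symmetric] eq_fract)

lemma rf_deriv_numeral [simp]: "rf_deriv (numeral n) = 0"
  by (simp add: numeral_ratfun rf_deriv_const)

lemma rf_deriv_1 [simp]: "rf_deriv 1 = 0"
  using rf_deriv_const[of 1] of_nat_ratfun[of 1] by simp

lemma rf_deriv_0 [simp]: "rf_deriv 0 = 0"
  using rf_deriv_const[of 0] of_nat_ratfun[of 0] by simp

lemma rf_var_conv: "rf_var = to_fract [:0, 1:]"
  by (simp add: rf_var_def to_fract_def)

lemma rf_deriv_var [simp]: "rf_deriv rf_var = 1"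
  using of_nat_ratfun[of 1] by (simp add: rf_var_conv rf_deriv_to_fract pderiv_pCons)

lemma rf_deriv_add [simp]: "rf_deriv (a + b) = rf_deriv a + rf_deriv b"
proof -
  obtain p q where a: "a = Fract p q" "q \<noteq> 0" by (cases a rule: Fract_cases) auto
  obtain r s where b: "b = Fract r s" "s \<noteq> 0" by (cases b rule: Fract_cases) auto
  show ?thesis using a(2) b(2) unfolding a(1) b(1)
    by (simp add: rf_deriv_Fract eq_fract pderiv_add pderiv_mult) algebra
qed

lemma rf_deriv_mult [simp]: "rf_deriv (a * b) = rf_deriv a * b + a * rf_deriv b"
proof -
  obtain p q where a: "a = Fract p q" "q \<noteq> 0" by (cases a rule: Fract_cases) auto
  obtain r s where b: "b = Fract r s" "s \<noteq> 0" by (cases b rule: Fract_cases) auto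
  show ?thesis using a(2) b(2) unfolding a(1) b(1)
    by (simp add: rf_deriv_Fract eq_fract pderiv_add pderiv_mult) algebra
qed

lemma rf_deriv_minus [simp]: "rf_deriv (- a) = - rf_deriv a"
  using rf_deriv_add[of a "- a"] by (simp add: eq_neg_iff_add_eq_0 add.commute)

lemma rf_deriv_diff [simp]: "rf_deriv (a - b) = rf_deriv a - rf_deriv b"
  using rf_deriv_add[of a "- b"] by simp

lemma rf_deriv_power_Suc: "rf_deriv (a ^ Suc n) = of_nat (Suc n) * a ^ n * rf_deriv a"
  by (induction n) (simp_all add: algebra_simps)

lemma rf_deriv_power [simp]: "rf_deriv (a ^ numeral n) = numeral n * a ^ pred_numeral n * rf_deriv a"
proof -
  have "numeral n = Suc (pred_numeral n)" by (rule numeral_eq_Suc)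
  thus ?thesis using rf_deriv_power_Suc[of a "pred_numeral n"] by (metis of_nat_numeral)
qed

definition logderiv :: "ratfun \<Rightarrow> ratfun" where "logderiv a = rf_deriv a / a"

lemma logderiv_mult: "a \<noteq> 0 \<Longrightarrow> b \<noteq> 0 \<Longrightarrow> logderiv (a * b) = logderiv a + logderiv b"
  by (simp add: logderiv_def add_divide_distrib)

lemma logderiv_power: "a \<noteq> 0 \<Longrightarrow> logderiv (a ^ n) = of_nat n * logderiv a"
  by (induction n) (simp_all add: logderiv_mult algebra_simps, simp add: logderiv_def)

lemma logderiv_divide:
  assumes "a \<noteq> 0" "b \<noteq> 0"
  shows "logderiv (a / b) = logderiv a - logderiv b"
proof -
  have "logderiv a = logderiv (a / b) + logderiv b"
    using logderiv_mult[of "a / b" b] assms by simp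
  thus ?thesis by simp
qed

lemma logderiv_numeral [simp]: "logderiv (numeral n) = 0"
  by (simp add: logderiv_def)

lemma logderiv_minus [simp]: "logderiv (- a) = logderiv a"
  by (simp add: logderiv_def)

lemma rf_deriv_divide:
  assumes "b \<noteq> 0"
  shows "rf_deriv (a / b) = (rf_deriv a * b - a * rf_deriv b) / b ^ 2"
proof -
  have "rf_deriv a = rf_deriv (a / b) * b + a / b * rf_deriv b"
    using rf_deriv_mult[of "a / b" b] assms by simp
  hence "rf_deriv a * b - a * rf_deriv b = rf_deriv (a / b) * b ^ 2"
    using assms by (simp add: algebra_simps power2_eq_square)
  thus ?thesis using assms by simp
qed

text \<open>The operator for arbitrary rational functions p and q: composites with y are formed
  inside the field, without returning to polynomials.\<close>

definition pf_operator :: "ratfun \<Rightarrow> ratfun \<Rightarrow> monic_op2" where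
  "pf_operator p q = conj_op (- (1/12) * (rf_deriv p / p)) (pullback_op gauss_A gauss_B (12^3 * q / p))"

lemma picard_fuchs_conv: "picard_fuchs P Q = pf_operator (to_fract P) (to_fract Q)"
  by (simp add: picard_fuchs_def pf_operator_def Let_def)

text \<open>The factorizations express that \<open>1728 q/p\<close> is ramified of order 3 over \<open>0\<close> (at the zeros of \<open>p3\<close>)
  and of order 2 over \<open>1\<close> (at those of \<open>s2\<close>); \<open>p1\<close> and \<open>s1\<close> carry the elliptic points.\<close>

lemma pf_operator_formula:
  assumes nz: "p3 \<noteq> 0" "p1 \<noteq> 0" "s1 \<noteq> 0" "s2 \<noteq> 0" "q \<noteq> 0" "Z \<noteq> 0"
    and p: "p = p3 ^ 3 * p1" and s: "p - 1728 * q = s2 ^ 2 * s1"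
    and W: "rf_deriv q * p - q * rf_deriv p = p3 ^ 2 * s2 * Z"
  defines "A \<equiv> logderiv q + logderiv s1 / 2 - logderiv Z + 2 / 3 * logderiv p1"
  shows "pf_operator p q = (A, - 60 * Z ^ 2 / (p3 ^ 2 * p1 ^ 2 * q * s1) + A * logderiv p / 12 +
     rf_deriv (logderiv p) / 12 - logderiv p ^ 2 / 144)"
proof -
  define X where "X = 12^3 * q / p"
  define g where "g = logderiv p / 12"
  have p0: "p \<noteq> 0" using nz by (simp add: p)
  have X0: "X \<noteq> 0" using nz p0 by (simp add: X_def)
  have X1: "X - 1 = - (s2 ^ 2 * s1 / p)"
    using p0 by (simp add: X_def s[symmetric] diff_divide_distrib)
  have X10: "X - 1 \<noteq> 0" unfolding X1 using nz p0 by simp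
  have DX: "rf_deriv X = 1728 * (p3 ^ 2 * s2 * Z / p ^ 2)"
  proof -
    have "rf_deriv X = 1728 * (rf_deriv q * p - q * rf_deriv p) / p ^ 2"
      unfolding X_def by (simp add: rf_deriv_divide[OF p0] right_diff_distrib mult.assoc)
    thus ?thesis unfolding W by simp
  qed
  have DX0: "rf_deriv X \<noteq> 0" unfolding DX using nz p0 by simp
  have lp: "logderiv p = 3 * logderiv p3 + logderiv p1"
    unfolding p using nz by (simp add: logderiv_mult logderiv_power)
  have lX: "logderiv X = logderiv q - logderiv p"
    unfolding X_def using nz p0 by (simp add: logderiv_divide logderiv_mult)
  have lX1: "logderiv (X - 1) = 2 * logderiv s2 + logderiv s1 - logderiv p"
    unfolding X1 using nz p0 by (simp add: logderiv_divide logderiv_mult logderiv_power)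
  have lDX: "logderiv (rf_deriv X) = 2 * logderiv p3 + logderiv s2 + logderiv Z - 2 * logderiv p"
    unfolding DX using nz p0 by (simp add: logderiv_divide logderiv_mult logderiv_power)
  have "gauss_A X * rf_deriv X = logderiv X + logderiv (X - 1) / 2"
    by (simp add: gauss_A_def logderiv_def distrib_right)
  hence A0: "gauss_A X * rf_deriv X - rf_deriv (rf_deriv X) / rf_deriv X = A - 2 * g"
  proof -
    assume *: "gauss_A X * rf_deriv X = logderiv X + logderiv (X - 1) / 2"
    have "gauss_A X * rf_deriv X - rf_deriv (rf_deriv X) / rf_deriv X = logderiv X + logderiv (X - 1) / 2 - logderiv (rf_deriv X)"
      unfolding * by (simp only: logderiv_def)
    \<comment> \<open>The zeros of s2 cancel between X - 1 and X'. Those of p3 disappear from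
      \<open>A\<close> through the term \<open>2 * g\<close>, which is the effect of the conjugation
      by p^(-1/12).\<close>
    also have "\<dots> = A - 2 * g" unfolding lX lX1 lDX A_def g_def lp by (simp add: field_simps)
    finally show ?thesis .
  qed
  have B0: "gauss_B X * rf_deriv X ^ 2 = - 60 * Z ^ 2 / (p3 ^ 2 * p1 ^ 2 * q * s1)"
  proof -
    \<comment> \<open>5/144 comes from the Gauss operator and 1728 from X'^2 / X; their product is
      the 60.\<close>
    have "gauss_B X * rf_deriv X ^ 2 = - (5 / 144 * 1728) * ((p3 ^ 2 * s2 * Z) ^ 2 / (p ^ 2 * q * s2 ^ 2 * s1))"
      unfolding gauss_B_def X1 DX unfolding X_def using nz p0
      by (simp add: power2_eq_square mult_ac)
    also have "(p3 ^ 2 * s2 * Z) ^ 2 / (p ^ 2 * q * s2 ^ 2 * s1) = Z ^ 2 / (p3 ^ 2 * p1 ^ 2 * q * s1)"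
    proof -
      have "(p3 ^ 2 * s2 * Z) ^ 2 = (p3 ^ 4 * s2 ^ 2) * Z ^ 2"
        "p ^ 2 * q * s2 ^ 2 * s1 = (p3 ^ 4 * s2 ^ 2) * (p3 ^ 2 * p1 ^ 2 * q * s1)" unfolding p by algebra+
      thus ?thesis using nz by (simp only: mult_divide_mult_cancel_left mult_eq_0_iff power_eq_0_iff) simp
    qed
    finally show ?thesis by simp
  qed
  have "rf_deriv g = rf_deriv (logderiv p) / 12" unfolding g_def by (simp add: rf_deriv_divide power2_eq_square)
  moreover have "- (1/12) * (rf_deriv p / p) = - g" by (simp add: g_def logderiv_def)
  ultimately have "pf_operator p q = (A - 2 * g - 2 * (- g), gauss_B X * rf_deriv X ^ 2 - (A - 2 * g) * (- g) + (- g) ^ 2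
      - (- (rf_deriv (logderiv p) / 12)))"
    unfolding pf_operator_def conj_op_def pullback_op_def Let_def X_def[symmetric] prod.case
    by (simp only: A0 rf_deriv_minus)
  also have "\<dots> = (A, - 60 * Z ^ 2 / (p3 ^ 2 * p1 ^ 2 * q * s1) + A * logderiv p / 12 +
     rf_deriv (logderiv p) / 12 - logderiv p ^ 2 / 144)"
    unfolding B0 by (simp add: g_def field_simps power2_eq_square)
  finally show ?thesis .
qed

text \<open>Apart from the one on logarithmic derivatives, the identities assumed here are
  polynomial. n0 y1 is the numerator of the logarithmic derivative of p over the denominator p3 p1;
  \<open>w\<close> clears the hypergeometric term, and 144 clears the denominators due to the
  exponent 1/12. In the last identity the two terms with the derivative of y1 cancel, so the second
  coefficient is free of y''.\<close>

lemma pf_operator_criterion: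
  assumes nz: "p3 \<noteq> 0" "p1 \<noteq> 0" "s1 \<noteq> 0" "s2 \<noteq> 0" "q \<noteq> 0" "Z \<noteq> 0" "v \<noteq> 0" "y1 \<noteq> 0"
    and p: "p = p3 ^ 3 * p1" and s: "p - 1728 * q = s2 ^ 2 * s1"
    and W: "rf_deriv q * p - q * rf_deriv p = p3 ^ 2 * s2 * Z"
    and n: "3 * rf_deriv p3 * p1 + p3 * rf_deriv p1 = n0 * y1"
    and A: "logderiv q + logderiv s1 / 2 - logderiv Z + 2 / 3 * logderiv p1 = u / v - logderiv y1"
    and w: "- 60 * Z ^ 2 * v = w * (q * s1)"
    and B: "144 * w + 12 * u * (n0 * y1) * (p3 * p1) - 12 * v * rf_deriv y1 * n0 * (p3 * p1) +
       12 * v * (rf_deriv (n0 * y1) * (p3 * p1) - n0 * y1 * rf_deriv (p3 * p1)) - v * (n0 * y1) ^ 2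
       = 144 * \<beta> * (p3 * p1) ^ 2"
  shows "pf_operator p q = (u / v - logderiv y1, \<beta> / v)"
proof -
  define M where "M = p3 * p1"
  define n where "n = n0 * y1"
  have M0: "M \<noteq> 0" using nz by (simp add: M_def)
  have "logderiv p = 3 * logderiv p3 + logderiv p1"
    unfolding p using nz by (simp add: logderiv_mult logderiv_power)
  also have "\<dots> = n / M"
    unfolding n_def n[symmetric] M_def logderiv_def using nz by (simp add: field_simps)
  finally have lp: "logderiv p = n / M" .
  have 1: "- 60 * Z ^ 2 / (p3 ^ 2 * p1 ^ 2 * q * s1) = w / v / M ^ 2"
  proof -
    have "- 60 * Z ^ 2 / (q * s1) = w / v" by (subst frac_eq_eq) (use w nz in auto)
    moreover have "- 60 * Z ^ 2 / (p3 ^ 2 * p1 ^ 2 * q * s1) = - 60 * Z ^ 2 / (q * s1) / M ^ 2"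
      by (simp add: M_def power_mult_distrib mult_ac)
    ultimately show ?thesis by simp
  qed
  have 2: "(u / v - logderiv y1) * (n / M) / 12 = (u * n * M - v * rf_deriv y1 * n0 * M) / (12 * v) / M ^ 2"
    using nz M0 unfolding n_def logderiv_def by (simp add: field_simps power2_eq_square)
  have 3: "rf_deriv (n / M) / 12 = (rf_deriv n * M - n * rf_deriv M) / 12 / M ^ 2"
    using M0 by (simp add: rf_deriv_divide)
  have "w / v / M ^ 2 + (u * n * M - v * rf_deriv y1 * n0 * M) / (12 * v) / M ^ 2 +
      (rf_deriv n * M - n * rf_deriv M) / 12 / M ^ 2 - (n / M) ^ 2 / 144 =
      (144 * w + 12 * u * n * M - 12 * v * rf_deriv y1 * n0 * M + 12 * v * (rf_deriv n * M - n * rf_deriv M) - v * n ^ 2)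
      / (144 * v * M ^ 2)"
    using nz M0 by (simp add: field_simps)
  also have "\<dots> = \<beta> / v"
    using B nz M0 unfolding M_def[symmetric] n_def[symmetric] by simp
  finally show ?thesis
    unfolding pf_operator_formula[OF nz(1-6) p s W] A lp 1 2 3 by simp
qed

text \<open>The lists give j as a function of the Hauptmodul in factored form. In a numerator,
  exponent 3 marks ramified points over j = 0 and exponent 1 the elliptic points of order 3; the
  roots of a denominator are the finite cusps, with their widths as exponents.\<close>

definition num_factors_2 :: "(int list \<times> nat) list" where "num_factors_2 = [([16, 1], 3)]"
definition den_factors_2 :: "(int list \<times> nat) list" where "den_factors_2 = [([0, 1], 1)]"
definition num_factors_3 :: "(int list \<times> nat) list" where "num_factors_3 = [([27, 1], 1), ([3, 1], 3)]"
definition den_factors_3 :: "(int list \<times> nat) list" where "den_factors_3 = [([0, 1], 1)]"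
definition num_factors_5 :: "(int list \<times> nat) list" where "num_factors_5 = [([5, 10, 1], 3)]"
definition den_factors_5 :: "(int list \<times> nat) list" where "den_factors_5 = [([0, 1], 1)]"
definition num_factors_6 :: "(int list \<times> nat) list" where "num_factors_6 = [([6, 1], 3), ([24, 84, 18, 1], 3)]"
definition den_factors_6 :: "(int list \<times> nat) list" where "den_factors_6 = [([0, 1], 1), ([9, 1], 2), ([8, 1], 3)]"
definition num_factors_7 :: "(int list \<times> nat) list" where "num_factors_7 = [([49, 13, 1], 1), ([1, 5, 1], 3)]"
definition den_factors_7 :: "(int list \<times> nat) list" where "den_factors_7 = [([0, 1], 1)]"
definition num_factors_10 :: "(int list \<times> nat) list" where "num_factors_10 = [([80, 1040, 1280, 640, 160, 20, 1], 3)]"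
definition den_factors_10 :: "(int list \<times> nat) list" where "den_factors_10 = [([0, 1], 1), ([5, 1], 2), ([4, 1], 5)]"
definition num_factors_13 :: "(int list \<times> nat) list" where "num_factors_13 = [([13, 5, 1], 1), ([1, 19, 20, 7, 1], 3)]"
definition den_factors_13 :: "(int list \<times> nat) list" where "den_factors_13 = [([0, 1], 1)]"
text \<open>Only non-constant polynomials are ever substituted. For them every nonzero polynomial
  expression with integer coefficients is nonzero, which is what the denominators require.\<close>

definition transcendental :: "ratfun \<Rightarrow> bool" where
  "transcendental y \<longleftrightarrow> (\<exists>f. degree f > 0 \<and> y = to_fract f)"

lemma to_fract_add_complex: "to_fract (p + q :: complex poly) = to_fract p + to_fract q"
  by (simp add: to_fract_def)

lemma to_fract_horner: "to_fract (horner cs p) = horner cs (to_fract (p :: complex poly))"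
proof (induction cs)
  case Nil
  show ?case by (simp add: to_fract_def Zero_fract_def)
next
  case (Cons c cs)
  have "to_fract (of_int c :: complex poly) = of_int c"
    by (cases c rule: int_cases2) (simp_all add: to_fract_def Fract_of_nat_eq flip: minus_fract)
  moreover have "to_fract (p * q) = to_fract p * to_fract q" for q
    by (simp add: to_fract_def)
  ultimately show ?case using Cons by (simp add: to_fract_add_complex)
qed

lemma degree_horner_eq:
  assumes "degree (p :: complex poly) > 0" "cs \<noteq> []" "last cs \<noteq> 0"
  shows "degree (horner cs p) = (length cs - 1) * degree p \<and> horner cs p \<noteq> 0"
  using assms(2,3)
proof (induction cs)
  case (Cons c cs)
  have 0: "p \<noteq> 0" using assms(1) by auto
  show ?case
  proof (cases "cs = []")
    case False
    hence IH: "degree (horner cs p) = (length cs - 1) * degree p" "horner cs p \<noteq> 0"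
      using Cons by auto
    have d: "degree (p * horner cs p) = length cs * degree p"
      using IH 0 False by (cases cs) (auto simp: degree_mult_eq)
    have "degree (of_int c :: complex poly) < degree (p * horner cs p)"
      using d assms(1) False by (simp add: of_int_poly)
    hence "degree (of_int c + p * horner cs p) = length cs * degree p"
      unfolding degree_add_eq_right[OF \<open>degree (of_int c) < degree (p * horner cs p)\<close>] d by simp
    moreover have "length cs * degree p \<noteq> 0" using assms(1) False by simp
    ultimately show ?thesis by auto
  qed (use Cons in auto)
qed auto

lemma transcendental_var: "transcendental rf_var"
  unfolding transcendental_def rf_var_conv by (rule exI[of _ "[:0, 1:]"]) simp

lemma transcendental_horner:
  assumes "transcendental y" "length cs > 1" "last cs \<noteq> 0"
  shows "transcendental (horner cs y)"
proof -
  obtain f where f: "degree f > 0" "y = to_fract f" using assms by (auto simp: transcendental_def)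
  have "cs \<noteq> []" using assms by auto
  from degree_horner_eq[OF f(1) this assms(3)] show ?thesis
    unfolding transcendental_def f(2) using f(1) assms(2)
    by (intro exI[of _ "horner cs f"]) (auto simp: to_fract_horner)
qed

text \<open>\<open>r\<close> is separate from its Horner form so that denominators can be stated in
  ordinary notation, leaving just a polynomial identity to prove.\<close>

lemma transcendental_ne_0:
  assumes "transcendental y" "cs \<noteq> []" "last cs \<noteq> 0" "r = horner cs y"
  shows "r \<noteq> 0"
proof -
  obtain f where f: "degree f > 0" "y = to_fract f" using assms by (auto simp: transcendental_def)
  show ?thesis unfolding assms(4) f(2)
    using degree_horner_eq[OF f(1) assms(2,3)] by (simp flip: to_fract_horner)
qed

lemma transcendental_deriv_ne_0: "transcendental y \<Longrightarrow> rf_deriv y \<noteq> 0"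
  by (auto simp: transcendental_def rf_deriv_to_fract pderiv_eq_0_iff)

section \<open>The operators of levels 2, 3, 5, 6, 7, 10 and 13 in a variable y\<close>

lemma frac_sum_2:
  assumes "f \<noteq> 0" "g \<noteq> 0" "k \<noteq> 0" "k * (a * g + \<beta> * b * f) = (u :: 'a :: field)"
  shows "a / f + \<beta> * (b / g) = u / (k * (f * g))"
  using assms(1-3) unfolding assms(4)[symmetric] by (simp add: field_simps)

lemma frac_sum_3:
  assumes "f \<noteq> 0" "g \<noteq> 0" "h \<noteq> 0" "k \<noteq> 0"
    "k * (a * g * h + \<beta> * b * f * h + \<gamma> * c * f * g) = (u :: 'a :: field)"
  shows "a / f + \<beta> * (b / g) + \<gamma> * (c / h) = u / (k * (f * g * h))"
  using assms(1-4) unfolding assms(5)[symmetric] by (simp add: field_simps)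

lemma frac_sum_4:
  assumes "f \<noteq> 0" "g \<noteq> 0" "h \<noteq> 0" "i \<noteq> 0" "k \<noteq> 0"
    "k * (a * g * h * i + \<beta> * b * f * h * i + \<gamma> * c * f * g * i + \<delta> * d * f * g * h) = (u :: 'a :: field)"
  shows "a / f + \<beta> * (b / g) + \<gamma> * (c / h) + \<delta> * (d / i) = u / (k * (f * g * h * i))"
  using assms(1-5) unfolding assms(6)[symmetric] by (simp add: field_simps)

lemma logderiv_1 [simp]: "logderiv 1 = 0"
  by (simp add: logderiv_def)

text \<open>The elliptic point y = -64 of order 2 enters with weight 1 - 1/2. The points y = -16
  over j = 0 and y = 8 over j = 1728 are fully ramified, so neither is singular.\<close>

lemma pf_operator_base_2:
  assumes y: "transcendental y"
  shows "pf_operator (factors num_factors_2 y) (factors den_factors_2 y) =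
    (logderiv y + 1/2 * logderiv (y + 64) - logderiv (rf_deriv y),
     1 * rf_deriv y ^ 2 / (16 * (y * (y + 64))))"
proof -
  define y1 y2 where y12: "y1 = rf_deriv y" "y2 = rf_deriv y1"
  have y1 [simp]: "rf_deriv y = y1" and y2 [simp]: "rf_deriv y1 = y2" by (simp_all add: y12)
  have y0: "y \<noteq> 0" and y10: "y1 \<noteq> 0"
    using transcendental_ne_0[OF y, of "[0, 1]"] transcendental_deriv_ne_0[OF y] by auto
    have nz0: "y + 16 \<noteq> 0"
      by (rule transcendental_ne_0[OF y, of "[16, 1]"]) (simp_all, algebra?)
    have nz1: "y + 64 \<noteq> 0"
      by (rule transcendental_ne_0[OF y, of "[64, 1]"]) (simp_all, algebra?)
    have nz2: "y - 8 \<noteq> 0"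
      by (rule transcendental_ne_0[OF y, of "[-8, 1]"]) (simp_all, algebra?)
  note nz = y0 y10 nz0 nz1 nz2
  have A: "logderiv y + 1/2 * logderiv (y + 64) = ((24 * y + 1024) * y1) / (16 * (y * (y + 64)))"
    unfolding logderiv_def using nz
    by (intro frac_sum_2) (simp_all, algebra?)
  have "pf_operator (factors num_factors_2 y) (factors den_factors_2 y) =
    (((24 * y + 1024) * y1) / (16 * (y * (y + 64))) - logderiv y1, (1 * y1 ^ 2) / (16 * (y * (y + 64))))"
  proof (rule pf_operator_criterion)
    show "factors num_factors_2 y = ((y + 16)) ^ 3 * (1)"
      unfolding num_factors_2_def by (simp; algebra)
    show "factors num_factors_2 y - 1728 * factors den_factors_2 y = (y - 8) ^ 2 * (y + 64)"
      unfolding num_factors_2_def den_factors_2_def by (simp; algebra)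
    \<comment> \<open>The factor -2 in Z is deg q - deg p, minus the width of the cusp at y =
      infinity; at each of these seven levels it is -N.\<close>
    show "rf_deriv (factors den_factors_2 y) * factors num_factors_2 y - factors den_factors_2 y * rf_deriv (factors num_factors_2 y)
        = ((y + 16)) ^ 2 * (y - 8) * (- 2 * y1)"
      unfolding num_factors_2_def den_factors_2_def by (simp; algebra)
    show "3 * rf_deriv ((y + 16)) * (1) + ((y + 16)) * rf_deriv (1) = (3) * y1"
      by (simp; algebra)
    show "logderiv (factors den_factors_2 y) + logderiv (y + 64) / 2 - logderiv (- 2 * y1) + 2 / 3 * logderiv (1)
        = ((24 * y + 1024) * y1) / (16 * (y * (y + 64))) - logderiv y1"
      unfolding A[symmetric] den_factors_2_def using nz
      by (simp add: logderiv_mult logderiv_power add.commute[of _ y])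
    \<comment> \<open>\<open>w\<close> is read off from this identity: -3840 = -60 * 2^2 *
      16.\<close>
    show "- 60 * (- 2 * y1) ^ 2 * (16 * (y * (y + 64))) = (- 3840) * y1 ^ 2 * (factors den_factors_2 y * (y + 64))"
      unfolding den_factors_2_def by (simp; algebra)
    show "144 * ((- 3840) * y1 ^ 2) + 12 * ((24 * y + 1024) * y1) * ((3) * y1) * (((y + 16)) * (1))
        - 12 * (16 * (y * (y + 64))) * rf_deriv y1 * (3) * (((y + 16)) * (1))
        + 12 * (16 * (y * (y + 64))) * (rf_deriv ((3) * y1) * (((y + 16)) * (1)) - (3) * y1 * rf_deriv (((y + 16)) * (1)))
        - (16 * (y * (y + 64))) * ((3) * y1) ^ 2 = 144 * (1 * y1 ^ 2) * (((y + 16)) * (1)) ^ 2"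
      by (simp; algebra)
  qed (use nz in \<open>simp_all add: den_factors_2_def add.commute\<close>)
  thus ?thesis by (simp only: A y1)
qed

text \<open>The elliptic point y = -27 of order 3 divides P only once and enters with weight 1 -
  1/3. There is no elliptic point of order 2, so P - 1728 Q is a perfect square.\<close>

lemma pf_operator_base_3:
  assumes y: "transcendental y"
  shows "pf_operator (factors num_factors_3 y) (factors den_factors_3 y) =
    (logderiv y + 2/3 * logderiv (y + 27) - logderiv (rf_deriv y),
     1 * rf_deriv y ^ 2 / (9 * (y * (y + 27))))"
proof -
  define y1 y2 where y12: "y1 = rf_deriv y" "y2 = rf_deriv y1"
  have y1 [simp]: "rf_deriv y = y1" and y2 [simp]: "rf_deriv y1 = y2" by (simp_all add: y12)
  have y0: "y \<noteq> 0" and y10: "y1 \<noteq> 0"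
    using transcendental_ne_0[OF y, of "[0, 1]"] transcendental_deriv_ne_0[OF y] by auto
    have nz0: "y + 3 \<noteq> 0"
      by (rule transcendental_ne_0[OF y, of "[3, 1]"]) (simp_all, algebra?)
    have nz1: "y + 27 \<noteq> 0"
      by (rule transcendental_ne_0[OF y, of "[27, 1]"]) (simp_all, algebra?)
    have nz2: "y ^ 2 + 18 * y - 27 \<noteq> 0"
      by (rule transcendental_ne_0[OF y, of "[-27, 18, 1]"]) (simp_all, algebra?)
  note nz = y0 y10 nz0 nz1 nz2
  have A: "logderiv y + 2/3 * logderiv (y + 27) = ((15 * y + 243) * y1) / (9 * (y * (y + 27)))"
    unfolding logderiv_def using nz
    by (intro frac_sum_2) (simp_all, algebra?)
  have "pf_operator (factors num_factors_3 y) (factors den_factors_3 y) =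
    (((15 * y + 243) * y1) / (9 * (y * (y + 27))) - logderiv y1, (1 * y1 ^ 2) / (9 * (y * (y + 27))))"
  proof (rule pf_operator_criterion)
    show "factors num_factors_3 y = ((y + 3)) ^ 3 * ((y + 27))"
      unfolding num_factors_3_def by (simp; algebra)
    show "factors num_factors_3 y - 1728 * factors den_factors_3 y = (y ^ 2 + 18 * y - 27) ^ 2 * (1)"
      unfolding num_factors_3_def den_factors_3_def by (simp; algebra)
    show "rf_deriv (factors den_factors_3 y) * factors num_factors_3 y - factors den_factors_3 y * rf_deriv (factors num_factors_3 y)
        = ((y + 3)) ^ 2 * (y ^ 2 + 18 * y - 27) * (- 3 * y1)"
      unfolding num_factors_3_def den_factors_3_def by (simp; algebra)
    show "3 * rf_deriv ((y + 3)) * ((y + 27)) + ((y + 3)) * rf_deriv ((y + 27)) = (4 * y + 84) * y1"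
      by (simp; algebra)
    show "logderiv (factors den_factors_3 y) + logderiv (1) / 2 - logderiv (- 3 * y1) + 2 / 3 * logderiv ((y + 27))
        = ((15 * y + 243) * y1) / (9 * (y * (y + 27))) - logderiv y1"
      unfolding A[symmetric] den_factors_3_def using nz
      by (simp add: logderiv_mult logderiv_power add.commute[of _ y])
    show "- 60 * (- 3 * y1) ^ 2 * (9 * (y * (y + 27))) = (- 4860 * y - 131220) * y1 ^ 2 * (factors den_factors_3 y * (1))"
      unfolding den_factors_3_def by (simp; algebra)
    show "144 * ((- 4860 * y - 131220) * y1 ^ 2) + 12 * ((15 * y + 243) * y1) * ((4 * y + 84) * y1) * (((y + 3)) * ((y + 27)))
        - 12 * (9 * (y * (y + 27))) * rf_deriv y1 * (4 * y + 84) * (((y + 3)) * ((y + 27)))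
        + 12 * (9 * (y * (y + 27))) * (rf_deriv ((4 * y + 84) * y1) * (((y + 3)) * ((y + 27))) - (4 * y + 84) * y1 * rf_deriv (((y + 3)) * ((y + 27))))
        - (9 * (y * (y + 27))) * ((4 * y + 84) * y1) ^ 2 = 144 * (1 * y1 ^ 2) * (((y + 3)) * ((y + 27))) ^ 2"
      by (simp; algebra)
  qed (use nz in \<open>simp_all add: den_factors_3_def add.commute\<close>)
  thus ?thesis by (simp only: A y1)
qed

text \<open>Two conjugate elliptic points of order 2 appear together as the quadratic factor y^2 +
  22 y + 125, with weight 1/2.\<close>

lemma pf_operator_base_5:
  assumes y: "transcendental y"
  shows "pf_operator (factors num_factors_5 y) (factors den_factors_5 y) =
    (logderiv y + 1/2 * logderiv (y ^ 2 + 22 * y + 125) - logderiv (rf_deriv y),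
     (y + 10) * rf_deriv y ^ 2 / (4 * (y * (y ^ 2 + 22 * y + 125))))"
proof -
  define y1 y2 where y12: "y1 = rf_deriv y" "y2 = rf_deriv y1"
  have y1 [simp]: "rf_deriv y = y1" and y2 [simp]: "rf_deriv y1 = y2" by (simp_all add: y12)
  have y0: "y \<noteq> 0" and y10: "y1 \<noteq> 0"
    using transcendental_ne_0[OF y, of "[0, 1]"] transcendental_deriv_ne_0[OF y] by auto
    have nz0: "y ^ 2 + 10 * y + 5 \<noteq> 0"
      by (rule transcendental_ne_0[OF y, of "[5, 10, 1]"]) (simp_all, algebra?)
    have nz1: "y ^ 2 + 22 * y + 125 \<noteq> 0"
      by (rule transcendental_ne_0[OF y, of "[125, 22, 1]"]) (simp_all, algebra?)
    have nz2: "y ^ 2 + 4 * y - 1 \<noteq> 0"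
      by (rule transcendental_ne_0[OF y, of "[-1, 4, 1]"]) (simp_all, algebra?)
  note nz = y0 y10 nz0 nz1 nz2
  have A: "logderiv y + 1/2 * logderiv (y ^ 2 + 22 * y + 125) = ((8 * y ^ 2 + 132 * y + 500) * y1) / (4 * (y * (y ^ 2 + 22 * y + 125)))"
    unfolding logderiv_def using nz
    by (intro frac_sum_2) (simp_all, algebra?)
  have "pf_operator (factors num_factors_5 y) (factors den_factors_5 y) =
    (((8 * y ^ 2 + 132 * y + 500) * y1) / (4 * (y * (y ^ 2 + 22 * y + 125))) - logderiv y1, ((y + 10) * y1 ^ 2) / (4 * (y * (y ^ 2 + 22 * y + 125))))"
  proof (rule pf_operator_criterion)
    show "factors num_factors_5 y = ((y ^ 2 + 10 * y + 5)) ^ 3 * (1)"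
      unfolding num_factors_5_def by (simp; algebra)
    show "factors num_factors_5 y - 1728 * factors den_factors_5 y = (y ^ 2 + 4 * y - 1) ^ 2 * (y ^ 2 + 22 * y + 125)"
      unfolding num_factors_5_def den_factors_5_def by (simp; algebra)
    show "rf_deriv (factors den_factors_5 y) * factors num_factors_5 y - factors den_factors_5 y * rf_deriv (factors num_factors_5 y)
        = ((y ^ 2 + 10 * y + 5)) ^ 2 * (y ^ 2 + 4 * y - 1) * (- 5 * y1)"
      unfolding num_factors_5_def den_factors_5_def by (simp; algebra)
    show "3 * rf_deriv ((y ^ 2 + 10 * y + 5)) * (1) + ((y ^ 2 + 10 * y + 5)) * rf_deriv (1) = (6 * y + 30) * y1"
      by (simp; algebra)
    show "logderiv (factors den_factors_5 y) + logderiv (y ^ 2 + 22 * y + 125) / 2 - logderiv (- 5 * y1) + 2 / 3 * logderiv (1)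
        = ((8 * y ^ 2 + 132 * y + 500) * y1) / (4 * (y * (y ^ 2 + 22 * y + 125))) - logderiv y1"
      unfolding A[symmetric] den_factors_5_def using nz
      by (simp add: logderiv_mult logderiv_power add.commute[of _ y])
    show "- 60 * (- 5 * y1) ^ 2 * (4 * (y * (y ^ 2 + 22 * y + 125))) = (- 6000) * y1 ^ 2 * (factors den_factors_5 y * (y ^ 2 + 22 * y + 125))"
      unfolding den_factors_5_def by (simp; algebra)
    show "144 * ((- 6000) * y1 ^ 2) + 12 * ((8 * y ^ 2 + 132 * y + 500) * y1) * ((6 * y + 30) * y1) * (((y ^ 2 + 10 * y + 5)) * (1))
        - 12 * (4 * (y * (y ^ 2 + 22 * y + 125))) * rf_deriv y1 * (6 * y + 30) * (((y ^ 2 + 10 * y + 5)) * (1))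
        + 12 * (4 * (y * (y ^ 2 + 22 * y + 125))) * (rf_deriv ((6 * y + 30) * y1) * (((y ^ 2 + 10 * y + 5)) * (1)) - (6 * y + 30) * y1 * rf_deriv (((y ^ 2 + 10 * y + 5)) * (1)))
        - (4 * (y * (y ^ 2 + 22 * y + 125))) * ((6 * y + 30) * y1) ^ 2 = 144 * ((y + 10) * y1 ^ 2) * (((y ^ 2 + 10 * y + 5)) * (1)) ^ 2"
      by (simp; algebra)
  qed (use nz in \<open>simp_all add: den_factors_5_def add.commute\<close>)
  thus ?thesis by (simp only: A y1)
qed

text \<open>Without elliptic points only the cusps are singular. At -8 and -9 the multiplicities 3
  and 2 in Q are reduced by the multiplicities 2 and 1 in Z, so each cusp enters with weight
  1.\<close>

lemma pf_operator_base_6: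
  assumes y: "transcendental y"
  shows "pf_operator (factors num_factors_6 y) (factors den_factors_6 y) =
    (logderiv y + logderiv (y + 8) + logderiv (y + 9) - logderiv (rf_deriv y),
     (y + 6) * rf_deriv y ^ 2 / ((y * (y + 8) * (y + 9))))"
proof -
  define y1 y2 where y12: "y1 = rf_deriv y" "y2 = rf_deriv y1"
  have y1 [simp]: "rf_deriv y = y1" and y2 [simp]: "rf_deriv y1 = y2" by (simp_all add: y12)
  have y0: "y \<noteq> 0" and y10: "y1 \<noteq> 0"
    using transcendental_ne_0[OF y, of "[0, 1]"] transcendental_deriv_ne_0[OF y] by auto
    have nz0: "y + 6 \<noteq> 0"
      by (rule transcendental_ne_0[OF y, of "[6, 1]"]) (simp_all, algebra?)
    have nz1: "y ^ 3 + 18 * y ^ 2 + 84 * y + 24 \<noteq> 0"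
      by (rule transcendental_ne_0[OF y, of "[24, 84, 18, 1]"]) (simp_all, algebra?)
    have nz2: "y ^ 6 + 36 * y ^ 5 + 504 * y ^ 4 + 3384 * y ^ 3 + 10584 * y ^ 2 + 11232 * y - 1728 \<noteq> 0"
      by (rule transcendental_ne_0[OF y, of "[-1728, 11232, 10584, 3384, 504, 36, 1]"]) (simp_all, algebra?)
    have nz3: "y + 9 \<noteq> 0"
      by (rule transcendental_ne_0[OF y, of "[9, 1]"]) (simp_all, algebra?)
    have nz4: "y + 8 \<noteq> 0"
      by (rule transcendental_ne_0[OF y, of "[8, 1]"]) (simp_all, algebra?)
  note nz = y0 y10 nz0 nz1 nz2 nz3 nz4
  have A: "logderiv y + logderiv (y + 8) + logderiv (y + 9) = ((3 * y ^ 2 + 34 * y + 72) * y1) / ((y * (y + 8) * (y + 9)))"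
    unfolding logderiv_def using nz
    by (intro frac_sum_3[where \<beta> = 1 and \<gamma> = 1 and k = 1, unfolded mult_1]) (simp_all, algebra?)
  have "pf_operator (factors num_factors_6 y) (factors den_factors_6 y) =
    (((3 * y ^ 2 + 34 * y + 72) * y1) / ((y * (y + 8) * (y + 9))) - logderiv y1, ((y + 6) * y1 ^ 2) / ((y * (y + 8) * (y + 9))))"
  proof (rule pf_operator_criterion)
    show "factors num_factors_6 y = ((y + 6) * (y ^ 3 + 18 * y ^ 2 + 84 * y + 24)) ^ 3 * (1)"
      unfolding num_factors_6_def by (simp; algebra)
    show "factors num_factors_6 y - 1728 * factors den_factors_6 y = (y ^ 6 + 36 * y ^ 5 + 504 * y ^ 4 + 3384 * y ^ 3 + 10584 * y ^ 2 + 11232 * y - 1728) ^ 2 * (1)"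
      unfolding num_factors_6_def den_factors_6_def by (simp; algebra)
    show "rf_deriv (factors den_factors_6 y) * factors num_factors_6 y - factors den_factors_6 y * rf_deriv (factors num_factors_6 y)
        = ((y + 6) * (y ^ 3 + 18 * y ^ 2 + 84 * y + 24)) ^ 2 * (y ^ 6 + 36 * y ^ 5 + 504 * y ^ 4 + 3384 * y ^ 3 + 10584 * y ^ 2 + 11232 * y - 1728) * (- 6 * y1 * (y + 8) ^ 2 * (y + 9))"
      unfolding num_factors_6_def den_factors_6_def by (simp; algebra)
    show "3 * rf_deriv ((y + 6) * (y ^ 3 + 18 * y ^ 2 + 84 * y + 24)) * (1) + ((y + 6) * (y ^ 3 + 18 * y ^ 2 + 84 * y + 24)) * rf_deriv (1) = (12 * y ^ 3 + 216 * y ^ 2 + 1152 * y + 1584) * y1"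
      by (simp; algebra)
    show "logderiv (factors den_factors_6 y) + logderiv (1) / 2 - logderiv (- 6 * y1 * (y + 8) ^ 2 * (y + 9)) + 2 / 3 * logderiv (1)
        = ((3 * y ^ 2 + 34 * y + 72) * y1) / ((y * (y + 8) * (y + 9))) - logderiv y1"
      unfolding A[symmetric] den_factors_6_def using nz
      by (simp add: logderiv_mult logderiv_power add.commute[of _ y])
    show "- 60 * (- 6 * y1 * (y + 8) ^ 2 * (y + 9)) ^ 2 * ((y * (y + 8) * (y + 9))) = (- 2160 * y ^ 3 - 54000 * y ^ 2 - 449280 * y - 1244160) * y1 ^ 2 * (factors den_factors_6 y * (1))"
      unfolding den_factors_6_def by (simp; algebra)
    show "144 * ((- 2160 * y ^ 3 - 54000 * y ^ 2 - 449280 * y - 1244160) * y1 ^ 2) + 12 * ((3 * y ^ 2 + 34 * y + 72) * y1) * ((12 * y ^ 3 + 216 * y ^ 2 + 1152 * y + 1584) * y1) * (((y + 6) * (y ^ 3 + 18 * y ^ 2 + 84 * y + 24)) * (1))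
        - 12 * ((y * (y + 8) * (y + 9))) * rf_deriv y1 * (12 * y ^ 3 + 216 * y ^ 2 + 1152 * y + 1584) * (((y + 6) * (y ^ 3 + 18 * y ^ 2 + 84 * y + 24)) * (1))
        + 12 * ((y * (y + 8) * (y + 9))) * (rf_deriv ((12 * y ^ 3 + 216 * y ^ 2 + 1152 * y + 1584) * y1) * (((y + 6) * (y ^ 3 + 18 * y ^ 2 + 84 * y + 24)) * (1)) - (12 * y ^ 3 + 216 * y ^ 2 + 1152 * y + 1584) * y1 * rf_deriv (((y + 6) * (y ^ 3 + 18 * y ^ 2 + 84 * y + 24)) * (1)))
        - ((y * (y + 8) * (y + 9))) * ((12 * y ^ 3 + 216 * y ^ 2 + 1152 * y + 1584) * y1) ^ 2 = 144 * ((y + 6) * y1 ^ 2) * (((y + 6) * (y ^ 3 + 18 * y ^ 2 + 84 * y + 24)) * (1)) ^ 2"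
      by (simp; algebra)
  qed (use nz in \<open>simp_all add: den_factors_6_def add.commute\<close>)
  thus ?thesis by (simp only: A y1)
qed

text \<open>The quadratic factor carries two elliptic points of order 3: exponent 1 in P, weight 2/3
  in the operator.\<close>

lemma pf_operator_base_7:
  assumes y: "transcendental y"
  shows "pf_operator (factors num_factors_7 y) (factors den_factors_7 y) =
    (logderiv y + 2/3 * logderiv (y ^ 2 + 13 * y + 49) - logderiv (rf_deriv y),
     (4 * y + 21) * rf_deriv y ^ 2 / (9 * (y * (y ^ 2 + 13 * y + 49))))"
proof -
  define y1 y2 where y12: "y1 = rf_deriv y" "y2 = rf_deriv y1"
  have y1 [simp]: "rf_deriv y = y1" and y2 [simp]: "rf_deriv y1 = y2" by (simp_all add: y12)
  have y0: "y \<noteq> 0" and y10: "y1 \<noteq> 0"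
    using transcendental_ne_0[OF y, of "[0, 1]"] transcendental_deriv_ne_0[OF y] by auto
    have nz0: "y ^ 2 + 5 * y + 1 \<noteq> 0"
      by (rule transcendental_ne_0[OF y, of "[1, 5, 1]"]) (simp_all, algebra?)
    have nz1: "y ^ 2 + 13 * y + 49 \<noteq> 0"
      by (rule transcendental_ne_0[OF y, of "[49, 13, 1]"]) (simp_all, algebra?)
    have nz2: "y ^ 4 + 14 * y ^ 3 + 63 * y ^ 2 + 70 * y - 7 \<noteq> 0"
      by (rule transcendental_ne_0[OF y, of "[-7, 70, 63, 14, 1]"]) (simp_all, algebra?)
  note nz = y0 y10 nz0 nz1 nz2
  have A: "logderiv y + 2/3 * logderiv (y ^ 2 + 13 * y + 49) = ((21 * y ^ 2 + 195 * y + 441) * y1) / (9 * (y * (y ^ 2 + 13 * y + 49)))"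
    unfolding logderiv_def using nz
    by (intro frac_sum_2) (simp_all, algebra?)
  have "pf_operator (factors num_factors_7 y) (factors den_factors_7 y) =
    (((21 * y ^ 2 + 195 * y + 441) * y1) / (9 * (y * (y ^ 2 + 13 * y + 49))) - logderiv y1, ((4 * y + 21) * y1 ^ 2) / (9 * (y * (y ^ 2 + 13 * y + 49))))"
  proof (rule pf_operator_criterion)
    show "factors num_factors_7 y = ((y ^ 2 + 5 * y + 1)) ^ 3 * ((y ^ 2 + 13 * y + 49))"
      unfolding num_factors_7_def by (simp; algebra)
    show "factors num_factors_7 y - 1728 * factors den_factors_7 y = (y ^ 4 + 14 * y ^ 3 + 63 * y ^ 2 + 70 * y - 7) ^ 2 * (1)"
      unfolding num_factors_7_def den_factors_7_def by (simp; algebra)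
    show "rf_deriv (factors den_factors_7 y) * factors num_factors_7 y - factors den_factors_7 y * rf_deriv (factors num_factors_7 y)
        = ((y ^ 2 + 5 * y + 1)) ^ 2 * (y ^ 4 + 14 * y ^ 3 + 63 * y ^ 2 + 70 * y - 7) * (- 7 * y1)"
      unfolding num_factors_7_def den_factors_7_def by (simp; algebra)
    show "3 * rf_deriv ((y ^ 2 + 5 * y + 1)) * ((y ^ 2 + 13 * y + 49)) + ((y ^ 2 + 5 * y + 1)) * rf_deriv ((y ^ 2 + 13 * y + 49)) = (8 * y ^ 3 + 116 * y ^ 2 + 556 * y + 748) * y1"
      by (simp; algebra)
    show "logderiv (factors den_factors_7 y) + logderiv (1) / 2 - logderiv (- 7 * y1) + 2 / 3 * logderiv ((y ^ 2 + 13 * y + 49))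
        = ((21 * y ^ 2 + 195 * y + 441) * y1) / (9 * (y * (y ^ 2 + 13 * y + 49))) - logderiv y1"
      unfolding A[symmetric] den_factors_7_def using nz
      by (simp add: logderiv_mult logderiv_power add.commute[of _ y])
    show "- 60 * (- 7 * y1) ^ 2 * (9 * (y * (y ^ 2 + 13 * y + 49))) = (- 26460 * y ^ 2 - 343980 * y - 1296540) * y1 ^ 2 * (factors den_factors_7 y * (1))"
      unfolding den_factors_7_def by (simp; algebra)
    show "144 * ((- 26460 * y ^ 2 - 343980 * y - 1296540) * y1 ^ 2) + 12 * ((21 * y ^ 2 + 195 * y + 441) * y1) * ((8 * y ^ 3 + 116 * y ^ 2 + 556 * y + 748) * y1) * (((y ^ 2 + 5 * y + 1)) * ((y ^ 2 + 13 * y + 49)))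
        - 12 * (9 * (y * (y ^ 2 + 13 * y + 49))) * rf_deriv y1 * (8 * y ^ 3 + 116 * y ^ 2 + 556 * y + 748) * (((y ^ 2 + 5 * y + 1)) * ((y ^ 2 + 13 * y + 49)))
        + 12 * (9 * (y * (y ^ 2 + 13 * y + 49))) * (rf_deriv ((8 * y ^ 3 + 116 * y ^ 2 + 556 * y + 748) * y1) * (((y ^ 2 + 5 * y + 1)) * ((y ^ 2 + 13 * y + 49))) - (8 * y ^ 3 + 116 * y ^ 2 + 556 * y + 748) * y1 * rf_deriv (((y ^ 2 + 5 * y + 1)) * ((y ^ 2 + 13 * y + 49))))
        - (9 * (y * (y ^ 2 + 13 * y + 49))) * ((8 * y ^ 3 + 116 * y ^ 2 + 556 * y + 748) * y1) ^ 2 = 144 * ((4 * y + 21) * y1 ^ 2) * (((y ^ 2 + 5 * y + 1)) * ((y ^ 2 + 13 * y + 49))) ^ 2"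
      by (simp; algebra)
  qed (use nz in \<open>simp_all add: den_factors_7_def add.commute\<close>)
  thus ?thesis by (simp only: A y1)
qed

text \<open>Cusps at -5 and -4, of widths 2 and 5, together with two elliptic points of order 2, the
  roots of y^2 + 8 y + 20.\<close>

lemma pf_operator_base_10:
  assumes y: "transcendental y"
  shows "pf_operator (factors num_factors_10 y) (factors den_factors_10 y) =
    (logderiv y + logderiv (y + 4) + logderiv (y + 5) + 1/2 * logderiv (y ^ 2 + 8 * y + 20) - logderiv (rf_deriv y),
     (9 * y ^ 3 + 95 * y ^ 2 + 340 * y + 400) * rf_deriv y ^ 2 / (4 * (y * (y + 4) * (y + 5) * (y ^ 2 + 8 * y + 20))))"
proof -
  define y1 y2 where y12: "y1 = rf_deriv y" "y2 = rf_deriv y1"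
  have y1 [simp]: "rf_deriv y = y1" and y2 [simp]: "rf_deriv y1 = y2" by (simp_all add: y12)
  have y0: "y \<noteq> 0" and y10: "y1 \<noteq> 0"
    using transcendental_ne_0[OF y, of "[0, 1]"] transcendental_deriv_ne_0[OF y] by auto
    have nz0: "y ^ 6 + 20 * y ^ 5 + 160 * y ^ 4 + 640 * y ^ 3 + 1280 * y ^ 2 + 1040 * y + 80 \<noteq> 0"
      by (rule transcendental_ne_0[OF y, of "[80, 1040, 1280, 640, 160, 20, 1]"]) (simp_all, algebra?)
    have nz1: "y ^ 2 + 8 * y + 20 \<noteq> 0"
      by (rule transcendental_ne_0[OF y, of "[20, 8, 1]"]) (simp_all, algebra?)
    have nz2: "y ^ 8 + 26 * y ^ 7 + 284 * y ^ 6 + 1680 * y ^ 5 + 5760 * y ^ 4 + 11256 * y ^ 3 + 11176 * y ^ 2 + 3824 * y - 160 \<noteq> 0"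
      by (rule transcendental_ne_0[OF y, of "[-160, 3824, 11176, 11256, 5760, 1680, 284, 26, 1]"]) (simp_all, algebra?)
    have nz3: "y + 5 \<noteq> 0"
      by (rule transcendental_ne_0[OF y, of "[5, 1]"]) (simp_all, algebra?)
    have nz4: "y + 4 \<noteq> 0"
      by (rule transcendental_ne_0[OF y, of "[4, 1]"]) (simp_all, algebra?)
  note nz = y0 y10 nz0 nz1 nz2 nz3 nz4
  have A: "logderiv y + logderiv (y + 4) + logderiv (y + 5) + 1/2 * logderiv (y ^ 2 + 8 * y + 20) = ((16 * y ^ 4 + 220 * y ^ 3 + 1120 * y ^ 2 + 2400 * y + 1600) * y1) / (4 * (y * (y + 4) * (y + 5) * (y ^ 2 + 8 * y + 20)))"
    unfolding logderiv_def using nz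
    by (intro frac_sum_4[where \<beta> = 1 and \<gamma> = 1, unfolded mult_1]) (simp_all, algebra?)
  have "pf_operator (factors num_factors_10 y) (factors den_factors_10 y) =
    (((16 * y ^ 4 + 220 * y ^ 3 + 1120 * y ^ 2 + 2400 * y + 1600) * y1) / (4 * (y * (y + 4) * (y + 5) * (y ^ 2 + 8 * y + 20))) - logderiv y1, ((9 * y ^ 3 + 95 * y ^ 2 + 340 * y + 400) * y1 ^ 2) / (4 * (y * (y + 4) * (y + 5) * (y ^ 2 + 8 * y + 20))))"
  proof (rule pf_operator_criterion)
    show "factors num_factors_10 y = ((y ^ 6 + 20 * y ^ 5 + 160 * y ^ 4 + 640 * y ^ 3 + 1280 * y ^ 2 + 1040 * y + 80)) ^ 3 * (1)"
      unfolding num_factors_10_def by (simp; algebra)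
    show "factors num_factors_10 y - 1728 * factors den_factors_10 y = (y ^ 8 + 26 * y ^ 7 + 284 * y ^ 6 + 1680 * y ^ 5 + 5760 * y ^ 4 + 11256 * y ^ 3 + 11176 * y ^ 2 + 3824 * y - 160) ^ 2 * (y ^ 2 + 8 * y + 20)"
      unfolding num_factors_10_def den_factors_10_def by (simp; algebra)
    show "rf_deriv (factors den_factors_10 y) * factors num_factors_10 y - factors den_factors_10 y * rf_deriv (factors num_factors_10 y)
        = ((y ^ 6 + 20 * y ^ 5 + 160 * y ^ 4 + 640 * y ^ 3 + 1280 * y ^ 2 + 1040 * y + 80)) ^ 2 * (y ^ 8 + 26 * y ^ 7 + 284 * y ^ 6 + 1680 * y ^ 5 + 5760 * y ^ 4 + 11256 * y ^ 3 + 11176 * y ^ 2 + 3824 * y - 160) * (- 10 * y1 * (y + 5) * (y + 4) ^ 4)"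
      unfolding num_factors_10_def den_factors_10_def by (simp; algebra)
    show "3 * rf_deriv ((y ^ 6 + 20 * y ^ 5 + 160 * y ^ 4 + 640 * y ^ 3 + 1280 * y ^ 2 + 1040 * y + 80)) * (1) + ((y ^ 6 + 20 * y ^ 5 + 160 * y ^ 4 + 640 * y ^ 3 + 1280 * y ^ 2 + 1040 * y + 80)) * rf_deriv (1) = (18 * y ^ 5 + 300 * y ^ 4 + 1920 * y ^ 3 + 5760 * y ^ 2 + 7680 * y + 3120) * y1"
      by (simp; algebra)
    show "logderiv (factors den_factors_10 y) + logderiv (y ^ 2 + 8 * y + 20) / 2 - logderiv (- 10 * y1 * (y + 5) * (y + 4) ^ 4) + 2 / 3 * logderiv (1)
        = ((16 * y ^ 4 + 220 * y ^ 3 + 1120 * y ^ 2 + 2400 * y + 1600) * y1) / (4 * (y * (y + 4) * (y + 5) * (y ^ 2 + 8 * y + 20))) - logderiv y1"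
      unfolding A[symmetric] den_factors_10_def using nz
      by (simp add: logderiv_mult logderiv_power add.commute[of _ y])
    show "- 60 * (- 10 * y1 * (y + 5) * (y + 4) ^ 4) ^ 2 * (4 * (y * (y + 4) * (y + 5) * (y ^ 2 + 8 * y + 20))) = (- 24000 * y ^ 5 - 504000 * y ^ 4 - 4224000 * y ^ 3 - 17664000 * y ^ 2 - 36864000 * y - 30720000) * y1 ^ 2 * (factors den_factors_10 y * (y ^ 2 + 8 * y + 20))"
      unfolding den_factors_10_def by (simp; algebra)
    show "144 * ((- 24000 * y ^ 5 - 504000 * y ^ 4 - 4224000 * y ^ 3 - 17664000 * y ^ 2 - 36864000 * y - 30720000) * y1 ^ 2) + 12 * ((16 * y ^ 4 + 220 * y ^ 3 + 1120 * y ^ 2 + 2400 * y + 1600) * y1) * ((18 * y ^ 5 + 300 * y ^ 4 + 1920 * y ^ 3 + 5760 * y ^ 2 + 7680 * y + 3120) * y1) * (((y ^ 6 + 20 * y ^ 5 + 160 * y ^ 4 + 640 * y ^ 3 + 1280 * y ^ 2 + 1040 * y + 80)) * (1))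
        - 12 * (4 * (y * (y + 4) * (y + 5) * (y ^ 2 + 8 * y + 20))) * rf_deriv y1 * (18 * y ^ 5 + 300 * y ^ 4 + 1920 * y ^ 3 + 5760 * y ^ 2 + 7680 * y + 3120) * (((y ^ 6 + 20 * y ^ 5 + 160 * y ^ 4 + 640 * y ^ 3 + 1280 * y ^ 2 + 1040 * y + 80)) * (1))
        + 12 * (4 * (y * (y + 4) * (y + 5) * (y ^ 2 + 8 * y + 20))) * (rf_deriv ((18 * y ^ 5 + 300 * y ^ 4 + 1920 * y ^ 3 + 5760 * y ^ 2 + 7680 * y + 3120) * y1) * (((y ^ 6 + 20 * y ^ 5 + 160 * y ^ 4 + 640 * y ^ 3 + 1280 * y ^ 2 + 1040 * y + 80)) * (1)) - (18 * y ^ 5 + 300 * y ^ 4 + 1920 * y ^ 3 + 5760 * y ^ 2 + 7680 * y + 3120) * y1 * rf_deriv (((y ^ 6 + 20 * y ^ 5 + 160 * y ^ 4 + 640 * y ^ 3 + 1280 * y ^ 2 + 1040 * y + 80)) * (1)))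
        - (4 * (y * (y + 4) * (y + 5) * (y ^ 2 + 8 * y + 20))) * ((18 * y ^ 5 + 300 * y ^ 4 + 1920 * y ^ 3 + 5760 * y ^ 2 + 7680 * y + 3120) * y1) ^ 2 = 144 * ((9 * y ^ 3 + 95 * y ^ 2 + 340 * y + 400) * y1 ^ 2) * (((y ^ 6 + 20 * y ^ 5 + 160 * y ^ 4 + 640 * y ^ 3 + 1280 * y ^ 2 + 1040 * y + 80)) * (1)) ^ 2"
      by (simp; algebra)
  qed (use nz in \<open>simp_all add: den_factors_10_def add.commute\<close>)
  thus ?thesis by (simp only: A y1)
qed

text \<open>The only level here with elliptic points of both orders: two of order 2, the roots of
  y^2 + 6 y + 13, and two of order 3, the roots of y^2 + 5 y + 13. Hence the denominator 36 = 4 *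
  9.\<close>

lemma pf_operator_base_13:
  assumes y: "transcendental y"
  shows "pf_operator (factors num_factors_13 y) (factors den_factors_13 y) =
    (logderiv y + 1/2 * logderiv (y ^ 2 + 6 * y + 13) + 2/3 * logderiv (y ^ 2 + 5 * y + 13) - logderiv (rf_deriv y),
     (49 * y ^ 3 + 351 * y ^ 2 + 1027 * y + 1014) * rf_deriv y ^ 2 / (36 * (y * (y ^ 2 + 6 * y + 13) * (y ^ 2 + 5 * y + 13))))"
proof -
  define y1 y2 where y12: "y1 = rf_deriv y" "y2 = rf_deriv y1"
  have y1 [simp]: "rf_deriv y = y1" and y2 [simp]: "rf_deriv y1 = y2" by (simp_all add: y12)
  have y0: "y \<noteq> 0" and y10: "y1 \<noteq> 0"
    using transcendental_ne_0[OF y, of "[0, 1]"] transcendental_deriv_ne_0[OF y] by auto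
    have nz0: "y ^ 4 + 7 * y ^ 3 + 20 * y ^ 2 + 19 * y + 1 \<noteq> 0"
      by (rule transcendental_ne_0[OF y, of "[1, 19, 20, 7, 1]"]) (simp_all, algebra?)
    have nz1: "y ^ 2 + 5 * y + 13 \<noteq> 0"
      by (rule transcendental_ne_0[OF y, of "[13, 5, 1]"]) (simp_all, algebra?)
    have nz2: "y ^ 2 + 6 * y + 13 \<noteq> 0"
      by (rule transcendental_ne_0[OF y, of "[13, 6, 1]"]) (simp_all, algebra?)
    have nz3: "y ^ 6 + 10 * y ^ 5 + 46 * y ^ 4 + 108 * y ^ 3 + 122 * y ^ 2 + 38 * y - 1 \<noteq> 0"
      by (rule transcendental_ne_0[OF y, of "[-1, 38, 122, 108, 46, 10, 1]"]) (simp_all, algebra?)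
  note nz = y0 y10 nz0 nz1 nz2 nz3
  have A: "logderiv y + 1/2 * logderiv (y ^ 2 + 6 * y + 13) + 2/3 * logderiv (y ^ 2 + 5 * y + 13) = ((120 * y ^ 4 + 1092 * y ^ 3 + 4368 * y ^ 2 + 8112 * y + 6084) * y1) / (36 * (y * (y ^ 2 + 6 * y + 13) * (y ^ 2 + 5 * y + 13)))"
    unfolding logderiv_def using nz
    by (intro frac_sum_3) (simp_all, algebra?)
  have "pf_operator (factors num_factors_13 y) (factors den_factors_13 y) =
    (((120 * y ^ 4 + 1092 * y ^ 3 + 4368 * y ^ 2 + 8112 * y + 6084) * y1) / (36 * (y * (y ^ 2 + 6 * y + 13) * (y ^ 2 + 5 * y + 13))) - logderiv y1, ((49 * y ^ 3 + 351 * y ^ 2 + 1027 * y + 1014) * y1 ^ 2) / (36 * (y * (y ^ 2 + 6 * y + 13) * (y ^ 2 + 5 * y + 13))))"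
  proof (rule pf_operator_criterion)
    show "factors num_factors_13 y = ((y ^ 4 + 7 * y ^ 3 + 20 * y ^ 2 + 19 * y + 1)) ^ 3 * ((y ^ 2 + 5 * y + 13))"
      unfolding num_factors_13_def by (simp; algebra)
    show "factors num_factors_13 y - 1728 * factors den_factors_13 y = (y ^ 6 + 10 * y ^ 5 + 46 * y ^ 4 + 108 * y ^ 3 + 122 * y ^ 2 + 38 * y - 1) ^ 2 * (y ^ 2 + 6 * y + 13)"
      unfolding num_factors_13_def den_factors_13_def by (simp; algebra)
    show "rf_deriv (factors den_factors_13 y) * factors num_factors_13 y - factors den_factors_13 y * rf_deriv (factors num_factors_13 y)
        = ((y ^ 4 + 7 * y ^ 3 + 20 * y ^ 2 + 19 * y + 1)) ^ 2 * (y ^ 6 + 10 * y ^ 5 + 46 * y ^ 4 + 108 * y ^ 3 + 122 * y ^ 2 + 38 * y - 1) * (- 13 * y1)"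
      unfolding num_factors_13_def den_factors_13_def by (simp; algebra)
    show "3 * rf_deriv ((y ^ 4 + 7 * y ^ 3 + 20 * y ^ 2 + 19 * y + 1)) * ((y ^ 2 + 5 * y + 13)) + ((y ^ 4 + 7 * y ^ 3 + 20 * y ^ 2 + 19 * y + 1)) * rf_deriv ((y ^ 2 + 5 * y + 13)) = (14 * y ^ 5 + 142 * y ^ 4 + 666 * y ^ 3 + 1614 * y ^ 2 + 1942 * y + 746) * y1"
      by (simp; algebra)
    show "logderiv (factors den_factors_13 y) + logderiv (y ^ 2 + 6 * y + 13) / 2 - logderiv (- 13 * y1) + 2 / 3 * logderiv ((y ^ 2 + 5 * y + 13))
        = ((120 * y ^ 4 + 1092 * y ^ 3 + 4368 * y ^ 2 + 8112 * y + 6084) * y1) / (36 * (y * (y ^ 2 + 6 * y + 13) * (y ^ 2 + 5 * y + 13))) - logderiv y1"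
      unfolding A[symmetric] den_factors_13_def using nz
      by (simp add: logderiv_mult logderiv_power add.commute[of _ y])
    show "- 60 * (- 13 * y1) ^ 2 * (36 * (y * (y ^ 2 + 6 * y + 13) * (y ^ 2 + 5 * y + 13))) = (- 365040 * y ^ 2 - 1825200 * y - 4745520) * y1 ^ 2 * (factors den_factors_13 y * (y ^ 2 + 6 * y + 13))"
      unfolding den_factors_13_def by (simp; algebra)
    show "144 * ((- 365040 * y ^ 2 - 1825200 * y - 4745520) * y1 ^ 2) + 12 * ((120 * y ^ 4 + 1092 * y ^ 3 + 4368 * y ^ 2 + 8112 * y + 6084) * y1) * ((14 * y ^ 5 + 142 * y ^ 4 + 666 * y ^ 3 + 1614 * y ^ 2 + 1942 * y + 746) * y1) * (((y ^ 4 + 7 * y ^ 3 + 20 * y ^ 2 + 19 * y + 1)) * ((y ^ 2 + 5 * y + 13)))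
        - 12 * (36 * (y * (y ^ 2 + 6 * y + 13) * (y ^ 2 + 5 * y + 13))) * rf_deriv y1 * (14 * y ^ 5 + 142 * y ^ 4 + 666 * y ^ 3 + 1614 * y ^ 2 + 1942 * y + 746) * (((y ^ 4 + 7 * y ^ 3 + 20 * y ^ 2 + 19 * y + 1)) * ((y ^ 2 + 5 * y + 13)))
        + 12 * (36 * (y * (y ^ 2 + 6 * y + 13) * (y ^ 2 + 5 * y + 13))) * (rf_deriv ((14 * y ^ 5 + 142 * y ^ 4 + 666 * y ^ 3 + 1614 * y ^ 2 + 1942 * y + 746) * y1) * (((y ^ 4 + 7 * y ^ 3 + 20 * y ^ 2 + 19 * y + 1)) * ((y ^ 2 + 5 * y + 13))) - (14 * y ^ 5 + 142 * y ^ 4 + 666 * y ^ 3 + 1614 * y ^ 2 + 1942 * y + 746) * y1 * rf_deriv (((y ^ 4 + 7 * y ^ 3 + 20 * y ^ 2 + 19 * y + 1)) * ((y ^ 2 + 5 * y + 13))))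
        - (36 * (y * (y ^ 2 + 6 * y + 13) * (y ^ 2 + 5 * y + 13))) * ((14 * y ^ 5 + 142 * y ^ 4 + 666 * y ^ 3 + 1614 * y ^ 2 + 1942 * y + 746) * y1) ^ 2 = 144 * ((49 * y ^ 3 + 351 * y ^ 2 + 1027 * y + 1014) * y1 ^ 2) * (((y ^ 4 + 7 * y ^ 3 + 20 * y ^ 2 + 19 * y + 1)) * ((y ^ 2 + 5 * y + 13))) ^ 2"
      by (simp; algebra)
  qed (use nz in \<open>simp_all add: den_factors_13_def add.commute\<close>)
  thus ?thesis by (simp only: A y1)
qed

section \<open>The operators in the Hauptmodul itself\<close>

lemma scaled_logderiv_eq:
  assumes "f \<noteq> 0" "d \<noteq> 0" "c * rf_deriv f * d = n * f"
  shows "c * logderiv f = n / d"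
  using assms by (simp add: logderiv_def frac_eq_eq)

lemma logderiv_eq:
  assumes "f \<noteq> 0" "d \<noteq> 0" "rf_deriv f * d = n * f"
  shows "logderiv f = n / d"
  using scaled_logderiv_eq[of f d 1 n] assms by simp

text \<open>The operator sees p and q only through q / p and the logarithmic derivative of p. This
  disposes of the constant that the uniqueness of P and Q leaves open.\<close>

lemma pf_operator_mult_const:
  assumes "k \<noteq> 0" "rf_deriv k = 0"
  shows "pf_operator (k * p) (k * q) = pf_operator p q"
proof -
  have "12 ^ 3 * (k * q) / (k * p) = 12 ^ 3 * q / p"
    using assms(1) by (simp add: mult.left_commute[of _ k])
  moreover have "rf_deriv (k * p) / (k * p) = rf_deriv p / p" using assms by simp
  ultimately show ?thesis by (simp only: pf_operator_def)
qed

lemma to_fract_mult_complex: "to_fract (p * q :: complex poly) = to_fract p * to_fract q"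
  by (simp add: to_fract_def)

lemma to_fract_one_complex: "to_fract (1 :: complex poly) = 1"
  by (simp add: to_fract_def One_fract_def)

lemma to_fract_power_complex: "to_fract (p ^ n :: complex poly) = to_fract p ^ n"
  by (induction n) (simp_all add: to_fract_mult_complex to_fract_one_complex)

lemma to_fract_factors: "to_fract (factors fs p) = factors fs (to_fract (p :: complex poly))"
  by (induction fs rule: factors.induct[where ?a1.0 = p])
    (simp_all add: to_fract_one_complex to_fract_mult_complex to_fract_power_complex to_fract_horner)

lemma to_fract_compose_horner: "to_fract (compose_horner cs p) = compose_horner cs (to_fract (p :: complex poly))"
  by (induction cs arbitrary: p) (simp_all add: to_fract_horner)

lemma picard_fuchs_level_poly:
  assumes "c \<noteq> 0"
  shows "picard_fuchs (smult c (level_poly cs fs)) (smult c (level_poly cs gs)) =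
    pf_operator (factors fs (compose_horner cs rf_var)) (factors gs (compose_horner cs rf_var))"
proof -
  have "smult c p = [:c:] * p" for p by simp
  thus ?thesis unfolding picard_fuchs_conv level_poly_def
    by (simp only: to_fract_mult_complex to_fract_factors to_fract_compose_horner rf_var_conv[symmetric])
      (rule pf_operator_mult_const; use assms in \<open>simp add: rf_deriv_const\<close>)
qed

text \<open>Here y is the Hauptmodul itself, so y' = 1 and its logarithmic derivative drops out; the
  levels 3, 5, 6, 7, 10 and 13 are treated alike.\<close>

lemma picard_fuchs_2:
  fixes t :: ratfun
  defines "t \<equiv> rf_var"
  shows "pf_operator (factors num_factors_2 (compose_horner [] t)) (factors den_factors_2 (compose_horner [] t)) =
    (1/t + 1/(2*(t+64)),
     1/(16*t*(t+64)))"
proof -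
  have t: "transcendental t" and [simp]: "rf_deriv t = 1"
    unfolding t_def by (simp_all add: transcendental_var)
  have t0: "t \<noteq> 0" using transcendental_ne_0[OF t, of "[0, 1]"] by simp
  have nz0: "t + 64 \<noteq> 0"
    by (rule transcendental_ne_0[OF t, of "[64, 1]"]) (simp_all, algebra?)
  note nz = t0 nz0
  have T0: "logderiv t = 1/t"
    by (rule logderiv_eq) (simp_all add: nz del: distrib_left_numeral, algebra?)
  have T1: "1/2 * logderiv (t + 64) = 1/(2*(t+64))"
    by (rule scaled_logderiv_eq) (simp_all add: nz del: distrib_left_numeral, algebra?)
  have "logderiv t + 1/2 * logderiv (t + 64) - logderiv (rf_deriv t) = 1/t + 1/(2*(t+64))"
    unfolding T0[symmetric] T1[symmetric] by (simp; algebra?)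
  moreover have "1 * rf_deriv t ^ 2 / (16 * (t * (t + 64))) = 1/(16*t*(t+64))"
  proof (subst frac_eq_eq)
    show "1 * rf_deriv t ^ 2 * (16*t*(t+64)) = 1 * (16 * (t * (t + 64)))"
      by (simp; algebra?)
  qed (simp_all add: nz del: distrib_left_numeral)
  ultimately show ?thesis
    unfolding compose_horner.simps pf_operator_base_2[OF t] by (simp only:)
qed

lemma picard_fuchs_3:
  fixes t :: ratfun
  defines "t \<equiv> rf_var"
  shows "pf_operator (factors num_factors_3 (compose_horner [] t)) (factors den_factors_3 (compose_horner [] t)) =
    (1/t + 2/(3*(t+27)),
     1/(9*t*(t+27)))"
proof -
  have t: "transcendental t" and [simp]: "rf_deriv t = 1"
    unfolding t_def by (simp_all add: transcendental_var)
  have t0: "t \<noteq> 0" using transcendental_ne_0[OF t, of "[0, 1]"] by simp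
  have nz0: "t + 27 \<noteq> 0"
    by (rule transcendental_ne_0[OF t, of "[27, 1]"]) (simp_all, algebra?)
  note nz = t0 nz0
  have T0: "logderiv t = 1/t"
    by (rule logderiv_eq) (simp_all add: nz del: distrib_left_numeral, algebra?)
  have T1: "2/3 * logderiv (t + 27) = 2/(3*(t+27))"
    by (rule scaled_logderiv_eq) (simp_all add: nz del: distrib_left_numeral, algebra?)
  have "logderiv t + 2/3 * logderiv (t + 27) - logderiv (rf_deriv t) = 1/t + 2/(3*(t+27))"
    unfolding T0[symmetric] T1[symmetric] by (simp; algebra?)
  moreover have "1 * rf_deriv t ^ 2 / (9 * (t * (t + 27))) = 1/(9*t*(t+27))"
  proof (subst frac_eq_eq)
    show "1 * rf_deriv t ^ 2 * (9*t*(t+27)) = 1 * (9 * (t * (t + 27)))"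
      by (simp; algebra?)
  qed (simp_all add: nz del: distrib_left_numeral)
  ultimately show ?thesis
    unfolding compose_horner.simps pf_operator_base_3[OF t] by (simp only:)
qed

text \<open>Over the elliptic point y = -64 the map y = t (t + 16) is doubly ramified at t = -8. The
  double zero compensates the weight 1/2 against y', and the singularity disappears.\<close>

lemma picard_fuchs_4:
  fixes t :: ratfun
  defines "t \<equiv> rf_var"
  shows "pf_operator (factors num_factors_2 (compose_horner [[0, 16, 1]] t)) (factors den_factors_2 (compose_horner [[0, 16, 1]] t)) =
    (1/t + 1/(t+16),
     1/(4*t*(t+16)))"
proof -
  have t: "transcendental t" and [simp]: "rf_deriv t = 1"
    unfolding t_def by (simp_all add: transcendental_var)
  have t0: "t \<noteq> 0" using transcendental_ne_0[OF t, of "[0, 1]"] by simp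
  have nz0: "t + 16 \<noteq> 0"
    by (rule transcendental_ne_0[OF t, of "[16, 1]"]) (simp_all, algebra?)
  have nz1: "t + 8 \<noteq> 0"
    by (rule transcendental_ne_0[OF t, of "[8, 1]"]) (simp_all, algebra?)
  note nz = t0 nz0 nz1
  have T0: "logderiv t = 1/t"
    by (rule logderiv_eq) (simp_all add: nz del: distrib_left_numeral, algebra?)
  have T1: "logderiv (t + 16) = 1/(t+16)"
    by (rule logderiv_eq) (simp_all add: nz del: distrib_left_numeral, algebra?)
  define y where "y = compose_horner [[0, 16, 1]] t"
  have y: "transcendental y"
    unfolding y_def compose_horner.simps by (intro transcendental_horner t) simp_all
  have Y: "y = (t + 16) * t"
    unfolding y_def by (simp; algebra)
  have D: "rf_deriv y = 2 * ((t + 8))"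
    unfolding Y by (simp; algebra)
  have y0: "y \<noteq> 0" using transcendental_ne_0[OF y, of "[0, 1]"] by simp
  have ynz0: "y + 64 \<noteq> 0"
    by (rule transcendental_ne_0[OF y, of "[64, 1]"]) (simp_all, algebra?)
  have L: "logderiv y = logderiv (t + 16) + logderiv t"
    unfolding Y by (simp add: logderiv_mult logderiv_power nz)
  have LD: "logderiv (rf_deriv y) = logderiv (t + 8)"
    unfolding D by (simp add: logderiv_mult logderiv_power nz del: distrib_left_numeral)
  have F0: "y + 64 = (t + 8) ^ 2" unfolding Y by algebra
  have L0: "logderiv (y + 64) = 2 * logderiv (t + 8)"
    unfolding F0 by (simp add: logderiv_mult logderiv_power nz)
  have "logderiv y + 1/2 * logderiv (y + 64) - logderiv (rf_deriv y) = 1/t + 1/(t+16)"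
    unfolding L LD L0 T0[symmetric] T1[symmetric] by algebra
  moreover have "1 * rf_deriv y ^ 2 / (16 * (y * (y + 64))) = 1/(4*t*(t+16))"
  proof (subst frac_eq_eq)
    show "1 * rf_deriv y ^ 2 * (4*t*(t+16)) = 1 * (16 * (y * (y + 64)))"
      unfolding D unfolding Y by algebra
  qed (simp_all add: nz y0 ynz0)
  ultimately show ?thesis
    unfolding y_def[symmetric] pf_operator_base_2[OF y] by (simp only:)
qed

lemma picard_fuchs_5:
  fixes t :: ratfun
  defines "t \<equiv> rf_var"
  shows "pf_operator (factors num_factors_5 (compose_horner [] t)) (factors den_factors_5 (compose_horner [] t)) =
    (1/t + (t+11)/(t^2+22*t+125),
     (t+10)/(4*t*(t^2+22*t+125)))"
proof -
  have t: "transcendental t" and [simp]: "rf_deriv t = 1"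
    unfolding t_def by (simp_all add: transcendental_var)
  have t0: "t \<noteq> 0" using transcendental_ne_0[OF t, of "[0, 1]"] by simp
  have nz0: "t ^ 2 + 22 * t + 125 \<noteq> 0"
    by (rule transcendental_ne_0[OF t, of "[125, 22, 1]"]) (simp_all, algebra?)
  note nz = t0 nz0
  have T0: "logderiv t = 1/t"
    by (rule logderiv_eq) (simp_all add: nz del: distrib_left_numeral, algebra?)
  have T1: "1/2 * logderiv (t ^ 2 + 22 * t + 125) = (t+11)/(t^2+22*t+125)"
    by (rule scaled_logderiv_eq) (simp_all add: nz del: distrib_left_numeral, algebra?)
  have "logderiv t + 1/2 * logderiv (t ^ 2 + 22 * t + 125) - logderiv (rf_deriv t) = 1/t + (t+11)/(t^2+22*t+125)"
    unfolding T0[symmetric] T1[symmetric] by (simp; algebra?)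
  moreover have "(t + 10) * rf_deriv t ^ 2 / (4 * (t * (t ^ 2 + 22 * t + 125))) = (t+10)/(4*t*(t^2+22*t+125))"
  proof (subst frac_eq_eq)
    show "(t + 10) * rf_deriv t ^ 2 * (4*t*(t^2+22*t+125)) = (t+10) * (4 * (t * (t ^ 2 + 22 * t + 125)))"
      by (simp; algebra?)
  qed (simp_all add: nz del: distrib_left_numeral)
  ultimately show ?thesis
    unfolding compose_horner.simps pf_operator_base_5[OF t] by (simp only:)
qed

lemma picard_fuchs_6:
  fixes t :: ratfun
  defines "t \<equiv> rf_var"
  shows "pf_operator (factors num_factors_6 (compose_horner [] t)) (factors den_factors_6 (compose_horner [] t)) =
    (1/t + 1/(t+8) + 1/(t+9),
     (t+6)/(t*(t+8)*(t+9)))"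
proof -
  have t: "transcendental t" and [simp]: "rf_deriv t = 1"
    unfolding t_def by (simp_all add: transcendental_var)
  have t0: "t \<noteq> 0" using transcendental_ne_0[OF t, of "[0, 1]"] by simp
  have nz0: "t + 8 \<noteq> 0"
    by (rule transcendental_ne_0[OF t, of "[8, 1]"]) (simp_all, algebra?)
  have nz1: "t + 9 \<noteq> 0"
    by (rule transcendental_ne_0[OF t, of "[9, 1]"]) (simp_all, algebra?)
  note nz = t0 nz0 nz1
  have T0: "logderiv t = 1/t"
    by (rule logderiv_eq) (simp_all add: nz del: distrib_left_numeral, algebra?)
  have T1: "logderiv (t + 8) = 1/(t+8)"
    by (rule logderiv_eq) (simp_all add: nz del: distrib_left_numeral, algebra?)
  have T2: "logderiv (t + 9) = 1/(t+9)"
    by (rule logderiv_eq) (simp_all add: nz del: distrib_left_numeral, algebra?)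
  have "logderiv t + logderiv (t + 8) + logderiv (t + 9) - logderiv (rf_deriv t) = 1/t + 1/(t+8) + 1/(t+9)"
    unfolding T0[symmetric] T1[symmetric] T2[symmetric] by (simp; algebra?)
  moreover have "(t + 6) * rf_deriv t ^ 2 / ((t * (t + 8) * (t + 9))) = (t+6)/(t*(t+8)*(t+9))"
  proof (subst frac_eq_eq)
    show "(t + 6) * rf_deriv t ^ 2 * (t*(t+8)*(t+9)) = (t+6) * ((t * (t + 8) * (t + 9)))"
      by (simp; algebra?)
  qed (simp_all add: nz del: distrib_left_numeral)
  ultimately show ?thesis
    unfolding compose_horner.simps pf_operator_base_6[OF t] by (simp only:)
qed

lemma picard_fuchs_7:
  fixes t :: ratfun
  defines "t \<equiv> rf_var"
  shows "pf_operator (factors num_factors_7 (compose_horner [] t)) (factors den_factors_7 (compose_horner [] t)) =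
    (1/t + (4*t+26)/(3*(t^2+13*t+49)),
     (4*t+21)/(9*t*(t^2+13*t+49)))"
proof -
  have t: "transcendental t" and [simp]: "rf_deriv t = 1"
    unfolding t_def by (simp_all add: transcendental_var)
  have t0: "t \<noteq> 0" using transcendental_ne_0[OF t, of "[0, 1]"] by simp
  have nz0: "t ^ 2 + 13 * t + 49 \<noteq> 0"
    by (rule transcendental_ne_0[OF t, of "[49, 13, 1]"]) (simp_all, algebra?)
  note nz = t0 nz0
  have T0: "logderiv t = 1/t"
    by (rule logderiv_eq) (simp_all add: nz del: distrib_left_numeral, algebra?)
  have T1: "2/3 * logderiv (t ^ 2 + 13 * t + 49) = (4*t+26)/(3*(t^2+13*t+49))"
    by (rule scaled_logderiv_eq) (simp_all add: nz del: distrib_left_numeral, algebra?)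
  have "logderiv t + 2/3 * logderiv (t ^ 2 + 13 * t + 49) - logderiv (rf_deriv t) = 1/t + (4*t+26)/(3*(t^2+13*t+49))"
    unfolding T0[symmetric] T1[symmetric] by (simp; algebra?)
  moreover have "(4 * t + 21) * rf_deriv t ^ 2 / (9 * (t * (t ^ 2 + 13 * t + 49))) = (4*t+21)/(9*t*(t^2+13*t+49))"
  proof (subst frac_eq_eq)
    show "(4 * t + 21) * rf_deriv t ^ 2 * (9*t*(t^2+13*t+49)) = (4*t+21) * (9 * (t * (t ^ 2 + 13 * t + 49)))"
      by (simp; algebra?)
  qed (simp_all add: nz del: distrib_left_numeral)
  ultimately show ?thesis
    unfolding compose_horner.simps pf_operator_base_7[OF t] by (simp only:)
qed

text \<open>Two quadratic steps over level 2. The cusp t = -4 is doubly ramified over y = 0 and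
  keeps weight 2 - 1 = 1; all points over y = -64 are ramified and drop out.\<close>

lemma picard_fuchs_8:
  fixes t :: ratfun
  defines "t \<equiv> rf_var"
  shows "pf_operator (factors num_factors_2 (compose_horner [[0, 8, 1], [0, 16, 1]] t)) (factors den_factors_2 (compose_horner [[0, 8, 1], [0, 16, 1]] t)) =
    (1/t + 1/(t+4) + 1/(t+8),
     1/(t*(t+8)))"
proof -
  have t: "transcendental t" and [simp]: "rf_deriv t = 1"
    unfolding t_def by (simp_all add: transcendental_var)
  have t0: "t \<noteq> 0" using transcendental_ne_0[OF t, of "[0, 1]"] by simp
  have nz0: "t + 4 \<noteq> 0"
    by (rule transcendental_ne_0[OF t, of "[4, 1]"]) (simp_all, algebra?)
  have nz1: "t + 8 \<noteq> 0"
    by (rule transcendental_ne_0[OF t, of "[8, 1]"]) (simp_all, algebra?)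
  have nz2: "t ^ 2 + 8 * t + 8 \<noteq> 0"
    by (rule transcendental_ne_0[OF t, of "[8, 8, 1]"]) (simp_all, algebra?)
  note nz = t0 nz0 nz1 nz2
  have T0: "logderiv t = 1/t"
    by (rule logderiv_eq) (simp_all add: nz del: distrib_left_numeral, algebra?)
  have T1: "logderiv (t + 4) = 1/(t+4)"
    by (rule logderiv_eq) (simp_all add: nz del: distrib_left_numeral, algebra?)
  have T2: "logderiv (t + 8) = 1/(t+8)"
    by (rule logderiv_eq) (simp_all add: nz del: distrib_left_numeral, algebra?)
  define y where "y = compose_horner [[0, 8, 1], [0, 16, 1]] t"
  have y: "transcendental y"
    unfolding y_def compose_horner.simps by (intro transcendental_horner t) simp_all
  have Y: "y = t * (t + 8) * (t + 4) ^ 2"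
    unfolding y_def by (simp; algebra)
  have D: "rf_deriv y = 4 * ((t + 4) * (t ^ 2 + 8 * t + 8))"
    unfolding Y by (simp; algebra)
  have y0: "y \<noteq> 0" using transcendental_ne_0[OF y, of "[0, 1]"] by simp
  have ynz0: "y + 64 \<noteq> 0"
    by (rule transcendental_ne_0[OF y, of "[64, 1]"]) (simp_all, algebra?)
  have L: "logderiv y = logderiv t + logderiv (t + 8) + 2 * logderiv (t + 4)"
    unfolding Y by (simp add: logderiv_mult logderiv_power nz)
  have LD: "logderiv (rf_deriv y) = logderiv (t + 4) + logderiv (t ^ 2 + 8 * t + 8)"
    unfolding D by (simp add: logderiv_mult logderiv_power nz del: distrib_left_numeral)
  have F0: "y + 64 = (t ^ 2 + 8 * t + 8) ^ 2" unfolding Y by algebra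
  have L0: "logderiv (y + 64) = 2 * logderiv (t ^ 2 + 8 * t + 8)"
    unfolding F0 by (simp add: logderiv_mult logderiv_power nz)
  have "logderiv y + 1/2 * logderiv (y + 64) - logderiv (rf_deriv y) = 1/t + 1/(t+4) + 1/(t+8)"
    unfolding L LD L0 T0[symmetric] T1[symmetric] T2[symmetric] by algebra
  moreover have "1 * rf_deriv y ^ 2 / (16 * (y * (y + 64))) = 1/(t*(t+8))"
  proof (subst frac_eq_eq)
    show "1 * rf_deriv y ^ 2 * (t*(t+8)) = 1 * (16 * (y * (y + 64)))"
      unfolding D unfolding Y by algebra
  qed (simp_all add: nz y0 ynz0)
  ultimately show ?thesis
    unfolding y_def[symmetric] pf_operator_base_2[OF y] by (simp only:)
qed

text \<open>Triple ramification over the elliptic point of order 3, y + 27 = (t + 3)^3, removes it: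
  3 * 2/3 = 2 is the exponent of t + 3 in y'.\<close>

lemma picard_fuchs_9:
  fixes t :: ratfun
  defines "t \<equiv> rf_var"
  shows "pf_operator (factors num_factors_3 (compose_horner [[0, 27, 9, 1]] t)) (factors den_factors_3 (compose_horner [[0, 27, 9, 1]] t)) =
    (1/t + (2*t+9)/(t^2+9*t+27),
     (t+3)/(t*(t^2+9*t+27)))"
proof -
  have t: "transcendental t" and [simp]: "rf_deriv t = 1"
    unfolding t_def by (simp_all add: transcendental_var)
  have t0: "t \<noteq> 0" using transcendental_ne_0[OF t, of "[0, 1]"] by simp
  have nz0: "t ^ 2 + 9 * t + 27 \<noteq> 0"
    by (rule transcendental_ne_0[OF t, of "[27, 9, 1]"]) (simp_all, algebra?)
  have nz1: "t + 3 \<noteq> 0"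
    by (rule transcendental_ne_0[OF t, of "[3, 1]"]) (simp_all, algebra?)
  note nz = t0 nz0 nz1
  have T0: "logderiv t = 1/t"
    by (rule logderiv_eq) (simp_all add: nz del: distrib_left_numeral, algebra?)
  have T1: "logderiv (t ^ 2 + 9 * t + 27) = (2*t+9)/(t^2+9*t+27)"
    by (rule logderiv_eq) (simp_all add: nz del: distrib_left_numeral, algebra?)
  define y where "y = compose_horner [[0, 27, 9, 1]] t"
  have y: "transcendental y"
    unfolding y_def compose_horner.simps by (intro transcendental_horner t) simp_all
  have Y: "y = t * (t ^ 2 + 9 * t + 27)"
    unfolding y_def by (simp; algebra)
  have D: "rf_deriv y = 3 * ((t + 3) ^ 2)"
    unfolding Y by (simp; algebra)
  have y0: "y \<noteq> 0" using transcendental_ne_0[OF y, of "[0, 1]"] by simp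
  have ynz0: "y + 27 \<noteq> 0"
    by (rule transcendental_ne_0[OF y, of "[27, 1]"]) (simp_all, algebra?)
  have L: "logderiv y = logderiv t + logderiv (t ^ 2 + 9 * t + 27)"
    unfolding Y by (simp add: logderiv_mult logderiv_power nz)
  have LD: "logderiv (rf_deriv y) = 2 * logderiv (t + 3)"
    unfolding D by (simp add: logderiv_mult logderiv_power nz del: distrib_left_numeral)
  have F0: "y + 27 = (t + 3) ^ 3" unfolding Y by algebra
  have L0: "logderiv (y + 27) = 3 * logderiv (t + 3)"
    unfolding F0 by (simp add: logderiv_mult logderiv_power nz)
  have "logderiv y + 2/3 * logderiv (y + 27) - logderiv (rf_deriv y) = 1/t + (2*t+9)/(t^2+9*t+27)"
    unfolding L LD L0 T0[symmetric] T1[symmetric] by algebra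
  moreover have "1 * rf_deriv y ^ 2 / (9 * (y * (y + 27))) = (t+3)/(t*(t^2+9*t+27))"
  proof (subst frac_eq_eq)
    show "1 * rf_deriv y ^ 2 * (t*(t^2+9*t+27)) = (t+3) * (9 * (y * (y + 27)))"
      unfolding D unfolding Y by algebra
  qed (simp_all add: nz y0 ynz0)
  ultimately show ?thesis
    unfolding y_def[symmetric] pf_operator_base_3[OF y] by (simp only:)
qed

lemma picard_fuchs_10:
  fixes t :: ratfun
  defines "t \<equiv> rf_var"
  shows "pf_operator (factors num_factors_10 (compose_horner [] t)) (factors den_factors_10 (compose_horner [] t)) =
    (1/t + 1/(t+4) + 1/(t+5) + (t+4)/(t^2+8*t+20),
     (9*t^3+95*t^2+340*t+400)/(4*t*(t+4)*(t+5)*(t^2+8*t+20)))"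
proof -
  have t: "transcendental t" and [simp]: "rf_deriv t = 1"
    unfolding t_def by (simp_all add: transcendental_var)
  have t0: "t \<noteq> 0" using transcendental_ne_0[OF t, of "[0, 1]"] by simp
  have nz0: "t + 4 \<noteq> 0"
    by (rule transcendental_ne_0[OF t, of "[4, 1]"]) (simp_all, algebra?)
  have nz1: "t + 5 \<noteq> 0"
    by (rule transcendental_ne_0[OF t, of "[5, 1]"]) (simp_all, algebra?)
  have nz2: "t ^ 2 + 8 * t + 20 \<noteq> 0"
    by (rule transcendental_ne_0[OF t, of "[20, 8, 1]"]) (simp_all, algebra?)
  note nz = t0 nz0 nz1 nz2
  have T0: "logderiv t = 1/t"
    by (rule logderiv_eq) (simp_all add: nz del: distrib_left_numeral, algebra?)
  have T1: "logderiv (t + 4) = 1/(t+4)"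
    by (rule logderiv_eq) (simp_all add: nz del: distrib_left_numeral, algebra?)
  have T2: "logderiv (t + 5) = 1/(t+5)"
    by (rule logderiv_eq) (simp_all add: nz del: distrib_left_numeral, algebra?)
  have T3: "1/2 * logderiv (t ^ 2 + 8 * t + 20) = (t+4)/(t^2+8*t+20)"
    by (rule scaled_logderiv_eq) (simp_all add: nz del: distrib_left_numeral, algebra?)
  have "logderiv t + logderiv (t + 4) + logderiv (t + 5) + 1/2 * logderiv (t ^ 2 + 8 * t + 20) - logderiv (rf_deriv t) = 1/t + 1/(t+4) + 1/(t+5) + (t+4)/(t^2+8*t+20)"
    unfolding T0[symmetric] T1[symmetric] T2[symmetric] T3[symmetric] by (simp; algebra?)
  moreover have "(9 * t ^ 3 + 95 * t ^ 2 + 340 * t + 400) * rf_deriv t ^ 2 / (4 * (t * (t + 4) * (t + 5) * (t ^ 2 + 8 * t + 20))) = (9*t^3+95*t^2+340*t+400)/(4*t*(t+4)*(t+5)*(t^2+8*t+20))"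
  proof (subst frac_eq_eq)
    show "(9 * t ^ 3 + 95 * t ^ 2 + 340 * t + 400) * rf_deriv t ^ 2 * (4*t*(t+4)*(t+5)*(t^2+8*t+20)) = (9*t^3+95*t^2+340*t+400) * (4 * (t * (t + 4) * (t + 5) * (t ^ 2 + 8 * t + 20)))"
      by (simp; algebra?)
  qed (simp_all add: nz del: distrib_left_numeral)
  ultimately show ?thesis
    unfolding compose_horner.simps pf_operator_base_10[OF t] by (simp only:)
qed

text \<open>The point t = -3 is doubly ramified over the cusp y = -9 and keeps weight 2 - 1 = 1 in
  the first coefficient, while it cancels from the second; y = -8 splits into t = -2 and t =
  -4.\<close>

lemma picard_fuchs_12:
  fixes t :: ratfun
  defines "t \<equiv> rf_var"
  shows "pf_operator (factors num_factors_6 (compose_horner [[0, 6, 1]] t)) (factors den_factors_6 (compose_horner [[0, 6, 1]] t)) =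
    (1/t + 1/(t+2) + 1/(t+3) + 1/(t+4) + 1/(t+6),
     4*(t^2+6*t+6)/(t*(t+2)*(t+4)*(t+6)))"
proof -
  have t: "transcendental t" and [simp]: "rf_deriv t = 1"
    unfolding t_def by (simp_all add: transcendental_var)
  have t0: "t \<noteq> 0" using transcendental_ne_0[OF t, of "[0, 1]"] by simp
  have nz0: "t + 2 \<noteq> 0"
    by (rule transcendental_ne_0[OF t, of "[2, 1]"]) (simp_all, algebra?)
  have nz1: "t + 3 \<noteq> 0"
    by (rule transcendental_ne_0[OF t, of "[3, 1]"]) (simp_all, algebra?)
  have nz2: "t + 4 \<noteq> 0"
    by (rule transcendental_ne_0[OF t, of "[4, 1]"]) (simp_all, algebra?)
  have nz3: "t + 6 \<noteq> 0"
    by (rule transcendental_ne_0[OF t, of "[6, 1]"]) (simp_all, algebra?)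
  note nz = t0 nz0 nz1 nz2 nz3
  have T0: "logderiv t = 1/t"
    by (rule logderiv_eq) (simp_all add: nz del: distrib_left_numeral, algebra?)
  have T1: "logderiv (t + 2) = 1/(t+2)"
    by (rule logderiv_eq) (simp_all add: nz del: distrib_left_numeral, algebra?)
  have T2: "logderiv (t + 3) = 1/(t+3)"
    by (rule logderiv_eq) (simp_all add: nz del: distrib_left_numeral, algebra?)
  have T3: "logderiv (t + 4) = 1/(t+4)"
    by (rule logderiv_eq) (simp_all add: nz del: distrib_left_numeral, algebra?)
  have T4: "logderiv (t + 6) = 1/(t+6)"
    by (rule logderiv_eq) (simp_all add: nz del: distrib_left_numeral, algebra?)
  define y where "y = compose_horner [[0, 6, 1]] t"
  have y: "transcendental y"
    unfolding y_def compose_horner.simps by (intro transcendental_horner t) simp_all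
  have Y: "y = t * (t + 6)"
    unfolding y_def by (simp; algebra)
  have D: "rf_deriv y = 2 * ((t + 3))"
    unfolding Y by (simp; algebra)
  have y0: "y \<noteq> 0" using transcendental_ne_0[OF y, of "[0, 1]"] by simp
  have ynz0: "y + 8 \<noteq> 0"
    by (rule transcendental_ne_0[OF y, of "[8, 1]"]) (simp_all, algebra?)
  have ynz1: "y + 9 \<noteq> 0"
    by (rule transcendental_ne_0[OF y, of "[9, 1]"]) (simp_all, algebra?)
  have L: "logderiv y = logderiv t + logderiv (t + 6)"
    unfolding Y by (simp add: logderiv_mult logderiv_power nz)
  have LD: "logderiv (rf_deriv y) = logderiv (t + 3)"
    unfolding D by (simp add: logderiv_mult logderiv_power nz del: distrib_left_numeral)
  have F0: "y + 8 = (t + 2) * (t + 4)" unfolding Y by algebra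
  have L0: "logderiv (y + 8) = logderiv (t + 2) + logderiv (t + 4)"
    unfolding F0 by (simp add: logderiv_mult logderiv_power nz)
  have F1: "y + 9 = (t + 3) ^ 2" unfolding Y by algebra
  have L1: "logderiv (y + 9) = 2 * logderiv (t + 3)"
    unfolding F1 by (simp add: logderiv_mult logderiv_power nz)
  have "logderiv y + logderiv (y + 8) + logderiv (y + 9) - logderiv (rf_deriv y) = 1/t + 1/(t+2) + 1/(t+3) + 1/(t+4) + 1/(t+6)"
    unfolding L LD L0 L1 T0[symmetric] T1[symmetric] T2[symmetric] T3[symmetric] T4[symmetric] by algebra
  moreover have "(y + 6) * rf_deriv y ^ 2 / ((y * (y + 8) * (y + 9))) = 4*(t^2+6*t+6)/(t*(t+2)*(t+4)*(t+6))"
  proof (subst frac_eq_eq)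
    show "(y + 6) * rf_deriv y ^ 2 * (t*(t+2)*(t+4)*(t+6)) = 4*(t^2+6*t+6) * ((y * (y + 8) * (y + 9)))"
      unfolding D unfolding Y by algebra
  qed (simp_all add: nz y0 ynz0 ynz1)
  ultimately show ?thesis
    unfolding y_def[symmetric] pf_operator_base_6[OF y] by (simp only:)
qed

lemma picard_fuchs_13:
  fixes t :: ratfun
  defines "t \<equiv> rf_var"
  shows "pf_operator (factors num_factors_13 (compose_horner [] t)) (factors den_factors_13 (compose_horner [] t)) =
    (1/t + (t+3)/(t^2+6*t+13) + (4*t+10)/(3*(t^2+5*t+13)),
     (49*t^3+351*t^2+1027*t+1014)/(36*t*(t^2+5*t+13)*(t^2+6*t+13)))"
proof -
  have t: "transcendental t" and [simp]: "rf_deriv t = 1"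
    unfolding t_def by (simp_all add: transcendental_var)
  have t0: "t \<noteq> 0" using transcendental_ne_0[OF t, of "[0, 1]"] by simp
  have nz0: "t ^ 2 + 6 * t + 13 \<noteq> 0"
    by (rule transcendental_ne_0[OF t, of "[13, 6, 1]"]) (simp_all, algebra?)
  have nz1: "t ^ 2 + 5 * t + 13 \<noteq> 0"
    by (rule transcendental_ne_0[OF t, of "[13, 5, 1]"]) (simp_all, algebra?)
  note nz = t0 nz0 nz1
  have T0: "logderiv t = 1/t"
    by (rule logderiv_eq) (simp_all add: nz del: distrib_left_numeral, algebra?)
  have T1: "1/2 * logderiv (t ^ 2 + 6 * t + 13) = (t+3)/(t^2+6*t+13)"
    by (rule scaled_logderiv_eq) (simp_all add: nz del: distrib_left_numeral, algebra?)
  have T2: "2/3 * logderiv (t ^ 2 + 5 * t + 13) = (4*t+10)/(3*(t^2+5*t+13))"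
    by (rule scaled_logderiv_eq) (simp_all add: nz del: distrib_left_numeral, algebra?)
  have "logderiv t + 1/2 * logderiv (t ^ 2 + 6 * t + 13) + 2/3 * logderiv (t ^ 2 + 5 * t + 13) - logderiv (rf_deriv t) = 1/t + (t+3)/(t^2+6*t+13) + (4*t+10)/(3*(t^2+5*t+13))"
    unfolding T0[symmetric] T1[symmetric] T2[symmetric] by (simp; algebra?)
  moreover have "(49 * t ^ 3 + 351 * t ^ 2 + 1027 * t + 1014) * rf_deriv t ^ 2 / (36 * (t * (t ^ 2 + 6 * t + 13) * (t ^ 2 + 5 * t + 13))) = (49*t^3+351*t^2+1027*t+1014)/(36*t*(t^2+5*t+13)*(t^2+6*t+13))"
  proof (subst frac_eq_eq)
    show "(49 * t ^ 3 + 351 * t ^ 2 + 1027 * t + 1014) * rf_deriv t ^ 2 * (36*t*(t^2+5*t+13)*(t^2+6*t+13)) = (49*t^3+351*t^2+1027*t+1014) * (36 * (t * (t ^ 2 + 6 * t + 13) * (t ^ 2 + 5 * t + 13)))"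
      by (simp; algebra?)
  qed (simp_all add: nz del: distrib_left_numeral)
  ultimately show ?thesis
    unfolding compose_horner.simps pf_operator_base_13[OF t] by (simp only:)
qed

text \<open>Three quadratic steps over level 2. The cusp t = -2 has multiplicity 4 in y and 3 in y',
  again leaving weight 1.\<close>

lemma picard_fuchs_16:
  fixes t :: ratfun
  defines "t \<equiv> rf_var"
  shows "pf_operator (factors num_factors_2 (compose_horner [[0, 4, 1], [0, 8, 1], [0, 16, 1]] t)) (factors den_factors_2 (compose_horner [[0, 4, 1], [0, 8, 1], [0, 16, 1]] t)) =
    (1/t + 1/(t+2) + 1/(t+4) + (2*t+4)/(t^2+4*t+8),
     4*(t+2)^2/(t*(t+4)*(t^2+4*t+8)))"
proof -
  have t: "transcendental t" and [simp]: "rf_deriv t = 1"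
    unfolding t_def by (simp_all add: transcendental_var)
  have t0: "t \<noteq> 0" using transcendental_ne_0[OF t, of "[0, 1]"] by simp
  have nz0: "t + 2 \<noteq> 0"
    by (rule transcendental_ne_0[OF t, of "[2, 1]"]) (simp_all, algebra?)
  have nz1: "t + 4 \<noteq> 0"
    by (rule transcendental_ne_0[OF t, of "[4, 1]"]) (simp_all, algebra?)
  have nz2: "t ^ 2 + 4 * t + 8 \<noteq> 0"
    by (rule transcendental_ne_0[OF t, of "[8, 4, 1]"]) (simp_all, algebra?)
  have nz3: "t ^ 4 + 8 * t ^ 3 + 24 * t ^ 2 + 32 * t + 8 \<noteq> 0"
    by (rule transcendental_ne_0[OF t, of "[8, 32, 24, 8, 1]"]) (simp_all, algebra?)
  note nz = t0 nz0 nz1 nz2 nz3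
  have T0: "logderiv t = 1/t"
    by (rule logderiv_eq) (simp_all add: nz del: distrib_left_numeral, algebra?)
  have T1: "logderiv (t + 2) = 1/(t+2)"
    by (rule logderiv_eq) (simp_all add: nz del: distrib_left_numeral, algebra?)
  have T2: "logderiv (t + 4) = 1/(t+4)"
    by (rule logderiv_eq) (simp_all add: nz del: distrib_left_numeral, algebra?)
  have T3: "logderiv (t ^ 2 + 4 * t + 8) = (2*t+4)/(t^2+4*t+8)"
    by (rule logderiv_eq) (simp_all add: nz del: distrib_left_numeral, algebra?)
  define y where "y = compose_horner [[0, 4, 1], [0, 8, 1], [0, 16, 1]] t"
  have y: "transcendental y"
    unfolding y_def compose_horner.simps by (intro transcendental_horner t) simp_all
  have Y: "y = t * (t + 4) * (t ^ 2 + 4 * t + 8) * (t + 2) ^ 4"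
    unfolding y_def by (simp; algebra)
  have D: "rf_deriv y = 8 * ((t + 2) ^ 3 * (t ^ 4 + 8 * t ^ 3 + 24 * t ^ 2 + 32 * t + 8))"
    unfolding Y by (simp; algebra)
  have y0: "y \<noteq> 0" using transcendental_ne_0[OF y, of "[0, 1]"] by simp
  have ynz0: "y + 64 \<noteq> 0"
    by (rule transcendental_ne_0[OF y, of "[64, 1]"]) (simp_all, algebra?)
  have L: "logderiv y = logderiv t + logderiv (t + 4) + logderiv (t ^ 2 + 4 * t + 8) + 4 * logderiv (t + 2)"
    unfolding Y by (simp add: logderiv_mult logderiv_power nz)
  have LD: "logderiv (rf_deriv y) = 3 * logderiv (t + 2) + logderiv (t ^ 4 + 8 * t ^ 3 + 24 * t ^ 2 + 32 * t + 8)"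
    unfolding D by (simp add: logderiv_mult logderiv_power nz del: distrib_left_numeral)
  have F0: "y + 64 = (t ^ 4 + 8 * t ^ 3 + 24 * t ^ 2 + 32 * t + 8) ^ 2" unfolding Y by algebra
  have L0: "logderiv (y + 64) = 2 * logderiv (t ^ 4 + 8 * t ^ 3 + 24 * t ^ 2 + 32 * t + 8)"
    unfolding F0 by (simp add: logderiv_mult logderiv_power nz)
  have "logderiv y + 1/2 * logderiv (y + 64) - logderiv (rf_deriv y) = 1/t + 1/(t+2) + 1/(t+4) + (2*t+4)/(t^2+4*t+8)"
    unfolding L LD L0 T0[symmetric] T1[symmetric] T2[symmetric] T3[symmetric] by algebra
  moreover have "1 * rf_deriv y ^ 2 / (16 * (y * (y + 64))) = 4*(t+2)^2/(t*(t+4)*(t^2+4*t+8))"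
  proof (subst frac_eq_eq)
    show "1 * rf_deriv y ^ 2 * (t*(t+4)*(t^2+4*t+8)) = 4*(t+2)^2 * (16 * (y * (y + 64)))"
      unfolding D unfolding Y by algebra
  qed (simp_all add: nz y0 ynz0)
  ultimately show ?thesis
    unfolding y_def[symmetric] pf_operator_base_2[OF y] by (simp only:)
qed

text \<open>Total ramification over a cusp of level 6, y + 8 = (t + 2)^3, leaves weight 3 - 2 = 1 at
  t = -2. The cusp y = -9 splits into t = -3 and two conjugate points.\<close>

lemma picard_fuchs_18:
  fixes t :: ratfun
  defines "t \<equiv> rf_var"
  shows "pf_operator (factors num_factors_6 (compose_horner [[0, 12, 6, 1]] t)) (factors den_factors_6 (compose_horner [[0, 12, 6, 1]] t)) =
    (1/t + 1/(t+2) + 1/(t+3) + (2*t+3)/(t^2+3*t+3) + (2*t+6)/(t^2+6*t+12),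
     9*(t+2)*(t^3+6*t^2+12*t+6)/(t*(t+3)*(t^2+3*t+3)*(t^2+6*t+12)))"
proof -
  have t: "transcendental t" and [simp]: "rf_deriv t = 1"
    unfolding t_def by (simp_all add: transcendental_var)
  have t0: "t \<noteq> 0" using transcendental_ne_0[OF t, of "[0, 1]"] by simp
  have nz0: "t + 2 \<noteq> 0"
    by (rule transcendental_ne_0[OF t, of "[2, 1]"]) (simp_all, algebra?)
  have nz1: "t + 3 \<noteq> 0"
    by (rule transcendental_ne_0[OF t, of "[3, 1]"]) (simp_all, algebra?)
  have nz2: "t ^ 2 + 3 * t + 3 \<noteq> 0"
    by (rule transcendental_ne_0[OF t, of "[3, 3, 1]"]) (simp_all, algebra?)
  have nz3: "t ^ 2 + 6 * t + 12 \<noteq> 0"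
    by (rule transcendental_ne_0[OF t, of "[12, 6, 1]"]) (simp_all, algebra?)
  note nz = t0 nz0 nz1 nz2 nz3
  have T0: "logderiv t = 1/t"
    by (rule logderiv_eq) (simp_all add: nz del: distrib_left_numeral, algebra?)
  have T1: "logderiv (t + 2) = 1/(t+2)"
    by (rule logderiv_eq) (simp_all add: nz del: distrib_left_numeral, algebra?)
  have T2: "logderiv (t + 3) = 1/(t+3)"
    by (rule logderiv_eq) (simp_all add: nz del: distrib_left_numeral, algebra?)
  have T3: "logderiv (t ^ 2 + 3 * t + 3) = (2*t+3)/(t^2+3*t+3)"
    by (rule logderiv_eq) (simp_all add: nz del: distrib_left_numeral, algebra?)
  have T4: "logderiv (t ^ 2 + 6 * t + 12) = (2*t+6)/(t^2+6*t+12)"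
    by (rule logderiv_eq) (simp_all add: nz del: distrib_left_numeral, algebra?)
  define y where "y = compose_horner [[0, 12, 6, 1]] t"
  have y: "transcendental y"
    unfolding y_def compose_horner.simps by (intro transcendental_horner t) simp_all
  have Y: "y = t * (t ^ 2 + 6 * t + 12)"
    unfolding y_def by (simp; algebra)
  have D: "rf_deriv y = 3 * ((t + 2) ^ 2)"
    unfolding Y by (simp; algebra)
  have y0: "y \<noteq> 0" using transcendental_ne_0[OF y, of "[0, 1]"] by simp
  have ynz0: "y + 8 \<noteq> 0"
    by (rule transcendental_ne_0[OF y, of "[8, 1]"]) (simp_all, algebra?)
  have ynz1: "y + 9 \<noteq> 0"
    by (rule transcendental_ne_0[OF y, of "[9, 1]"]) (simp_all, algebra?)
  have L: "logderiv y = logderiv t + logderiv (t ^ 2 + 6 * t + 12)"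
    unfolding Y by (simp add: logderiv_mult logderiv_power nz)
  have LD: "logderiv (rf_deriv y) = 2 * logderiv (t + 2)"
    unfolding D by (simp add: logderiv_mult logderiv_power nz del: distrib_left_numeral)
  have F0: "y + 8 = (t + 2) ^ 3" unfolding Y by algebra
  have L0: "logderiv (y + 8) = 3 * logderiv (t + 2)"
    unfolding F0 by (simp add: logderiv_mult logderiv_power nz)
  have F1: "y + 9 = (t + 3) * (t ^ 2 + 3 * t + 3)" unfolding Y by algebra
  have L1: "logderiv (y + 9) = logderiv (t + 3) + logderiv (t ^ 2 + 3 * t + 3)"
    unfolding F1 by (simp add: logderiv_mult logderiv_power nz)
  have "logderiv y + logderiv (y + 8) + logderiv (y + 9) - logderiv (rf_deriv y) = 1/t + 1/(t+2) + 1/(t+3) + (2*t+3)/(t^2+3*t+3) + (2*t+6)/(t^2+6*t+12)"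
    unfolding L LD L0 L1 T0[symmetric] T1[symmetric] T2[symmetric] T3[symmetric] T4[symmetric] by algebra
  moreover have "(y + 6) * rf_deriv y ^ 2 / ((y * (y + 8) * (y + 9))) = 9*(t+2)*(t^3+6*t^2+12*t+6)/(t*(t+3)*(t^2+3*t+3)*(t^2+6*t+12))"
  proof (subst frac_eq_eq)
    show "(y + 6) * rf_deriv y ^ 2 * (t*(t+3)*(t^2+3*t+3)*(t^2+6*t+12)) = 9*(t+2)*(t^3+6*t^2+12*t+6) * ((y * (y + 8) * (y + 9)))"
      unfolding D unfolding Y by algebra
  qed (simp_all add: nz y0 ynz0 ynz1)
  ultimately show ?thesis
    unfolding y_def[symmetric] pf_operator_base_6[OF y] by (simp only:)
qed

text \<open>Over each of the two elliptic points of level 5 the map of degree 5 has two double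
  points and one simple point. The double points are the roots of the quartic factor of y' and drop
  out; the simple ones are the roots of t^2 + 2 t + 5 and stay elliptic.\<close>

lemma picard_fuchs_25:
  fixes t :: ratfun
  defines "t \<equiv> rf_var"
  shows "pf_operator (factors num_factors_5 (compose_horner [[0, 25, 25, 15, 5, 1]] t)) (factors den_factors_5 (compose_horner [[0, 25, 25, 15, 5, 1]] t)) =
    (1/t + (4*t^3+15*t^2+30*t+25)/(t^4+5*t^3+15*t^2+25*t+25) + (t+1)/(t^2+2*t+5),
     25*(t^5+5*t^4+15*t^3+25*t^2+25*t+10)/(4*t*(t^2+2*t+5)*(t^4+5*t^3+15*t^2+25*t+25)))"
proof -
  have t: "transcendental t" and [simp]: "rf_deriv t = 1"
    unfolding t_def by (simp_all add: transcendental_var)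
  have t0: "t \<noteq> 0" using transcendental_ne_0[OF t, of "[0, 1]"] by simp
  have nz0: "t ^ 4 + 5 * t ^ 3 + 15 * t ^ 2 + 25 * t + 25 \<noteq> 0"
    by (rule transcendental_ne_0[OF t, of "[25, 25, 15, 5, 1]"]) (simp_all, algebra?)
  have nz1: "t ^ 2 + 2 * t + 5 \<noteq> 0"
    by (rule transcendental_ne_0[OF t, of "[5, 2, 1]"]) (simp_all, algebra?)
  have nz2: "t ^ 4 + 4 * t ^ 3 + 9 * t ^ 2 + 10 * t + 5 \<noteq> 0"
    by (rule transcendental_ne_0[OF t, of "[5, 10, 9, 4, 1]"]) (simp_all, algebra?)
  note nz = t0 nz0 nz1 nz2
  have T0: "logderiv t = 1/t"
    by (rule logderiv_eq) (simp_all add: nz del: distrib_left_numeral, algebra?)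
  have T1: "logderiv (t ^ 4 + 5 * t ^ 3 + 15 * t ^ 2 + 25 * t + 25) = (4*t^3+15*t^2+30*t+25)/(t^4+5*t^3+15*t^2+25*t+25)"
    by (rule logderiv_eq) (simp_all add: nz del: distrib_left_numeral, algebra?)
  have T2: "1/2 * logderiv (t ^ 2 + 2 * t + 5) = (t+1)/(t^2+2*t+5)"
    by (rule scaled_logderiv_eq) (simp_all add: nz del: distrib_left_numeral, algebra?)
  define y where "y = compose_horner [[0, 25, 25, 15, 5, 1]] t"
  have y: "transcendental y"
    unfolding y_def compose_horner.simps by (intro transcendental_horner t) simp_all
  have Y: "y = t * (t ^ 4 + 5 * t ^ 3 + 15 * t ^ 2 + 25 * t + 25)"
    unfolding y_def by (simp; algebra)
  have D: "rf_deriv y = 5 * ((t ^ 4 + 4 * t ^ 3 + 9 * t ^ 2 + 10 * t + 5))"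
    unfolding Y by (simp; algebra)
  have y0: "y \<noteq> 0" using transcendental_ne_0[OF y, of "[0, 1]"] by simp
  have ynz0: "y ^ 2 + 22 * y + 125 \<noteq> 0"
    by (rule transcendental_ne_0[OF y, of "[125, 22, 1]"]) (simp_all, algebra?)
  have L: "logderiv y = logderiv t + logderiv (t ^ 4 + 5 * t ^ 3 + 15 * t ^ 2 + 25 * t + 25)"
    unfolding Y by (simp add: logderiv_mult logderiv_power nz)
  have LD: "logderiv (rf_deriv y) = logderiv (t ^ 4 + 4 * t ^ 3 + 9 * t ^ 2 + 10 * t + 5)"
    unfolding D by (simp add: logderiv_mult logderiv_power nz del: distrib_left_numeral)
  have F0: "y ^ 2 + 22 * y + 125 = (t ^ 2 + 2 * t + 5) * (t ^ 4 + 4 * t ^ 3 + 9 * t ^ 2 + 10 * t + 5) ^ 2" unfolding Y by algebra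
  have L0: "logderiv (y ^ 2 + 22 * y + 125) = logderiv (t ^ 2 + 2 * t + 5) + 2 * logderiv (t ^ 4 + 4 * t ^ 3 + 9 * t ^ 2 + 10 * t + 5)"
    unfolding F0 by (simp add: logderiv_mult logderiv_power nz)
  have "logderiv y + 1/2 * logderiv (y ^ 2 + 22 * y + 125) - logderiv (rf_deriv y) = 1/t + (4*t^3+15*t^2+30*t+25)/(t^4+5*t^3+15*t^2+25*t+25) + (t+1)/(t^2+2*t+5)"
    unfolding L LD L0 T0[symmetric] T1[symmetric] T2[symmetric] by algebra
  moreover have "(y + 10) * rf_deriv y ^ 2 / (4 * (y * (y ^ 2 + 22 * y + 125))) = 25*(t^5+5*t^4+15*t^3+25*t^2+25*t+10)/(4*t*(t^2+2*t+5)*(t^4+5*t^3+15*t^2+25*t+25))"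
  proof (subst frac_eq_eq)
    show "(y + 10) * rf_deriv y ^ 2 * (4*t*(t^2+2*t+5)*(t^4+5*t^3+15*t^2+25*t+25)) = 25*(t^5+5*t^4+15*t^3+25*t^2+25*t+10) * (4 * (y * (y ^ 2 + 22 * y + 125)))"
      unfolding D unfolding Y by algebra
  qed (simp_all add: nz y0 ynz0)
  ultimately show ?thesis
    unfolding y_def[symmetric] pf_operator_base_5[OF y] by (simp only:)
qed

section \<open>Identification of the levels\<close>

text \<open>One predicate for the three parts of the conclusion, so that each level yields a single
  fact in which only the operator has to be rewritten.\<close>

definition has_picard_fuchs_operator :: "complex poly \<Rightarrow> complex poly \<Rightarrow> monic_op2 \<Rightarrow> bool" where
  "has_picard_fuchs_operator P Q L \<longleftrightarrow> h_fun P Q analytic_on {0} \<and>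
    (\<forall>\<^sub>F z in at 0. apply_op (picard_fuchs P Q) (h_fun P Q) z = 0) \<and> picard_fuchs P Q = L"

lemma level_operator:
  assumes "j_representation N P Q"
    and "\<And>\<tau>. hauptmodul N \<tau> = eta_quotient (of_int k) (eta_exponents num den) \<tau>"
    and "check_level N K k num den L (factors_degree Pf * compose_degree cs) (factors_degree Qf * compose_degree cs)"
    and "check_relation (Suc K) k num den cs Pf Qf"
    and "\<And>x :: complex. factors Pf x = 0 \<Longrightarrow> factors Qf x = 0 \<Longrightarrow> False"
  shows "has_picard_fuchs_operator P Q
    (pf_operator (factors Pf (compose_horner cs rf_var)) (factors Qf (compose_horner cs rf_var)))"
proof -
  have ident: "poly P 0 \<noteq> 0" "poly Q 0 = 0" "poly (pderiv Q) 0 \<noteq> 0"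
    "\<exists>c. c \<noteq> 0 \<and> P = smult c (level_poly cs Pf) \<and> Q = smult c (level_poly cs Qf)"
    by (rule level_identification[OF assms(1-4)]; rule assms(5); assumption)+
  obtain c where c: "c \<noteq> 0" "P = smult c (level_poly cs Pf)" "Q = smult c (level_poly cs Qf)"
    using ident(4) by blast
  show ?thesis
    unfolding has_picard_fuchs_operator_def
  proof (intro conjI)
    show "picard_fuchs P Q = pf_operator (factors Pf (compose_horner cs rf_var)) (factors Qf (compose_horner cs rf_var))"
      unfolding c(2,3) by (rule picard_fuchs_level_poly[OF c(1)])
  qed (rule h_fun_solves_picard_fuchs[OF ident(1-3)])+
qed

text \<open>The zeros of the denominator are integers that can be inserted into the numerator; the
  same works at the other levels.\<close>

lemma no_common_root_2:
  "factors num_factors_2 (x :: complex) = 0 \<Longrightarrow> factors den_factors_2 x = 0 \<Longrightarrow> False"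
  by (auto simp: num_factors_2_def den_factors_2_def add_eq_0_iff)

lemma no_common_root_3:
  "factors num_factors_3 (x :: complex) = 0 \<Longrightarrow> factors den_factors_3 x = 0 \<Longrightarrow> False"
  by (auto simp: num_factors_3_def den_factors_3_def add_eq_0_iff)

lemma no_common_root_5:
  "factors num_factors_5 (x :: complex) = 0 \<Longrightarrow> factors den_factors_5 x = 0 \<Longrightarrow> False"
  by (auto simp: num_factors_5_def den_factors_5_def add_eq_0_iff)

lemma no_common_root_6:
  "factors num_factors_6 (x :: complex) = 0 \<Longrightarrow> factors den_factors_6 x = 0 \<Longrightarrow> False"
  by (auto simp: num_factors_6_def den_factors_6_def add_eq_0_iff)

lemma no_common_root_7:
  "factors num_factors_7 (x :: complex) = 0 \<Longrightarrow> factors den_factors_7 x = 0 \<Longrightarrow> False"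
  by (auto simp: num_factors_7_def den_factors_7_def add_eq_0_iff)

lemma no_common_root_10:
  "factors num_factors_10 (x :: complex) = 0 \<Longrightarrow> factors den_factors_10 x = 0 \<Longrightarrow> False"
  by (auto simp: num_factors_10_def den_factors_10_def add_eq_0_iff)

lemma no_common_root_13:
  "factors num_factors_13 (x :: complex) = 0 \<Longrightarrow> factors den_factors_13 x = 0 \<Longrightarrow> False"
  by (auto simp: num_factors_13_def den_factors_13_def add_eq_0_iff)

text \<open>4 is the least admissible precision, the degree bound 3 of P plus length
  \<open>L\<close> plus 1; all levels choose it in this way. At prime level the rows (0, 1) and (1,
  d) exhaust the cosets, so \<open>L\<close> is empty.\<close>

lemma level_2:
  assumes "j_representation 2 P Q"
  shows "has_picard_fuchs_operator P Q (pf_operator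
    (factors num_factors_2 (compose_horner [] rf_var)) (factors den_factors_2 (compose_horner [] rf_var)))"
proof (rule level_operator[OF assms, of 4096 "[(2, 24)]" "[(1, 24)]" 4 "[]"])
  show "hauptmodul 2 \<tau> = eta_quotient (of_int 4096) (eta_exponents [(2, 24)] [(1, 24)]) \<tau>" for \<tau>
    by (simp add: hauptmodul_def eta_quotient_def eta_exponents_def power_int_minus divide_inverse mult_ac)
  show "check_level 2 4 4096 [(2, 24)] [(1, 24)] []
    (factors_degree num_factors_2 * compose_degree []) (factors_degree den_factors_2 * compose_degree [])"
    by code_simp
  show "check_relation (Suc 4) 4096 [(2, 24)] [(1, 24)] [] num_factors_2 den_factors_2"
    by code_simp
qed (rule no_common_root_2)

lemma level_3:
  assumes "j_representation 3 P Q"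
  shows "has_picard_fuchs_operator P Q (pf_operator
    (factors num_factors_3 (compose_horner [] rf_var)) (factors den_factors_3 (compose_horner [] rf_var)))"
proof (rule level_operator[OF assms, of 729 "[(3, 12)]" "[(1, 12)]" 5 "[]"])
  show "hauptmodul 3 \<tau> = eta_quotient (of_int 729) (eta_exponents [(3, 12)] [(1, 12)]) \<tau>" for \<tau>
    by (simp add: hauptmodul_def eta_quotient_def eta_exponents_def power_int_minus divide_inverse mult_ac)
  show "check_level 3 5 729 [(3, 12)] [(1, 12)] []
    (factors_degree num_factors_3 * compose_degree []) (factors_degree den_factors_3 * compose_degree [])"
    by code_simp
  show "check_relation (Suc 5) 729 [(3, 12)] [(1, 12)] [] num_factors_3 den_factors_3"
    by code_simp
qed (rule no_common_root_3)

text \<open>P / Q is that of level 2 at y = t (t + 16). The extra row (2, 1) belongs to the third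
  cusp, 1/2.\<close>

lemma level_4:
  assumes "j_representation 4 P Q"
  shows "has_picard_fuchs_operator P Q (pf_operator
    (factors num_factors_2 (compose_horner [[0, 16, 1]] rf_var)) (factors den_factors_2 (compose_horner [[0, 16, 1]] rf_var)))"
proof (rule level_operator[OF assms, of 256 "[(4, 8)]" "[(1, 8)]" 8 "[(2, 1)]"])
  show "hauptmodul 4 \<tau> = eta_quotient (of_int 256) (eta_exponents [(4, 8)] [(1, 8)]) \<tau>" for \<tau>
    by (simp add: hauptmodul_def eta_quotient_def eta_exponents_def power_int_minus divide_inverse mult_ac)
  show "check_level 4 8 256 [(4, 8)] [(1, 8)] [(2, 1)]
    (factors_degree num_factors_2 * compose_degree [[0, 16, 1]]) (factors_degree den_factors_2 * compose_degree [[0, 16, 1]])"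
    by code_simp
  show "check_relation (Suc 8) 256 [(4, 8)] [(1, 8)] [[0, 16, 1]] num_factors_2 den_factors_2"
    by code_simp
qed (rule no_common_root_2)

lemma level_5:
  assumes "j_representation 5 P Q"
  shows "has_picard_fuchs_operator P Q (pf_operator
    (factors num_factors_5 (compose_horner [] rf_var)) (factors den_factors_5 (compose_horner [] rf_var)))"
proof (rule level_operator[OF assms, of 125 "[(5, 6)]" "[(1, 6)]" 7 "[]"])
  show "hauptmodul 5 \<tau> = eta_quotient (of_int 125) (eta_exponents [(5, 6)] [(1, 6)]) \<tau>" for \<tau>
    by (simp add: hauptmodul_def eta_quotient_def eta_exponents_def power_int_minus divide_inverse mult_ac)
  show "check_level 5 7 125 [(5, 6)] [(1, 6)] []
    (factors_degree num_factors_5 * compose_degree []) (factors_degree den_factors_5 * compose_degree [])"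
    by code_simp
  show "check_relation (Suc 7) 125 [(5, 6)] [(1, 6)] [] num_factors_5 den_factors_5"
    by code_simp
qed (rule no_common_root_5)

text \<open>Besides (0, 1) and the six rows (1, d), three rows belong to the cusp 1/2 of width 3 and
  two to the cusp 1/3 of width 2; the precision is 18 = 12 + 5 + 1.\<close>

lemma level_6:
  assumes "j_representation 6 P Q"
  shows "has_picard_fuchs_operator P Q (pf_operator
    (factors num_factors_6 (compose_horner [] rf_var)) (factors den_factors_6 (compose_horner [] rf_var)))"
proof (rule level_operator[OF assms, of 72 "[(2, 1), (6, 5)]" "[(1, 5), (3, 1)]" 18 "[(2, 1), (2, 3), (2, 5), (3, 1), (3, 2)]"])
  show "hauptmodul 6 \<tau> = eta_quotient (of_int 72) (eta_exponents [(2, 1), (6, 5)] [(1, 5), (3, 1)]) \<tau>" for \<tau>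
    by (simp add: hauptmodul_def eta_quotient_def eta_exponents_def power_int_minus divide_inverse mult_ac)
  show "check_level 6 18 72 [(2, 1), (6, 5)] [(1, 5), (3, 1)] [(2, 1), (2, 3), (2, 5), (3, 1), (3, 2)]
    (factors_degree num_factors_6 * compose_degree []) (factors_degree den_factors_6 * compose_degree [])"
    by code_simp
  show "check_relation (Suc 18) 72 [(2, 1), (6, 5)] [(1, 5), (3, 1)] [] num_factors_6 den_factors_6"
    by code_simp
qed (rule no_common_root_6)

lemma level_7:
  assumes "j_representation 7 P Q"
  shows "has_picard_fuchs_operator P Q (pf_operator
    (factors num_factors_7 (compose_horner [] rf_var)) (factors den_factors_7 (compose_horner [] rf_var)))"
proof (rule level_operator[OF assms, of 49 "[(7, 4)]" "[(1, 4)]" 9 "[]"])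
  show "hauptmodul 7 \<tau> = eta_quotient (of_int 49) (eta_exponents [(7, 4)] [(1, 4)]) \<tau>" for \<tau>
    by (simp add: hauptmodul_def eta_quotient_def eta_exponents_def power_int_minus divide_inverse mult_ac)
  show "check_level 7 9 49 [(7, 4)] [(1, 4)] []
    (factors_degree num_factors_7 * compose_degree []) (factors_degree den_factors_7 * compose_degree [])"
    by code_simp
  show "check_relation (Suc 9) 49 [(7, 4)] [(1, 4)] [] num_factors_7 den_factors_7"
    by code_simp
qed (rule no_common_root_7)

lemma level_8:
  assumes "j_representation 8 P Q"
  shows "has_picard_fuchs_operator P Q (pf_operator
    (factors num_factors_2 (compose_horner [[0, 8, 1], [0, 16, 1]] rf_var)) (factors den_factors_2 (compose_horner [[0, 8, 1], [0, 16, 1]] rf_var)))"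
proof (rule level_operator[OF assms, of 32 "[(2, 2), (8, 4)]" "[(1, 4), (4, 2)]" 16 "[(2, 1), (2, 3), (4, 1)]"])
  show "hauptmodul 8 \<tau> = eta_quotient (of_int 32) (eta_exponents [(2, 2), (8, 4)] [(1, 4), (4, 2)]) \<tau>" for \<tau>
    by (simp add: hauptmodul_def eta_quotient_def eta_exponents_def power_int_minus divide_inverse mult_ac)
  show "check_level 8 16 32 [(2, 2), (8, 4)] [(1, 4), (4, 2)] [(2, 1), (2, 3), (4, 1)]
    (factors_degree num_factors_2 * compose_degree [[0, 8, 1], [0, 16, 1]]) (factors_degree den_factors_2 * compose_degree [[0, 8, 1], [0, 16, 1]])"
    by code_simp
  show "check_relation (Suc 16) 32 [(2, 2), (8, 4)] [(1, 4), (4, 2)] [[0, 8, 1], [0, 16, 1]] num_factors_2 den_factors_2"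
    by code_simp
qed (rule no_common_root_2)

lemma level_9:
  assumes "j_representation 9 P Q"
  shows "has_picard_fuchs_operator P Q (pf_operator
    (factors num_factors_3 (compose_horner [[0, 27, 9, 1]] rf_var)) (factors den_factors_3 (compose_horner [[0, 27, 9, 1]] rf_var)))"
proof (rule level_operator[OF assms, of 27 "[(9, 3)]" "[(1, 3)]" 15 "[(3, 1), (3, 2)]"])
  show "hauptmodul 9 \<tau> = eta_quotient (of_int 27) (eta_exponents [(9, 3)] [(1, 3)]) \<tau>" for \<tau>
    by (simp add: hauptmodul_def eta_quotient_def eta_exponents_def power_int_minus divide_inverse mult_ac)
  show "check_level 9 15 27 [(9, 3)] [(1, 3)] [(3, 1), (3, 2)]
    (factors_degree num_factors_3 * compose_degree [[0, 27, 9, 1]]) (factors_degree den_factors_3 * compose_degree [[0, 27, 9, 1]])"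
    by code_simp
  show "check_relation (Suc 15) 27 [(9, 3)] [(1, 3)] [[0, 27, 9, 1]] num_factors_3 den_factors_3"
    by code_simp
qed (rule no_common_root_3)

lemma level_10:
  assumes "j_representation 10 P Q"
  shows "has_picard_fuchs_operator P Q (pf_operator
    (factors num_factors_10 (compose_horner [] rf_var)) (factors den_factors_10 (compose_horner [] rf_var)))"
proof (rule level_operator[OF assms, of 20 "[(2, 1), (10, 3)]" "[(1, 3), (5, 1)]" 26 "[(2, 1), (2, 3), (2, 5), (2, 7), (2, 9), (5, 1), (5, 2)]"])
  show "hauptmodul 10 \<tau> = eta_quotient (of_int 20) (eta_exponents [(2, 1), (10, 3)] [(1, 3), (5, 1)]) \<tau>" for \<tau>
    by (simp add: hauptmodul_def eta_quotient_def eta_exponents_def power_int_minus divide_inverse mult_ac)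
  show "check_level 10 26 20 [(2, 1), (10, 3)] [(1, 3), (5, 1)] [(2, 1), (2, 3), (2, 5), (2, 7), (2, 9), (5, 1), (5, 2)]
    (factors_degree num_factors_10 * compose_degree []) (factors_degree den_factors_10 * compose_degree [])"
    by code_simp
  show "check_relation (Suc 26) 20 [(2, 1), (10, 3)] [(1, 3), (5, 1)] [] num_factors_10 den_factors_10"
    by code_simp
qed (rule no_common_root_10)

lemma level_12:
  assumes "j_representation 12 P Q"
  shows "has_picard_fuchs_operator P Q (pf_operator
    (factors num_factors_6 (compose_horner [[0, 6, 1]] rf_var)) (factors den_factors_6 (compose_horner [[0, 6, 1]] rf_var)))"
proof (rule level_operator[OF assms, of 12 "[(2, 2), (3, 1), (12, 3)]" "[(1, 3), (4, 1), (6, 2)]" 36 "[(2, 1), (2, 3), (2, 5), (3, 1), (3, 2), (3, 4), (3, 7), (4, 1), (4, 3), (4, 5), (6, 1)]"])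
  show "hauptmodul 12 \<tau> = eta_quotient (of_int 12) (eta_exponents [(2, 2), (3, 1), (12, 3)] [(1, 3), (4, 1), (6, 2)]) \<tau>" for \<tau>
    by (simp add: hauptmodul_def eta_quotient_def eta_exponents_def power_int_minus divide_inverse mult_ac)
  show "check_level 12 36 12 [(2, 2), (3, 1), (12, 3)] [(1, 3), (4, 1), (6, 2)] [(2, 1), (2, 3), (2, 5), (3, 1), (3, 2), (3, 4), (3, 7), (4, 1), (4, 3), (4, 5), (6, 1)]
    (factors_degree num_factors_6 * compose_degree [[0, 6, 1]]) (factors_degree den_factors_6 * compose_degree [[0, 6, 1]])"
    by code_simp
  show "check_relation (Suc 36) 12 [(2, 2), (3, 1), (12, 3)] [(1, 3), (4, 1), (6, 2)] [[0, 6, 1]] num_factors_6 den_factors_6"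
    by code_simp
qed (rule no_common_root_6)

lemma level_13:
  assumes "j_representation 13 P Q"
  shows "has_picard_fuchs_operator P Q (pf_operator
    (factors num_factors_13 (compose_horner [] rf_var)) (factors den_factors_13 (compose_horner [] rf_var)))"
proof (rule level_operator[OF assms, of 13 "[(13, 2)]" "[(1, 2)]" 15 "[]"])
  show "hauptmodul 13 \<tau> = eta_quotient (of_int 13) (eta_exponents [(13, 2)] [(1, 2)]) \<tau>" for \<tau>
    by (simp add: hauptmodul_def eta_quotient_def eta_exponents_def power_int_minus divide_inverse mult_ac)
  show "check_level 13 15 13 [(13, 2)] [(1, 2)] []
    (factors_degree num_factors_13 * compose_degree []) (factors_degree den_factors_13 * compose_degree [])"
    by code_simp
  show "check_relation (Suc 15) 13 [(13, 2)] [(1, 2)] [] num_factors_13 den_factors_13"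
    by code_simp
qed (rule no_common_root_13)

lemma level_16:
  assumes "j_representation 16 P Q"
  shows "has_picard_fuchs_operator P Q (pf_operator
    (factors num_factors_2 (compose_horner [[0, 4, 1], [0, 8, 1], [0, 16, 1]] rf_var)) (factors den_factors_2 (compose_horner [[0, 4, 1], [0, 8, 1], [0, 16, 1]] rf_var)))"
proof (rule level_operator[OF assms, of 8 "[(2, 1), (16, 2)]" "[(1, 2), (8, 1)]" 32 "[(2, 1), (2, 3), (2, 5), (2, 7), (4, 1), (4, 3), (8, 1)]"])
  show "hauptmodul 16 \<tau> = eta_quotient (of_int 8) (eta_exponents [(2, 1), (16, 2)] [(1, 2), (8, 1)]) \<tau>" for \<tau>
    by (simp add: hauptmodul_def eta_quotient_def eta_exponents_def power_int_minus divide_inverse mult_ac)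
  show "check_level 16 32 8 [(2, 1), (16, 2)] [(1, 2), (8, 1)] [(2, 1), (2, 3), (2, 5), (2, 7), (4, 1), (4, 3), (8, 1)]
    (factors_degree num_factors_2 * compose_degree [[0, 4, 1], [0, 8, 1], [0, 16, 1]]) (factors_degree den_factors_2 * compose_degree [[0, 4, 1], [0, 8, 1], [0, 16, 1]])"
    by code_simp
  show "check_relation (Suc 32) 8 [(2, 1), (16, 2)] [(1, 2), (8, 1)] [[0, 4, 1], [0, 8, 1], [0, 16, 1]] num_factors_2 den_factors_2"
    by code_simp
qed (rule no_common_root_2)

text \<open>The largest of the checks: index 36, hence 17 rows besides (0, 1) and the (1, d), and
  precision 36 + 17 + 1 = 54.\<close>

lemma level_18:
  assumes "j_representation 18 P Q"
  shows "has_picard_fuchs_operator P Q (pf_operator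
    (factors num_factors_6 (compose_horner [[0, 12, 6, 1]] rf_var)) (factors den_factors_6 (compose_horner [[0, 12, 6, 1]] rf_var)))"
proof (rule level_operator[OF assms, of 6 "[(2, 1), (3, 1), (18, 2)]" "[(1, 2), (6, 1), (9, 1)]" 54 "[(2, 1), (2, 3), (2, 5), (2, 7), (2, 9), (2, 11), (2, 13), (2, 15), (2, 17), (3, 1), (3, 2), (3, 4), (3, 5), (6, 1), (6, 5), (9, 1), (9, 2)]"])
  show "hauptmodul 18 \<tau> = eta_quotient (of_int 6) (eta_exponents [(2, 1), (3, 1), (18, 2)] [(1, 2), (6, 1), (9, 1)]) \<tau>" for \<tau>
    by (simp add: hauptmodul_def eta_quotient_def eta_exponents_def power_int_minus divide_inverse mult_ac)
  show "check_level 18 54 6 [(2, 1), (3, 1), (18, 2)] [(1, 2), (6, 1), (9, 1)] [(2, 1), (2, 3), (2, 5), (2, 7), (2, 9), (2, 11), (2, 13), (2, 15), (2, 17), (3, 1), (3, 2), (3, 4), (3, 5), (6, 1), (6, 5), (9, 1), (9, 2)]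
    (factors_degree num_factors_6 * compose_degree [[0, 12, 6, 1]]) (factors_degree den_factors_6 * compose_degree [[0, 12, 6, 1]])"
    by code_simp
  show "check_relation (Suc 54) 6 [(2, 1), (3, 1), (18, 2)] [(1, 2), (6, 1), (9, 1)] [[0, 12, 6, 1]] num_factors_6 den_factors_6"
    by code_simp
qed (rule no_common_root_6)

text \<open>The rows (5, d) belong to four cusps of width 1, at which t has order 0.\<close>

lemma level_25:
  assumes "j_representation 25 P Q"
  shows "has_picard_fuchs_operator P Q (pf_operator
    (factors num_factors_5 (compose_horner [[0, 25, 25, 15, 5, 1]] rf_var)) (factors den_factors_5 (compose_horner [[0, 25, 25, 15, 5, 1]] rf_var)))"
proof (rule level_operator[OF assms, of 5 "[(25, 1)]" "[(1, 1)]" 35 "[(5, 1), (5, 2), (5, 3), (5, 4)]"])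
  show "hauptmodul 25 \<tau> = eta_quotient (of_int 5) (eta_exponents [(25, 1)] [(1, 1)]) \<tau>" for \<tau>
    by (simp add: hauptmodul_def eta_quotient_def eta_exponents_def power_int_minus divide_inverse mult_ac)
  show "check_level 25 35 5 [(25, 1)] [(1, 1)] [(5, 1), (5, 2), (5, 3), (5, 4)]
    (factors_degree num_factors_5 * compose_degree [[0, 25, 25, 15, 5, 1]]) (factors_degree den_factors_5 * compose_degree [[0, 25, 25, 15, 5, 1]])"
    by code_simp
  show "check_relation (Suc 35) 5 [(25, 1)] [(1, 1)] [[0, 25, 25, 15, 5, 1]] num_factors_5 den_factors_5"
    by code_simp
qed (rule no_common_root_5)

theorem theorem7p2:
  fixes N :: nat and P Q :: "complex poly"
  assumes "N \<in> levels"
    and "j_representation N P Q"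
  shows "h_fun P Q analytic_on {0} \<and>
    (\<forall>\<^sub>F z in at 0. apply_op (picard_fuchs P Q) (h_fun P Q) z = 0) \<and>
    (let t = rf_var; L = picard_fuchs P Q in
      (N = 2 \<longrightarrow> L = (1/t + 1/(2*(t+64)), 1/(16*t*(t+64)))) \<and>
      (N = 3 \<longrightarrow> L = (1/t + 2/(3*(t+27)), 1/(9*t*(t+27)))) \<and>
      (N = 4 \<longrightarrow> L = (1/t + 1/(t+16), 1/(4*t*(t+16)))) \<and>
      (N = 5 \<longrightarrow> L =
        (1/t + (t+11)/(t^2+22*t+125),
         (t+10)/(4*t*(t^2+22*t+125)))) \<and>
      (N = 6 \<longrightarrow> L =
        (1/t + 1/(t+8) + 1/(t+9),
         (t+6)/(t*(t+8)*(t+9)))) \<and>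
      (N = 7 \<longrightarrow> L =
        (1/t + (4*t+26)/(3*(t^2+13*t+49)),
         (4*t+21)/(9*t*(t^2+13*t+49)))) \<and>
      (N = 8 \<longrightarrow> L =
        (1/t + 1/(t+4) + 1/(t+8),
         1/(t*(t+8)))) \<and>
      (N = 9 \<longrightarrow> L =
        (1/t + (2*t+9)/(t^2+9*t+27),
         (t+3)/(t*(t^2+9*t+27)))) \<and>
      (N = 10 \<longrightarrow> L =
        (1/t + 1/(t+4) + 1/(t+5) + (t+4)/(t^2+8*t+20),
         (9*t^3+95*t^2+340*t+400)/(4*t*(t+4)*(t+5)*(t^2+8*t+20)))) \<and>
      (N = 12 \<longrightarrow> L =
        (1/t + 1/(t+2) + 1/(t+3) + 1/(t+4) + 1/(t+6),
         4*(t^2+6*t+6)/(t*(t+2)*(t+4)*(t+6)))) \<and>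
      (N = 13 \<longrightarrow> L =
        (1/t + (t+3)/(t^2+6*t+13) + (4*t+10)/(3*(t^2+5*t+13)),
         (49*t^3+351*t^2+1027*t+1014)/(36*t*(t^2+5*t+13)*(t^2+6*t+13)))) \<and>
      (N = 16 \<longrightarrow> L =
        (1/t + 1/(t+2) + 1/(t+4) + (2*t+4)/(t^2+4*t+8),
         4*(t+2)^2/(t*(t+4)*(t^2+4*t+8)))) \<and>
      (N = 18 \<longrightarrow> L =
        (1/t + 1/(t+2) + 1/(t+3) + (2*t+3)/(t^2+3*t+3) + (2*t+6)/(t^2+6*t+12),
         9*(t+2)*(t^3+6*t^2+12*t+6)/(t*(t+3)*(t^2+3*t+3)*(t^2+6*t+12)))) \<and>
      (N = 25 \<longrightarrow> L =
        (1/t + (4*t^3+15*t^2+30*t+25)/(t^4+5*t^3+15*t^2+25*t+25) + (t+1)/(t^2+2*t+5),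
         25*(t^5+5*t^4+15*t^3+25*t^2+25*t+10)
           /(4*t*(t^2+2*t+5)*(t^4+5*t^3+15*t^2+25*t+25)))))"
proof -
  consider "N = 2" | "N = 3" | "N = 4" | "N = 5" | "N = 6" | "N = 7" | "N = 8" | "N = 9" | "N = 10" | "N = 12" | "N = 13" | "N = 16" | "N = 18" | "N = 25"
    using assms(1) by (auto simp: levels_def)
  thus ?thesis
  proof cases
    case 1
    note h = level_2[OF assms(2)[unfolded 1], unfolded picard_fuchs_2 has_picard_fuchs_operator_def]
    show ?thesis
      unfolding 1 Let_def
      \<comment> \<open>All implications except the one for the present level have a false equation
        between numerals as premise. Rewriting with nothing but numeral equality keeps the rational
        functions intact, so that \<open>h\<close> matches verbatim.\<close>
      by (simp only: numeral_eq_iff num.distinct num.inject simp_thms) (rule h)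
  next
    case 2
    note h = level_3[OF assms(2)[unfolded 2], unfolded picard_fuchs_3 has_picard_fuchs_operator_def]
    show ?thesis
      unfolding 2 Let_def
      by (simp only: numeral_eq_iff num.distinct num.inject simp_thms) (rule h)
  next
    case 3
    note h = level_4[OF assms(2)[unfolded 3], unfolded picard_fuchs_4 has_picard_fuchs_operator_def]
    show ?thesis
      unfolding 3 Let_def
      by (simp only: numeral_eq_iff num.distinct num.inject simp_thms) (rule h)
  next
    case 4
    note h = level_5[OF assms(2)[unfolded 4], unfolded picard_fuchs_5 has_picard_fuchs_operator_def]
    show ?thesis
      unfolding 4 Let_def
      by (simp only: numeral_eq_iff num.distinct num.inject simp_thms) (rule h)
  next
    case 5
    note h = level_6[OF assms(2)[unfolded 5], unfolded picard_fuchs_6 has_picard_fuchs_operator_def]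
    show ?thesis
      unfolding 5 Let_def
      by (simp only: numeral_eq_iff num.distinct num.inject simp_thms) (rule h)
  next
    case 6
    note h = level_7[OF assms(2)[unfolded 6], unfolded picard_fuchs_7 has_picard_fuchs_operator_def]
    show ?thesis
      unfolding 6 Let_def
      by (simp only: numeral_eq_iff num.distinct num.inject simp_thms) (rule h)
  next
    case 7
    note h = level_8[OF assms(2)[unfolded 7], unfolded picard_fuchs_8 has_picard_fuchs_operator_def]
    show ?thesis
      unfolding 7 Let_def
      by (simp only: numeral_eq_iff num.distinct num.inject simp_thms) (rule h)
  next
    case 8
    note h = level_9[OF assms(2)[unfolded 8], unfolded picard_fuchs_9 has_picard_fuchs_operator_def]
    show ?thesis
      unfolding 8 Let_def
      by (simp only: numeral_eq_iff num.distinct num.inject simp_thms) (rule h)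
  next
    case 9
    note h = level_10[OF assms(2)[unfolded 9], unfolded picard_fuchs_10 has_picard_fuchs_operator_def]
    show ?thesis
      unfolding 9 Let_def
      by (simp only: numeral_eq_iff num.distinct num.inject simp_thms) (rule h)
  next
    case 10
    note h = level_12[OF assms(2)[unfolded 10], unfolded picard_fuchs_12 has_picard_fuchs_operator_def]
    show ?thesis
      unfolding 10 Let_def
      by (simp only: numeral_eq_iff num.distinct num.inject simp_thms) (rule h)
  next
    case 11
    note h = level_13[OF assms(2)[unfolded 11], unfolded picard_fuchs_13 has_picard_fuchs_operator_def]
    show ?thesis
      unfolding 11 Let_def
      by (simp only: numeral_eq_iff num.distinct num.inject simp_thms) (rule h)
  next
    case 12
    note h = level_16[OF assms(2)[unfolded 12], unfolded picard_fuchs_16 has_picard_fuchs_operator_def]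
    show ?thesis
      unfolding 12 Let_def
      by (simp only: numeral_eq_iff num.distinct num.inject simp_thms) (rule h)
  next
    case 13
    note h = level_18[OF assms(2)[unfolded 13], unfolded picard_fuchs_18 has_picard_fuchs_operator_def]
    show ?thesis
      unfolding 13 Let_def
      by (simp only: numeral_eq_iff num.distinct num.inject simp_thms) (rule h)
  next
    case 14
    note h = level_25[OF assms(2)[unfolded 14], unfolded picard_fuchs_25 has_picard_fuchs_operator_def]
    show ?thesis
      unfolding 14 Let_def
      by (simp only: numeral_eq_iff num.distinct num.inject simp_thms) (rule h)
  qed
qed

end
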